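(* Let $\mathscr A$ be a profinitary hereditary abelian category. Let $C_{\mathscr A}$ be the subalgebra of the Hall algebra $H_{\mathscr A}$ generated by the isomorphism classes of all almost simple objects, and let $U_{\mathscr A}$ be the subalgebra of $H_{\mathscr A}$ generated by all homogeneous components $(V_{\mathscr A})_\gamma$ with $\dim_{\mathbb Q}(V_{\mathscr A})_\gamma=1$, $\gamma\in\Gamma_{\mathscr A}$. Then both $C_{\mathscr A}$ and $U_{\mathscr A}$ are Nichols algebras (in the braided tensor category $\mathscr C_{\chi_{\mathscr A}}$).
   Context: All categories are essentially small. $\mathrm{Iso}\,\mathscr A$ is the set of isomorphism classes $[X]$ of objects, an abelian monoid under $\oplus$. $\underline{\mathrm{Ext}}^1_{\mathscr A}(A,B)$ is the set of all $[X]$ such that there is a short exact sequence $B\rightarrowtail X\twoheadrightarrow A$. The Grothendieck monoid $\Gamma_{\mathscr A}$ is the quotient of $\mathrm{Iso}\,\mathscr A$ by the congruence which is the transitive closure of: $[X]\equiv[Y]$ if $[X],[Y]\in\underline{\mathrm{Ext}}^1_{\mathscr A}(M,N)$ for some $M,N$; $|X|$ is the image of $X$ in $\Gamma_{\mathscr A}$. $\mathscr A$ is profinitary if all Hom sets are finite and $\{[X]:|X|=\gamma\}$ is finite for all $\gamma\in\Gamma_{\mathscr A}$. $\mathscr A$ is hereditary if $\mathrm{Ext}^i_{\mathscr A}(M,N)=0$ for all $i>1$. A non-zero object $X$ is almost simple if $[X]\in\underline{\mathrm{Ext}}^1_{\mathscr A}(A,B)$ implies $\{[A],[B]\}=\{[X],[0]\}$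 (in an abelian category, this is the same as simple). Let $\mathcal E(A,B)_X$ be the set of all short exact sequences $B\rightarrowtail X\twoheadrightarrow A$ and $F_{A,B}^X=\#\mathcal E(A,B)_X/(\#\mathrm{Aut}\,A\cdot\#\mathrm{Aut}\,B)$. The Hall algebra $H_{\mathscr A}$ is the $\mathbb Q$-vector space with basis $\mathrm{Iso}\,\mathscr A$, product $[A]\cdot[B]=\sum_{[C]}F_{A,B}^C[C]$, unit $1=[0]$, coproduct $\Delta([C])=\sum_{[A],[B]}F^{A,B}_C\,[A]\otimes[B]$ with $F^{A,B}_C=\frac{\#\mathrm{Aut}\,A\cdot\#\mathrm{Aut}\,B}{\#\mathrm{Aut}\,C}F_{B,A}^C$ (finite sums for a profinitary abelian category), counit $\varepsilon([C])=\delta_{[0],[C]}$. It is $\Gamma_{\mathscr A}$-graded by $[M]\mapsto|M|$. $V_{\mathscr A}=\{v:\Delta(v)=v\otimes1+1\otimes v\}$ is a graded subspace. $\mathscr C_{\chi_{\mathscr A}}$ is the tensor category of $\Gamma_{\mathscr A}$-graded $\mathbb Q$-vector spaces with braiding $\Psi_{U,V}(u\otimes v)=\chi_{\mathscr A}(\gamma,\delta)\,v\otimes u$ for $u\in U_\gamma$, $v\in V_\delta$, where $\chi_{\mathscr A}(|M|,|N|)=\#\mathrm{Ext}^1_{\mathscr A}(M,N)/\#\mathrm{Hom}_{\mathscr A}(M,N)$ is a well-defined bicharacter $\Gamma_{\mathscr A}\times\Gamma_{\mathscr A}\to\mathbb Q^\times$; $H_{\mathscr A}$ is a bialgebra in this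 category. A Nichols algebra of an object $V$ of a braided $\mathbb F$-linear tensor category is a graded unital bialgebra $B=\bigoplus_{n\ge0}B_n$ in it with $B_0=\mathbb F$, $B_1=V$, such that $B_1=\mathrm{Prim}(B)$ and $B$ is generated as an algebra by $B_1$; a Nichols algebra is a Nichols algebra of some object. *)

theory Defs
  imports Complex_Main "HOL-Algebra.Group" "HOL-Library.Function_Algebras"
begin

section \<open>Abelian categories\<close>

text \<open>Each arrow determines its domain and codomain; \<open>Comp \<A> g f\<close> is ``g after f'', and is only
  meaningful if \<open>Cod \<A> f = Dom \<A> g\<close>. \<open>Null \<A> X Y\<close> and \<open>Plus \<A>\<close> are the group structure on
  the hom sets. The objects form a set, so the category is small.\<close>

record ('o, 'm) preadd_cat =
  Ob :: "'o set"
  Arr :: "'m set"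
  Dom :: "'m \<Rightarrow> 'o"
  Cod :: "'m \<Rightarrow> 'o"
  Ident :: "'o \<Rightarrow> 'm"
  Comp :: "'m \<Rightarrow> 'm \<Rightarrow> 'm"
  Null :: "'o \<Rightarrow> 'o \<Rightarrow> 'm"
  Plus :: "'m \<Rightarrow> 'm \<Rightarrow> 'm"

definition Hom_set :: "('o, 'm) preadd_cat \<Rightarrow> 'o \<Rightarrow> 'o \<Rightarrow> 'm set" where
  "Hom_set \<A> X Y = {f \<in> Arr \<A>. Dom \<A> f = X \<and> Cod \<A> f = Y}"

definition Hom_group :: "('o, 'm) preadd_cat \<Rightarrow> 'o \<Rightarrow> 'o \<Rightarrow> 'm monoid" where
  "Hom_group \<A> X Y = \<lparr>carrier = Hom_set \<A> X Y, mult = Plus \<A>, one = Null \<A> X Y\<rparr>"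

definition is_mono :: "('o, 'm) preadd_cat \<Rightarrow> 'm \<Rightarrow> bool" where
  "is_mono \<A> f \<longleftrightarrow> f \<in> Arr \<A> \<and>
     (\<forall>W \<in> Ob \<A>. \<forall>u \<in> Hom_set \<A> W (Dom \<A> f). \<forall>v \<in> Hom_set \<A> W (Dom \<A> f).
        Comp \<A> f u = Comp \<A> f v \<longrightarrow> u = v)"

definition is_epi :: "('o, 'm) preadd_cat \<Rightarrow> 'm \<Rightarrow> bool" where
  "is_epi \<A> f \<longleftrightarrow> f \<in> Arr \<A> \<and>
     (\<forall>W \<in> Ob \<A>. \<forall>u \<in> Hom_set \<A> (Cod \<A> f) W. \<forall>v \<in> Hom_set \<A> (Cod \<A> f) W.
        Comp \<A> u f = Comp \<A> v f \<longrightarrow> u = v)"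

definition is_isom :: "('o, 'm) preadd_cat \<Rightarrow> 'm \<Rightarrow> bool" where
  "is_isom \<A> f \<longleftrightarrow> f \<in> Arr \<A> \<and>
     (\<exists>g \<in> Hom_set \<A> (Cod \<A> f) (Dom \<A> f).
        Comp \<A> g f = Ident \<A> (Dom \<A> f) \<and> Comp \<A> f g = Ident \<A> (Cod \<A> f))"

definition is_kernel :: "('o, 'm) preadd_cat \<Rightarrow> 'm \<Rightarrow> 'm \<Rightarrow> bool" where
  "is_kernel \<A> f k \<longleftrightarrow> f \<in> Arr \<A> \<and> k \<in> Arr \<A> \<and> Cod \<A> k = Dom \<A> f \<and>
     Comp \<A> f k = Null \<A> (Dom \<A> k) (Cod \<A> f) \<and>
     (\<forall>h \<in> Arr \<A>. Cod \<A> h = Dom \<A> f \<and> Comp \<A> f h = Null \<A> (Dom \<A> h) (Cod \<A> f) \<longrightarrow>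
        (\<exists>!u. u \<in> Hom_set \<A> (Dom \<A> h) (Dom \<A> k) \<and> Comp \<A> k u = h))"

definition is_cokernel :: "('o, 'm) preadd_cat \<Rightarrow> 'm \<Rightarrow> 'm \<Rightarrow> bool" where
  "is_cokernel \<A> f c \<longleftrightarrow> f \<in> Arr \<A> \<and> c \<in> Arr \<A> \<and> Dom \<A> c = Cod \<A> f \<and>
     Comp \<A> c f = Null \<A> (Dom \<A> f) (Cod \<A> c) \<and>
     (\<forall>h \<in> Arr \<A>. Dom \<A> h = Cod \<A> f \<and> Comp \<A> h f = Null \<A> (Dom \<A> f) (Cod \<A> h) \<longrightarrow>
        (\<exists>!u. u \<in> Hom_set \<A> (Cod \<A> c) (Cod \<A> h) \<and> Comp \<A> u c = h))"

definition is_zero_object :: "('o, 'm) preadd_cat \<Rightarrow> 'o \<Rightarrow> bool" where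
  "is_zero_object \<A> Z \<longleftrightarrow> Z \<in> Ob \<A> \<and>
     (\<forall>X \<in> Ob \<A>. (\<exists>!f. f \<in> Hom_set \<A> X Z) \<and> (\<exists>!f. f \<in> Hom_set \<A> Z X))"

definition is_biproduct :: "('o, 'm) preadd_cat \<Rightarrow> 'o \<Rightarrow> 'o \<Rightarrow> 'o \<Rightarrow> bool" where
  "is_biproduct \<A> X Y S \<longleftrightarrow> S \<in> Ob \<A> \<and>
     (\<exists>i \<in> Hom_set \<A> X S. \<exists>j \<in> Hom_set \<A> Y S. \<exists>p \<in> Hom_set \<A> S X. \<exists>q \<in> Hom_set \<A> S Y.
        Comp \<A> p i = Ident \<A> X \<and> Comp \<A> q j = Ident \<A> Y \<and>
        Comp \<A> q i = Null \<A> X Y \<and> Comp \<A> p j = Null \<A> Y X \<and>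
        Plus \<A> (Comp \<A> i p) (Comp \<A> j q) = Ident \<A> S)"

locale category =
  fixes \<A> :: "('o, 'm) preadd_cat"
  assumes Dom_Ob: "f \<in> Arr \<A> \<Longrightarrow> Dom \<A> f \<in> Ob \<A>"
    and Cod_Ob: "f \<in> Arr \<A> \<Longrightarrow> Cod \<A> f \<in> Ob \<A>"
    and Ident_Hom: "X \<in> Ob \<A> \<Longrightarrow> Ident \<A> X \<in> Hom_set \<A> X X"
    and Comp_Hom: "\<lbrakk>f \<in> Hom_set \<A> X Y; g \<in> Hom_set \<A> Y Z\<rbrakk> \<Longrightarrow> Comp \<A> g f \<in> Hom_set \<A> X Z"
    and Comp_Ident: "f \<in> Arr \<A> \<Longrightarrow> Comp \<A> f (Ident \<A> (Dom \<A> f)) = f"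
    and Ident_Comp: "f \<in> Arr \<A> \<Longrightarrow> Comp \<A> (Ident \<A> (Cod \<A> f)) f = f"
    and Comp_assoc: "\<lbrakk>f \<in> Hom_set \<A> W X; g \<in> Hom_set \<A> X Y; h \<in> Hom_set \<A> Y Z\<rbrakk> \<Longrightarrow>
      Comp \<A> h (Comp \<A> g f) = Comp \<A> (Comp \<A> h g) f"

locale abelian_category = category \<A> for \<A> :: "('o, 'm) preadd_cat" +
  assumes Hom_comm_group: "\<lbrakk>X \<in> Ob \<A>; Y \<in> Ob \<A>\<rbrakk> \<Longrightarrow> comm_group (Hom_group \<A> X Y)"
    and Comp_Plus: "\<lbrakk>f \<in> Hom_set \<A> X Y; f' \<in> Hom_set \<A> X Y; g \<in> Hom_set \<A> Y Z\<rbrakk> \<Longrightarrow>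
      Comp \<A> g (Plus \<A> f f') = Plus \<A> (Comp \<A> g f) (Comp \<A> g f')"
    and Plus_Comp: "\<lbrakk>f \<in> Hom_set \<A> X Y; g \<in> Hom_set \<A> Y Z; g' \<in> Hom_set \<A> Y Z\<rbrakk> \<Longrightarrow>
      Comp \<A> (Plus \<A> g g') f = Plus \<A> (Comp \<A> g f) (Comp \<A> g' f)"
    and ex_zero_object: "\<exists>Z. is_zero_object \<A> Z"
    and ex_biproduct: "\<lbrakk>X \<in> Ob \<A>; Y \<in> Ob \<A>\<rbrakk> \<Longrightarrow> \<exists>S. is_biproduct \<A> X Y S"
    and ex_kernel: "f \<in> Arr \<A> \<Longrightarrow> \<exists>k. is_kernel \<A> f k"
    and ex_cokernel: "f \<in> Arr \<A> \<Longrightarrow> \<exists>c. is_cokernel \<A> f c"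
    and mono_normal: "is_mono \<A> f \<Longrightarrow> \<exists>g. is_kernel \<A> g f"
    and epi_normal: "is_epi \<A> f \<Longrightarrow> \<exists>g. is_cokernel \<A> g f"


section \<open>Extensions, the Grothendieck monoid\<close>

text \<open>\<open>short_exact \<A> B X A (f, g)\<close>: the pair is a short exact sequence \<open>B \<rightarrow> X \<rightarrow> A\<close> with
  subobject \<open>B\<close> and quotient \<open>A\<close>.\<close>

definition short_exact :: "('o, 'm) preadd_cat \<Rightarrow> 'o \<Rightarrow> 'o \<Rightarrow> 'o \<Rightarrow> 'm \<times> 'm \<Rightarrow> bool" where
  "short_exact \<A> B X A = (\<lambda>(f, g). f \<in> Hom_set \<A> B X \<and> g \<in> Hom_set \<A> X A \<and>
     is_kernel \<A> g f \<and> is_cokernel \<A> f g)"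

definition isomorphic :: "('o, 'm) preadd_cat \<Rightarrow> 'o \<Rightarrow> 'o \<Rightarrow> bool" where
  "isomorphic \<A> X Y \<longleftrightarrow> (\<exists>f \<in> Hom_set \<A> X Y. is_isom \<A> f)"

definition iso_class :: "('o, 'm) preadd_cat \<Rightarrow> 'o \<Rightarrow> 'o set" where
  "iso_class \<A> X = {Y \<in> Ob \<A>. isomorphic \<A> X Y}"

definition Iso :: "('o, 'm) preadd_cat \<Rightarrow> 'o set set" where
  "Iso \<A> = iso_class \<A> ` Ob \<A>"

definition zero_class :: "('o, 'm) preadd_cat \<Rightarrow> 'o set" where
  "zero_class \<A> = iso_class \<A> (SOME Z. is_zero_object \<A> Z)"

definition Iso_plus :: "('o, 'm) preadd_cat \<Rightarrow> 'o set \<Rightarrow> 'o set \<Rightarrow> 'o set" where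
  "Iso_plus \<A> a b =
     (THE c. \<exists>X \<in> a. \<exists>Y \<in> b. \<exists>S. is_biproduct \<A> X Y S \<and> c = iso_class \<A> S)"

definition Ext_objects :: "('o, 'm) preadd_cat \<Rightarrow> 'o \<Rightarrow> 'o \<Rightarrow> 'o set set" where
  "Ext_objects \<A> A B = {iso_class \<A> X |X. X \<in> Ob \<A> \<and> (\<exists>s. short_exact \<A> B X A s)}"

definition groth_rel :: "('o, 'm) preadd_cat \<Rightarrow> ('o set \<times> 'o set) set" where
  "groth_rel \<A> = {(a, b). \<exists>M \<in> Ob \<A>. \<exists>N \<in> Ob \<A>. a \<in> Ext_objects \<A> M N \<and> b \<in> Ext_objects \<A> M N}\<^sup>+"

definition groth_class :: "('o, 'm) preadd_cat \<Rightarrow> 'o set \<Rightarrow> 'o set set" where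
  "groth_class \<A> a = groth_rel \<A> `` {a}"

definition groth_monoid :: "('o, 'm) preadd_cat \<Rightarrow> 'o set set monoid" where
  "groth_monoid \<A> =
     \<lparr>carrier = Iso \<A> // groth_rel \<A>,
      mult = (\<lambda>\<gamma> \<delta>. THE \<epsilon>. \<exists>a \<in> \<gamma>. \<exists>b \<in> \<delta>. \<epsilon> = groth_class \<A> (Iso_plus \<A> a b)),
      one = groth_class \<A> (zero_class \<A>)\<rparr>"

definition profinitary :: "('o, 'm) preadd_cat \<Rightarrow> bool" where
  "profinitary \<A> \<longleftrightarrow> (\<forall>X \<in> Ob \<A>. \<forall>Y \<in> Ob \<A>. finite (Hom_set \<A> X Y)) \<and>
     (\<forall>\<gamma> \<in> carrier (groth_monoid \<A>). finite {a \<in> Iso \<A>. groth_class \<A> a = \<gamma>})"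

definition almost_simple :: "('o, 'm) preadd_cat \<Rightarrow> 'o \<Rightarrow> bool" where
  "almost_simple \<A> X \<longleftrightarrow> X \<in> Ob \<A> \<and> \<not> is_zero_object \<A> X \<and>
     (\<forall>A \<in> Ob \<A>. \<forall>B \<in> Ob \<A>. iso_class \<A> X \<in> Ext_objects \<A> A B \<longrightarrow>
        {iso_class \<A> A, iso_class \<A> B} = {iso_class \<A> X, zero_class \<A>})"


section \<open>Yoneda Ext\<close>

text \<open>Exactness of \<open>g\<close> after \<open>f\<close> at the middle object: the image of \<open>f\<close> (the monomorphism in its
  epi-mono factorisation) is a kernel of \<open>g\<close>.\<close>

definition exact_pair :: "('o, 'm) preadd_cat \<Rightarrow> 'm \<Rightarrow> 'm \<Rightarrow> bool" where
  "exact_pair \<A> f g \<longleftrightarrow>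
     (\<exists>k e. is_kernel \<A> g k \<and> is_epi \<A> e \<and> Cod \<A> e = Dom \<A> k \<and> f = Comp \<A> k e)"

text \<open>Exact sequences \<open>0 \<rightarrow> N \<rightarrow> E\<^sub>1 \<rightarrow> \<dots> \<rightarrow> E\<^sub>n \<rightarrow> M \<rightarrow> 0\<close> for \<open>n \<ge> 1\<close>, as the list of the \<open>n + 1\<close> inner
  arrows from left to right.\<close>

definition yoneda_exts :: "('o, 'm) preadd_cat \<Rightarrow> nat \<Rightarrow> 'o \<Rightarrow> 'o \<Rightarrow> 'm list set" where
  "yoneda_exts \<A> n M N = {fs. length fs = n + 1 \<and> set fs \<subseteq> Arr \<A> \<and>
     Dom \<A> (fs ! 0) = N \<and> Cod \<A> (fs ! n) = M \<and> is_mono \<A> (fs ! 0) \<and> is_epi \<A> (fs ! n) \<and>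
     (\<forall>i < n. Cod \<A> (fs ! i) = Dom \<A> (fs ! (i + 1)) \<and> exact_pair \<A> (fs ! i) (fs ! (i + 1)))}"

text \<open>Morphisms of such sequences that are the identity on \<open>N\<close> and \<open>M\<close>.\<close>

definition yoneda_step :: "('o, 'm) preadd_cat \<Rightarrow> nat \<Rightarrow> 'o \<Rightarrow> 'o \<Rightarrow> ('m list \<times> 'm list) set" where
  "yoneda_step \<A> n M N = {(fs, gs). fs \<in> yoneda_exts \<A> n M N \<and> gs \<in> yoneda_exts \<A> n M N \<and>
     (\<exists>\<phi> :: nat \<Rightarrow> 'm. \<phi> 0 = Ident \<A> N \<and> \<phi> (n + 1) = Ident \<A> M \<and>
        (\<forall>i \<in> {1..n}. \<phi> i \<in> Hom_set \<A> (Dom \<A> (fs ! i)) (Dom \<A> (gs ! i))) \<and>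
        (\<forall>i \<le> n. Comp \<A> (\<phi> (i + 1)) (fs ! i) = Comp \<A> (gs ! i) (\<phi> i)))}"

text \<open>\<open>Ext\<^sup>n(M, N)\<close> for \<open>n \<ge> 1\<close> as a set; only its cardinality and its vanishing are used below, so the
  Baer sum is not needed. The group vanishes iff the set has exactly one element.\<close>

definition yoneda_Ext :: "('o, 'm) preadd_cat \<Rightarrow> nat \<Rightarrow> 'o \<Rightarrow> 'o \<Rightarrow> 'm list set set" where
  "yoneda_Ext \<A> n M N =
     yoneda_exts \<A> n M N // (yoneda_step \<A> n M N \<union> (yoneda_step \<A> n M N)\<inverse>)\<^sup>*"

definition hereditary :: "('o, 'm) preadd_cat \<Rightarrow> bool" where
  "hereditary \<A> \<longleftrightarrow> (\<forall>n > 1. \<forall>M \<in> Ob \<A>. \<forall>N \<in> Ob \<A>. is_singleton (yoneda_Ext \<A> n M N))"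

definition euler_char :: "('o, 'm) preadd_cat \<Rightarrow> 'o set set \<Rightarrow> 'o set set \<Rightarrow> rat" where
  "euler_char \<A> \<gamma> \<delta> =
     (THE q. \<forall>M \<in> Ob \<A>. \<forall>N \<in> Ob \<A>.
        groth_class \<A> (iso_class \<A> M) = \<gamma> \<and> groth_class \<A> (iso_class \<A> N) = \<delta> \<longrightarrow>
        q = of_nat (card (yoneda_Ext \<A> 1 M N)) / of_nat (card (Hom_set \<A> M N)))"


section \<open>Rational vector spaces and their tensor products\<close>

text \<open>All vector spaces are realised as subspaces of some \<open>'x \<Rightarrow> rat\<close> with the pointwise operations
  (every rational vector space embeds into such a space). For subspaces \<open>S\<close> of \<open>'x \<Rightarrow> rat\<close> and \<open>T\<close> of
  \<open>'y \<Rightarrow> rat\<close> the canonical map from the tensor product of \<open>S\<close> and \<open>T\<close> to \<open>'x \<times> 'y \<Rightarrow> rat\<close> is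
  injective, so the tensor product is the span of the elementary tensors defined below.\<close>

definition qscale :: "rat \<Rightarrow> ('x \<Rightarrow> rat) \<Rightarrow> 'x \<Rightarrow> rat" where
  "qscale c u = (\<lambda>x. c * u x)"

global_interpretation qvec: vector_space "qscale :: rat \<Rightarrow> ('x \<Rightarrow> rat) \<Rightarrow> 'x \<Rightarrow> rat"
  by unfold_locales (auto simp: qscale_def fun_eq_iff algebra_simps)

definition tensor :: "('x \<Rightarrow> rat) \<Rightarrow> ('y \<Rightarrow> rat) \<Rightarrow> 'x \<times> 'y \<Rightarrow> rat"  (infixr "\<otimes>\<^sub>\<rat>" 72) where
  "u \<otimes>\<^sub>\<rat> v = (\<lambda>(x, y). u x * v y)"

definition tensor_space ::
    "('x \<Rightarrow> rat) set \<Rightarrow> ('y \<Rightarrow> rat) set \<Rightarrow> ('x \<times> 'y \<Rightarrow> rat) set" where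
  "tensor_space S T = qvec.span {u \<otimes>\<^sub>\<rat> v |u v. u \<in> S \<and> v \<in> T}"

text \<open>The tensor product of two linear maps defined on \<open>S\<close> and \<open>T\<close>; it is uniquely determined
  on \<open>tensor_space S T\<close> and arbitrary elsewhere.\<close>

definition tensor_map ::
    "('x \<Rightarrow> rat) set \<Rightarrow> ('y \<Rightarrow> rat) set \<Rightarrow> (('x \<Rightarrow> rat) \<Rightarrow> 'z \<Rightarrow> rat) \<Rightarrow>
     (('y \<Rightarrow> rat) \<Rightarrow> 'w \<Rightarrow> rat) \<Rightarrow> ('x \<times> 'y \<Rightarrow> rat) \<Rightarrow> 'z \<times> 'w \<Rightarrow> rat" where
  "tensor_map S T f g =
     (SOME L. Vector_Spaces.linear qscale qscale L \<and>
        (\<forall>u \<in> S. \<forall>v \<in> T. L (u \<otimes>\<^sub>\<rat> v) = f u \<otimes>\<^sub>\<rat> g v))"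

definition assoc_right :: "(('x \<times> 'y) \<times> 'z \<Rightarrow> rat) \<Rightarrow> 'x \<times> ('y \<times> 'z) \<Rightarrow> rat" where
  "assoc_right t = (\<lambda>(x, y, z). t ((x, y), z))"

definition assoc_left :: "('x \<times> ('y \<times> 'z) \<Rightarrow> rat) \<Rightarrow> ('x \<times> 'y) \<times> 'z \<Rightarrow> rat" where
  "assoc_left t = (\<lambda>((x, y), z). t (x, y, z))"

definition direct_sum_of :: "'i set \<Rightarrow> ('i \<Rightarrow> ('x \<Rightarrow> rat) set) \<Rightarrow> ('x \<Rightarrow> rat) set \<Rightarrow> bool" where
  "direct_sum_of I W S \<longleftrightarrow> (\<forall>i \<in> I. qvec.subspace (W i)) \<and> S = qvec.span (\<Union>i \<in> I. W i) \<and>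
     (\<forall>F w. finite F \<and> F \<subseteq> I \<and> (\<forall>i \<in> F. w i \<in> W i) \<and> (\<Sum>i \<in> F. w i) = 0 \<longrightarrow> (\<forall>i \<in> F. w i = 0))"


section \<open>The braided tensor category of graded vector spaces\<close>

definition bicharacter :: "'g monoid \<Rightarrow> ('g \<Rightarrow> 'g \<Rightarrow> rat) \<Rightarrow> bool" where
  "bicharacter \<Gamma> \<chi> \<longleftrightarrow>
     (\<forall>\<alpha> \<in> carrier \<Gamma>. \<forall>\<beta> \<in> carrier \<Gamma>. \<chi> \<alpha> \<beta> \<noteq> 0) \<and>
     (\<forall>\<alpha> \<in> carrier \<Gamma>. \<forall>\<beta> \<in> carrier \<Gamma>. \<forall>\<gamma> \<in> carrier \<Gamma>.
        \<chi> (\<alpha> \<otimes>\<^bsub>\<Gamma>\<^esub> \<beta>) \<gamma> = \<chi> \<alpha> \<gamma> * \<chi> \<beta> \<gamma> \<and> \<chi> \<alpha> (\<beta> \<otimes>\<^bsub>\<Gamma>\<^esub> \<gamma>) = \<chi> \<alpha> \<beta> * \<chi> \<alpha> \<gamma>)"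

record ('g, 'x) gspace =
  space :: "('x \<Rightarrow> rat) set"
  component :: "'g \<Rightarrow> ('x \<Rightarrow> rat) set"

definition graded_space :: "'g monoid \<Rightarrow> ('g, 'x, 'r) gspace_scheme \<Rightarrow> bool" where
  "graded_space \<Gamma> V \<longleftrightarrow> direct_sum_of (carrier \<Gamma>) (component V) (space V)"

definition graded_subspace ::
    "'g monoid \<Rightarrow> ('g, 'x, 'r) gspace_scheme \<Rightarrow> ('g, 'x, 's) gspace_scheme \<Rightarrow> bool" where
  "graded_subspace \<Gamma> W V \<longleftrightarrow> graded_space \<Gamma> W \<and> graded_space \<Gamma> V \<and>
     (\<forall>\<gamma> \<in> carrier \<Gamma>. component W \<gamma> \<subseteq> component V \<gamma>)"

definition graded_morphism ::
    "'g monoid \<Rightarrow> ('g, 'x, 'r) gspace_scheme \<Rightarrow> ('g, 'y, 's) gspace_scheme \<Rightarrow>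
     (('x \<Rightarrow> rat) \<Rightarrow> 'y \<Rightarrow> rat) \<Rightarrow> bool" where
  "graded_morphism \<Gamma> V W f \<longleftrightarrow>
     (\<forall>u \<in> space V. \<forall>v \<in> space V. f (u + v) = f u + f v) \<and>
     (\<forall>c. \<forall>u \<in> space V. f (qscale c u) = qscale c (f u)) \<and>
     (\<forall>\<gamma> \<in> carrier \<Gamma>. f ` component V \<gamma> \<subseteq> component W \<gamma>)"

definition graded_tensor ::
    "'g monoid \<Rightarrow> ('g, 'x, 'r) gspace_scheme \<Rightarrow> ('g, 'y, 's) gspace_scheme \<Rightarrow> ('g, 'x \<times> 'y) gspace" where
  "graded_tensor \<Gamma> V W =
     \<lparr>space = tensor_space (space V) (space W),
      component = (\<lambda>\<gamma>. qvec.span {u \<otimes>\<^sub>\<rat> v |u v. \<exists>\<alpha> \<in> carrier \<Gamma>. \<exists>\<beta> \<in> carrier \<Gamma>.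
        \<alpha> \<otimes>\<^bsub>\<Gamma>\<^esub> \<beta> = \<gamma> \<and> u \<in> component V \<alpha> \<and> v \<in> component W \<beta>})\<rparr>"

definition unit_object :: "'g monoid \<Rightarrow> ('g, unit) gspace" where
  "unit_object \<Gamma> = \<lparr>space = UNIV, component = (\<lambda>\<gamma>. if \<gamma> = \<one>\<^bsub>\<Gamma>\<^esub> then UNIV else {0})\<rparr>"

definition left_unitor :: "(unit \<times> 'x \<Rightarrow> rat) \<Rightarrow> 'x \<Rightarrow> rat" where
  "left_unitor t = (\<lambda>x. t ((), x))"

definition right_unitor :: "('x \<times> unit \<Rightarrow> rat) \<Rightarrow> 'x \<Rightarrow> rat" where
  "right_unitor t = (\<lambda>x. t (x, ()))"

definition braiding ::
    "'g monoid \<Rightarrow> ('g \<Rightarrow> 'g \<Rightarrow> rat) \<Rightarrow> ('g, 'x, 'r) gspace_scheme \<Rightarrow> ('g, 'y, 's) gspace_scheme \<Rightarrow>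
     ('x \<times> 'y \<Rightarrow> rat) \<Rightarrow> 'y \<times> 'x \<Rightarrow> rat" where
  "braiding \<Gamma> \<chi> V W =
     (SOME L. Vector_Spaces.linear qscale qscale L \<and>
        (\<forall>\<gamma> \<in> carrier \<Gamma>. \<forall>\<delta> \<in> carrier \<Gamma>. \<forall>u \<in> component V \<gamma>. \<forall>v \<in> component W \<delta>.
           L (u \<otimes>\<^sub>\<rat> v) = qscale (\<chi> \<gamma> \<delta>) (v \<otimes>\<^sub>\<rat> u)))"

text \<open>The map \<open>id \<otimes> \<Psi> \<otimes> id\<close> on \<open>(V \<otimes> V) \<otimes> (V \<otimes> V)\<close>.\<close>

definition middle_braiding ::
    "'g monoid \<Rightarrow> ('g \<Rightarrow> 'g \<Rightarrow> rat) \<Rightarrow> ('g, 'x, 'r) gspace_scheme \<Rightarrow>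
     (('x \<times> 'x) \<times> ('x \<times> 'x) \<Rightarrow> rat) \<Rightarrow> ('x \<times> 'x) \<times> ('x \<times> 'x) \<Rightarrow> rat" where
  "middle_braiding \<Gamma> \<chi> V =
     assoc_left \<circ>
     tensor_map (space V) (tensor_space (space V) (tensor_space (space V) (space V))) id
       (assoc_right \<circ>
        tensor_map (tensor_space (space V) (space V)) (space V) (braiding \<Gamma> \<chi> V V) id \<circ>
        assoc_left) \<circ>
     assoc_right"


section \<open>Bialgebras and Nichols algebras\<close>

text \<open>The product is the linear map \<open>B \<otimes> B \<rightarrow> B\<close>; the product of \<open>u\<close> and \<open>v\<close> is
  \<open>product B (u \<otimes>\<^sub>\<rat> v)\<close>.\<close>

record ('g, 'x) bialg = "('g, 'x) gspace" +
  product :: "('x \<times> 'x \<Rightarrow> rat) \<Rightarrow> 'x \<Rightarrow> rat"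
  unity :: "'x \<Rightarrow> rat"
  coproduct :: "('x \<Rightarrow> rat) \<Rightarrow> 'x \<times> 'x \<Rightarrow> rat"
  counit :: "('x \<Rightarrow> rat) \<Rightarrow> rat"

definition algebra_in :: "'g monoid \<Rightarrow> ('g, 'x) bialg \<Rightarrow> bool" where
  "algebra_in \<Gamma> B \<longleftrightarrow> graded_space \<Gamma> B \<and>
     graded_morphism \<Gamma> (graded_tensor \<Gamma> B B) B (product B) \<and>
     unity B \<in> component B \<one>\<^bsub>\<Gamma>\<^esub> \<and>
     (\<forall>t \<in> tensor_space (tensor_space (space B) (space B)) (space B).
        product B (tensor_map (tensor_space (space B) (space B)) (space B) (product B) id t) =
        product B (tensor_map (space B) (tensor_space (space B) (space B)) id (product B)
          (assoc_right t))) \<and>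
     (\<forall>u \<in> space B. product B (unity B \<otimes>\<^sub>\<rat> u) = u \<and> product B (u \<otimes>\<^sub>\<rat> unity B) = u)"

text \<open>The counit as a map to the unit object.\<close>

definition counit_map :: "('g, 'x) bialg \<Rightarrow> ('x \<Rightarrow> rat) \<Rightarrow> unit \<Rightarrow> rat" where
  "counit_map B u = (\<lambda>_. counit B u)"

definition coalgebra_in :: "'g monoid \<Rightarrow> ('g, 'x) bialg \<Rightarrow> bool" where
  "coalgebra_in \<Gamma> B \<longleftrightarrow> graded_space \<Gamma> B \<and>
     graded_morphism \<Gamma> B (graded_tensor \<Gamma> B B) (coproduct B) \<and>
     graded_morphism \<Gamma> B (unit_object \<Gamma>) (counit_map B) \<and>
     (\<forall>u \<in> space B.
        assoc_right (tensor_map (space B) (space B) (coproduct B) id (coproduct B u)) =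
          tensor_map (space B) (space B) id (coproduct B) (coproduct B u) \<and>
        left_unitor (tensor_map (space B) (space B) (counit_map B) id (coproduct B u)) = u \<and>
        right_unitor (tensor_map (space B) (space B) id (counit_map B) (coproduct B u)) = u)"

definition bialgebra_in :: "'g monoid \<Rightarrow> ('g \<Rightarrow> 'g \<Rightarrow> rat) \<Rightarrow> ('g, 'x) bialg \<Rightarrow> bool" where
  "bialgebra_in \<Gamma> \<chi> B \<longleftrightarrow> comm_monoid \<Gamma> \<and> bicharacter \<Gamma> \<chi> \<and> algebra_in \<Gamma> B \<and> coalgebra_in \<Gamma> B \<and>
     (\<forall>t \<in> tensor_space (space B) (space B).
        coproduct B (product B t) =
          tensor_map (tensor_space (space B) (space B)) (tensor_space (space B) (space B))
            (product B) (product B)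
            (middle_braiding \<Gamma> \<chi> B
              (tensor_map (space B) (space B) (coproduct B) (coproduct B) t))) \<and>
     coproduct B (unity B) = unity B \<otimes>\<^sub>\<rat> unity B \<and>
     (\<forall>u \<in> space B. \<forall>v \<in> space B. counit B (product B (u \<otimes>\<^sub>\<rat> v)) = counit B u * counit B v) \<and>
     counit B (unity B) = 1"

definition Prim :: "('g, 'x) bialg \<Rightarrow> ('x \<Rightarrow> rat) set" where
  "Prim B = {v \<in> space B. coproduct B v = v \<otimes>\<^sub>\<rat> unity B + unity B \<otimes>\<^sub>\<rat> v}"

definition subalgebra_gen :: "('g, 'x) bialg \<Rightarrow> ('x \<Rightarrow> rat) set \<Rightarrow> ('x \<Rightarrow> rat) set" where
  "subalgebra_gen B S = \<Inter>{W. qvec.subspace W \<and> W \<subseteq> space B \<and> unity B \<in> W \<and> S \<subseteq> W \<and>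
     (\<forall>u \<in> W. \<forall>v \<in> W. product B (u \<otimes>\<^sub>\<rat> v) \<in> W)}"

definition sub_bialg :: "('g, 'x) bialg \<Rightarrow> ('x \<Rightarrow> rat) set \<Rightarrow> ('g, 'x) bialg" where
  "sub_bialg B W = B\<lparr>space := W, component := (\<lambda>\<gamma>. W \<inter> component B \<gamma>)\<rparr>"

text \<open>\<open>nat_grading \<Gamma> B G\<close>: the bialgebra \<open>B\<close> is graded by the natural numbers, with \<open>n\<close>-th
  component the subobject \<open>G n\<close>.\<close>

definition nat_grading ::
    "'g monoid \<Rightarrow> ('g, 'x) bialg \<Rightarrow> (nat \<Rightarrow> ('g, 'x) gspace) \<Rightarrow> bool" where
  "nat_grading \<Gamma> B G \<longleftrightarrow>
     (\<forall>n. graded_subspace \<Gamma> (G n) B) \<and>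
     direct_sum_of UNIV (\<lambda>n. space (G n)) (space B) \<and>
     unity B \<in> space (G 0) \<and>
     (\<forall>m n. \<forall>u \<in> space (G m). \<forall>v \<in> space (G n). product B (u \<otimes>\<^sub>\<rat> v) \<in> space (G (m + n))) \<and>
     (\<forall>n. \<forall>u \<in> space (G n).
        coproduct B u \<in> qvec.span (\<Union>i \<le> n. tensor_space (space (G i)) (space (G (n - i))))) \<and>
     (\<forall>n > 0. \<forall>u \<in> space (G n). counit B u = 0)"

definition nichols_algebra_of ::
    "'g monoid \<Rightarrow> ('g \<Rightarrow> 'g \<Rightarrow> rat) \<Rightarrow> ('g, 'x) gspace \<Rightarrow> ('g, 'x) bialg \<Rightarrow> bool" where
  "nichols_algebra_of \<Gamma> \<chi> V B \<longleftrightarrow> bialgebra_in \<Gamma> \<chi> B \<and>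
     (\<exists>G. nat_grading \<Gamma> B G \<and>
        space (G 0) = qvec.span {unity B} \<and> G 1 = V \<and>
        space (G 1) = Prim B \<and> subalgebra_gen B (space (G 1)) = space B)"

definition nichols_algebra :: "'g monoid \<Rightarrow> ('g \<Rightarrow> 'g \<Rightarrow> rat) \<Rightarrow> ('g, 'x) bialg \<Rightarrow> bool" where
  "nichols_algebra \<Gamma> \<chi> B \<longleftrightarrow> (\<exists>V. nichols_algebra_of \<Gamma> \<chi> V B)"


section \<open>The Hall algebra\<close>

definition Aut_set :: "('o, 'm) preadd_cat \<Rightarrow> 'o \<Rightarrow> 'm set" where
  "Aut_set \<A> X = {f \<in> Hom_set \<A> X X. is_isom \<A> f}"

definition hall_number :: "('o, 'm) preadd_cat \<Rightarrow> 'o \<Rightarrow> 'o \<Rightarrow> 'o \<Rightarrow> rat" where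
  "hall_number \<A> A B X =
     of_nat (card {s. short_exact \<A> B X A s}) / of_nat (card (Aut_set \<A> A) * card (Aut_set \<A> B))"

definition dual_hall_number :: "('o, 'm) preadd_cat \<Rightarrow> 'o \<Rightarrow> 'o \<Rightarrow> 'o \<Rightarrow> rat" where
  "dual_hall_number \<A> A B C =
     of_nat (card (Aut_set \<A> A) * card (Aut_set \<A> B)) / of_nat (card (Aut_set \<A> C)) * hall_number \<A> B A C"

text \<open>A representative of an isomorphism class; the numbers above only depend on the classes of
  the objects.\<close>

definition rep :: "'o set \<Rightarrow> 'o" where
  "rep a = (SOME X. X \<in> a)"

definition basis_vector :: "'x \<Rightarrow> 'x \<Rightarrow> rat" where
  "basis_vector a = (\<lambda>b. if b = a then 1 else 0)"

definition hall_space :: "('o, 'm) preadd_cat \<Rightarrow> ('o set \<Rightarrow> rat) set" where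
  "hall_space \<A> = {u. finite {a. u a \<noteq> 0} \<and> {a. u a \<noteq> 0} \<subseteq> Iso \<A>}"

definition hall_algebra :: "('o, 'm) preadd_cat \<Rightarrow> ('o set set, 'o set) bialg" where
  "hall_algebra \<A> =
     \<lparr>space = hall_space \<A>,
      component = (\<lambda>\<gamma>. {u \<in> hall_space \<A>. \<forall>a. u a \<noteq> 0 \<longrightarrow> groth_class \<A> a = \<gamma>}),
      product = (\<lambda>t c. if c \<in> Iso \<A>
        then \<Sum>p | t p \<noteq> 0. t p * hall_number \<A> (rep (fst p)) (rep (snd p)) (rep c) else 0),
      unity = basis_vector (zero_class \<A>),
      coproduct = (\<lambda>u (a, b). if a \<in> Iso \<A> \<and> b \<in> Iso \<A>
        then \<Sum>c | u c \<noteq> 0. u c * dual_hall_number \<A> (rep a) (rep b) (rep c) else 0),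
      counit = (\<lambda>u. u (zero_class \<A>))\<rparr>"

definition C_algebra :: "('o, 'm) preadd_cat \<Rightarrow> ('o set \<Rightarrow> rat) set" where
  "C_algebra \<A> = subalgebra_gen (hall_algebra \<A>)
     {basis_vector (iso_class \<A> X) |X. almost_simple \<A> X}"

definition V_component :: "('o, 'm) preadd_cat \<Rightarrow> 'o set set \<Rightarrow> ('o set \<Rightarrow> rat) set" where
  "V_component \<A> \<gamma> = Prim (hall_algebra \<A>) \<inter> component (hall_algebra \<A>) \<gamma>"

definition U_algebra :: "('o, 'm) preadd_cat \<Rightarrow> ('o set \<Rightarrow> rat) set" where
  "U_algebra \<A> = subalgebra_gen (hall_algebra \<A>)
     (\<Union>\<gamma> \<in> {\<gamma> \<in> carrier (groth_monoid \<A>). qvec.dim (V_component \<A> \<gamma>) = 1}. V_component \<A> \<gamma>)"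

end

theory Submission
  imports Defs
begin

text \<open>Green's theorem makes the Hall algebra of a hereditary category a braided bialgebra. Its combinatorial
  core is the count of \<open>3 \<times> 3\<close> diagrams with prescribed corners: completing one amounts to filling a
  2-extension \<open>N \<rightarrow> S \<rightarrow> T \<rightarrow> M\<close>, i.e. factoring the middle map through an object \<open>X\<close> with exact sequences
  \<open>N \<rightarrow> X \<rightarrow> T\<close> and \<open>S \<rightarrow> X \<rightarrow> M\<close>. The obstruction lies in the second Ext group, which
  vanishes, and the classes of fillings form a torsor under the first one.

  A subalgebra generated by homogeneous primitive elements is a subbialgebra, spanned by the products of
  \<open>n\<close> generators, \<open>n \<ge> 0\<close>. The form \<open>\<langle>[A], [B]\<rangle> = \<delta> / #Aut A\<close> makes product and coproduct adjoint, so the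
  spaces for different \<open>n\<close> are orthogonal and a primitive element orthogonal to the generators is orthogonal to
  the whole subalgebra. Since the form is positive definite, the sum is direct and every primitive element has
  degree 1. Both algebras have homogeneous primitive generators.\<close>

section \<open>Abelian categories\<close>

text \<open>Green's formula and the multiplicativity of the Euler form, which in turn makes that
  form well defined on classes, come from one weighted count. For a fixed 2-extension with ends N
  and M, the sum over X of (fillings through X) / #Aut X equals (classes of fillings) / #Hom(M, N).
  The denominator is a stabiliser: the automorphisms of X that fix a filling differ from the
  identity by maps that factor through some M \<rightarrow> N. The number of classes is found by
  comparison, which avoids Baer sums: it is constant along morphisms of 2-extensions, and the
  vanishing of Ext^2 connects the given 2-extension by such morphisms with the one whose middle map
  is 0, where the fillings are the short exact sequences themselves.

  The other obstacle is finiteness. All counts run over isomorphism classes and need a finite index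
  set that contains the subobjects and quotients of its members. The set used consists of the direct
  summands of all objects of one class in the Grothendieck monoid.\<close>

definition dual_cat :: "('o, 'm) preadd_cat \<Rightarrow> ('o, 'm) preadd_cat" where
  "dual_cat \<A> = \<lparr>Ob = Ob \<A>, Arr = Arr \<A>, Dom = Cod \<A>, Cod = Dom \<A>, Ident = Ident \<A>,
     Comp = (\<lambda>g f. Comp \<A> f g), Null = (\<lambda>X Y. Null \<A> Y X), Plus = Plus \<A>\<rparr>"

lemma dual_cat_simps [simp]:
  "Ob (dual_cat \<A>) = Ob \<A>" "Arr (dual_cat \<A>) = Arr \<A>" "Dom (dual_cat \<A>) = Cod \<A>"
  "Cod (dual_cat \<A>) = Dom \<A>" "Ident (dual_cat \<A>) = Ident \<A>" "Comp (dual_cat \<A>) g f = Comp \<A> f g"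
  "Null (dual_cat \<A>) X Y = Null \<A> Y X" "Plus (dual_cat \<A>) = Plus \<A>"
  by (simp_all add: dual_cat_def)

lemma Hom_set_dual [simp]: "Hom_set (dual_cat \<A>) X Y = Hom_set \<A> Y X"
  by (auto simp: Hom_set_def)

lemma dual_dual [simp]: "dual_cat (dual_cat \<A>) = \<A>"
  by (simp add: dual_cat_def)

lemma is_mono_dual [simp]: "is_mono (dual_cat \<A>) f = is_epi \<A> f"
  by (simp add: is_mono_def is_epi_def)

lemma is_epi_dual [simp]: "is_epi (dual_cat \<A>) f = is_mono \<A> f"
  by (simp add: is_mono_def is_epi_def)

lemma is_kernel_dual [simp]: "is_kernel (dual_cat \<A>) f k = is_cokernel \<A> f k"
  by (simp add: is_kernel_def is_cokernel_def)

lemma is_cokernel_dual [simp]: "is_cokernel (dual_cat \<A>) f k = is_kernel \<A> f k"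
  by (simp add: is_kernel_def is_cokernel_def)

lemma is_isom_dual [simp]: "is_isom (dual_cat \<A>) f = is_isom \<A> f"
  by (auto simp: is_isom_def)

lemma is_zero_object_dual [simp]: "is_zero_object (dual_cat \<A>) Z = is_zero_object \<A> Z"
  by (auto simp: is_zero_object_def)

lemma is_biproduct_dual [simp]: "is_biproduct (dual_cat \<A>) X Y S = is_biproduct \<A> X Y S"
  unfolding is_biproduct_def by (simp, blast)

text \<open>\<open>short_exact\<close> without the objects, which the arrows determine; in this form
  duality just swaps the two arrows.\<close>

definition ses :: "('o, 'm) preadd_cat \<Rightarrow> 'm \<Rightarrow> 'm \<Rightarrow> bool" where
  "ses \<A> f g \<longleftrightarrow> is_kernel \<A> g f \<and> is_cokernel \<A> f g"

lemma ses_dual [simp]: "ses (dual_cat \<A>) f g = ses \<A> g f"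
  by (auto simp: ses_def)

lemma short_exact_iff: "short_exact \<A> B X A (f, g) \<longleftrightarrow> f \<in> Hom_set \<A> B X \<and> g \<in> Hom_set \<A> X A \<and> ses \<A> f g"
  by (simp add: short_exact_def ses_def)

text \<open>There is no separate notion of pushout: it is
  \<open>is_pullback (dual_cat \<A>)\<close>, so that facts on pushouts are instances of facts on
  pullbacks.\<close>

definition is_pullback :: "('o, 'm) preadd_cat \<Rightarrow> 'm \<Rightarrow> 'm \<Rightarrow> 'm \<Rightarrow> 'm \<Rightarrow> bool" where
  "is_pullback \<A> f g p q \<longleftrightarrow> f \<in> Arr \<A> \<and> g \<in> Arr \<A> \<and> p \<in> Arr \<A> \<and> q \<in> Arr \<A> \<and> Cod \<A> f = Cod \<A> g \<and>
     Dom \<A> p = Dom \<A> q \<and> Cod \<A> p = Dom \<A> f \<and> Cod \<A> q = Dom \<A> g \<and> Comp \<A> f p = Comp \<A> g q \<and>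
     (\<forall>x \<in> Arr \<A>. \<forall>y \<in> Arr \<A>. Dom \<A> x = Dom \<A> y \<and> Cod \<A> x = Dom \<A> f \<and> Cod \<A> y = Dom \<A> g \<and>
        Comp \<A> f x = Comp \<A> g y \<longrightarrow>
        (\<exists>!u. u \<in> Hom_set \<A> (Dom \<A> x) (Dom \<A> p) \<and> Comp \<A> p u = x \<and> Comp \<A> q u = y))"

context abelian_category
begin

abbreviation cmp (infixr "\<cdot>" 70) where "g \<cdot> f \<equiv> Comp \<A> g f"
abbreviation arr where "arr f \<equiv> f \<in> Arr \<A>"
abbreviation dom where "dom f \<equiv> Dom \<A> f"
abbreviation cod where "cod f \<equiv> Cod \<A> f"
abbreviation Hom where "Hom X Y \<equiv> Hom_set \<A> X Y"
abbreviation nul where "nul X Y \<equiv> Null \<A> X Y"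

section \<open>Composition and the additive structure of the hom sets\<close>

lemma Hom_iff: "f \<in> Hom X Y \<longleftrightarrow> arr f \<and> dom f = X \<and> cod f = Y"
  by (simp add: Hom_set_def)

lemma arr_Hom [simp]: "arr f \<Longrightarrow> f \<in> Hom (dom f) (cod f)"
  by (simp add: Hom_iff)

lemma Hom_Ob: "f \<in> Hom X Y \<Longrightarrow> X \<in> Ob \<A> \<and> Y \<in> Ob \<A>"
  using Dom_Ob Cod_Ob by (auto simp: Hom_iff)

lemma arr_Ob [simp]: "arr f \<Longrightarrow> dom f \<in> Ob \<A>" "arr f \<Longrightarrow> cod f \<in> Ob \<A>"
  using Dom_Ob Cod_Ob by auto

lemma comp_simps [simp]:
  assumes "arr f" "arr g" "cod f = dom g"
  shows "arr (g \<cdot> f)" "dom (g \<cdot> f) = dom f" "cod (g \<cdot> f) = cod g"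
  using Comp_Hom[of f "dom f" "cod f" g "cod g"] assms by (auto simp: Hom_iff)

lemma comp_assoc [simp]:
  assumes "arr f" "arr g" "arr h" "cod f = dom g" "cod g = dom h"
  shows "(h \<cdot> g) \<cdot> f = h \<cdot> g \<cdot> f"
  using Comp_assoc[of f "dom f" "cod f" g "cod g" h "cod h"] assms by (auto simp: Hom_iff)

text \<open>Composites are normalised by bracketing to the right, where \<open>g \<cdot> f\<close>
  is no longer a subterm once something is composed on the right. The tail \<open>w\<close> makes an
  equation for \<open>g \<cdot> f\<close> applicable again; \<open>square\<close> does the same for
  commuting squares.\<close>

lemma reassoc:
  assumes "g \<cdot> f = h" "arr f" "arr g" "cod f = dom g" "arr w" "cod w = dom f"
  shows "g \<cdot> f \<cdot> w = h \<cdot> w"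
  using assms comp_assoc[of w f g] by simp

lemma square:
  assumes "g \<cdot> f = g' \<cdot> f'" "arr f" "arr g" "cod f = dom g" "arr f'" "arr g'" "cod f' = dom g'" "dom f = dom f'" "arr w" "cod w = dom f"
  shows "g \<cdot> f \<cdot> w = g' \<cdot> f' \<cdot> w"
  using assms comp_assoc[of w f g] comp_assoc[of w f' g'] by simp

lemma ident_simps [simp]:
  assumes "X \<in> Ob \<A>"
  shows "arr (Ident \<A> X)" "dom (Ident \<A> X) = X" "cod (Ident \<A> X) = X"
  using Ident_Hom[OF assms] by (auto simp: Hom_iff)

lemma comp_ident [simp]: "arr f \<Longrightarrow> dom f = X \<Longrightarrow> f \<cdot> Ident \<A> X = f"
  "arr f \<Longrightarrow> cod f = X \<Longrightarrow> Ident \<A> X \<cdot> f = f"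
  using Comp_Ident Ident_Comp by auto

lemma Hom_group_simps [simp]: "carrier (Hom_group \<A> X Y) = Hom X Y"
  "mult (Hom_group \<A> X Y) = Plus \<A>" "one (Hom_group \<A> X Y) = nul X Y"
  by (simp_all add: Hom_group_def)

lemma nul_Hom: "X \<in> Ob \<A> \<Longrightarrow> Y \<in> Ob \<A> \<Longrightarrow> nul X Y \<in> Hom X Y"
  using monoid.one_closed[OF comm_monoid.axioms(1)[OF comm_group.axioms(1)[OF Hom_comm_group[of X Y]]]] by simp

lemma nul_simps [simp]:
  assumes "X \<in> Ob \<A>" "Y \<in> Ob \<A>"
  shows "arr (nul X Y)" "dom (nul X Y) = X" "cod (nul X Y) = Y"
  using nul_Hom[OF assms] by (auto simp: Hom_iff)

lemma plus_simps [simp]: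
  assumes "arr f" "arr g" "dom f = dom g" "cod f = cod g"
  shows "arr (Plus \<A> f g)" "dom (Plus \<A> f g) = dom g" "cod (Plus \<A> f g) = cod g"
proof -
  interpret G: comm_group "Hom_group \<A> (dom g) (cod g)" using assms by (intro Hom_comm_group) auto
  have "Plus \<A> f g \<in> Hom (dom g) (cod g)" using G.m_closed[of f g] assms by (simp add: Hom_iff)
  then show "arr (Plus \<A> f g)" "dom (Plus \<A> f g) = dom g" "cod (Plus \<A> f g) = cod g"
    by (auto simp: Hom_iff)
qed

lemma plus_nul [simp]:
  assumes "arr f" "dom f = X" "cod f = Y"
  shows "Plus \<A> f (nul X Y) = f" "Plus \<A> (nul X Y) f = f"
proof -
  interpret G: comm_group "Hom_group \<A> X Y" using assms by (intro Hom_comm_group) auto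
  show "Plus \<A> f (nul X Y) = f" "Plus \<A> (nul X Y) f = f"
    using G.r_one[of f] G.l_one[of f] assms by (auto simp: Hom_iff)
qed

lemma plus_cancel:
  assumes "Plus \<A> f g = Plus \<A> f h" "arr f" "g \<in> Hom (dom f) (cod f)" "h \<in> Hom (dom f) (cod f)"
  shows "g = h"
proof -
  interpret G: comm_group "Hom_group \<A> (dom f) (cod f)" using assms by (intro Hom_comm_group) auto
  show ?thesis using G.Units_l_cancel[of f g h] assms by (auto simp: Hom_iff)
qed

lemma plus_comm:
  assumes "arr f" "g \<in> Hom (dom f) (cod f)"
  shows "Plus \<A> f g = Plus \<A> g f"
proof -
  interpret G: comm_group "Hom_group \<A> (dom f) (cod f)" using assms by (intro Hom_comm_group) auto
  show ?thesis using G.m_comm[of f g] assms by (auto simp: Hom_iff)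
qed

lemma plus_assoc:
  assumes "f \<in> Hom X Y" "g \<in> Hom X Y" "h \<in> Hom X Y"
  shows "Plus \<A> (Plus \<A> f g) h = Plus \<A> f (Plus \<A> g h)"
proof -
  interpret G: comm_group "Hom_group \<A> X Y" using assms Hom_Ob by (intro Hom_comm_group) auto
  show ?thesis using G.m_assoc[of f g h] assms by auto
qed

lemma ex_neg:
  assumes "arr f"
  obtains g where "g \<in> Hom (dom f) (cod f)" "Plus \<A> f g = nul (dom f) (cod f)" "Plus \<A> g f = nul (dom f) (cod f)"
proof -
  interpret G: comm_group "Hom_group \<A> (dom f) (cod f)" using assms by (intro Hom_comm_group) auto
  show ?thesis using that[of "inv\<^bsub>Hom_group \<A> (dom f) (cod f)\<^esub> f"] G.inv_closed[of f] G.r_inv[of f] G.l_inv[of f] assms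
    by auto
qed

lemma comp_plus:
  assumes "arr f" "arr f'" "arr g" "dom f = dom f'" "cod f = dom g" "cod f' = dom g"
  shows "g \<cdot> Plus \<A> f f' = Plus \<A> (g \<cdot> f) (g \<cdot> f')"
  using Comp_Plus[of f "dom f" "cod f" f' g "cod g"] assms by (auto simp: Hom_iff)

lemma plus_comp:
  assumes "arr f" "arr g" "arr g'" "cod f = dom g" "dom g' = dom g" "cod g' = cod g"
  shows "Plus \<A> g g' \<cdot> f = Plus \<A> (g \<cdot> f) (g' \<cdot> f)"
  using Plus_Comp[of f "dom f" "cod f" g "cod g" g'] assms by (auto simp: Hom_iff)

lemma comp_nul [simp]:
  assumes "arr g" "X \<in> Ob \<A>" "dom g = Y"
  shows "g \<cdot> nul X Y = nul X (cod g)"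
proof -
  have Y: "Y \<in> Ob \<A>" using assms by auto
  have "Plus \<A> (g \<cdot> nul X Y) (g \<cdot> nul X Y) = g \<cdot> nul X Y"
    using comp_plus[of "nul X Y" "nul X Y" g] assms Y by simp
  also have "\<dots> = Plus \<A> (g \<cdot> nul X Y) (nul X (cod g))" using assms Y by simp
  finally show ?thesis by (rule plus_cancel) (use assms Y in \<open>auto simp: Hom_iff\<close>)
qed

lemma nul_comp [simp]:
  assumes "arr f" "Z \<in> Ob \<A>" "cod f = Y"
  shows "nul Y Z \<cdot> f = nul (dom f) Z"
proof -
  have Y: "Y \<in> Ob \<A>" using assms by auto
  have "Plus \<A> (nul Y Z \<cdot> f) (nul Y Z \<cdot> f) = nul Y Z \<cdot> f"
    using plus_comp[of f "nul Y Z" "nul Y Z"] assms Y by simp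
  also have "\<dots> = Plus \<A> (nul Y Z \<cdot> f) (nul (dom f) Z)" using assms Y by simp
  finally show ?thesis by (rule plus_cancel) (use assms Y in \<open>auto simp: Hom_iff\<close>)
qed

end

text \<open>The axioms come in dual pairs. Interpreting the theory in the opposite category turns
  later facts on kernels, monomorphisms and pullbacks into facts on cokernels, epimorphisms and
  pushouts.\<close>

lemma dual_cat_abelian: "abelian_category \<A> \<Longrightarrow> abelian_category (dual_cat \<A>)"
proof -
  assume "abelian_category \<A>"
  then interpret abelian_category \<A> .
  have 1: "Hom_group (dual_cat \<A>) X Y = Hom_group \<A> Y X" for X Y by (simp add: Hom_group_def)
  have "category (dual_cat \<A>)"
    by (rule category.intro) (auto simp: Hom_iff)
  moreover have "abelian_category_axioms (dual_cat \<A>)"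
  proof (rule abelian_category_axioms.intro, goal_cases)
    case 1 then show ?case using Hom_comm_group 1 by (simp add: \<open>\<And>X Y. Hom_group (dual_cat \<A>) X Y = Hom_group \<A> Y X\<close>)
  next
    case (2 f X Y f' g Z) then show ?case using plus_comp[of g f f'] by (simp add: Hom_iff)
  next
    case (3 f X Y g Z g') then show ?case using comp_plus[of g g' f] by (simp add: Hom_iff)
  next
    case (5 X Y) then show ?case using ex_biproduct by simp
  qed (use ex_zero_object ex_kernel ex_cokernel mono_normal epi_normal in simp_all)
  ultimately show ?thesis by (rule abelian_category.intro)
qed

context abelian_category
begin

section \<open>Monomorphisms, kernels and isomorphisms\<close>

lemma mono_cancel:
  assumes "is_mono \<A> f" "f \<cdot> u = f \<cdot> v" "arr u" "arr v" "dom u = dom v" "cod u = dom f" "cod v = dom f"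
  shows "u = v"
proof -
  have "u \<in> Hom (dom u) (dom f)" "v \<in> Hom (dom u) (dom f)" "dom u \<in> Ob \<A>"
    using assms by (simp_all add: Hom_iff)
  then show ?thesis using assms(1,2) unfolding is_mono_def by blast
qed

lemma mono_nul:
  assumes "is_mono \<A> f" "f \<cdot> u = nul (dom u) (cod f)" "arr u" "cod u = dom f"
  shows "u = nul (dom u) (dom f)"
proof -
  have "arr f" using assms by (simp add: is_mono_def)
  with assms show ?thesis using mono_cancel[OF assms(1), of u "nul (dom u) (dom f)"] by simp
qed

text \<open>Additivity reduces cancellation to zero maps: the test is applied to u - v, where
  \<open>v'\<close> is the negative of \<open>v\<close>.\<close>

lemma monoI:
  assumes f: "arr f" and z: "\<And>w. arr w \<Longrightarrow> cod w = dom f \<Longrightarrow> f \<cdot> w = nul (dom w) (cod f) \<Longrightarrow> w = nul (dom w) (dom f)"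
  shows "is_mono \<A> f"
  unfolding is_mono_def
proof (intro conjI ballI impI f)
  fix W u v assume *: "W \<in> Ob \<A>" "u \<in> Hom W (dom f)" "v \<in> Hom W (dom f)" "f \<cdot> u = f \<cdot> v"
  obtain v' where v': "v' \<in> Hom (dom v) (cod v)" "Plus \<A> v v' = nul (dom v) (cod v)" "Plus \<A> v' v = nul (dom v) (cod v)"
    using ex_neg[of v] * by (auto simp: Hom_iff)
  have "f \<cdot> Plus \<A> u v' = f \<cdot> Plus \<A> v v'"
    using * v' f comp_plus[of u v' f] comp_plus[of v v' f] by (simp add: Hom_iff)
  then have "Plus \<A> v' u = Plus \<A> v' v"
    using z[of "Plus \<A> u v'"] * v' f plus_comm[of v' u] by (simp add: Hom_iff)
  then show "u = v" by (rule plus_cancel) (use * v' in \<open>auto simp: Hom_iff\<close>)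
qed

lemma mono_comp:
  assumes "is_mono \<A> f" "is_mono \<A> g" "cod f = dom g"
  shows "is_mono \<A> (g \<cdot> f)"
proof -
  have a: "arr f" "arr g" using assms by (auto simp: is_mono_def)
  show ?thesis
  proof (rule monoI)
    fix w assume w: "arr w" "cod w = dom (g \<cdot> f)" "(g \<cdot> f) \<cdot> w = nul (dom w) (cod (g \<cdot> f))"
    then have "f \<cdot> w = nul (dom (f \<cdot> w)) (dom g)" using a assms mono_nul[of g "f \<cdot> w"] by simp
    then show "w = nul (dom w) (dom (g \<cdot> f))" using w a assms mono_nul[of f w] by simp
  qed (use a assms in simp)
qed

lemma mono_left:
  assumes "is_mono \<A> (g \<cdot> f)" "arr f" "arr g" "cod f = dom g"
  shows "is_mono \<A> f"
proof (rule monoI)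
  fix w assume "arr w" "cod w = dom f" "f \<cdot> w = nul (dom w) (cod f)"
  then show "w = nul (dom w) (dom f)" using assms mono_nul[of "g \<cdot> f" w] by simp
qed (use assms in simp)

lemma kernel_simps:
  assumes "is_kernel \<A> f k"
  shows "arr f" "arr k" "cod k = dom f" "f \<cdot> k = nul (dom k) (cod f)"
  using assms by (auto simp: is_kernel_def)

lemma kernel_factor:
  assumes "is_kernel \<A> f k" "arr h" "cod h = dom f" "f \<cdot> h = nul (dom h) (cod f)"
  obtains u where "arr u" "dom u = dom h" "cod u = dom k" "k \<cdot> u = h"
proof -
  have "\<exists>!u. u \<in> Hom_set \<A> (Dom \<A> h) (Dom \<A> k) \<and> Comp \<A> k u = h"
    using assms unfolding is_kernel_def by blast
  then show ?thesis using that by (auto simp: Hom_iff)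
qed

lemma kernel_mono:
  assumes "is_kernel \<A> f k" shows "is_mono \<A> k"
  unfolding is_mono_def
proof (intro conjI ballI impI)
  note k = kernel_simps[OF assms]
  show "arr k" by fact
  fix W u v assume *: "W \<in> Ob \<A>" "u \<in> Hom W (dom k)" "v \<in> Hom W (dom k)" "k \<cdot> u = k \<cdot> v"
  have u: "arr u" "dom u = W" "cod u = dom k" using * by (auto simp: Hom_iff)
  have "f \<cdot> k \<cdot> u = nul (dom (k \<cdot> u)) (cod f)" "arr (k \<cdot> u)" "cod (k \<cdot> u) = dom f"
    using k u by (simp_all add: reassoc[OF k(4)])
  then have "\<exists>!w. w \<in> Hom_set \<A> (Dom \<A> (k \<cdot> u)) (Dom \<A> k) \<and> Comp \<A> k w = k \<cdot> u"
    using assms unfolding is_kernel_def by blast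
  moreover have "dom (k \<cdot> u) = W" using u k by simp
  ultimately show "u = v" using *(2-4) by metis
qed

lemma kernelI:
  assumes "is_mono \<A> k" "arr f" "cod k = dom f" "f \<cdot> k = nul (dom k) (cod f)"
    and "\<And>h. arr h \<Longrightarrow> cod h = dom f \<Longrightarrow> f \<cdot> h = nul (dom h) (cod f) \<Longrightarrow> \<exists>u. arr u \<and> dom u = dom h \<and> cod u = dom k \<and> k \<cdot> u = h"
  shows "is_kernel \<A> f k"
  unfolding is_kernel_def
proof (intro conjI ballI impI)
  fix h assume h: "arr h" "cod h = dom f \<and> f \<cdot> h = nul (dom h) (cod f)"
  then obtain u where u: "arr u \<and> dom u = dom h \<and> cod u = dom k \<and> k \<cdot> u = h" using assms(5) by blast
  show "\<exists>!u. u \<in> Hom (dom h) (dom k) \<and> k \<cdot> u = h"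
  proof (rule ex1I[of _ u])
    show "u \<in> Hom (dom h) (dom k) \<and> k \<cdot> u = h" using u by (simp add: Hom_iff)
    fix v assume "v \<in> Hom (dom h) (dom k) \<and> k \<cdot> v = h"
    then show "v = u" by (auto simp: Hom_iff intro!: mono_cancel[OF assms(1), of v u] simp: u)
  qed
qed (use assms in \<open>auto simp: is_mono_def\<close>)

lemma iso_mono:
  assumes "is_isom \<A> f" shows "is_mono \<A> f"
proof -
  obtain g where "arr f" "arr g" "dom g = cod f" "cod g = dom f" "g \<cdot> f = Ident \<A> (dom f)"
    using assms by (auto simp: is_isom_def Hom_iff)
  note g = this
  show ?thesis
  proof (rule monoI)
    fix w assume w: "arr w" "cod w = dom f" "f \<cdot> w = nul (dom w) (cod f)"
    then have "g \<cdot> f \<cdot> w = nul (dom w) (dom f)" using g by simp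
    moreover have "g \<cdot> f \<cdot> w = w" using g w(1,2) by (simp add: reassoc[OF g(5)])
    ultimately show "w = nul (dom w) (dom f)" by simp
  qed (use g in simp)
qed

lemma is_isom_inverse:
  assumes "is_isom \<A> f"
  obtains g where "is_isom \<A> g" "arr g" "dom g = cod f" "cod g = dom f" "g \<cdot> f = Ident \<A> (dom f)" "f \<cdot> g = Ident \<A> (cod f)"
proof -
  obtain g where g: "g \<in> Hom (cod f) (dom f)" "g \<cdot> f = Ident \<A> (dom f)" "f \<cdot> g = Ident \<A> (cod f)"
    using assms unfolding is_isom_def by blast
  moreover have "is_isom \<A> g" using g assms unfolding is_isom_def by (auto simp: Hom_iff intro!: bexI[of _ f])
  ultimately show ?thesis using that by (simp add: Hom_iff)
qed

lemma is_isomI: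
  "arr f \<Longrightarrow> arr g \<Longrightarrow> dom g = cod f \<Longrightarrow> cod g = dom f \<Longrightarrow> g \<cdot> f = Ident \<A> (dom f) \<Longrightarrow> f \<cdot> g = Ident \<A> (cod f) \<Longrightarrow> is_isom \<A> f"
  unfolding is_isom_def by (auto simp: Hom_iff)

lemma is_isom_comp:
  assumes "is_isom \<A> f" "is_isom \<A> g" "cod f = dom g"
  shows "is_isom \<A> (g \<cdot> f)"
proof -
  have a: "arr f" "arr g" using assms by (auto simp: is_isom_def)
  obtain f' where f': "arr f'" "dom f' = cod f" "cod f' = dom f" "f' \<cdot> f = Ident \<A> (dom f)" "f \<cdot> f' = Ident \<A> (cod f)"
    using is_isom_inverse[OF assms(1)] by metis
  obtain g' where g': "arr g'" "dom g' = cod g" "cod g' = dom g" "g' \<cdot> g = Ident \<A> (dom g)" "g \<cdot> g' = Ident \<A> (cod g)"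
    using is_isom_inverse[OF assms(2)] by metis
  show ?thesis using a f' g' assms(3)
    by (intro is_isomI[of _ "f' \<cdot> g'"]) (simp_all add: reassoc[OF f'(4)] reassoc[OF f'(5)] reassoc[OF g'(4)] reassoc[OF g'(5)])
qed

lemma is_isom_ident [simp]: "X \<in> Ob \<A> \<Longrightarrow> is_isom \<A> (Ident \<A> X)"
  by (intro is_isomI[of _ "Ident \<A> X"]) auto

text \<open>A monomorphism is a kernel of some \<open>g\<close>; being epi it forces
  \<open>g\<close> to be 0, so the identity factors through \<open>f\<close>. The right inverse
  obtained in this way is two-sided because \<open>f\<close> is mono.\<close>

lemma mono_epi_isom:
  assumes "is_mono \<A> f" "is_epi \<A> f" shows "is_isom \<A> f"
proof -
  have a: "arr f" using assms by (simp add: is_mono_def)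
  obtain g where g: "is_kernel \<A> g f" using mono_normal[OF assms(1)] by auto
  note gs = kernel_simps[OF g]
  have "g \<cdot> f = nul (cod f) (cod g) \<cdot> f" using gs by simp
  moreover have "g \<in> Hom (cod f) (cod g)" "nul (cod f) (cod g) \<in> Hom (cod f) (cod g)" "cod g \<in> Ob \<A>"
    using gs by (simp_all add: Hom_iff)
  ultimately have "g = nul (cod f) (cod g)" using assms(2) unfolding is_epi_def by blast
  then have "g \<cdot> Ident \<A> (cod f) = nul (cod f) (cod g)" using gs by simp
  then obtain u where u: "arr u" "dom u = cod f" "cod u = dom f" "f \<cdot> u = Ident \<A> (cod f)"
    using kernel_factor[OF g, of "Ident \<A> (cod f)"] gs by auto
  have "u \<cdot> f = Ident \<A> (dom f)"
    by (rule mono_cancel[OF assms(1)]) (use u a in \<open>simp_all add: reassoc[OF u(4)]\<close>)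
  then show ?thesis using u a by (intro is_isomI[of f u]) auto
qed

lemma kernel_isom:
  assumes "is_kernel \<A> f k" "is_isom \<A> u" "cod u = dom k"
  shows "is_kernel \<A> f (k \<cdot> u)"
proof -
  note k = kernel_simps[OF assms(1)]
  obtain v where v: "arr v" "dom v = cod u" "cod v = dom u" "v \<cdot> u = Ident \<A> (dom u)" "u \<cdot> v = Ident \<A> (cod u)"
    using is_isom_inverse[OF assms(2)] by metis
  have u: "arr u" using assms(2) by (simp add: is_isom_def)
  show ?thesis
  proof (rule kernelI)
    show "is_mono \<A> (k \<cdot> u)" using mono_comp iso_mono kernel_mono assms by blast
    fix h assume h: "arr h" "cod h = dom f" "f \<cdot> h = nul (dom h) (cod f)"
    then obtain w where "arr w" "dom w = dom h" "cod w = dom k" "k \<cdot> w = h" using kernel_factor[OF assms(1)] by metis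
    then show "\<exists>w. arr w \<and> dom w = dom h \<and> cod w = dom (k \<cdot> u) \<and> (k \<cdot> u) \<cdot> w = h"
      using u v k assms by (intro exI[of _ "v \<cdot> w"]) (simp add: reassoc[OF v(5)])
  qed (use k u assms in \<open>auto simp: reassoc[OF k(4)]\<close>)
qed

lemma kernel_unique:
  assumes "is_kernel \<A> f k" "is_kernel \<A> f k'"
  obtains u where "is_isom \<A> u" "arr u" "dom u = dom k'" "cod u = dom k" "k \<cdot> u = k'"
proof -
  note k = kernel_simps[OF assms(1)] and k' = kernel_simps[OF assms(2)]
  obtain u where u: "arr u" "dom u = dom k'" "cod u = dom k" "k \<cdot> u = k'"
    using kernel_factor[OF assms(1), of k'] k' by auto
  obtain v where v: "arr v" "dom v = dom k" "cod v = dom k'" "k' \<cdot> v = k"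
    using kernel_factor[OF assms(2), of k] k by auto
  have "u \<cdot> v = Ident \<A> (dom k)"
    by (rule mono_cancel[OF kernel_mono[OF assms(1)]]) (use u v k k' in \<open>simp_all add: reassoc[OF u(4)]\<close>)
  moreover have "v \<cdot> u = Ident \<A> (dom k')"
    by (rule mono_cancel[OF kernel_mono[OF assms(2)]]) (use u v k k' in \<open>simp_all add: reassoc[OF v(4)]\<close>)
  ultimately have "is_isom \<A> u" using u v by (intro is_isomI[of u v]) simp_all
  then show ?thesis using that u by simp
qed

lemmas dual_ax = dual_cat_abelian[OF abelian_category_axioms]

section \<open>Epimorphisms, cokernels and short exact sequences\<close>

lemma epi_cancel:
  assumes "is_epi \<A> f" "u \<cdot> f = v \<cdot> f" "arr u" "arr v" "cod u = cod v" "dom u = cod f" "dom v = cod f"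
  shows "u = v"
  using abelian_category.mono_cancel[OF dual_ax, of f u v] assms by simp

lemma epi_nul:
  assumes "is_epi \<A> f" "u \<cdot> f = nul (dom f) (cod u)" "arr u" "dom u = cod f"
  shows "u = nul (cod f) (cod u)"
  using abelian_category.mono_nul[OF dual_ax, of f u] assms by simp

lemma epiI:
  assumes "arr f" "\<And>w. arr w \<Longrightarrow> dom w = cod f \<Longrightarrow> w \<cdot> f = nul (dom f) (cod w) \<Longrightarrow> w = nul (cod f) (cod w)"
  shows "is_epi \<A> f"
  using abelian_category.monoI[OF dual_ax, of f] assms by simp

lemma epi_comp:
  assumes "is_epi \<A> f" "is_epi \<A> g" "cod f = dom g"
  shows "is_epi \<A> (g \<cdot> f)"
  using abelian_category.mono_comp[OF dual_ax, of g f] assms by simp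

lemma epi_right:
  assumes "is_epi \<A> (g \<cdot> f)" "arr f" "arr g" "cod f = dom g"
  shows "is_epi \<A> g"
  using abelian_category.mono_left[OF dual_ax, of f g] assms by simp

lemma cokernel_simps:
  assumes "is_cokernel \<A> f k"
  shows "arr f" "arr k" "dom k = cod f" "k \<cdot> f = nul (dom f) (cod k)"
  using assms by (auto simp: is_cokernel_def)

lemma cokernel_factor:
  assumes "is_cokernel \<A> f k" "arr h" "dom h = cod f" "h \<cdot> f = nul (dom f) (cod h)"
  obtains u where "arr u" "dom u = cod k" "cod u = cod h" "u \<cdot> k = h"
  using abelian_category.kernel_factor[OF dual_ax, of f k h] assms by auto

lemma cokernel_epi: "is_cokernel \<A> f k \<Longrightarrow> is_epi \<A> k"
  using abelian_category.kernel_mono[OF dual_ax, of f k] by simp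

lemma cokernelI:
  assumes "is_epi \<A> k" "arr f" "dom k = cod f" "k \<cdot> f = nul (dom f) (cod k)"
    and "\<And>h. arr h \<Longrightarrow> dom h = cod f \<Longrightarrow> h \<cdot> f = nul (dom f) (cod h) \<Longrightarrow> \<exists>u. arr u \<and> dom u = cod k \<and> cod u = cod h \<and> u \<cdot> k = h"
  shows "is_cokernel \<A> f k"
  using abelian_category.kernelI[OF dual_ax, of k f] assms by (simp add: conj_ac)

lemma iso_epi: "is_isom \<A> f \<Longrightarrow> is_epi \<A> f"
  using abelian_category.iso_mono[OF dual_ax, of f] by simp

lemma ses_simps:
  assumes "ses \<A> f g"
  shows "arr f" "arr g" "cod f = dom g" "g \<cdot> f = nul (dom f) (cod g)" "is_mono \<A> f" "is_epi \<A> g"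
    "is_kernel \<A> g f" "is_cokernel \<A> f g"
  using assms kernel_mono[of g f] cokernel_epi[of f g] by (auto simp: ses_def is_kernel_def)

text \<open>The monomorphism is a kernel of some \<open>h\<close>, and \<open>h\<close> factors
  through the cokernel \<open>g\<close>. Hence whatever \<open>g\<close> kills is also killed by
  \<open>h\<close> and lifts to \<open>f\<close>.\<close>

lemma mono_cokernel_ses:
  assumes "is_mono \<A> f" "is_cokernel \<A> f g"
  shows "ses \<A> f g"
proof -
  obtain h where h: "is_kernel \<A> h f" using mono_normal[OF assms(1)] by auto
  note hs = kernel_simps[OF h] and g = cokernel_simps[OF assms(2)]
  obtain u where u: "arr u" "dom u = cod g" "cod u = cod h" "u \<cdot> g = h"
    using cokernel_factor[OF assms(2), of h] hs by auto
  have "is_kernel \<A> g f"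
  proof (rule kernelI)
    fix w assume w: "arr w" "cod w = dom g" "g \<cdot> w = nul (dom w) (cod g)"
    have "h \<cdot> w = u \<cdot> g \<cdot> w" using u g w(1,2) by (simp add: reassoc[OF u(4)])
    then have "h \<cdot> w = nul (dom w) (cod h)" using u w g by simp
    then obtain x where "arr x" "dom x = dom w" "cod x = dom f" "f \<cdot> x = w"
      using kernel_factor[OF h, of w] w hs g by auto
    then show "\<exists>u. arr u \<and> dom u = dom w \<and> cod u = dom f \<and> f \<cdot> u = w" by blast
  qed (use assms g in auto)
  then show ?thesis using assms by (simp add: ses_def)
qed

lemma epi_kernel_ses:
  assumes "is_epi \<A> g" "is_kernel \<A> g f"
  shows "ses \<A> f g"
  using abelian_category.mono_cokernel_ses[OF dual_ax, of g f] assms by simp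

section \<open>Pullbacks and pushouts\<close>

lemma pullback_simps:
  assumes "is_pullback \<A> f g p q"
  shows "arr f" "arr g" "arr p" "arr q" "cod f = cod g" "dom p = dom q" "cod p = dom f" "cod q = dom g"
    "f \<cdot> p = g \<cdot> q"
  using assms by (auto simp: is_pullback_def)

lemma pullback_factor:
  assumes "is_pullback \<A> f g p q" "arr x" "arr y" "dom x = dom y" "cod x = dom f" "cod y = dom g" "f \<cdot> x = g \<cdot> y"
  obtains u where "arr u" "dom u = dom x" "cod u = dom p" "p \<cdot> u = x" "q \<cdot> u = y"
proof -
  have "\<exists>!u. u \<in> Hom_set \<A> (Dom \<A> x) (Dom \<A> p) \<and> Comp \<A> p u = x \<and> Comp \<A> q u = y"
    using assms unfolding is_pullback_def by blast
  then show ?thesis using that by (auto simp: Hom_iff)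
qed

lemma pullback_unique:
  assumes "is_pullback \<A> f g p q" "arr u" "arr v" "dom u = dom v" "cod u = dom p" "cod v = dom p"
    "p \<cdot> u = p \<cdot> v" "q \<cdot> u = q \<cdot> v"
  shows "u = v"
proof -
  note pb = pullback_simps[OF assms(1)]
  have "f \<cdot> p \<cdot> u = g \<cdot> q \<cdot> u" using pb assms by (simp add: reassoc[OF pb(9)])
  moreover have "\<forall>x \<in> Arr \<A>. \<forall>y \<in> Arr \<A>. Dom \<A> x = Dom \<A> y \<and> Cod \<A> x = Dom \<A> f \<and> Cod \<A> y = Dom \<A> g \<and>
        Comp \<A> f x = Comp \<A> g y \<longrightarrow>
        (\<exists>!u. u \<in> Hom_set \<A> (Dom \<A> x) (Dom \<A> p) \<and> Comp \<A> p u = x \<and> Comp \<A> q u = y)"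
    using assms(1) unfolding is_pullback_def by blast
  moreover have "p \<cdot> u \<in> Arr \<A>" "q \<cdot> u \<in> Arr \<A>" "dom (p \<cdot> u) = dom (q \<cdot> u)" "cod (p \<cdot> u) = dom f" "cod (q \<cdot> u) = dom g"
    using pb assms by simp_all
  ultimately have "\<exists>!w. w \<in> Hom_set \<A> (dom (p \<cdot> u)) (dom p) \<and> p \<cdot> w = p \<cdot> u \<and> q \<cdot> w = q \<cdot> u" by blast
  then show ?thesis using pb assms by (auto simp: Hom_iff)
qed

text \<open>The pullback is the kernel of the difference d = f p - g q on the biproduct. Stability
  of epimorphisms is proved along with existence because it uses this construction: if
  \<open>f\<close> is epi then so is \<open>d\<close>, as d i = f, and \<open>d\<close> is the
  cokernel of its kernel. \<open>pullback_epi\<close> transfers the result to any pullback.\<close>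

lemma pullback_exists:
  assumes f: "arr f" "arr g" "cod f = cod g"
  obtains p q where "is_pullback \<A> f g p q" "is_epi \<A> f \<longrightarrow> is_epi \<A> q"
proof -
  obtain S i j p q where "i \<in> Hom (dom f) S" "j \<in> Hom (dom g) S" "p \<in> Hom S (dom f)" "q \<in> Hom S (dom g)"
    and S: "S \<in> Ob \<A>" "p \<cdot> i = Ident \<A> (dom f)" "q \<cdot> j = Ident \<A> (dom g)" "q \<cdot> i = nul (dom f) (dom g)"
      "p \<cdot> j = nul (dom g) (dom f)" "Plus \<A> (i \<cdot> p) (j \<cdot> q) = Ident \<A> S"
    using ex_biproduct[of "dom f" "dom g"] f unfolding is_biproduct_def by auto
  then have h: "arr i" "arr j" "arr p" "arr q" "dom i = dom f" "dom j = dom g" "cod i = S" "cod j = S"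
      "dom p = S" "dom q = S" "cod p = dom f" "cod q = dom g"
    by (auto simp: Hom_iff)
  obtain g' where "g' \<in> Hom (dom g) (cod g)" and g'2: "Plus \<A> g g' = nul (dom g) (cod g)"
    using ex_neg[of g] f by metis
  then have g': "arr g'" "dom g' = dom g" "cod g' = cod g" by (auto simp: Hom_iff)
  define d where "d = Plus \<A> (f \<cdot> p) (g' \<cdot> q)"
  have d: "arr d" "dom d = S" "cod d = cod g" using f g' h by (simp_all add: d_def)
  obtain k where k: "is_kernel \<A> d k" using ex_kernel[OF d(1)] by auto
  note ks = kernel_simps[OF k]
  have dw: "d \<cdot> w = Plus \<A> (f \<cdot> p \<cdot> w) (g' \<cdot> q \<cdot> w)" if "arr w" "cod w = S" for w
    using that f g' h unfolding d_def by (simp add: plus_comp)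
  have gg: "Plus \<A> (g \<cdot> w) (g' \<cdot> w) = nul (dom w) (cod g)" if "arr w" "cod w = dom g" for w
    using that f g' plus_comp[of w g g'] g'2 by simp
  have eq: "d \<cdot> w = nul (dom w) (cod g) \<longleftrightarrow> f \<cdot> p \<cdot> w = g \<cdot> q \<cdot> w" if w: "arr w" "cod w = S" for w
  proof
    assume "d \<cdot> w = nul (dom w) (cod g)"
    then have "Plus \<A> (g' \<cdot> q \<cdot> w) (f \<cdot> p \<cdot> w) = Plus \<A> (g' \<cdot> q \<cdot> w) (g \<cdot> q \<cdot> w)"
      using dw[OF w] gg[of "q \<cdot> w"] plus_comm[of "f \<cdot> p \<cdot> w" "g' \<cdot> q \<cdot> w"] plus_comm[of "g \<cdot> q \<cdot> w" "g' \<cdot> q \<cdot> w"] w f g' h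
      by (simp add: Hom_iff)
    then show "f \<cdot> p \<cdot> w = g \<cdot> q \<cdot> w"
      by (rule plus_cancel) (use w f g' h in \<open>simp_all add: Hom_iff\<close>)
  next
    assume "f \<cdot> p \<cdot> w = g \<cdot> q \<cdot> w"
    then show "d \<cdot> w = nul (dom w) (cod g)" using dw[OF w] gg[of "q \<cdot> w"] w f g' h by simp
  qed
  have joint: "u = v" if u: "arr u" "arr v" "cod u = S" "cod v = S" "p \<cdot> u = p \<cdot> v" "q \<cdot> u = q \<cdot> v" "dom u = dom v" for u v
  proof -
    have "Plus \<A> (i \<cdot> p) (j \<cdot> q) \<cdot> u = Plus \<A> (i \<cdot> p) (j \<cdot> q) \<cdot> v"
      using plus_comp[of u "i \<cdot> p" "j \<cdot> q"] plus_comp[of v "i \<cdot> p" "j \<cdot> q"] u h by simp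
    then show ?thesis using S u by simp
  qed
  have "is_pullback \<A> f g (p \<cdot> k) (q \<cdot> k)"
    unfolding is_pullback_def
  proof (intro conjI ballI impI)
    show "f \<cdot> p \<cdot> k = g \<cdot> q \<cdot> k" using eq[of k] ks d by simp
    fix x y assume xy: "arr x" "arr y" "dom x = dom y \<and> cod x = dom f \<and> cod y = dom g \<and> f \<cdot> x = g \<cdot> y"
    define w where "w = Plus \<A> (i \<cdot> x) (j \<cdot> y)"
    have w: "arr w" "dom w = dom y" "cod w = S" using xy h by (simp_all add: w_def)
    have pw: "p \<cdot> w = x"
      using xy h S comp_plus[of "i \<cdot> x" "j \<cdot> y" p] f by (simp add: w_def reassoc[OF S(2)] reassoc[OF S(5)])
    have qw: "q \<cdot> w = y"
      using xy h S comp_plus[of "i \<cdot> x" "j \<cdot> y" q] f by (simp add: w_def reassoc[OF S(3)] reassoc[OF S(4)])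
    have "d \<cdot> w = nul (dom w) (cod d)" using eq[of w] w pw qw xy d by simp
    then obtain u where u: "arr u" "dom u = dom w" "cod u = dom k" "k \<cdot> u = w"
      using kernel_factor[OF k, of w] w d by auto
    show "\<exists>!u. u \<in> Hom (dom x) (dom (p \<cdot> k)) \<and> (p \<cdot> k) \<cdot> u = x \<and> (q \<cdot> k) \<cdot> u = y"
    proof (rule ex1I[of _ u])
      have "(p \<cdot> k) \<cdot> u = x" "(q \<cdot> k) \<cdot> u = y"
        using comp_assoc[of u k p] comp_assoc[of u k q] u(1,3,4) pw qw ks d h by simp_all
      moreover have "u \<in> Hom (dom x) (dom (p \<cdot> k))" using u(1-3) ks d h w xy by (simp add: Hom_iff)
      ultimately show "u \<in> Hom (dom x) (dom (p \<cdot> k)) \<and> (p \<cdot> k) \<cdot> u = x \<and> (q \<cdot> k) \<cdot> u = y" by blast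
      fix v assume v: "v \<in> Hom (dom x) (dom (p \<cdot> k)) \<and> (p \<cdot> k) \<cdot> v = x \<and> (q \<cdot> k) \<cdot> v = y"
      have vv: "arr v" "dom v = dom x" "cod v = dom k" using v ks d h by (simp_all add: Hom_iff)
      have "(p \<cdot> k) \<cdot> v = p \<cdot> k \<cdot> v" "(q \<cdot> k) \<cdot> v = q \<cdot> k \<cdot> v"
        by (rule comp_assoc; use vv ks d h in simp)+
      then have "p \<cdot> k \<cdot> v = x" "q \<cdot> k \<cdot> v = y"
        using v by metis+
      then have "k \<cdot> v = w"
        by (intro joint[of "k \<cdot> v" w]) (use vv pw qw ks w xy d h in simp_all)
      then show "v = u"
        using mono_cancel[OF kernel_mono[OF k], of v u] u(1-4) vv w(2) xy(3) by simp
    qed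
  qed (use f h ks d in simp_all)
  moreover have "is_epi \<A> (q \<cdot> k)" if fe: "is_epi \<A> f"
  proof -
    have di: "d \<cdot> i = f" using dw[of i] h S f g' by simp
    then have "is_epi \<A> d" using epi_right[of d i] fe d h by simp
    then have sd: "ses \<A> k d" using k by (rule epi_kernel_ses)
    show ?thesis
    proof (rule epiI)
      \<comment> \<open>Since w q vanishes on the kernel of \<open>d\<close>, it has the form t d.
        Restriction to the first summand gives t f = 0, hence t = 0 and w q = 0; restriction to the
        second summand then gives w = 0.\<close>
      fix w assume w: "arr w" "dom w = cod (q \<cdot> k)" "w \<cdot> q \<cdot> k = nul (dom (q \<cdot> k)) (cod w)"
      then obtain t where t: "arr t" "dom t = cod d" "cod t = cod w" "t \<cdot> d = w \<cdot> q"
        using cokernel_factor[OF ses_simps(8)[OF sd], of "w \<cdot> q"] ks d h by auto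
      have "t \<cdot> f = w \<cdot> q \<cdot> i" using t d h w ks by (simp add: di[symmetric] reassoc[OF t(4)])
      then have "t \<cdot> f = nul (dom f) (cod t)" using t d h w ks S f by simp
      then have "t = nul (cod f) (cod t)" using epi_nul[OF fe, of t] t d f by simp
      then have "w \<cdot> q = nul S (cod w)" using t d f nul_comp[of d "cod w" "cod f"] w by simp
      then have "w \<cdot> q \<cdot> j = nul S (cod w) \<cdot> j" using w h ks d by (simp add: reassoc)
      then show "w = nul (cod (q \<cdot> k)) (cod w)" using w h ks d S by simp
    qed (use ks d h in simp)
  qed
  ultimately show ?thesis using that by blast
qed

lemma pullback_epi:
  assumes "is_pullback \<A> f g p q" "is_epi \<A> f"
  shows "is_epi \<A> q"
proof -
  note pb = pullback_simps[OF assms(1)]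
  obtain p' q' where p': "is_pullback \<A> f g p' q'" "is_epi \<A> q'"
    using pullback_exists[of f g] pb assms(2) by metis
  note pb' = pullback_simps[OF p'(1)]
  obtain u where "arr u" "dom u = dom p'" "cod u = dom p" "q \<cdot> u = q'"
    using pullback_factor[OF assms(1), of p' q'] pb' by metis
  then show ?thesis using epi_right[of q u] p' pb by simp
qed

text \<open>Pulling back does not change the kernel: \<open>k'\<close> is the map into the pullback
  with components \<open>k\<close> and 0.\<close>

lemma pullback_ses:
  assumes "ses \<A> k f" "is_pullback \<A> f g p q"
  obtains k' where "ses \<A> k' q" "dom k' = dom k" "p \<cdot> k' = k"
proof -
  note s = ses_simps[OF assms(1)] and pb = pullback_simps[OF assms(2)]
  obtain k' where k': "arr k'" "dom k' = dom k" "cod k' = dom p" "p \<cdot> k' = k" "q \<cdot> k' = nul (dom k) (dom g)"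
    using pullback_factor[OF assms(2), of k "nul (dom k) (dom g)"] s pb by auto
  have "is_kernel \<A> q k'"
  proof (rule kernelI)
    show "is_mono \<A> k'" using mono_left[of p k'] k' s pb by simp
    fix h assume h: "arr h" "cod h = dom q" "q \<cdot> h = nul (dom h) (cod q)"
    have "f \<cdot> p \<cdot> h = g \<cdot> q \<cdot> h" using h pb by (simp add: reassoc[OF pb(9)])
    then have "f \<cdot> p \<cdot> h = nul (dom h) (cod f)" using h pb by simp
    then obtain u where u: "arr u" "dom u = dom h" "cod u = dom k" "k \<cdot> u = p \<cdot> h"
      using kernel_factor[OF s(7), of "p \<cdot> h"] h pb by auto
    have "k' \<cdot> u = h"
      by (rule pullback_unique[OF assms(2)]) (use u k' h pb s in \<open>simp_all add: reassoc[OF k'(4)] reassoc[OF k'(5)]\<close>)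
    then show "\<exists>u. arr u \<and> dom u = dom h \<and> cod u = dom k' \<and> k' \<cdot> u = h" using u k' by auto
  qed (use k' pb in auto)
  then have "ses \<A> k' q" using pullback_epi[OF assms(2) s(6)] by (intro epi_kernel_ses)
  then show ?thesis using that k' by blast
qed

lemma pushout_simps:
  assumes "is_pullback (dual_cat \<A>) f g p q"
  shows "arr f" "arr g" "arr p" "arr q" "dom f = dom g" "cod p = cod q" "dom p = cod f" "dom q = cod g"
    "p \<cdot> f = q \<cdot> g"
  using abelian_category.pullback_simps[OF dual_ax assms] by simp_all

lemma pushout_factor:
  assumes "is_pullback (dual_cat \<A>) f g p q" "arr x" "arr y" "cod x = cod y" "dom x = cod f" "dom y = cod g" "x \<cdot> f = y \<cdot> g"
  obtains u where "arr u" "cod u = cod x" "dom u = cod p" "u \<cdot> p = x" "u \<cdot> q = y"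
  using abelian_category.pullback_factor[OF dual_ax assms(1), of x y] assms by auto

lemma pushout_unique:
  assumes "is_pullback (dual_cat \<A>) f g p q" "arr u" "arr v" "cod u = cod v" "dom u = cod p" "dom v = cod p"
    "u \<cdot> p = v \<cdot> p" "u \<cdot> q = v \<cdot> q"
  shows "u = v"
  using abelian_category.pullback_unique[OF dual_ax assms(1), of u v] assms by auto

lemma pushout_exists:
  assumes "arr f" "arr g" "dom f = dom g"
  obtains p q where "is_pullback (dual_cat \<A>) f g p q"
  by (rule abelian_category.pullback_exists[OF dual_ax, of f g]) (use assms that in simp_all)

lemma pushout_ses:
  assumes "ses \<A> f k" "is_pullback (dual_cat \<A>) f g p q"
  obtains k' where "ses \<A> q k'" "cod k' = cod k" "k' \<cdot> p = k"
  using abelian_category.pullback_ses[OF dual_ax, of k f g p q] assms by auto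

lemma pullback_sym:
  assumes "is_pullback \<A> f g p q"
  shows "is_pullback \<A> g f q p"
  unfolding is_pullback_def
proof (intro conjI ballI impI)
  note pb = pullback_simps[OF assms]
  fix x y assume xy: "arr x" "arr y" "dom x = dom y \<and> cod x = dom g \<and> cod y = dom f \<and> g \<cdot> x = f \<cdot> y"
  obtain u where u: "arr u" "dom u = dom y" "cod u = dom p" "p \<cdot> u = y" "q \<cdot> u = x"
    using pullback_factor[OF assms, of y x] xy by metis
  show "\<exists>!u. u \<in> Hom (dom x) (dom q) \<and> q \<cdot> u = x \<and> p \<cdot> u = y"
  proof (rule ex1I[of _ u])
    fix v assume v: "v \<in> Hom (dom x) (dom q) \<and> q \<cdot> v = x \<and> p \<cdot> v = y"
    show "v = u" by (rule pullback_unique[OF assms]) (use u v pb xy in \<open>auto simp: Hom_iff\<close>)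
  qed (use u pb xy in \<open>auto simp: Hom_iff\<close>)
qed (use pullback_simps[OF assms] in auto)

lemma pushout_sym: "is_pullback (dual_cat \<A>) f g p q \<Longrightarrow> is_pullback (dual_cat \<A>) g f q p"
  by (rule abelian_category.pullback_sym[OF dual_ax])

text \<open>\<open>e\<close> is the cokernel of the kernel of \<open>f\<close>. To see that
  \<open>m\<close> is mono, a map \<open>w\<close> with m w = 0 is lifted to the domain of
  \<open>e\<close> after composition with an epimorphism \<open>q\<close>, by a pullback. The lift
  is killed by \<open>f\<close>, hence by \<open>e\<close>, so w q = 0.\<close>

lemma epi_mono_factorization:
  assumes "arr f"
  obtains e m where "is_epi \<A> e" "is_mono \<A> m" "arr e" "arr m" "cod e = dom m" "m \<cdot> e = f"
proof -
  obtain k where k: "is_kernel \<A> f k" using ex_kernel assms by blast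
  note ks = kernel_simps[OF k]
  obtain e where e: "is_cokernel \<A> k e" using ex_cokernel ks(2) by blast
  note es = cokernel_simps[OF e]
  obtain m where m: "arr m" "dom m = cod e" "cod m = cod f" "m \<cdot> e = f"
    using cokernel_factor[OF e, of f] ks by auto
  have s: "ses \<A> k e" using mono_cokernel_ses kernel_mono k e by blast
  have "is_mono \<A> m"
  proof (rule monoI)
    fix w assume w: "arr w" "cod w = dom m" "m \<cdot> w = nul (dom w) (cod m)"
    obtain p q where pb: "is_pullback \<A> e w p q" using pullback_exists[of e w] es w m by metis
    note pbs = pullback_simps[OF pb]
    have "f \<cdot> p = m \<cdot> e \<cdot> p" using m es pbs(1-8) by (simp add: reassoc[OF m(4)])
    then have "f \<cdot> p = m \<cdot> w \<cdot> q" using pbs by simp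
    moreover have "m \<cdot> w \<cdot> q = nul (dom w) (cod m) \<cdot> q"
      by (rule reassoc[OF w(3)]) (use w(1,2) m(1) pbs(4,8) in simp_all)
    ultimately have "f \<cdot> p = nul (dom p) (cod f)" using w(1) m(1,3) pbs(4,6,8) assms by simp
    then obtain u where u: "arr u" "dom u = dom p" "cod u = dom k" "k \<cdot> u = p"
      using kernel_factor[OF k, of p] pbs es ks by auto
    have "e \<cdot> p = nul (dom p) (cod e)" using reassoc[OF es(4), of u] u es ks by simp
    then have "w \<cdot> q = nul (dom q) (cod w)" using pbs by simp
    then show "w = nul (dom w) (dom m)" using epi_nul[OF pullback_epi[OF pb cokernel_epi[OF e]], of w] pbs w by simp
  qed (use m in simp)
  then show ?thesis using that cokernel_epi[OF e] es m by auto
qed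

text \<open>Because \<open>m'\<close> is mono, \<open>e'\<close> kills the kernel of
  \<open>e\<close> and therefore factors through \<open>e\<close>; the comparison map is mono and
  epi.\<close>

lemma epi_mono_unique:
  assumes "is_epi \<A> e" "is_mono \<A> m" "cod e = dom m" "is_epi \<A> e'" "is_mono \<A> m'" "cod e' = dom m'"
    and eq: "m \<cdot> e = m' \<cdot> e'" and d: "dom e = dom e'" "cod m = cod m'"
  obtains u where "is_isom \<A> u" "arr u" "dom u = cod e" "cod u = cod e'" "u \<cdot> e = e'" "m' \<cdot> u = m"
proof -
  have a: "arr e" "arr m" "arr e'" "arr m'" using assms by (auto simp: is_mono_def is_epi_def)
  obtain k where k: "is_kernel \<A> e k" using ex_kernel a by blast
  note ks = kernel_simps[OF k]
  have s: "ses \<A> k e" using epi_kernel_ses assms k by blast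
  have "m \<cdot> e \<cdot> k = m' \<cdot> e' \<cdot> k" by (rule square[OF eq]) (use a assms ks in simp_all)
  then have "e' \<cdot> k = nul (dom k) (dom m')"
    using mono_nul[OF assms(5), of "e' \<cdot> k"] a assms ks by simp
  then obtain u where u: "arr u" "dom u = cod e" "cod u = cod e'" "u \<cdot> e = e'"
    using cokernel_factor[OF ses_simps(8)[OF s], of e'] a ks assms by auto
  have "m' \<cdot> u = m"
    by (rule epi_cancel[OF assms(1)]) (use a assms u in simp_all)
  moreover have "is_mono \<A> u" using mono_left[of m' u] assms u a calculation by simp
  moreover have "is_epi \<A> u" using epi_right[of u e] assms u a by simp
  ultimately show ?thesis using that mono_epi_isom u by blast
qed

text \<open>Half of the short five lemma with identities at the outer terms; the other half is its
  dual.\<close>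

lemma five_mono:
  assumes "ses \<A> f g" "ses \<A> f' g'" "arr b" "dom b = cod f" "cod b = cod f'" "b \<cdot> f = f'" "g' \<cdot> b = g"
  shows "is_mono \<A> b"
proof (rule monoI)
  note s = ses_simps[OF assms(1)] and s' = ses_simps[OF assms(2)]
  fix w assume w: "arr w" "cod w = dom b" "b \<cdot> w = nul (dom w) (cod b)"
  have g: "cod g' = cod g" using assms(3,5,7) s' by (metis comp_simps(3))
  have "g \<cdot> w = g' \<cdot> b \<cdot> w" using assms(3-7) w(1,2) s' s by (simp add: reassoc[OF assms(7)])
  then have "g \<cdot> w = nul (dom w) (cod g)" using w s' s assms g by simp
  then obtain x where x: "arr x" "dom x = dom w" "cod x = dom f" "f \<cdot> x = w"
    using kernel_factor[OF s(7), of w] w s assms by auto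
  have "f' \<cdot> x = b \<cdot> f \<cdot> x" using assms(3-7) x(1-3) s s' by (simp add: reassoc[OF assms(6)])
  then have "f' \<cdot> x = nul (dom x) (cod f')" using x w assms by simp
  then have "x = nul (dom x) (dom f)" using mono_nul[OF s'(5), of x] x s assms by (metis comp_simps(2))
  then show "w = nul (dom w) (dom b)" using x s assms by (metis arr_Ob(1) comp_nul)
qed (use assms in simp)

lemma five_isom:
  assumes "ses \<A> f g" "ses \<A> f' g'" "arr b" "dom b = cod f" "cod b = cod f'" "b \<cdot> f = f'" "g' \<cdot> b = g"
  shows "is_isom \<A> b"
proof (rule mono_epi_isom)
  show "is_mono \<A> b" using five_mono assms by blast
  have "is_mono (dual_cat \<A>) b"
    by (rule abelian_category.five_mono[OF dual_ax, of g' f' g f]) (use assms ses_simps[OF assms(1)] ses_simps[OF assms(2)] in simp_all)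
  then show "is_epi \<A> b" by simp
qed

text \<open>In a morphism of short exact sequences that is the identity on the quotients, the left
  square is a pushout: the map from the actual pushout is invertible by the five lemma. This is the
  existence half of the universal property, \<open>ses_pushout_unique\<close> the uniqueness
  half.\<close>

lemma ses_pushout_factor:
  assumes "ses \<A> s g" "ses \<A> s' g'" "arr b" "dom b = cod s" "cod b = cod s'" "g' \<cdot> b = g"
    and "arr \<phi>" "dom \<phi> = dom s" "cod \<phi> = dom s'" "b \<cdot> s = s' \<cdot> \<phi>"
    and "arr h" "dom h = cod s" "arr h'" "dom h' = dom s'" "cod h = cod h'" "h \<cdot> s = h' \<cdot> \<phi>"
  obtains u where "arr u" "dom u = cod s'" "cod u = cod h" "u \<cdot> b = h" "u \<cdot> s' = h'"
proof -
  note S = ses_simps[OF assms(1)] and S' = ses_simps[OF assms(2)]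
  obtain p q where po: "is_pullback (dual_cat \<A>) s \<phi> p q"
    using pushout_exists[of s \<phi>] S assms by auto
  note pos = pushout_simps[OF po]
  obtain c where c: "ses \<A> q c" "cod c = cod g" "c \<cdot> p = g" using pushout_ses[OF assms(1) po] by metis
  note cs = ses_simps[OF c(1)]
  obtain v where v: "arr v" "cod v = cod b" "dom v = cod p" "v \<cdot> p = b" "v \<cdot> q = s'"
    using pushout_factor[OF po, of b s'] assms S' S by metis
  have gg: "cod g' = cod g" using assms(3,5,6) S' by (metis comp_simps(3))
  have "g' \<cdot> v = c"
  proof (rule pushout_unique[OF po])
    show "(g' \<cdot> v) \<cdot> p = c \<cdot> p" using v S' c pos assms(3-6) by simp
    show "(g' \<cdot> v) \<cdot> q = c \<cdot> q" using v S' c cs pos(2-4,6,8,9) assms(3-5,7,9) gg by simp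
  qed (use v c cs S S' pos assms(3-6) gg in simp_all)
  then have "is_isom \<A> v"
    by (intro five_isom[OF c(1) assms(2)]) (use v pos assms in auto)
  then obtain v' where v': "arr v'" "dom v' = cod v" "cod v' = dom v" "v' \<cdot> v = Ident \<A> (dom v)"
    using is_isom_inverse by metis
  obtain w where w: "arr w" "cod w = cod h" "dom w = cod p" "w \<cdot> p = h" "w \<cdot> q = h'"
    using pushout_factor[OF po, of h h'] assms by metis
  have "v' \<cdot> b = p" using v v' pos reassoc[OF v'(4), of p] by simp
  moreover have "v' \<cdot> s' = q" using v v' pos reassoc[OF v'(4), of q] by simp
  ultimately show ?thesis using that[of "w \<cdot> v'"] v v' w assms S' by auto
qed

text \<open>The difference \<open>w\<close> of the two maps vanishes on \<open>s'\<close>, so it is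
  x g'. It also vanishes on \<open>b\<close>, whence x g = 0, and x = 0 since \<open>g\<close> is
  epi.\<close>

lemma ses_pushout_unique:
  assumes "ses \<A> s g" "ses \<A> s' g'" "arr b" "dom b = cod s" "cod b = cod s'" "g' \<cdot> b = g"
    and "arr u" "arr v" "dom u = cod s'" "dom v = cod s'" "u \<cdot> b = v \<cdot> b" "u \<cdot> s' = v \<cdot> s'" "cod u = cod v"
  shows "u = v"
proof -
  note S = ses_simps[OF assms(1)] and S' = ses_simps[OF assms(2)]
  obtain v' where v': "v' \<in> Hom (dom v) (cod v)" "Plus \<A> v v' = nul (dom v) (cod v)" "Plus \<A> v' v = nul (dom v) (cod v)"
    using ex_neg[of v] assms by metis
  then have v'': "arr v'" "dom v' = dom v" "cod v' = cod v" by (auto simp: Hom_iff)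
  define w where "w = Plus \<A> v' u"
  have w: "arr w" "dom w = cod s'" "cod w = cod v" using v'' assms by (simp_all add: w_def)
  have 1: "w \<cdot> b = nul (dom b) (cod v)"
    using plus_comp[of b v' u] plus_comp[of b v' v] v' v'' assms by (simp add: w_def)
  have 2: "w \<cdot> s' = nul (dom s') (cod v)"
    using plus_comp[of s' v' u] plus_comp[of s' v' v] v' v'' assms S' by (simp add: w_def)
  obtain x where x: "arr x" "dom x = cod g'" "cod x = cod w" "x \<cdot> g' = w"
    using cokernel_factor[OF S'(8), of w] w 2 S' by auto
  have "x \<cdot> g = w \<cdot> b" using x S' assms(3-5) by (simp add: assms(6)[symmetric] reassoc[OF x(4)])
  then have "x \<cdot> g = nul (dom g) (cod x)" using 1 x S assms w by simp
  then have "x = nul (cod g) (cod x)" using epi_nul[OF S(6), of x] x assms S S' by (metis comp_simps(3))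
  then have "w = nul (cod s') (cod v)" using x S' w S assms by (metis comp_simps(3) nul_comp arr_Ob(2))
  then have "Plus \<A> v' u = Plus \<A> v' v" using v' assms by (simp add: w_def)
  then show ?thesis by (rule plus_cancel) (use v'' assms in \<open>auto simp: Hom_iff\<close>)
qed

section \<open>Fillings of 2-extensions\<close>

text \<open>The kernel of \<open>t\<close> lies in that of \<open>m \<cdot> t\<close>, which is
  \<open>s\<close>, and on \<open>s\<close> the map \<open>t\<close> becomes \<open>c\<close>, with
  kernel \<open>n\<close>. Together with \<open>filling_ses'\<close> this shows that either of the
  two exact sequences of a filling implies the other, so a definition through one of them is
  self-dual.\<close>

lemma filling_ses:
  assumes "is_kernel \<A> c n" "is_cokernel \<A> c m" "arr s" "arr t" "dom s = dom c" "cod t = cod c" "cod s = dom t"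
    and ts: "t \<cdot> s = c" and "ses \<A> s (m \<cdot> t)"
  shows "ses \<A> (s \<cdot> n) t"
proof -
  note n = kernel_simps[OF assms(1)] and m = cokernel_simps[OF assms(2)] and S = ses_simps[OF assms(9)]
  have "is_epi \<A> t"
  proof (rule epiI)
    fix w assume w: "arr w" "dom w = cod t" "w \<cdot> t = nul (dom t) (cod w)"
    have "w \<cdot> t \<cdot> s = nul (dom s) (cod w)" using w assms(3,4,7) by (simp add: reassoc[OF w(3)])
    then have "w \<cdot> c = nul (dom c) (cod w)" using ts assms(5) by simp
    then obtain v where v: "arr v" "dom v = cod m" "cod v = cod w" "v \<cdot> m = w"
      using cokernel_factor[OF assms(2), of w] w assms n by auto
    have "v \<cdot> m \<cdot> t = nul (dom t) (cod v)" using w v m assms by (simp add: reassoc[OF v(4)])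
    then have "v = nul (cod m) (cod v)" using epi_nul[OF S(6), of v] v m assms by simp
    then show "w = nul (cod t) (cod w)" using v m assms by (metis arr_Ob(2) nul_comp)
  qed (use assms in simp)
  moreover have "is_kernel \<A> t (s \<cdot> n)"
  proof (rule kernelI)
    show "is_mono \<A> (s \<cdot> n)" using mono_comp kernel_mono[OF assms(1)] S(5) n assms by auto
    show "t \<cdot> s \<cdot> n = nul (dom (s \<cdot> n)) (cod t)" using n assms by (simp add: reassoc[OF ts])
    fix h assume h: "arr h" "cod h = dom t" "t \<cdot> h = nul (dom h) (cod t)"
    then obtain u where u: "arr u" "dom u = dom h" "cod u = dom s" "s \<cdot> u = h"
      using kernel_factor[OF S(7), of h] m assms by auto
    have "t \<cdot> s \<cdot> u = c \<cdot> u" by (rule reassoc[OF ts]) (use u(1,3) assms(3,4,7) in simp_all)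
    then have "c \<cdot> u = t \<cdot> h" using u(4) by simp
    then obtain v where v: "arr v" "dom v = dom u" "cod v = dom n" "n \<cdot> v = u"
      using kernel_factor[OF assms(1), of u] u h n assms(3-7) by auto
    then show "\<exists>u. arr u \<and> dom u = dom h \<and> cod u = dom (s \<cdot> n) \<and> (s \<cdot> n) \<cdot> u = h"
      using u n assms(3-7) by (intro exI[of _ v]) simp
  qed (use n assms in auto)
  ultimately show ?thesis by (rule epi_kernel_ses)
qed

lemma filling_ses':
  assumes "is_kernel \<A> c n" "is_cokernel \<A> c m" "arr s" "arr t" "dom s = dom c" "cod t = cod c" "cod s = dom t"
    and ts: "t \<cdot> s = c" and "ses \<A> (s \<cdot> n) t"
  shows "ses \<A> s (m \<cdot> t)"
  using abelian_category.filling_ses[OF dual_ax, of c m n t s] assms by simp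

end


text \<open>A correspondence that is total on both sides and preserves and reflects equivalence
  induces a bijection of classes. A relation is more convenient than a function here because a
  pushed-out filling exists only up to a choice.\<close>

lemma card_quotient_eq:
  assumes "equiv A r" "equiv B q"
    and total: "\<And>a. a \<in> A \<Longrightarrow> \<exists>b \<in> B. R a b" "\<And>b. b \<in> B \<Longrightarrow> \<exists>a \<in> A. R a b"
    and iff: "\<And>a a' b b'. a \<in> A \<Longrightarrow> a' \<in> A \<Longrightarrow> b \<in> B \<Longrightarrow> b' \<in> B \<Longrightarrow> R a b \<Longrightarrow> R a' b' \<Longrightarrow> (a, a') \<in> r \<longleftrightarrow> (b, b') \<in> q"
  shows "card (A // r) = card (B // q)"
proof -
  define f where "f = (\<lambda>C. q `` {SOME b. b \<in> B \<and> (\<exists>a \<in> C. R a b)})"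
  have f: "f (r `` {a}) = q `` {b}" if ab: "a \<in> A" "b \<in> B" "R a b" for a b
  proof -
    let ?b = "SOME b. b \<in> B \<and> (\<exists>a' \<in> r `` {a}. R a' b)"
    have "a \<in> r `` {a}" using equiv_class_self[OF assms(1)] ab by blast
    then have "b \<in> B \<and> (\<exists>a' \<in> r `` {a}. R a' b)" using ab by blast
    then have "?b \<in> B \<and> (\<exists>a' \<in> r `` {a}. R a' ?b)" by (rule someI)
    then obtain a' where a': "?b \<in> B" "(a, a') \<in> r" "R a' ?b" by blast
    have "a' \<in> A" using a'(2) assms(1) by (auto simp: equiv_def refl_on_def)
    then have "(b, ?b) \<in> q" using iff[OF ab(1) _ ab(2) a'(1) ab(3) a'(3)] a'(2) by simp
    then have "q `` {b} = q `` {?b}" by (rule equiv_class_eq[OF assms(2)])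
    then show ?thesis unfolding f_def by (rule sym)
  qed
  have "bij_betw f (A // r) (B // q)"
  proof (rule bij_betw_imageI[OF inj_onI subset_antisym[OF subsetI subsetI]])
    fix C D assume CD: "C \<in> A // r" "D \<in> A // r" "f C = f D"
    obtain a where a: "a \<in> A" "C = r `` {a}" using CD by (auto elim: quotientE)
    obtain a' where a': "a' \<in> A" "D = r `` {a'}" using CD by (auto elim: quotientE)
    obtain b b' where b: "b \<in> B" "b' \<in> B" "R a b" "R a' b'" using a a' total(1) by metis
    have "q `` {b} = q `` {b'}" using CD a a' b f by metis
    then have "(b, b') \<in> q" using b assms(2) by (simp add: eq_equiv_class_iff)
    then have "(a, a') \<in> r" using iff a a' b by blast
    then show "C = D" using equiv_class_eq[OF assms(1)] a a' by blast
  next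
    fix D assume "D \<in> f ` (A // r)"
    then obtain a where "a \<in> A" "D = f (r `` {a})" by (auto elim: quotientE)
    moreover obtain b where "b \<in> B" "R a b" using total(1) calculation by blast
    ultimately show "D \<in> B // q" using f by (metis quotientI)
  next
    fix D assume "D \<in> B // q"
    then obtain b where b: "b \<in> B" "D = q `` {b}" by (auto elim: quotientE)
    obtain a where "a \<in> A" "R a b" using total(2) b by blast
    then show "D \<in> f ` (A // r)" using f b by (metis image_eqI quotientI)
  qed
  then show ?thesis by (rule bij_betw_same_card)
qed

text \<open>A filling of the 2-extension with middle map \<open>c\<close> and last map \<open>m\<close> (the first one is a kernel of \<open>c\<close>).\<close>

definition fillings :: "('o, 'm) preadd_cat \<Rightarrow> 'm \<Rightarrow> 'm \<Rightarrow> 'o \<Rightarrow> ('m \<times> 'm) set" where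
  "fillings \<A> c m X = {(s, t). s \<in> Hom_set \<A> (Dom \<A> c) X \<and> t \<in> Hom_set \<A> X (Cod \<A> c) \<and>
     Comp \<A> t s = c \<and> ses \<A> s (Comp \<A> m t)}"

definition all_fillings :: "('o, 'm) preadd_cat \<Rightarrow> 'm \<Rightarrow> 'm \<Rightarrow> ('m \<times> 'm) set" where
  "all_fillings \<A> c m = (\<Union>X \<in> Ob \<A>. fillings \<A> c m X)"

text \<open>No inverse is asked for: a map of fillings is an isomorphism by the five lemma
  (\<open>filling_mor_isom\<close>), which makes the relation symmetric. All middle terms occur
  together; they are separated in \<open>filling_sum\<close>.\<close>

definition filling_rel :: "('o, 'm) preadd_cat \<Rightarrow> 'm \<Rightarrow> 'm \<Rightarrow> (('m \<times> 'm) \<times> ('m \<times> 'm)) set" where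
  "filling_rel \<A> c m = {((s, t), (s', t')). (s, t) \<in> all_fillings \<A> c m \<and> (s', t') \<in> all_fillings \<A> c m \<and>
     (\<exists>b \<in> Hom_set \<A> (Cod \<A> s) (Cod \<A> s'). Comp \<A> b s = s' \<and> Comp \<A> t' b = t)}"

context abelian_category
begin

section \<open>Isomorphism classes and their representatives\<close>

lemma isomorphic_refl: "X \<in> Ob \<A> \<Longrightarrow> isomorphic \<A> X X"
  unfolding isomorphic_def by (auto simp: Hom_iff intro!: bexI[of _ "Ident \<A> X"])

lemma isomorphic_sym: "isomorphic \<A> X Y \<Longrightarrow> isomorphic \<A> Y X"
proof -
  assume "isomorphic \<A> X Y"
  then obtain f where f: "f \<in> Hom X Y" "is_isom \<A> f" by (auto simp: isomorphic_def)
  then obtain g where "is_isom \<A> g" "arr g" "dom g = cod f" "cod g = dom f" using is_isom_inverse by metis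
  then show ?thesis using f unfolding isomorphic_def by (auto simp: Hom_iff)
qed

lemma isomorphic_trans: "isomorphic \<A> X Y \<Longrightarrow> isomorphic \<A> Y Z \<Longrightarrow> isomorphic \<A> X Z"
proof -
  assume "isomorphic \<A> X Y" "isomorphic \<A> Y Z"
  then obtain f g where "f \<in> Hom X Y" "is_isom \<A> f" "g \<in> Hom Y Z" "is_isom \<A> g" by (auto simp: isomorphic_def)
  then show ?thesis unfolding isomorphic_def
    by (intro bexI[of _ "g \<cdot> f"]) (auto simp: Hom_iff intro: is_isom_comp)
qed

lemma iso_class_eq_iff: "X \<in> Ob \<A> \<Longrightarrow> Y \<in> Ob \<A> \<Longrightarrow> iso_class \<A> X = iso_class \<A> Y \<longleftrightarrow> isomorphic \<A> X Y"
  unfolding iso_class_def using isomorphic_refl isomorphic_sym isomorphic_trans by blast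

lemma iso_class_in_Iso [simp]: "X \<in> Ob \<A> \<Longrightarrow> iso_class \<A> X \<in> Iso \<A>"
  by (simp add: Iso_def)

lemma rep_props:
  assumes "x \<in> Iso \<A>"
  shows "rep x \<in> Ob \<A>" "iso_class \<A> (rep x) = x"
proof -
  obtain X where X: "X \<in> Ob \<A>" "x = iso_class \<A> X" using assms by (auto simp: Iso_def)
  have "X \<in> x" using X isomorphic_refl by (auto simp: iso_class_def)
  then have "rep x \<in> x" unfolding rep_def by (rule someI)
  then have "rep x \<in> Ob \<A>" "isomorphic \<A> X (rep x)" using X by (auto simp: iso_class_def)
  then show "rep x \<in> Ob \<A>" "iso_class \<A> (rep x) = x" using X(1) iso_class_eq_iff[of X "rep x"] unfolding X(2) by simp_all
qed

lemma rep_iso_class: "X \<in> Ob \<A> \<Longrightarrow> isomorphic \<A> X (rep (iso_class \<A> X))"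
  using rep_props[of "iso_class \<A> X"] iso_class_eq_iff by fastforce

lemma iso_between:
  assumes "isomorphic \<A> X Y"
  obtains u v where "arr u" "dom u = X" "cod u = Y" "arr v" "dom v = Y" "cod v = X" "v \<cdot> u = Ident \<A> X" "u \<cdot> v = Ident \<A> Y"
    "is_isom \<A> u" "is_isom \<A> v"
proof -
  obtain u where u: "u \<in> Hom X Y" "is_isom \<A> u" using assms by (auto simp: isomorphic_def)
  then obtain v where "is_isom \<A> v" "arr v" "dom v = cod u" "cod v = dom u" "v \<cdot> u = Ident \<A> (dom u)" "u \<cdot> v = Ident \<A> (cod u)"
    using is_isom_inverse by metis
  moreover have "arr u" "dom u = X" "cod u = Y" using u by (simp_all add: Hom_iff)
  ultimately show ?thesis using u(2) that[of u] by simp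
qed

lemma ses_isom_mid:
  assumes "ses \<A> f g" "is_isom \<A> u" "dom u = cod f" "arr v" "dom v = cod u" "cod v = dom u"
    "v \<cdot> u = Ident \<A> (dom u)" "u \<cdot> v = Ident \<A> (cod u)"
  shows "ses \<A> (u \<cdot> f) (g \<cdot> v)"
proof -
  note s = ses_simps[OF assms(1)]
  have u: "arr u" using assms by (simp add: is_isom_def)
  have v: "is_isom \<A> v" using u assms by (intro is_isomI[of v u]) auto
  have e: "is_epi \<A> (g \<cdot> v)" using s assms iso_epi[OF v] epi_comp by simp
  have "is_kernel \<A> (g \<cdot> v) (u \<cdot> f)"
  proof (rule kernelI)
    show "is_mono \<A> (u \<cdot> f)" using mono_comp iso_mono s assms by simp
    show "(g \<cdot> v) \<cdot> u \<cdot> f = nul (dom (u \<cdot> f)) (cod (g \<cdot> v))"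
      using reassoc[OF assms(7), of f] s u assms by simp
    fix h assume h: "arr h" "cod h = dom (g \<cdot> v)" "(g \<cdot> v) \<cdot> h = nul (dom h) (cod (g \<cdot> v))"
    then obtain w where w: "arr w" "dom w = dom h" "cod w = dom f" "f \<cdot> w = v \<cdot> h"
      using kernel_factor[OF s(7), of "v \<cdot> h"] s assms u by auto
    then have "(u \<cdot> f) \<cdot> w = h" using reassoc[OF assms(8), of h] h s u assms by simp
    then show "\<exists>w. arr w \<and> dom w = dom h \<and> cod w = dom (u \<cdot> f) \<and> (u \<cdot> f) \<cdot> w = h"
      using w s u assms by (intro exI[of _ w]) simp
  qed (use s u assms in auto)
  then show ?thesis using epi_kernel_ses e by blast
qed

section \<open>Equivalence of fillings and its count\<close>

lemma fillingD:
  assumes "(s, t) \<in> fillings \<A> c m X"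
  shows "arr s" "arr t" "dom s = dom c" "cod s = X" "dom t = X" "cod t = cod c" "t \<cdot> s = c" "ses \<A> s (m \<cdot> t)"
  using assms by (auto simp: fillings_def Hom_iff)

lemma fillingI:
  "arr s \<Longrightarrow> arr t \<Longrightarrow> dom s = dom c \<Longrightarrow> cod s = X \<Longrightarrow> dom t = X \<Longrightarrow> cod t = cod c \<Longrightarrow> t \<cdot> s = c \<Longrightarrow> ses \<A> s (m \<cdot> t)
    \<Longrightarrow> (s, t) \<in> fillings \<A> c m X"
  by (auto simp: fillings_def Hom_iff)

lemma all_fillings_iff: "(s, t) \<in> all_fillings \<A> c m \<longleftrightarrow> (s, t) \<in> fillings \<A> c m (cod s)"
proof
  assume "(s, t) \<in> all_fillings \<A> c m"
  then obtain X where "(s, t) \<in> fillings \<A> c m X" by (auto simp: all_fillings_def)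
  then show "(s, t) \<in> fillings \<A> c m (cod s)" using fillingD(4) by metis
next
  assume a: "(s, t) \<in> fillings \<A> c m (cod s)"
  then have "cod s \<in> Ob \<A>" using fillingD by (metis arr_Ob(2))
  then show "(s, t) \<in> all_fillings \<A> c m" using a by (auto simp: all_fillings_def)
qed

lemma fillings_sub: "X \<in> Ob \<A> \<Longrightarrow> p \<in> fillings \<A> c m X \<Longrightarrow> p \<in> all_fillings \<A> c m"
  by (auto simp: all_fillings_def)

lemma filling_mor_isom:
  assumes "(s, t) \<in> fillings \<A> c m X" "(s', t') \<in> fillings \<A> c m X'" "arr m" "dom m = cod c"
    "arr b" "dom b = X" "cod b = X'" "b \<cdot> s = s'" "t' \<cdot> b = t"
  shows "is_isom \<A> b"
proof -
  note f = fillingD[OF assms(1)] and f' = fillingD[OF assms(2)]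
  show ?thesis
    by (rule five_isom[OF f(8) f'(8)]) (use f f' assms in auto)
qed

lemma filling_rel_iff:
  "((s, t), (s', t')) \<in> filling_rel \<A> c m \<longleftrightarrow> (s, t) \<in> fillings \<A> c m (cod s) \<and> (s', t') \<in> fillings \<A> c m (cod s') \<and>
     (\<exists>b. arr b \<and> dom b = cod s \<and> cod b = cod s' \<and> b \<cdot> s = s' \<and> t' \<cdot> b = t)"
  by (auto simp: filling_rel_def all_fillings_iff Hom_iff)

lemma filling_rel_equiv:
  assumes m: "arr m" "dom m = cod c"
  shows "equiv (all_fillings \<A> c m) (filling_rel \<A> c m)"
proof (intro equivI refl_onI symI transI)
  show "filling_rel \<A> c m \<subseteq> all_fillings \<A> c m \<times> all_fillings \<A> c m" by (auto simp: filling_rel_def)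
next
  fix p assume p: "p \<in> all_fillings \<A> c m"
  obtain s t where st: "p = (s, t)" by fastforce
  have f: "(s, t) \<in> fillings \<A> c m (cod s)" using p st all_fillings_iff by simp
  note fillingD[OF f]
  then have "arr (Ident \<A> (cod s)) \<and> dom (Ident \<A> (cod s)) = cod s \<and> cod (Ident \<A> (cod s)) = cod s \<and>
    Ident \<A> (cod s) \<cdot> s = s \<and> t \<cdot> Ident \<A> (cod s) = t" by simp
  then show "(p, p) \<in> filling_rel \<A> c m" unfolding st filling_rel_iff using f by blast
next
  fix p p' assume p: "(p, p') \<in> filling_rel \<A> c m"
  obtain s t s' t' where st: "p = (s, t)" "p' = (s', t')" by fastforce
  obtain b where b: "(s, t) \<in> fillings \<A> c m (cod s)" "(s', t') \<in> fillings \<A> c m (cod s')"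
    "arr b" "dom b = cod s" "cod b = cod s'" "b \<cdot> s = s'" "t' \<cdot> b = t"
    using p unfolding st filling_rel_iff by blast
  note f = fillingD[OF b(1)] and f' = fillingD[OF b(2)]
  have "is_isom \<A> b" using filling_mor_isom[OF b(1,2) m b(3-7)] .
  then obtain v where v: "arr v" "dom v = cod b" "cod v = dom b" "v \<cdot> b = Ident \<A> (dom b)" "b \<cdot> v = Ident \<A> (cod b)"
    using is_isom_inverse by metis
  have "v \<cdot> s' = s" using reassoc[OF v(4), of s] b(3-7) f(1-4) v by simp
  moreover have "t \<cdot> v = t'"
  proof -
    have "t' \<cdot> b \<cdot> v = t \<cdot> v" by (rule reassoc[OF b(7)]) (use b f' v in auto)
    then show ?thesis using v b f' by simp
  qed
  ultimately show "(p', p) \<in> filling_rel \<A> c m" unfolding st filling_rel_iff using b v by (intro conjI exI[of _ v]) auto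
next
  fix p p' p'' assume p: "(p, p') \<in> filling_rel \<A> c m" "(p', p'') \<in> filling_rel \<A> c m"
  obtain s t s' t' s'' t'' where st: "p = (s, t)" "p' = (s', t')" "p'' = (s'', t'')" by (metis surj_pair)
  obtain b where b: "(s, t) \<in> fillings \<A> c m (cod s)" "(s', t') \<in> fillings \<A> c m (cod s')"
    "arr b" "dom b = cod s" "cod b = cod s'" "b \<cdot> s = s'" "t' \<cdot> b = t"
    using p unfolding st filling_rel_iff by blast
  obtain b' where b': "(s'', t'') \<in> fillings \<A> c m (cod s'')"
    "arr b'" "dom b' = cod s'" "cod b' = cod s''" "b' \<cdot> s' = s''" "t'' \<cdot> b' = t'"
    using p unfolding st filling_rel_iff by blast
  note f = fillingD[OF b(1)] and f' = fillingD[OF b(2)] and f'' = fillingD[OF b'(1)]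
  have "(b' \<cdot> b) \<cdot> s = s''" using b b' f f' by simp
  moreover have "t'' \<cdot> b' \<cdot> b = t" using reassoc[OF b'(6), of b] b b' f' f'' by simp
  ultimately show "(p, p'') \<in> filling_rel \<A> c m" unfolding st filling_rel_iff
    using b b' f f' f'' by (intro conjI exI[of _ "b' \<cdot> b"]) auto
qed

lemma filling_transport:
  assumes "(s, t) \<in> fillings \<A> c m X" "arr m" "dom m = cod c" "isomorphic \<A> X Y"
  obtains s' t' where "(s', t') \<in> fillings \<A> c m Y" "((s, t), (s', t')) \<in> filling_rel \<A> c m"
proof -
  note f = fillingD[OF assms(1)]
  obtain u v where u: "arr u" "dom u = X" "cod u = Y" "arr v" "dom v = Y" "cod v = X" "v \<cdot> u = Ident \<A> X" "u \<cdot> v = Ident \<A> Y"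
    "is_isom \<A> u" "is_isom \<A> v"
    by (rule iso_between[OF assms(4)])
  have "ses \<A> (u \<cdot> s) ((m \<cdot> t) \<cdot> v)"
    by (rule ses_isom_mid[OF f(8)]) (use u f in auto)
  then have "(u \<cdot> s, t \<cdot> v) \<in> fillings \<A> c m Y"
    using u f assms reassoc[OF u(7), of s] by (intro fillingI) auto
  moreover have "((s, t), (u \<cdot> s, t \<cdot> v)) \<in> filling_rel \<A> c m"
    unfolding filling_rel_iff using calculation assms(1) f u by (intro conjI exI[of _ u]) auto
  ultimately show ?thesis using that by blast
qed

text \<open>The maps from one filling to another form a torsor under Hom(M, N), where M =
  \<open>cod m\<close> and N = \<open>dom n\<close>: the difference of two such maps vanishes on
  \<open>s\<close> and is killed by \<open>t'\<close>, so it is s' n h m t for a unique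
  \<open>h\<close>.\<close>

lemma filling_fiber_card:
  assumes n: "is_kernel \<A> c n" and m: "is_cokernel \<A> c m"
    and f: "(s, t) \<in> fillings \<A> c m X" and f': "(s', t') \<in> fillings \<A> c m X'"
    and b: "arr b" "dom b = X" "cod b = X'" "b \<cdot> s = s'" "t' \<cdot> b = t"
  shows "card {b \<in> Hom X X'. b \<cdot> s = s' \<and> t' \<cdot> b = t} = card (Hom (cod m) (dom n))"
proof -
  note F = fillingD[OF f] and F' = fillingD[OF f'] and N = kernel_simps[OF n] and M = cokernel_simps[OF m]
  note S = ses_simps[OF F(8)]
  have ses': "ses \<A> (s' \<cdot> n) t'" using filling_ses[OF n m F'(1,2)] F' by simp
  note S' = ses_simps[OF ses']
  define \<phi> where "\<phi> = (\<lambda>h. Plus \<A> b (s' \<cdot> n \<cdot> h \<cdot> m \<cdot> t))"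
  have \<phi>: "arr (s' \<cdot> n \<cdot> h \<cdot> m \<cdot> t)" "dom (s' \<cdot> n \<cdot> h \<cdot> m \<cdot> t) = X" "cod (s' \<cdot> n \<cdot> h \<cdot> m \<cdot> t) = X'"
    "(s' \<cdot> n \<cdot> h \<cdot> m \<cdot> t) \<cdot> s = nul (dom s) X'" "t' \<cdot> s' \<cdot> n \<cdot> h \<cdot> m \<cdot> t = nul X (cod t')"
    if h: "h \<in> Hom (cod m) (dom n)" for h
  proof -
    have h: "arr h" "dom h = cod m" "cod h = dom n" using h by (auto simp: Hom_iff)
    show a: "arr (s' \<cdot> n \<cdot> h \<cdot> m \<cdot> t)" "dom (s' \<cdot> n \<cdot> h \<cdot> m \<cdot> t) = X" "cod (s' \<cdot> n \<cdot> h \<cdot> m \<cdot> t) = X'"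
      using h F F' N M by simp_all
    have "(s' \<cdot> n \<cdot> h \<cdot> m \<cdot> t) \<cdot> s = s' \<cdot> n \<cdot> h \<cdot> m \<cdot> c" using h F F' N M by simp
    then show "(s' \<cdot> n \<cdot> h \<cdot> m \<cdot> t) \<cdot> s = nul (dom s) X'" using h F F' N M by simp
    have "t' \<cdot> s' \<cdot> n \<cdot> h \<cdot> m \<cdot> t = c \<cdot> n \<cdot> h \<cdot> m \<cdot> t"
      by (rule reassoc[OF F'(7)]) (use h F F' N M in simp_all)
    also have "\<dots> = nul (dom n) (cod c) \<cdot> h \<cdot> m \<cdot> t"
      by (rule reassoc[OF N(4)]) (use h F F' N M in simp_all)
    finally show "t' \<cdot> s' \<cdot> n \<cdot> h \<cdot> m \<cdot> t = nul X (cod t')" using h F F' N M by simp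
  qed
  have "bij_betw \<phi> (Hom (cod m) (dom n)) {b \<in> Hom X X'. b \<cdot> s = s' \<and> t' \<cdot> b = t}"
    unfolding bij_betw_def
  proof (intro conjI inj_onI Set.set_eqI iffI)
    fix h h' assume h: "h \<in> Hom (cod m) (dom n)" "h' \<in> Hom (cod m) (dom n)" "\<phi> h = \<phi> h'"
    have "s' \<cdot> n \<cdot> h \<cdot> m \<cdot> t = s' \<cdot> n \<cdot> h' \<cdot> m \<cdot> t"
      using plus_cancel[OF h(3)[unfolded \<phi>_def]] \<phi>[OF h(1)] \<phi>[OF h(2)] b by (simp add: Hom_iff)
    then have "(s' \<cdot> n) \<cdot> h \<cdot> m \<cdot> t = (s' \<cdot> n) \<cdot> h' \<cdot> m \<cdot> t"
      using h(1,2) F F' N M by (simp add: Hom_iff)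
    then have "h \<cdot> m \<cdot> t = h' \<cdot> m \<cdot> t"
      by (rule mono_cancel[OF S'(5)]) (use h(1,2) F F' N M in \<open>auto simp: Hom_iff\<close>)
    then show "h = h'"
      by (rule epi_cancel[OF S(6)]) (use h(1,2) F F' N M in \<open>auto simp: Hom_iff\<close>)
  next
    fix x assume "x \<in> \<phi> ` Hom (cod m) (dom n)"
    then obtain h where h: "h \<in> Hom (cod m) (dom n)" "x = \<phi> h" by blast
    note \<phi>h = \<phi>[OF h(1)]
    have "\<phi> h \<cdot> s = s'" "t' \<cdot> \<phi> h = t" unfolding \<phi>_def
      using plus_comp[of s b "s' \<cdot> n \<cdot> h \<cdot> m \<cdot> t"] comp_plus[of b "s' \<cdot> n \<cdot> h \<cdot> m \<cdot> t" t'] \<phi>h F F' b by auto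
    moreover have "\<phi> h \<in> Hom X X'" unfolding \<phi>_def using \<phi>h b by (simp add: Hom_iff)
    ultimately show "x \<in> {b \<in> Hom X X'. b \<cdot> s = s' \<and> t' \<cdot> b = t}" using h by simp
  next
    fix x assume "x \<in> {b \<in> Hom X X'. b \<cdot> s = s' \<and> t' \<cdot> b = t}"
    then have x: "arr x" "dom x = X" "cod x = X'" "x \<cdot> s = s'" "t' \<cdot> x = t" by (auto simp: Hom_iff)
    \<comment> \<open>\<open>b'\<close> is the negative of \<open>b\<close>, so that
      \<open>d\<close> below is the difference x - b.\<close>
    obtain b' where b'': "b' \<in> Hom (dom b) (cod b)" and b': "Plus \<A> b b' = nul (dom b) (cod b)" "Plus \<A> b' b = nul (dom b) (cod b)"
      using ex_neg[of b] b by metis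
    then have b'': "arr b'" "dom b' = X" "cod b' = X'" using b by (auto simp: Hom_iff)
    define d where "d = Plus \<A> b' x"
    have d: "arr d" "dom d = X" "cod d = X'" using b'' x by (simp_all add: d_def)
    have bd: "Plus \<A> b d = x" using plus_assoc[of b X X' b' x] b b' b'' x by (simp add: d_def Hom_iff)
    have X': "X \<in> Ob \<A>" "X' \<in> Ob \<A>" using b by auto
    have "d \<cdot> s = nul (dom s) X'"
      using X' plus_comp[of s b' x] plus_comp[of s b' b] b b' b'' x F by (simp add: d_def)
    then obtain k where k: "arr k" "dom k = cod m" "cod k = X'" "k \<cdot> m \<cdot> t = d"
      using cokernel_factor[OF S(8), of d] d F M by auto
    have "t' \<cdot> d = nul X (cod t')"
      using X' comp_plus[of b' x t'] comp_plus[of b' b t'] b b' b'' x F F' by (simp add: d_def)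
    then have "(t' \<cdot> k) \<cdot> m \<cdot> t = nul X (cod t')" using k F F' M by simp
    then have "t' \<cdot> k = nul (cod m) (cod t')"
      using epi_nul[OF S(6), of "t' \<cdot> k"] k F F' M by simp
    then obtain h where h: "arr h" "dom h = cod m" "cod h = dom n" "(s' \<cdot> n) \<cdot> h = k"
      using kernel_factor[OF S'(7), of k] k F F' M N by auto
    have "((s' \<cdot> n) \<cdot> h) \<cdot> m \<cdot> t = s' \<cdot> n \<cdot> h \<cdot> m \<cdot> t"
      using h(1-3) F(2,5,6) F'(1,3) M(2,3) N(2,3) by simp
    moreover have "((s' \<cdot> n) \<cdot> h) \<cdot> m \<cdot> t = d" unfolding h(4) by (rule k(4))
    ultimately have e: "s' \<cdot> n \<cdot> h \<cdot> m \<cdot> t = d" by (rule trans[OF sym])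
    have "x = \<phi> h" unfolding \<phi>_def e using bd by (rule sym)
    then show "x \<in> \<phi> ` Hom (cod m) (dom n)" using h by (auto simp: Hom_iff)
  qed
  then show ?thesis by (rule bij_betw_same_card[symmetric])
qed

lemma Hom_nonempty: "X \<in> Ob \<A> \<Longrightarrow> Y \<in> Ob \<A> \<Longrightarrow> Hom X Y \<noteq> {}"
  using nul_Hom by blast

text \<open>Orbit counting: Aut X acts on the fillings through X, the orbits are the classes that
  meet X, and the stabilisers have the size of Hom(M, N) by \<open>filling_fiber_card\<close>. Hence
  every class contributes 1 / #Hom(M, N), whatever its middle term. \<open>F\<close> is any finite
  set that contains all middle terms.\<close>

lemma filling_sum:
  assumes n: "is_kernel \<A> c n" and m: "is_cokernel \<A> c m"
    and fin: "\<And>X Y. X \<in> Ob \<A> \<Longrightarrow> Y \<in> Ob \<A> \<Longrightarrow> finite (Hom X Y)"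
    and F: "finite F" "F \<subseteq> Iso \<A>" "\<And>X. X \<in> Ob \<A> \<Longrightarrow> fillings \<A> c m X \<noteq> {} \<Longrightarrow> iso_class \<A> X \<in> F"
  shows "(\<Sum>x \<in> F. of_nat (card (fillings \<A> c m (rep x))) / of_nat (card (Aut_set \<A> (rep x)))) =
    (of_nat (card (all_fillings \<A> c m // filling_rel \<A> c m)) / of_nat (card (Hom (cod m) (dom n))) :: rat)"
proof -
  note N = kernel_simps[OF n] and M = cokernel_simps[OF m]
  let ?R = "filling_rel \<A> c m" and ?A = "all_fillings \<A> c m" and ?H = "Hom (cod m) (dom n)"
  have eq: "equiv ?A ?R" using filling_rel_equiv M by simp
  \<comment> \<open>The classes of fillings that have a member with middle term
    \<open>rep x\<close>.\<close>
  define C where "C = (\<lambda>x. {Q \<in> ?A // ?R. Q \<inter> fillings \<A> c m (rep x) \<noteq> {}})"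
  have H: "card ?H \<noteq> 0" using fin Hom_nonempty M N by simp
  have fin_fill: "finite (fillings \<A> c m X)" if X: "X \<in> Ob \<A>" for X
  proof (rule finite_subset)
    show "fillings \<A> c m X \<subseteq> Hom (dom c) X \<times> Hom X (cod c)" by (auto simp: fillings_def)
    show "finite (Hom (dom c) X \<times> Hom X (cod c))" using fin X M by simp
  qed
  have fin_aut: "finite (Aut_set \<A> X)" if X: "X \<in> Ob \<A>" for X
    using finite_subset[OF _ fin[OF X X], of "Aut_set \<A> X"] by (auto simp: Aut_set_def)
  \<comment> \<open>Orbit and stabiliser without a formal group action: Aut X is partitioned
    according to the filling to which an automorphism carries (s, t).\<close>
  have orbit: "card (Aut_set \<A> X) = card (Q \<inter> fillings \<A> c m X) * card ?H"
    if X: "X \<in> Ob \<A>" and Q: "Q \<in> ?A // ?R" "Q \<inter> fillings \<A> c m X \<noteq> {}" for X Q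
  proof -
    obtain s t where st: "(s, t) \<in> Q" "(s, t) \<in> fillings \<A> c m X" using Q by auto
    note f = fillingD[OF st(2)]
    obtain a where a: "a \<in> ?A" "Q = ?R `` {a}" using Q(1) by (auto elim: quotientE)
    then have "(a, (s, t)) \<in> ?R" using st by simp
    then have Qst: "Q = ?R `` {(s, t)}" unfolding a(2) by (rule equiv_class_eq[OF eq])
    define fib where "fib = (\<lambda>(s', t'). {b \<in> Hom X X. b \<cdot> s = s' \<and> t' \<cdot> b = t})"
    have card_fib: "card (fib p) = card ?H" if p: "p \<in> Q \<inter> fillings \<A> c m X" for p
    proof -
      obtain s' t' where p': "p = (s', t')" by fastforce
      have g: "(s', t') \<in> fillings \<A> c m X" using p p' by simp
      obtain b where "arr b" "dom b = cod s" "cod b = cod s'" "b \<cdot> s = s'" "t' \<cdot> b = t"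
        using p unfolding p' Qst by (auto simp: filling_rel_iff)
      then show ?thesis unfolding fib_def p' using filling_fiber_card[OF n m st(2) g] f fillingD[OF g] by simp
    qed
    have U: "Aut_set \<A> X = (\<Union>p \<in> Q \<inter> fillings \<A> c m X. fib p)"
    proof (intro Set.set_eqI iffI)
      fix b assume "b \<in> Aut_set \<A> X"
      then have b: "arr b" "dom b = X" "cod b = X" "is_isom \<A> b" by (auto simp: Aut_set_def Hom_iff)
      obtain v where v: "arr v" "dom v = X" "cod v = X" "v \<cdot> b = Ident \<A> X" "b \<cdot> v = Ident \<A> X"
        using is_isom_inverse[OF b(4)] b by metis
      have "ses \<A> (b \<cdot> s) ((m \<cdot> t) \<cdot> v)"
        by (rule ses_isom_mid[OF f(8)]) (use b v f in auto)
      then have g: "(b \<cdot> s, t \<cdot> v) \<in> fillings \<A> c m X"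
        using b v f M reassoc[OF v(4), of s] by (intro fillingI) auto
      have tvb: "(t \<cdot> v) \<cdot> b = t" using b v f by simp
      have "((s, t), (b \<cdot> s, t \<cdot> v)) \<in> ?R"
        unfolding filling_rel_iff using g st f b tvb by (intro conjI exI[of _ b]) auto
      then have "(b \<cdot> s, t \<cdot> v) \<in> Q" using Qst by simp
      moreover have "b \<in> fib (b \<cdot> s, t \<cdot> v)" unfolding fib_def using b tvb by (auto simp: Hom_iff)
      ultimately show "b \<in> (\<Union>p \<in> Q \<inter> fillings \<A> c m X. fib p)" using g by blast
    next
      fix b assume "b \<in> (\<Union>p \<in> Q \<inter> fillings \<A> c m X. fib p)"
      then obtain s' t' where "(s', t') \<in> fillings \<A> c m X" "b \<in> Hom X X" "b \<cdot> s = s'" "t' \<cdot> b = t"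
        by (auto simp: fib_def)
      then show "b \<in> Aut_set \<A> X"
        using filling_mor_isom[OF st(2), of s' t' X b] M by (auto simp: Aut_set_def Hom_iff)
    qed
    have "card (\<Union>p \<in> Q \<inter> fillings \<A> c m X. fib p) = (\<Sum>p \<in> Q \<inter> fillings \<A> c m X. card (fib p))"
    proof (rule card_UN_disjoint)
      show "finite (Q \<inter> fillings \<A> c m X)" using fin_fill[OF X] by simp
      show "\<forall>p \<in> Q \<inter> fillings \<A> c m X. finite (fib p)"
        using finite_subset[OF _ fin[OF X X]] by (auto simp: fib_def)
      show "\<forall>p \<in> Q \<inter> fillings \<A> c m X. \<forall>q \<in> Q \<inter> fillings \<A> c m X. p \<noteq> q \<longrightarrow> fib p \<inter> fib q = {}"
      proof (intro ballI impI)
        fix p q assume pq: "p \<in> Q \<inter> fillings \<A> c m X" "q \<in> Q \<inter> fillings \<A> c m X" "p \<noteq> q"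
        obtain s1 t1 s2 t2 where st12: "p = (s1, t1)" "q = (s2, t2)" by fastforce
        { fix b assume b: "b \<in> fib p" "b \<in> fib q"
          then have b': "b \<cdot> s = s1" "b \<cdot> s = s2" "t1 \<cdot> b = t2 \<cdot> b" "b \<in> Hom X X" "t1 \<cdot> b = t"
            by (auto simp: fib_def st12)
          have "(s1, t1) \<in> fillings \<A> c m X" "(s2, t2) \<in> fillings \<A> c m X" using pq st12 by auto
          note g = this and f1 = fillingD[OF this(1)] and f2 = fillingD[OF this(2)]
          have "is_isom \<A> b" by (rule filling_mor_isom[OF st(2) g(1)]) (use b' M in \<open>simp_all add: Hom_iff\<close>)
          then have "t1 = t2" by (rule epi_cancel[OF iso_epi b'(3)]) (use b'(4) f1 f2 in \<open>simp_all add: Hom_iff\<close>)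
          then have False using pq b' st12 by simp }
        then show "fib p \<inter> fib q = {}" by blast
      qed
    qed
    then show ?thesis using U card_fib by simp
  qed
  have one: "of_nat (card (fillings \<A> c m (rep x))) / of_nat (card (Aut_set \<A> (rep x))) = (of_nat (card (C x)) / of_nat (card ?H) :: rat)"
    and finC: "finite (C x)" if x: "x \<in> F" for x
  proof -
    have X: "rep x \<in> Ob \<A>" using rep_props F x by blast
    let ?f = "fillings \<A> c m (rep x)"
    have U: "?f = (\<Union>Q \<in> C x. Q \<inter> ?f)"
    proof (intro Set.set_eqI iffI)
      fix p assume p: "p \<in> ?f"
      then have "p \<in> ?A" using fillings_sub X by blast
      then obtain Q where "Q \<in> ?A // ?R" "p \<in> Q" using eq Union_quotient by blast
      then show "p \<in> (\<Union>Q \<in> C x. Q \<inter> ?f)" using p by (auto simp: C_def)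
    qed auto
    have disj: "\<forall>Q \<in> C x. \<forall>Q' \<in> C x. Q \<noteq> Q' \<longrightarrow> (Q \<inter> ?f) \<inter> (Q' \<inter> ?f) = {}"
    proof (intro ballI impI)
      fix Q Q' assume "Q \<in> C x" "Q' \<in> C x" "Q \<noteq> Q'"
      then have "Q \<inter> Q' = {}" using quotient_disj[OF eq, of Q Q'] by (auto simp: C_def)
      then show "(Q \<inter> ?f) \<inter> (Q' \<inter> ?f) = {}" by blast
    qed
    have "inj_on (\<lambda>Q. Q \<inter> ?f) (C x)"
    proof (rule inj_onI)
      fix Q Q' assume "Q \<in> C x" "Q' \<in> C x" "Q \<inter> ?f = Q' \<inter> ?f"
      then show "Q = Q'" using disj by (auto simp: C_def)
    qed
    moreover have "finite ((\<lambda>Q. Q \<inter> ?f) ` C x)"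
      by (rule finite_subset[of _ "Pow ?f"]) (use fin_fill[OF X] in auto)
    ultimately show "finite (C x)" using finite_imageD by blast
    then have "card ?f = (\<Sum>Q \<in> C x. card (Q \<inter> ?f))"
      using card_UN_disjoint[of "C x" "\<lambda>Q. Q \<inter> ?f"] disj fin_fill[OF X] U by simp
    then have "of_nat (card ?f) * of_nat (card ?H) = (\<Sum>Q \<in> C x. of_nat (card (Q \<inter> ?f) * card ?H) :: rat)"
      by (simp add: sum_distrib_right)
    also have "\<dots> = (\<Sum>Q \<in> C x. of_nat (card (Aut_set \<A> (rep x))))"
    proof (rule sum.cong[OF refl])
      fix Q assume "Q \<in> C x"
      then have "card (Q \<inter> ?f) * card ?H = card (Aut_set \<A> (rep x))" using orbit[OF X, of Q] by (simp add: C_def)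
      then show "of_nat (card (Q \<inter> ?f) * card ?H) = (of_nat (card (Aut_set \<A> (rep x))) :: rat)" by (simp only:)
    qed
    finally have "of_nat (card ?f) * of_nat (card ?H) = (of_nat (card (C x)) * of_nat (card (Aut_set \<A> (rep x))) :: rat)"
      by simp
    moreover have "Ident \<A> (rep x) \<in> Aut_set \<A> (rep x)" using X by (simp add: Aut_set_def Hom_iff)
    then have "card (Aut_set \<A> (rep x)) \<noteq> 0" using fin_aut[OF X] by auto
    ultimately show "of_nat (card ?f) / of_nat (card (Aut_set \<A> (rep x))) = (of_nat (card (C x)) / of_nat (card ?H) :: rat)"
      using H by (simp add: field_simps)
  qed
  \<comment> \<open>A filling can be transported to an isomorphic middle term, so each class meets
    the representative of its middle term, and, as shown below, no other one.\<close>
  have UC: "?A // ?R = (\<Union>x \<in> F. C x)"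
  proof (intro Set.set_eqI iffI)
    fix Q assume Q: "Q \<in> ?A // ?R"
    then obtain p where p: "p \<in> ?A" "Q = ?R `` {p}" by (auto elim: quotientE)
    obtain s t where st: "p = (s, t)" by fastforce
    have f: "(s, t) \<in> fillings \<A> c m (cod s)" using p st all_fillings_iff by simp
    have X: "cod s \<in> Ob \<A>" using fillingD[OF f] by (metis arr_Ob(2))
    then have x: "iso_class \<A> (cod s) \<in> F" using F(3) f by blast
    obtain s' t' where "(s', t') \<in> fillings \<A> c m (rep (iso_class \<A> (cod s)))" "((s, t), (s', t')) \<in> ?R"
      using filling_transport[OF f _ _ rep_iso_class[OF X]] M by metis
    then show "Q \<in> (\<Union>x \<in> F. C x)" using x Q p st by (auto simp: C_def)
  qed (auto simp: C_def)
  have "card (\<Union>x \<in> F. C x) = (\<Sum>x \<in> F. card (C x))"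
  proof (rule card_UN_disjoint[OF F(1)])
    show "\<forall>x \<in> F. \<forall>y \<in> F. x \<noteq> y \<longrightarrow> C x \<inter> C y = {}"
    proof (intro ballI impI, rule ccontr)
      fix x y assume xy: "x \<in> F" "y \<in> F" "x \<noteq> y" "C x \<inter> C y \<noteq> {}"
      then obtain Q p q where Q: "Q \<in> ?A // ?R" "p \<in> Q" "p \<in> fillings \<A> c m (rep x)" "q \<in> Q" "q \<in> fillings \<A> c m (rep y)"
        by (auto simp: C_def)
      obtain s t s' t' where st: "p = (s, t)" "q = (s', t')" by fastforce
      have "(p, q) \<in> ?R" using quotient_eq_iff[OF eq Q(1,1,2,4)] by simp
      then obtain b where b: "arr b" "dom b = cod s" "cod b = cod s'" "b \<cdot> s = s'" "t' \<cdot> b = t"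
        unfolding st filling_rel_iff by blast
      have "cod s = rep x" "cod s' = rep y" using Q st fillingD(4) by auto
      moreover have "is_isom \<A> b"
        using filling_mor_isom[of s t c m "rep x" s' t' "rep y" b] Q st b M calculation by simp
      ultimately have "isomorphic \<A> (rep x) (rep y)" unfolding isomorphic_def using b by (auto simp: Hom_iff)
      then have "x = y" using rep_props F xy iso_class_eq_iff by (metis subsetD)
      then show False using xy by simp
    qed
  qed (use finC in blast)
  then show ?thesis using one UC by (simp add: sum_divide_distrib)
qed


section \<open>Fillings and the second Yoneda extension group\<close>

text \<open>The image of a monomorphism is the monomorphism itself, so at the first place Yoneda's
  exactness is a kernel condition. The next lemma treats the last place.\<close>

lemma exact_pair_kernel:
  assumes "is_mono \<A> n"
  shows "exact_pair \<A> n c \<longleftrightarrow> is_kernel \<A> c n"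
proof
  assume "exact_pair \<A> n c"
  then obtain k e where k: "is_kernel \<A> c k" "is_epi \<A> e" "cod e = dom k" "n = k \<cdot> e"
    by (auto simp: exact_pair_def)
  have e: "arr e" "arr k" using k kernel_simps[OF k(1)] by (auto simp: is_epi_def)
  have "is_isom \<A> e" using mono_left[of k e] mono_epi_isom assms k e by simp
  then show "is_kernel \<A> c n" using kernel_isom k by simp
next
  assume k: "is_kernel \<A> c n"
  then have "is_epi \<A> (Ident \<A> (dom n))" "n = n \<cdot> Ident \<A> (dom n)" "cod (Ident \<A> (dom n)) = dom n"
    using kernel_simps[OF k] by (auto intro!: iso_epi)
  then show "exact_pair \<A> n c" unfolding exact_pair_def using k by blast
qed

lemma exact_pair_cokernel:
  assumes "is_epi \<A> m"
  shows "exact_pair \<A> c m \<longleftrightarrow> is_cokernel \<A> c m"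
proof
  assume "exact_pair \<A> c m"
  then obtain k e where k: "is_kernel \<A> m k" "is_epi \<A> e" "cod e = dom k" and c: "c = k \<cdot> e"
    by (auto simp: exact_pair_def)
  note ks = kernel_simps[OF k(1)]
  have e: "arr e" using k by (simp add: is_epi_def)
  have s: "is_cokernel \<A> k m" using epi_kernel_ses[OF assms k(1)] by (simp add: ses_def)
  show "is_cokernel \<A> c m"
  proof (rule cokernelI[OF assms])
    show "m \<cdot> c = nul (dom c) (cod m)" using reassoc[OF ks(4), of e] ks e k c by simp
    fix h assume h: "arr h" "dom h = cod c" "h \<cdot> c = nul (dom c) (cod h)"
    then have "(h \<cdot> k) \<cdot> e = nul (dom e) (cod (h \<cdot> k))" using ks e k c by simp
    then have "h \<cdot> k = nul (dom k) (cod h)" using epi_nul[OF k(2), of "h \<cdot> k"] h ks e k c by simp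
    then obtain u where "arr u" "dom u = cod m" "cod u = cod h" "u \<cdot> m = h"
      using cokernel_factor[OF s, of h] h c ks e k by auto
    then show "\<exists>u. arr u \<and> dom u = cod m \<and> cod u = cod h \<and> u \<cdot> m = h" by blast
  qed (use ks e k c in auto)
next
  assume m: "is_cokernel \<A> c m"
  note ms = cokernel_simps[OF m]
  obtain e k where ek: "is_epi \<A> e" "is_mono \<A> k" "arr e" "arr k" "cod e = dom k" "k \<cdot> e = c"
    using epi_mono_factorization ms by metis
  have "is_cokernel \<A> k m"
  proof (rule cokernelI[OF assms])
    have "(m \<cdot> k) \<cdot> e = nul (dom e) (cod (m \<cdot> k))" using ek ms by auto
    then show "m \<cdot> k = nul (dom k) (cod m)" using epi_nul[OF ek(1), of "m \<cdot> k"] ek ms by auto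
    fix h assume h: "arr h" "dom h = cod k" "h \<cdot> k = nul (dom k) (cod h)"
    then have "h \<cdot> c = nul (dom c) (cod h)" using reassoc[OF h(3), of e] ek ms by auto
    obtain u where "arr u" "dom u = cod m" "cod u = cod h" "u \<cdot> m = h"
      by (rule cokernel_factor[OF m, of h]) (use \<open>h \<cdot> c = nul (dom c) (cod h)\<close> h ek in auto)
    then show "\<exists>u. arr u \<and> dom u = cod m \<and> cod u = cod h \<and> u \<cdot> m = h" by blast
  qed (use ek ms in auto)
  then have "is_kernel \<A> m k" using mono_cokernel_ses[OF ek(2)] by (simp add: ses_def)
  then show "exact_pair \<A> c m" unfolding exact_pair_def using ek by blast
qed

lemma yoneda_exts2_iff:
  "[n, c, m] \<in> yoneda_exts \<A> 2 M N \<longleftrightarrow> is_kernel \<A> c n \<and> is_cokernel \<A> c m \<and> dom n = N \<and> cod m = M"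
proof -
  have "[n, c, m] \<in> yoneda_exts \<A> 2 M N \<longleftrightarrow> arr n \<and> arr c \<and> arr m \<and> dom n = N \<and> cod m = M \<and> is_mono \<A> n \<and> is_epi \<A> m \<and>
    cod n = dom c \<and> cod c = dom m \<and> exact_pair \<A> n c \<and> exact_pair \<A> c m"
    by (auto simp: yoneda_exts_def numeral_2_eq_2 less_Suc_eq)
  then show ?thesis
    using exact_pair_kernel[of n c] exact_pair_cokernel[of m c] kernel_mono[of c n] cokernel_epi[of c m]
      kernel_simps[of c n] cokernel_simps[of c m] by metis
qed

lemma yoneda_exts1_iff:
  "[f, g] \<in> yoneda_exts \<A> 1 M N \<longleftrightarrow> ses \<A> f g \<and> dom f = N \<and> cod g = M"
proof -
  have "[f, g] \<in> yoneda_exts \<A> 1 M N \<longleftrightarrow> arr f \<and> arr g \<and> dom f = N \<and> cod g = M \<and> is_mono \<A> f \<and> is_epi \<A> g \<and>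
    cod f = dom g \<and> exact_pair \<A> f g"
    by (auto simp: yoneda_exts_def less_Suc_eq)
  then show ?thesis
    using exact_pair_kernel[of f g] ses_simps[of f g] epi_kernel_ses[of g f] by metis
qed

lemma yoneda_exts_form:
  "fs \<in> yoneda_exts \<A> 1 M N \<Longrightarrow> \<exists>f g. fs = [f, g]"
  "fs \<in> yoneda_exts \<A> 2 M N \<Longrightarrow> \<exists>f g h. fs = [f, g, h]"
  by (auto simp: yoneda_exts_def length_Suc_conv numeral_eq_Suc)

text \<open>The new middle term is the pushout of \<open>s\<close> along \<phi>1. The morphism of
  2-extensions is the identity on M, so the quotient is unchanged and the new projection to it is
  \<open>m' \<cdot> t'\<close>.\<close>

lemma filling_push:
  assumes n': "is_kernel \<A> c' n'" and m: "is_cokernel \<A> c m" "is_cokernel \<A> c' m'"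
    and \<phi>: "arr \<phi>1" "dom \<phi>1 = dom c" "cod \<phi>1 = dom c'" "arr \<phi>2" "dom \<phi>2 = cod c" "cod \<phi>2 = cod c'"
      "\<phi>2 \<cdot> c = c' \<cdot> \<phi>1" "m' \<cdot> \<phi>2 = m"
    and f: "(s, t) \<in> fillings \<A> c m X"
  obtains s' t' g where "(s', t') \<in> fillings \<A> c' m' (cod s')" "arr g" "dom g = X" "cod g = cod s'"
    "g \<cdot> s = s' \<cdot> \<phi>1" "t' \<cdot> g = \<phi>2 \<cdot> t"
proof -
  note F = fillingD[OF f] and M = cokernel_simps[OF m(1)] and M' = cokernel_simps[OF m(2)]
  obtain g s' where po: "is_pullback (dual_cat \<A>) s \<phi>1 g s'"
    using pushout_exists[of s \<phi>1] F \<phi> by metis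
  note pos = pushout_simps[OF po]
  have "(\<phi>2 \<cdot> t) \<cdot> s = c' \<cdot> \<phi>1" using F \<phi> by simp
  then obtain t' where t': "arr t'" "cod t' = cod c'" "dom t' = cod g" "t' \<cdot> g = \<phi>2 \<cdot> t" "t' \<cdot> s' = c'"
    using pushout_factor[OF po, of "\<phi>2 \<cdot> t" c'] F \<phi> M' by auto
  obtain k' where k': "ses \<A> s' k'" "cod k' = cod (m \<cdot> t)" "k' \<cdot> g = m \<cdot> t"
    using pushout_ses[OF F(8) po] by metis
  note K = ses_simps[OF k'(1)]
  have mm: "cod m' = cod m" using \<phi> M' by (metis comp_simps(3))
  have "k' = m' \<cdot> t'"
  proof (rule pushout_unique[OF po])
    have "(m' \<cdot> t') \<cdot> g = m' \<cdot> \<phi>2 \<cdot> t" using t' pos M' by simp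
    also have "\<dots> = m \<cdot> t" by (rule reassoc[OF \<phi>(8)]) (use \<phi> F M' in simp_all)
    finally show "k' \<cdot> g = (m' \<cdot> t') \<cdot> g" using k' by simp
    show "k' \<cdot> s' = (m' \<cdot> t') \<cdot> s'" using t' pos(1-4,6-9) K M M' k' F mm \<phi>(3) by simp
  qed (use K t' M M' pos k' F mm in simp_all)
  then have "(s', t') \<in> fillings \<A> c' m' (cod s')"
    using k' t' pos \<phi> by (intro fillingI) auto
  then show ?thesis using that pos t' F by auto
qed

text \<open>A map of fillings over \<phi>1 and \<phi>2 exhibits its target as a pushout, by
  \<open>ses_pushout_factor\<close>. Two targets of the same filling are therefore
  equivalent.\<close>

lemma filling_push_unique:
  assumes m: "is_cokernel \<A> c m" "is_cokernel \<A> c' m'"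
    and \<phi>: "arr \<phi>1" "dom \<phi>1 = dom c" "cod \<phi>1 = dom c'" "arr \<phi>2" "dom \<phi>2 = cod c" "cod \<phi>2 = cod c'" "m' \<cdot> \<phi>2 = m"
    and f: "(s, t) \<in> fillings \<A> c m X" and f1: "(s1, t1) \<in> fillings \<A> c' m' X1" and f2: "(s2, t2) \<in> fillings \<A> c' m' X2"
    and g1: "arr g1" "dom g1 = X" "cod g1 = X1" "g1 \<cdot> s = s1 \<cdot> \<phi>1" "t1 \<cdot> g1 = \<phi>2 \<cdot> t"
    and g2: "arr g2" "dom g2 = X" "cod g2 = X2" "g2 \<cdot> s = s2 \<cdot> \<phi>1" "t2 \<cdot> g2 = \<phi>2 \<cdot> t"
  obtains b where "arr b" "dom b = X1" "cod b = X2" "b \<cdot> s1 = s2" "t2 \<cdot> b = t1"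
proof -
  note F = fillingD[OF f] and F1 = fillingD[OF f1] and F2 = fillingD[OF f2]
    and M = cokernel_simps[OF m(1)] and M' = cokernel_simps[OF m(2)]
  have "m' \<cdot> \<phi>2 \<cdot> t = m \<cdot> t" by (rule reassoc[OF \<phi>(7)]) (use \<phi> F M' in simp_all)
  then have e: "(m' \<cdot> t1) \<cdot> g1 = m \<cdot> t" using F1 g1 M' by simp
  obtain u where u: "arr u" "dom u = cod s1" "cod u = cod g2" "u \<cdot> g1 = g2" "u \<cdot> s1 = s2"
    by (rule ses_pushout_factor[OF F(8) F1(8) g1(1) _ _ e \<phi>(1) _ _ g1(4) g2(1) _ F2(1) _ _ g2(4)])
      (use F F1 F2 g1 g2 \<phi> in auto)
  have "t2 \<cdot> u = t1"
  proof (rule ses_pushout_unique[OF F(8) F1(8) g1(1) _ _ e])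
    have "(t2 \<cdot> u) \<cdot> g1 = t2 \<cdot> g2" using u F1 F2 g1 g2 by simp
    then show "(t2 \<cdot> u) \<cdot> g1 = t1 \<cdot> g1" using g1 g2 by simp
    show "(t2 \<cdot> u) \<cdot> s1 = t1 \<cdot> s1" using u F1 F2 g1 g2 by simp
  qed (use F F1 F2 g1 g2 \<phi> u in auto)
  then show ?thesis using that[of u] u F1 F2 g2 by auto
qed

text \<open>By \<open>filling_ses\<close> and \<open>filling_ses'\<close> the exact sequence with
  \<open>m\<close> may be exchanged for the one with \<open>n\<close>. Pulling a filling back along
  a morphism of 2-extensions is thus pushing it out in the opposite category.\<close>

lemma fillings_dual:
  assumes "is_kernel \<A> c n" "is_cokernel \<A> c m"
  shows "(t, s) \<in> fillings (dual_cat \<A>) c n X \<longleftrightarrow> (s, t) \<in> fillings \<A> c m X"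
proof
  assume a: "(t, s) \<in> fillings (dual_cat \<A>) c n X"
  then have "arr s" "arr t" "dom s = dom c" "cod s = X" "dom t = X" "cod t = cod c" "t \<cdot> s = c" "ses \<A> (s \<cdot> n) t"
    by (auto simp: fillings_def Hom_iff)
  then show "(s, t) \<in> fillings \<A> c m X" using filling_ses'[OF assms] by (intro fillingI) auto
next
  assume a: "(s, t) \<in> fillings \<A> c m X"
  note f = fillingD[OF a]
  then have "ses \<A> (s \<cdot> n) t" using filling_ses[OF assms] by simp
  then show "(t, s) \<in> fillings (dual_cat \<A>) c n X" using f by (auto simp: fillings_def Hom_iff)
qed

lemma filling_pull:
  assumes n: "is_kernel \<A> c n" "is_kernel \<A> c' n'" and m: "is_cokernel \<A> c m" "is_cokernel \<A> c' m'"
    and \<phi>: "arr \<phi>1" "dom \<phi>1 = dom c" "cod \<phi>1 = dom c'" "arr \<phi>2" "dom \<phi>2 = cod c" "cod \<phi>2 = cod c'"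
      "\<phi>2 \<cdot> c = c' \<cdot> \<phi>1" "\<phi>1 \<cdot> n = n'"
    and f: "(s', t') \<in> fillings \<A> c' m' X'"
  obtains s t g where "(s, t) \<in> fillings \<A> c m (dom t)" "arr g" "dom g = dom t" "cod g = X'"
    "g \<cdot> s = s' \<cdot> \<phi>1" "t' \<cdot> g = \<phi>2 \<cdot> t"
proof -
  have fd: "(t', s') \<in> fillings (dual_cat \<A>) c' n' X'" using fillings_dual[OF n(2) m(2)] f by simp
  obtain t s g where "(t, s) \<in> fillings (dual_cat \<A>) c n (dom t)" "arr g" "cod g = X'" "dom g = dom t"
    "t' \<cdot> g = \<phi>2 \<cdot> t" "g \<cdot> s = s' \<cdot> \<phi>1"
    by (rule abelian_category.filling_push[OF dual_ax, of c m c' n' n \<phi>2 \<phi>1 t' s' X']) (use n m \<phi> fd in simp_all)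
  then show ?thesis using that fillings_dual[OF n(1) m(1)] by auto
qed

lemma filling_pull_unique:
  assumes n: "is_kernel \<A> c n" "is_kernel \<A> c' n'" and m: "is_cokernel \<A> c m" "is_cokernel \<A> c' m'"
    and \<phi>: "arr \<phi>1" "dom \<phi>1 = dom c" "cod \<phi>1 = dom c'" "arr \<phi>2" "dom \<phi>2 = cod c" "cod \<phi>2 = cod c'" "\<phi>1 \<cdot> n = n'"
    and f: "(s, t) \<in> fillings \<A> c' m' X" and f1: "(s1, t1) \<in> fillings \<A> c m X1" and f2: "(s2, t2) \<in> fillings \<A> c m X2"
    and g1: "arr g1" "cod g1 = X" "dom g1 = X1" "g1 \<cdot> s1 = s \<cdot> \<phi>1" "t \<cdot> g1 = \<phi>2 \<cdot> t1"
    and g2: "arr g2" "cod g2 = X" "dom g2 = X2" "g2 \<cdot> s2 = s \<cdot> \<phi>1" "t \<cdot> g2 = \<phi>2 \<cdot> t2"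
  obtains b where "arr b" "dom b = X2" "cod b = X1" "b \<cdot> s2 = s1" "t1 \<cdot> b = t2"
proof -
  have fd: "(t, s) \<in> fillings (dual_cat \<A>) c' n' X" "(t1, s1) \<in> fillings (dual_cat \<A>) c n X1" "(t2, s2) \<in> fillings (dual_cat \<A>) c n X2"
    using fillings_dual[OF n(1) m(1)] fillings_dual[OF n(2) m(2)] f f1 f2 by simp_all
  show ?thesis
    by (rule abelian_category.filling_push_unique[OF dual_ax, of c' n' c n \<phi>2 \<phi>1 t s X t1 s1 X1 t2 s2 X2 g1 g2])
      (use n m \<phi> fd g1 g2 that in simp_all)
qed

text \<open>The correspondence relates two fillings that are joined by a map over \<phi>1 and
  \<phi>2. Pushing out provides partners in one direction and pulling back in the other; the two
  uniqueness lemmas show that equivalence is preserved and reflected.\<close>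

lemma card_fillings_step:
  assumes "is_kernel \<A> c n" "is_kernel \<A> c' n'" "is_cokernel \<A> c m" "is_cokernel \<A> c' m'"
    and \<phi>: "arr \<phi>1" "dom \<phi>1 = dom c" "cod \<phi>1 = dom c'" "arr \<phi>2" "dom \<phi>2 = cod c" "cod \<phi>2 = cod c'"
      "\<phi>2 \<cdot> c = c' \<cdot> \<phi>1" "\<phi>1 \<cdot> n = n'" "m' \<cdot> \<phi>2 = m"
  shows "card (all_fillings \<A> c m // filling_rel \<A> c m) = card (all_fillings \<A> c' m' // filling_rel \<A> c' m')"
proof -
  note M = cokernel_simps[OF assms(3)] and M' = cokernel_simps[OF assms(4)]
  define R where "R = (\<lambda>(s, t) (s', t'). \<exists>g. arr g \<and> dom g = cod s \<and> cod g = cod s' \<and> g \<cdot> s = s' \<cdot> \<phi>1 \<and> t' \<cdot> g = \<phi>2 \<cdot> t)"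
  show ?thesis
  proof (rule card_quotient_eq[where R = R])
    show "equiv (all_fillings \<A> c m) (filling_rel \<A> c m)" "equiv (all_fillings \<A> c' m') (filling_rel \<A> c' m')"
      using filling_rel_equiv M M' by auto
    show "\<exists>b \<in> all_fillings \<A> c' m'. R a b" if "a \<in> all_fillings \<A> c m" for a
    proof -
      obtain s t where st: "a = (s, t)" by fastforce
      have f: "(s, t) \<in> fillings \<A> c m (cod s)" using that st all_fillings_iff by simp
      obtain s' t' g where "(s', t') \<in> fillings \<A> c' m' (cod s')" "arr g" "dom g = cod s" "cod g = cod s'"
        "g \<cdot> s = s' \<cdot> \<phi>1" "t' \<cdot> g = \<phi>2 \<cdot> t"
        by (rule filling_push[OF assms(2-4) \<phi>(1-7,9) f])
      then show ?thesis unfolding st R_def by (intro bexI[of _ "(s', t')"]) (auto simp: all_fillings_iff)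
    qed
    show "\<exists>a \<in> all_fillings \<A> c m. R a b" if "b \<in> all_fillings \<A> c' m'" for b
    proof -
      obtain s' t' where st: "b = (s', t')" by fastforce
      have f: "(s', t') \<in> fillings \<A> c' m' (cod s')" using that st all_fillings_iff by simp
      obtain s t g where g: "(s, t) \<in> fillings \<A> c m (dom t)" "arr g" "dom g = dom t" "cod g = cod s'"
        "g \<cdot> s = s' \<cdot> \<phi>1" "t' \<cdot> g = \<phi>2 \<cdot> t"
        by (rule filling_pull[OF assms(1-4) \<phi>(1-8) f])
      then have "dom t = cod s" using fillingD by metis
      then show ?thesis unfolding st R_def using g by (intro bexI[of _ "(s, t)"]) (auto simp: all_fillings_iff)
    qed
    fix a a' b b'
    assume A: "a \<in> all_fillings \<A> c m" "a' \<in> all_fillings \<A> c m" "b \<in> all_fillings \<A> c' m'" "b' \<in> all_fillings \<A> c' m'"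
      "R a b" "R a' b'"
    obtain s t s' t' where a: "a = (s, t)" "a' = (s', t')" by fastforce
    obtain u v u' v' where b: "b = (u, v)" "b' = (u', v')" by fastforce
    have f: "(s, t) \<in> fillings \<A> c m (cod s)" "(s', t') \<in> fillings \<A> c m (cod s')"
      "(u, v) \<in> fillings \<A> c' m' (cod u)" "(u', v') \<in> fillings \<A> c' m' (cod u')"
      using A a b all_fillings_iff by auto
    note F = fillingD[OF f(1)] and F' = fillingD[OF f(2)] and G = fillingD[OF f(3)] and G' = fillingD[OF f(4)]
    obtain g where g: "arr g" "dom g = cod s" "cod g = cod u" "g \<cdot> s = u \<cdot> \<phi>1" "v \<cdot> g = \<phi>2 \<cdot> t"
      using A(5) by (auto simp: R_def a b)
    obtain g' where g': "arr g'" "dom g' = cod s'" "cod g' = cod u'" "g' \<cdot> s' = u' \<cdot> \<phi>1" "v' \<cdot> g' = \<phi>2 \<cdot> t'"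
      using A(6) by (auto simp: R_def a b)
    show "(a, a') \<in> filling_rel \<A> c m \<longleftrightarrow> (b, b') \<in> filling_rel \<A> c' m'"
    proof
      assume "(a, a') \<in> filling_rel \<A> c m"
      then obtain x where x: "arr x" "dom x = cod s" "cod x = cod s'" "x \<cdot> s = s'" "t' \<cdot> x = t"
        unfolding a filling_rel_iff by blast
      have e1: "(g' \<cdot> x) \<cdot> s = u' \<cdot> \<phi>1" using x g' F F' by simp
      have "v' \<cdot> g' \<cdot> x = \<phi>2 \<cdot> t' \<cdot> x" by (rule square[OF g'(5)]) (use x g' F F' G' \<phi> in simp_all)
      then have e2: "v' \<cdot> g' \<cdot> x = \<phi>2 \<cdot> t" using x by simp
      obtain y where "arr y" "dom y = cod u" "cod y = cod u'" "y \<cdot> u = u'" "v' \<cdot> y = v"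
        by (rule filling_push_unique[OF assms(3,4) \<phi>(1-6,9) f(1,3,4) g _ _ _ e1 e2]) (use x g' in simp_all)
      then show "(b, b') \<in> filling_rel \<A> c' m'" unfolding b filling_rel_iff using f by blast
    next
      assume "(b, b') \<in> filling_rel \<A> c' m'"
      then obtain x where x: "arr x" "dom x = cod u" "cod x = cod u'" "x \<cdot> u = u'" "v' \<cdot> x = v"
        unfolding b filling_rel_iff by blast
      have "x \<cdot> u \<cdot> \<phi>1 = u' \<cdot> \<phi>1" by (rule reassoc[OF x(4)]) (use x G G' \<phi> in simp_all)
      then have e1: "(x \<cdot> g) \<cdot> s = u' \<cdot> \<phi>1" using x g F G by simp
      have "v' \<cdot> x \<cdot> g = v \<cdot> g" by (rule reassoc[OF x(5)]) (use x g G G' in simp_all)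
      then have e2: "v' \<cdot> x \<cdot> g = \<phi>2 \<cdot> t" using g by simp
      obtain y where "arr y" "dom y = cod s" "cod y = cod s'" "y \<cdot> s = s'" "t' \<cdot> y = t"
        by (rule filling_pull_unique[OF assms(1-4) \<phi>(1-6,8) f(4,2,1) g'(1,3,2,4,5) _ _ _ e1 e2]) (use x g in simp_all)
      then show "(a, a') \<in> filling_rel \<A> c m" unfolding a filling_rel_iff using f by blast
    qed
  qed
qed

text \<open>Here the vanishing of Ext^2 enters: 2-extensions modulo zigzags form a one-element set,
  so the given one is connected with the one that has identities outside and 0 in the middle. The
  number of classes of fillings is constant along the zigzag, and at its end the fillings are the
  extensions of M by N.\<close>

lemma card_fillings_yoneda:
  assumes her: "hereditary \<A>" and n: "is_kernel \<A> c n" and m: "is_cokernel \<A> c m"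
  shows "card (all_fillings \<A> c m // filling_rel \<A> c m) = card (yoneda_Ext \<A> 1 (cod m) (dom n))"
proof -
  define M where "M = cod m"
  define N where "N = dom n"
  have MN: "M \<in> Ob \<A>" "N \<in> Ob \<A>" using kernel_simps[OF n] cokernel_simps[OF m] by (auto simp: M_def N_def)
  let ?E = "yoneda_exts \<A> 2 M N" and ?S = "yoneda_step \<A> 2 M N"
  let ?r = "(?S \<union> ?S\<inverse>)\<^sup>*"
  \<comment> \<open>The count as a function of the list of arrows, so that it can be followed along
    the zigzag.\<close>
  define P where "P = (\<lambda>fs. card (all_fillings \<A> (fs ! 1) (fs ! 2) // filling_rel \<A> (fs ! 1) (fs ! 2)))"
  have one_step: "P fs = P gs" if "(fs, gs) \<in> ?S" for fs gs
  proof -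
    have fg: "fs \<in> ?E" "gs \<in> ?E" using that by (auto simp: yoneda_step_def)
    obtain n c m n' c' m' where l: "fs = [n, c, m]" "gs = [n', c', m']" using fg yoneda_exts_form(2) by metis
    note e = fg[unfolded l yoneda_exts2_iff]
    from that obtain \<phi> where "\<phi> 0 = Ident \<A> N \<and> \<phi> (2 + 1) = Ident \<A> M \<and>
        (\<forall>i \<in> {1..2}. \<phi> i \<in> Hom (dom (fs ! i)) (dom (gs ! i))) \<and>
        (\<forall>i \<le> 2. \<phi> (i + 1) \<cdot> fs ! i = gs ! i \<cdot> \<phi> i)"
      unfolding yoneda_step_def by blast
    then have "\<phi> 0 = Ident \<A> N" "\<phi> 3 = Ident \<A> M"
      and h: "\<And>i. i \<in> {1..2} \<Longrightarrow> \<phi> i \<in> Hom (dom (fs ! i)) (dom (gs ! i))"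
      and q: "\<And>i. i \<le> 2 \<Longrightarrow> \<phi> (i + 1) \<cdot> fs ! i = gs ! i \<cdot> \<phi> i"
      by simp_all
    then have a: "\<phi> 1 \<cdot> n = n' \<cdot> Ident \<A> N" "\<phi> 2 \<cdot> c = c' \<cdot> \<phi> 1" "Ident \<A> M \<cdot> m = m' \<cdot> \<phi> 2"
      using q[of 0] q[of 1] q[of 2] l by (simp_all add: numeral_eq_Suc)
    have b: "\<phi> 1 \<in> Hom (dom c) (dom c')" "\<phi> 2 \<in> Hom (dom m) (dom m')"
      using h[of 1] h[of 2] l by (simp_all add: numeral_eq_Suc)
    have k: "is_kernel \<A> c n" "is_kernel \<A> c' n'" "is_cokernel \<A> c m" "is_cokernel \<A> c' m'"
      using e by simp_all
    have d: "dom n' = N" "cod m = M" using e by simp_all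
    have "card (all_fillings \<A> c m // filling_rel \<A> c m) = card (all_fillings \<A> c' m' // filling_rel \<A> c' m')"
    proof (rule card_fillings_step[OF k])
      show "\<phi> 1 \<cdot> n = n'" using a(1) d kernel_simps(2)[OF k(2)] by simp
      show "m' \<cdot> \<phi> 2 = m" using a(3) d cokernel_simps(2)[OF k(3)] by simp
    qed (use a(2) b kernel_simps[OF k(1)] kernel_simps[OF k(2)] cokernel_simps[OF k(3)] cokernel_simps[OF k(4)]
        in \<open>simp_all add: Hom_iff\<close>)
    then show ?thesis by (simp add: P_def l numeral_eq_Suc)
  qed
  have chain: "P fs = P gs" if "(fs, gs) \<in> ?r" for fs gs
    using that
  proof (induction rule: rtrancl_induct)
    case (step y z)
    then have "P y = P z" using one_step[of y z] one_step[of z y] by auto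
    then show ?case using step by simp
  qed simp
  \<comment> \<open>The base point with which every 2-extension is compared.\<close>
  have t: "is_kernel \<A> (nul N M) (Ident \<A> N)" "is_cokernel \<A> (nul N M) (Ident \<A> M)"
    using MN by (auto intro!: kernelI cokernelI iso_mono iso_epi)
  have "[n, c, m] \<in> ?E" "[Ident \<A> N, nul N M, Ident \<A> M] \<in> ?E"
    using n m t MN by (simp_all add: yoneda_exts2_iff M_def[symmetric] N_def[symmetric])
  moreover have "is_singleton (?E // ?r)"
    using her MN unfolding hereditary_def yoneda_Ext_def by simp
  ultimately have "?r `` {[n, c, m]} = ?r `` {[Ident \<A> N, nul N M, Ident \<A> M]}"
    unfolding is_singleton_def by (metis quotientI singletonD)
  then have "([n, c, m], [Ident \<A> N, nul N M, Ident \<A> M]) \<in> ?r" by auto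
  then have "P [n, c, m] = P [Ident \<A> N, nul N M, Ident \<A> M]" by (rule chain)
  then have 1: "card (all_fillings \<A> c m // filling_rel \<A> c m) =
    card (all_fillings \<A> (nul N M) (Ident \<A> M) // filling_rel \<A> (nul N M) (Ident \<A> M))"
    by (simp add: P_def)
  note [simp del] = One_nat_def
  let ?A = "all_fillings \<A> (nul N M) (Ident \<A> M)" and ?R = "filling_rel \<A> (nul N M) (Ident \<A> M)"
  let ?E1 = "yoneda_exts \<A> 1 M N" and ?S1 = "yoneda_step \<A> 1 M N"
  \<comment> \<open>For the zero middle map the condition t s = c is part of exactness.\<close>
  have A: "(s, t) \<in> ?A \<longleftrightarrow> [s, t] \<in> ?E1" for s t
    unfolding all_fillings_iff yoneda_exts1_iff fillings_def using MN by (auto simp: Hom_iff ses_simps)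
  have R: "((s, t), (s', t')) \<in> ?R \<longleftrightarrow> ([s, t], [s', t']) \<in> ?S1" for s t s' t'
  proof
    assume "((s, t), (s', t')) \<in> ?R"
    then obtain b where b: "[s, t] \<in> ?E1" "[s', t'] \<in> ?E1" "arr b" "dom b = cod s" "cod b = cod s'" "b \<cdot> s = s'" "t' \<cdot> b = t"
      unfolding filling_rel_iff A[symmetric] all_fillings_iff by blast
    note S = b(1,2)[unfolded yoneda_exts1_iff]
    define \<phi> where "\<phi> = (\<lambda>i::nat. if i = 0 then Ident \<A> N else if i = 1 then b else Ident \<A> M)"
    have "\<phi> 0 = Ident \<A> N \<and> \<phi> (1 + 1) = Ident \<A> M \<and>
        (\<forall>i \<in> {1..1}. \<phi> i \<in> Hom (dom ([s, t] ! i)) (dom ([s', t'] ! i))) \<and>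
        (\<forall>i \<le> 1. \<phi> (i + 1) \<cdot> [s, t] ! i = [s', t'] ! i \<cdot> \<phi> i)"
      using b S ses_simps[of s t] ses_simps[of s' t'] by (auto simp: \<phi>_def Hom_iff le_Suc_eq)
    then show "([s, t], [s', t']) \<in> ?S1" unfolding yoneda_step_def using b by blast
  next
    assume "([s, t], [s', t']) \<in> ?S1"
    then obtain \<phi> where "[s, t] \<in> ?E1 \<and> [s', t'] \<in> ?E1 \<and> \<phi> 0 = Ident \<A> N \<and> \<phi> (1 + 1) = Ident \<A> M \<and>
        (\<forall>i \<in> {1..1}. \<phi> i \<in> Hom (dom ([s, t] ! i)) (dom ([s', t'] ! i))) \<and>
        (\<forall>i \<le> 1. \<phi> (i + 1) \<cdot> [s, t] ! i = [s', t'] ! i \<cdot> \<phi> i)"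
      unfolding yoneda_step_def by blast
    then have e: "[s, t] \<in> ?E1" "[s', t'] \<in> ?E1" and \<phi>: "\<phi> 0 = Ident \<A> N" "\<phi> (1 + 1) = Ident \<A> M"
        "\<forall>i \<in> {1..1}. \<phi> i \<in> Hom (dom ([s, t] ! i)) (dom ([s', t'] ! i))"
        "\<forall>i \<le> 1. \<phi> (i + 1) \<cdot> [s, t] ! i = [s', t'] ! i \<cdot> \<phi> i"
      by blast+
    note S = e[unfolded yoneda_exts1_iff]
    have p: "\<phi> 1 \<cdot> s = s' \<cdot> Ident \<A> N" "Ident \<A> M \<cdot> t = t' \<cdot> \<phi> 1" "\<phi> 1 \<in> Hom (dom t) (dom t')"
      using \<phi>(3)[rule_format, of 1] \<phi>(4)[rule_format, of 0] \<phi>(4)[rule_format, of 1] \<phi>(1,2) by auto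
    have st: "ses \<A> s t" "cod t = M" "ses \<A> s' t'" "dom s' = N" using S by auto
    note a = ses_simps[OF st(1)] and a' = ses_simps[OF st(3)]
    have "arr (\<phi> 1)" "dom (\<phi> 1) = cod s" "cod (\<phi> 1) = cod s'" using p(3) a(3) a'(3) by (simp_all add: Hom_iff)
    moreover have "\<phi> 1 \<cdot> s = s'" using p(1) st(4) a'(1) by simp
    moreover have "t' \<cdot> \<phi> 1 = t" using p(2) st(2) a(2) by simp
    ultimately show "((s, t), (s', t')) \<in> ?R" unfolding filling_rel_iff using e[folded A, unfolded all_fillings_iff] by blast
  qed
  have eqR: "equiv ?A ?R" using filling_rel_equiv MN by simp
  have rst: "refl_on ?A ?R" "sym ?R" "trans ?R" using eqR by (auto elim: equivE)
  have S1: "?S1 \<subseteq> ?E1 \<times> ?E1" by (auto simp: yoneda_step_def)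
  have eqS: "equiv ?E1 ?S1"
  proof (intro equivI refl_onI symI transI S1)
    fix x assume x: "x \<in> ?E1"
    then obtain s t where "x = [s, t]" using yoneda_exts_form by blast
    then show "(x, x) \<in> ?S1" using x R[of s t s t] A[of s t] refl_onD[OF rst(1), of "(s, t)"] by simp
  next
    fix x y assume xy: "(x, y) \<in> ?S1"
    then obtain s t s' t' where "x = [s, t]" "y = [s', t']" using yoneda_exts_form S1 by (metis mem_Sigma_iff subsetD)
    then show "(y, x) \<in> ?S1" using xy R[of s t s' t'] R[of s' t' s t] symD[OF rst(2), of "(s, t)" "(s', t')"] by simp
  next
    fix x y z assume xy: "(x, y) \<in> ?S1" "(y, z) \<in> ?S1"
    then obtain s t s' t' where 1: "x = [s, t]" "y = [s', t']" using yoneda_exts_form S1 by (metis mem_Sigma_iff subsetD)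
    obtain s'' t'' where 2: "z = [s'', t'']" using xy yoneda_exts_form S1 by (metis mem_Sigma_iff subsetD)
    show "(x, z) \<in> ?S1"
      using xy 1 2 R[of s t s' t'] R[of s' t' s'' t''] R[of s t s'' t''] transD[OF rst(3), of "(s, t)" "(s', t')" "(s'', t'')"] by simp
  qed
  have 2: "card (?A // ?R) = card (?E1 // ?S1)"
  proof (rule card_quotient_eq[OF eqR eqS, where R = "\<lambda>p l. l = [fst p, snd p]"])
    show "\<exists>b \<in> ?E1. b = [fst a, snd a]" if "a \<in> ?A" for a using that A[of "fst a" "snd a"] by auto
    show "\<exists>a \<in> ?A. b = [fst a, snd a]" if "b \<in> ?E1" for b
      using that A yoneda_exts_form(1)[OF that] by (metis fst_conv snd_conv)
    show "(a, a') \<in> ?R \<longleftrightarrow> (b, b') \<in> ?S1" if "b = [fst a, snd a]" "b' = [fst a', snd a']" for a a' b b'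
      using that R[of "fst a" "snd a" "fst a'" "snd a'"] by simp
  qed
  \<comment> \<open>For 1-extensions the elementary steps already form an equivalence relation, so
    the closure in \<open>yoneda_Ext\<close> only adds the diagonal outside of
    \<open>?E1\<close>.\<close>
  have "?S1\<inverse> = ?S1" using eqS by (simp add: equiv_def sym_conv_converse_eq)
  moreover have "?S1\<^sup>* = ?S1 \<union> Id" using eqS by (simp add: rtrancl_trancl_reflcl trancl_id equiv_def)
  ultimately have "(?S1 \<union> ?S1\<inverse>)\<^sup>* = ?S1 \<union> Id" by simp
  moreover have "(?S1 \<union> Id) `` {x} = ?S1 `` {x}" if "x \<in> ?E1" for x
    using eqS that by (auto simp: equiv_def refl_on_def)
  ultimately have "yoneda_Ext \<A> 1 M N = ?E1 // ?S1"
    unfolding yoneda_Ext_def quotient_def by simp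
  then show ?thesis using 1 2 by (simp add: M_def N_def)
qed

end


section \<open>Counting short exact sequences\<close>

text \<open>The order of the arguments is quotient, subobject, middle term, as in
  \<open>hall_number\<close>.\<close>

definition ext_pairs :: "('o, 'm) preadd_cat \<Rightarrow> 'o \<Rightarrow> 'o \<Rightarrow> 'o \<Rightarrow> ('m \<times> 'm) set" where
  "ext_pairs \<A> M N X = {s. short_exact \<A> N X M s}"

definition isos :: "('o, 'm) preadd_cat \<Rightarrow> 'o \<Rightarrow> 'o \<Rightarrow> 'm set" where
  "isos \<A> X Y = {f \<in> Hom_set \<A> X Y. is_isom \<A> f}"

lemma isos_dual [simp]: "isos (dual_cat \<A>) X Y = isos \<A> Y X"
  by (simp add: isos_def)

lemma Aut_set_dual [simp]: "Aut_set (dual_cat \<A>) X = Aut_set \<A> X"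
  by (simp add: Aut_set_def)

lemma ext_pairs_iff: "(f, g) \<in> ext_pairs \<A> M N X \<longleftrightarrow> f \<in> Hom_set \<A> N X \<and> g \<in> Hom_set \<A> X M \<and> ses \<A> f g"
  by (simp add: ext_pairs_def short_exact_iff)

text \<open>Incidences are counted with weights 1 / w on one side and 1 / v on the other. The fibre
  over each p has mass 1, the fibre over each q has mass \<chi>. With \<chi> = 1 this yields
  associativity, with constant \<chi> the multiplicativity of the Euler form, and with the Euler
  form as \<chi> Green's formula.\<close>

lemma double_count:
  fixes N :: "'p \<Rightarrow> 'q \<Rightarrow> nat" and w :: "'x \<Rightarrow> rat" and v \<chi> :: "'y \<Rightarrow> rat"
  assumes "finite F" "finite G" "\<And>x. x \<in> F \<Longrightarrow> finite (P x)" "\<And>y. y \<in> G \<Longrightarrow> finite (Q y)"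
    and A: "\<And>x p. x \<in> F \<Longrightarrow> p \<in> P x \<Longrightarrow> (\<Sum>y \<in> G. of_nat (\<Sum>q \<in> Q y. N p q) / v y) = 1"
    and B: "\<And>y q. y \<in> G \<Longrightarrow> q \<in> Q y \<Longrightarrow> (\<Sum>x \<in> F. of_nat (\<Sum>p \<in> P x. N p q) / w x) = \<chi> y"
  shows "(\<Sum>x \<in> F. of_nat (card (P x)) / w x) = (\<Sum>y \<in> G. \<chi> y * of_nat (card (Q y)) / v y)"
proof -
  have "(\<Sum>x \<in> F. of_nat (card (P x)) / w x) = (\<Sum>x \<in> F. \<Sum>p \<in> P x. 1 / w x)" by simp
  also have "\<dots> = (\<Sum>x \<in> F. \<Sum>p \<in> P x. (\<Sum>y \<in> G. of_nat (\<Sum>q \<in> Q y. N p q) / v y) / w x)"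
    by (intro sum.cong refl) (simp only: A)
  also have "\<dots> = (\<Sum>x \<in> F. \<Sum>p \<in> P x. \<Sum>y \<in> G. \<Sum>q \<in> Q y. of_nat (N p q) / v y / w x)"
    by (simp add: sum_divide_distrib)
  also have "\<dots> = (\<Sum>x \<in> F. \<Sum>y \<in> G. \<Sum>q \<in> Q y. \<Sum>p \<in> P x. of_nat (N p q) / v y / w x)"
    by (intro sum.cong refl, subst sum.swap, intro sum.cong refl, subst sum.swap, rule refl)
  also have "\<dots> = (\<Sum>y \<in> G. \<Sum>q \<in> Q y. \<Sum>x \<in> F. \<Sum>p \<in> P x. of_nat (N p q) / v y / w x)"
    by (subst sum.swap, intro sum.cong refl, subst sum.swap, rule refl)
  also have "\<dots> = (\<Sum>y \<in> G. \<Sum>q \<in> Q y. (\<Sum>x \<in> F. of_nat (\<Sum>p \<in> P x. N p q) / w x) / v y)"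
    by (simp add: sum_divide_distrib mult.commute)
  also have "\<dots> = (\<Sum>y \<in> G. \<Sum>q \<in> Q y. \<chi> y / v y)"
    by (intro sum.cong refl) (simp only: B)
  finally show ?thesis by (simp add: mult.commute)
qed

lemma sum_indicator_card: "finite Q \<Longrightarrow> (\<Sum>q \<in> Q. if R q then 1 else 0) = card {q \<in> Q. R q}"
  by (simp add: sum.If_cases Int_def)

locale hom_finite = abelian_category \<A> for \<A> :: "('o, 'm) preadd_cat" +
  assumes finite_Hom: "X \<in> Ob \<A> \<Longrightarrow> Y \<in> Ob \<A> \<Longrightarrow> finite (Hom_set \<A> X Y)"

lemma hom_finite_dual: "hom_finite \<A> \<Longrightarrow> hom_finite (dual_cat \<A>)"
  unfolding hom_finite_def hom_finite_axioms_def by (simp add: dual_cat_abelian)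

context abelian_category
begin

lemma ext_pairsD:
  assumes "(f, g) \<in> ext_pairs \<A> M N X"
  shows "arr f" "dom f = N" "cod f = X" "arr g" "dom g = X" "cod g = M" "ses \<A> f g"
    "M \<in> Ob \<A>" "N \<in> Ob \<A>" "X \<in> Ob \<A>"
  using assms by (auto simp: ext_pairs_iff Hom_iff)

lemma ext_pairsI:
  "ses \<A> f g \<Longrightarrow> dom f = N \<Longrightarrow> cod f = X \<Longrightarrow> cod g = M \<Longrightarrow> (f, g) \<in> ext_pairs \<A> M N X"
  using ses_simps[of f g] by (auto simp: ext_pairs_iff Hom_iff)

lemma isos_iff: "u \<in> isos \<A> X Y \<longleftrightarrow> arr u \<and> dom u = X \<and> cod u = Y \<and> is_isom \<A> u"
  by (auto simp: isos_def Hom_iff)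

lemma Aut_isos: "Aut_set \<A> X = isos \<A> X X"
  by (simp add: Aut_set_def isos_def)

section \<open>Choices of isomorphisms, kernels, cokernels and images\<close>

lemma card_isos_left:
  assumes "isomorphic \<A> X Y"
  shows "card (isos \<A> X Y) = card (Aut_set \<A> Y)"
proof -
  obtain u v where u: "arr u" "dom u = X" "cod u = Y" "arr v" "dom v = Y" "cod v = X" "v \<cdot> u = Ident \<A> X" "u \<cdot> v = Ident \<A> Y"
    "is_isom \<A> u" "is_isom \<A> v"
    by (rule iso_between[OF assms])
  have "bij_betw (\<lambda>w. w \<cdot> u) (Aut_set \<A> Y) (isos \<A> X Y)"
    by (rule bij_betw_byWitness[where f' = "\<lambda>w. w \<cdot> v"])
      (use u in \<open>auto simp: Aut_isos isos_iff intro!: is_isom_comp\<close>)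
  then show ?thesis by (rule bij_betw_same_card[symmetric])
qed

lemma card_isos_right:
  assumes "isomorphic \<A> X Y"
  shows "card (isos \<A> X Y) = card (Aut_set \<A> X)"
proof -
  obtain u v where u: "arr u" "dom u = X" "cod u = Y" "arr v" "dom v = Y" "cod v = X" "v \<cdot> u = Ident \<A> X" "u \<cdot> v = Ident \<A> Y"
    "is_isom \<A> u" "is_isom \<A> v"
    by (rule iso_between[OF assms])
  have a: "v \<cdot> u \<cdot> w = w" if "arr w" "cod w = X" for w using reassoc[OF u(7), of w] that u by simp
  have b: "u \<cdot> v \<cdot> w = w" if "arr w" "cod w = Y" for w using reassoc[OF u(8), of w] that u by simp
  have "bij_betw (\<lambda>w. u \<cdot> w) (Aut_set \<A> X) (isos \<A> X Y)"
    by (rule bij_betw_byWitness[where f' = "\<lambda>w. v \<cdot> w"])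
      (use u a b in \<open>auto simp: Aut_isos isos_iff intro!: is_isom_comp\<close>)
  then show ?thesis by (rule bij_betw_same_card[symmetric])
qed

lemma isos_empty: "\<not> isomorphic \<A> X Y \<Longrightarrow> isos \<A> X Y = {}"
  by (auto simp: isomorphic_def isos_def)

text \<open>The kernels with domain exactly \<open>Y\<close> are the composites of one kernel with
  isomorphisms from \<open>Y\<close>. Counting isomorphisms instead of automorphisms covers the case
  that \<open>Y\<close> is not isomorphic to the kernel object, where both sides are 0.\<close>

lemma kernel_torsor:
  assumes "is_kernel \<A> h k0"
  shows "card {k. is_kernel \<A> h k \<and> dom k = Y} = card (isos \<A> Y (dom k0))"
proof -
  note k0 = kernel_simps[OF assms]
  have "bij_betw (\<lambda>u. k0 \<cdot> u) (isos \<A> Y (dom k0)) {k. is_kernel \<A> h k \<and> dom k = Y}"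
  proof (rule bij_betw_imageI[OF inj_onI subset_antisym[OF subsetI subsetI]])
    fix u v assume "u \<in> isos \<A> Y (dom k0)" "v \<in> isos \<A> Y (dom k0)" "k0 \<cdot> u = k0 \<cdot> v"
    then show "u = v" using mono_cancel[OF kernel_mono[OF assms], of u v] by (simp add: isos_iff)
  next
    fix k assume "k \<in> (\<lambda>u. k0 \<cdot> u) ` isos \<A> Y (dom k0)"
    then show "k \<in> {k. is_kernel \<A> h k \<and> dom k = Y}" using kernel_isom[OF assms] k0 by (auto simp: isos_iff)
  next
    fix k assume k: "k \<in> {k. is_kernel \<A> h k \<and> dom k = Y}"
    then obtain u where "is_isom \<A> u" "arr u" "dom u = dom k" "cod u = dom k0" "k0 \<cdot> u = k"
      using kernel_unique[OF assms, of k] by blast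
    then show "k \<in> (\<lambda>u. k0 \<cdot> u) ` isos \<A> Y (dom k0)" using k by (auto simp: isos_iff)
  qed
  then show ?thesis by (rule bij_betw_same_card[symmetric])
qed

lemma cokernel_torsor:
  assumes "is_cokernel \<A> h k0"
  shows "card {k. is_cokernel \<A> h k \<and> cod k = Y} = card (isos \<A> (cod k0) Y)"
  using abelian_category.kernel_torsor[OF dual_ax, of h k0 Y] assms by simp

text \<open>By uniqueness of images, a factorisation through \<open>Y\<close> is the same as an
  isomorphism from the image object to \<open>Y\<close>; the definite description picks out this
  isomorphism.\<close>

lemma epi_mono_torsor:
  assumes "is_epi \<A> e" "is_mono \<A> m" "cod e = dom m" "m \<cdot> e = h"
  shows "card {(q, k). is_epi \<A> q \<and> is_mono \<A> k \<and> cod q = Y \<and> dom k = Y \<and> k \<cdot> q = h} = card (isos \<A> (cod e) Y)"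
proof -
  have a: "arr e" "arr m" using assms by (auto simp: is_epi_def is_mono_def)
  let ?D = "{(q, k). is_epi \<A> q \<and> is_mono \<A> k \<and> cod q = Y \<and> dom k = Y \<and> k \<cdot> q = h}"
  have inj: "u = v" if "arr u" "arr v" "dom u = cod e" "dom v = cod e" "cod u = cod v" "u \<cdot> e = v \<cdot> e" for u v
    using epi_cancel[OF assms(1) that(6)] that by simp
  have "bij_betw (\<lambda>p. THE u. arr u \<and> dom u = cod e \<and> cod u = Y \<and> u \<cdot> e = fst p) ?D (isos \<A> (cod e) Y)"
  proof (rule bij_betw_imageI[OF inj_onI subset_antisym[OF subsetI subsetI]])
    have *: "\<exists>u \<in> isos \<A> (cod e) Y. (THE u. arr u \<and> dom u = cod e \<and> cod u = Y \<and> u \<cdot> e = q) = u \<and> u \<cdot> e = q \<and> k \<cdot> u = m"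
      if "(q, k) \<in> ?D" for q k
    proof -
      have qk: "is_epi \<A> q" "is_mono \<A> k" "cod q = Y" "dom k = Y" "k \<cdot> q = h" using that by auto
      then have b: "arr q" "arr k" by (auto simp: is_epi_def is_mono_def)
      have d: "dom e = dom q" "cod m = cod k"
        using comp_simps(2,3)[of e m] comp_simps(2,3)[of q k] a b assms(3,4) qk(3-5) by simp_all
      obtain u where u: "is_isom \<A> u" "arr u" "dom u = cod e" "cod u = cod q" "u \<cdot> e = q" "k \<cdot> u = m"
        by (rule epi_mono_unique[OF assms(1-3) qk(1,2), of])
          (use qk assms d in auto)
      have "(THE u. arr u \<and> dom u = cod e \<and> cod u = Y \<and> u \<cdot> e = q) = u"
        by (rule the_equality) (use u qk inj in auto)
      then show ?thesis using u qk by (auto simp: isos_iff)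
    qed
    {
      fix x y assume xy: "x \<in> ?D" "y \<in> ?D"
        "(THE u. arr u \<and> dom u = cod e \<and> cod u = Y \<and> u \<cdot> e = fst x) = (THE u. arr u \<and> dom u = cod e \<and> cod u = Y \<and> u \<cdot> e = fst y)"
      obtain q k q' k' where s: "x = (q, k)" "y = (q', k')" by fastforce
      define T where "T = (\<lambda>q. THE u. arr u \<and> dom u = cod e \<and> cod u = Y \<and> u \<cdot> e = q)"
      obtain u where u1: "u \<in> isos \<A> (cod e) Y" "T q = u" "u \<cdot> e = q" "k \<cdot> u = m"
        using *[OF xy(1)[unfolded s]] unfolding T_def by blast
      obtain u' where u2: "T q' = u'" "u' \<cdot> e = q'" "k' \<cdot> u' = m"
        using *[OF xy(2)[unfolded s]] unfolding T_def by blast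
      have "T q = T q'" using xy(3) unfolding T_def s by simp
      then have u: "u \<in> isos \<A> (cod e) Y" "u \<cdot> e = q" "k \<cdot> u = m" "u \<cdot> e = q'" "k' \<cdot> u = m"
        using u1 u2 by auto
      have kk: "is_mono \<A> k" "is_mono \<A> k'" "dom k = Y" "dom k' = Y" using xy s by auto
      then have "arr k" "arr k'" by (auto simp: is_mono_def)
      moreover have "cod k = cod m" "cod k' = cod m"
        using comp_simps(3)[of u k] comp_simps(3)[of u k'] u kk calculation by (simp_all add: isos_iff)
      ultimately have "k = k'"
        using epi_cancel[OF iso_epi, of u k k'] u kk by (simp add: isos_iff)
      then show "x = y" using s u by simp
    next
      fix u assume "u \<in> (\<lambda>p. THE u. arr u \<and> dom u = cod e \<and> cod u = Y \<and> u \<cdot> e = fst p) ` ?D"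
      then obtain q k where qk: "(q, k) \<in> ?D" and u: "u = (THE u. arr u \<and> dom u = cod e \<and> cod u = Y \<and> u \<cdot> e = q)" by auto
      from *[OF qk] obtain w where "w \<in> isos \<A> (cod e) Y" "(THE u. arr u \<and> dom u = cod e \<and> cod u = Y \<and> u \<cdot> e = q) = w"
        by blast
      then show "u \<in> isos \<A> (cod e) Y" using u by simp
    next
      fix u assume "u \<in> isos \<A> (cod e) Y"
      then have u: "arr u" "dom u = cod e" "cod u = Y" "is_isom \<A> u" by (auto simp: isos_iff)
      obtain v where v: "is_isom \<A> v" "arr v" "dom v = cod u" "cod v = dom u" "v \<cdot> u = Ident \<A> (dom u)"
        using is_isom_inverse[OF u(4)] by metis
      have "(m \<cdot> v) \<cdot> u \<cdot> e = m \<cdot> e" using reassoc[OF v(5), of e] u v a assms by simp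
      then have uD: "(u \<cdot> e, m \<cdot> v) \<in> ?D"
        using assms u v a epi_comp[OF assms(1) iso_epi[OF u(4)]] mono_comp[OF iso_mono[OF v(1)] assms(2)] by simp
      have "u = (THE w. arr w \<and> dom w = cod e \<and> cod w = Y \<and> w \<cdot> e = u \<cdot> e)"
        by (rule the_equality[symmetric]) (use u inj in auto)
      then have "u = (\<lambda>p. THE u. arr u \<and> dom u = cod e \<and> cod u = Y \<and> u \<cdot> e = fst p) (u \<cdot> e, m \<cdot> v)"
        by (simp only: fst_conv)
      then show "u \<in> (\<lambda>p. THE u. arr u \<and> dom u = cod e \<and> cod u = Y \<and> u \<cdot> e = fst p) ` ?D"
        using uD by (rule image_eqI)
    }
  qed
  then show ?thesis by (rule bij_betw_same_card)
qed

text \<open>The square g s = k \<sigma> is a pushout, because both rows have the same quotient. A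
  map that kills s \<nu> factors through \<sigma> on the subobject, and hence through
  \<open>g\<close>.\<close>

lemma ses_compose_quotient:
  assumes "ses \<A> s y" "ses \<A> \<nu> \<sigma>" "ses \<A> k r" "cod \<nu> = dom s" "cod \<sigma> = dom k"
    and g: "arr g" "dom g = cod s" "cod g = dom r" "r \<cdot> g = y" "g \<cdot> s = k \<cdot> \<sigma>"
  shows "ses \<A> (s \<cdot> \<nu>) g"
proof -
  note S = ses_simps[OF assms(1)] and V = ses_simps[OF assms(2)] and K = ses_simps[OF assms(3)]
  have "is_cokernel \<A> (s \<cdot> \<nu>) g"
  proof (rule cokernelI)
    show "is_epi \<A> g"
    proof (rule epiI[OF g(1)])
      fix w assume w: "arr w" "dom w = cod g" "w \<cdot> g = nul (dom g) (cod w)"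
      have "w \<cdot> g \<cdot> s = nul (dom g) (cod w) \<cdot> s" by (rule reassoc[OF w(3)]) (use w g S in simp_all)
      then have "(w \<cdot> k) \<cdot> \<sigma> = nul (dom \<sigma>) (cod (w \<cdot> k))" using w g S V K assms(4,5) by simp
      then have "w \<cdot> k = nul (dom k) (cod w)" using epi_nul[OF V(6), of "w \<cdot> k"] w g K V assms(5) by simp
      then obtain w' where w': "arr w'" "dom w' = cod r" "cod w' = cod w" "w' \<cdot> r = w"
        using cokernel_factor[OF K(8), of w] w g K by metis
      have "w' \<cdot> r \<cdot> g = w \<cdot> g" by (rule reassoc[OF w'(4)]) (use w' g K in simp_all)
      then have "w' \<cdot> y = nul (dom y) (cod w')" using w w' g S by simp
      moreover have "cod y = cod r" using g K by auto
      ultimately have "w' = nul (cod r) (cod w')" using epi_nul[OF S(6), of w'] w' by simp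
      then have "w' \<cdot> r = nul (dom r) (cod w')" using w'(1-3) w(1) K nul_comp[of r "cod w'" "cod r"] by simp
      then show "w = nul (cod g) (cod w)" using w' g by simp
    qed
    have "g \<cdot> s \<cdot> \<nu> = k \<cdot> \<sigma> \<cdot> \<nu>" by (rule square[OF g(5)]) (use g S V K assms(4,5) in auto)
    then show "g \<cdot> s \<cdot> \<nu> = nul (dom (s \<cdot> \<nu>)) (cod g)" using g S V K assms(4,5) by simp
    fix h assume h: "arr h" "dom h = cod (s \<cdot> \<nu>)" "h \<cdot> s \<cdot> \<nu> = nul (dom (s \<cdot> \<nu>)) (cod h)"
    then have "(h \<cdot> s) \<cdot> \<nu> = nul (dom \<nu>) (cod (h \<cdot> s))" using S V assms(4) by simp
    then obtain h' where h': "arr h'" "dom h' = cod \<sigma>" "cod h' = cod (h \<cdot> s)" "h' \<cdot> \<sigma> = h \<cdot> s"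
      by (rule_tac cokernel_factor[OF V(8), of "h \<cdot> s"]) (use h S V assms(4) in auto)
    obtain u where "arr u" "dom u = cod k" "cod u = cod h" "u \<cdot> g = h"
      by (rule ses_pushout_factor[OF assms(1,3) g(1) g(2) _ g(4) V(2) _ _ g(5) h(1) _ h'(1)])
        (use h h' g S V K assms(4,5) in auto)
    then show "\<exists>u. arr u \<and> dom u = cod g \<and> cod u = cod h \<and> u \<cdot> g = h" using g K by auto
  qed (use g S V assms(4) in auto)
  then show ?thesis using mono_cokernel_ses mono_comp[OF V(5) S(5)] assms(4) by blast
qed

text \<open>The border of a three by three diagram with corners N1, N2, M1, M2: \<open>i\<close>,
  \<open>p\<close> is the sequence N1, N, N2; \<open>k\<close>, \<open>r\<close> is M1, M, M2;
  \<open>j\<close>, \<open>q\<close> is N1, A, M1; \<open>l\<close>, \<open>z\<close> is N2, B, M2.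
  An object X at the centre receives a map from the pushout S of \<open>i\<close> and
  \<open>j\<close> and maps to the pullback T of \<open>r\<close> and \<open>z\<close>. The
  composite \<open>c\<close> is fixed by the border, with kernel object N1 and cokernel object M2,
  and completing the diagram is the same as filling the 2-extension N1, S, T, M2.\<close>

lemma corner_fillings:
  assumes ip: "ses \<A> i p" and jq: "ses \<A> j q" and kr: "ses \<A> k r" and lo: "ses \<A> l z"
    and dims: "dom i = dom j" "cod p = dom l" "cod q = dom k" "cod r = cod z"
  obtains c n m where "is_kernel \<A> c n" "is_cokernel \<A> c m" "dom n = dom i" "cod m = cod r"
    "\<And>X. card (fillings \<A> c m X) = card {((f, g), (a, b)). (f, g) \<in> ext_pairs \<A> (cod k) (cod i) X \<and>
       (a, b) \<in> ext_pairs \<A> (cod l) (cod j) X \<and> f \<cdot> i = a \<cdot> j \<and> g \<cdot> a = k \<cdot> q \<and> b \<cdot> f = l \<cdot> p \<and> r \<cdot> g = z \<cdot> b}"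
proof -
  note I = ses_simps[OF ip] and J = ses_simps[OF jq] and K = ses_simps[OF kr] and L = ses_simps[OF lo]
  obtain \<nu> \<alpha> where po: "is_pullback (dual_cat \<A>) i j \<nu> \<alpha>" using pushout_exists[of i j] I J dims by metis
  note PO = pushout_simps[OF po]
  obtain \<sigma>' where s': "ses \<A> \<alpha> \<sigma>'" "cod \<sigma>' = cod p" "\<sigma>' \<cdot> \<nu> = p" using pushout_ses[OF ip po] by metis
  obtain \<sigma> where s: "ses \<A> \<nu> \<sigma>" "cod \<sigma> = cod q" "\<sigma> \<cdot> \<alpha> = q" using pushout_ses[OF jq pushout_sym[OF po]] by metis
  note S' = ses_simps[OF s'(1)] and S = ses_simps[OF s(1)]
  obtain \<mu> \<beta> where pb: "is_pullback \<A> r z \<mu> \<beta>" using pullback_exists[of r z] K L dims by metis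
  note PB = pullback_simps[OF pb]
  obtain \<kappa> where ka: "ses \<A> \<kappa> \<beta>" "dom \<kappa> = dom k" "\<mu> \<cdot> \<kappa> = k" using pullback_ses[OF kr pb] by metis
  obtain \<theta> where la: "ses \<A> \<theta> \<mu>" "dom \<theta> = dom l" "\<beta> \<cdot> \<theta> = l" using pullback_ses[OF lo pullback_sym[OF pb]] by metis
  note KA = ses_simps[OF ka(1)] and LA = ses_simps[OF la(1)]
  have dS: "cod \<nu> = dom \<sigma>" "cod \<alpha> = dom \<sigma>" "dom \<sigma>' = dom \<sigma>" using S(3) S'(3) PO(6) by auto
  note PO = PO dS
  have e1: "r \<cdot> k \<cdot> \<sigma> = nul (cod \<nu>) (cod r)" using reassoc[OF K(4), of \<sigma>] K S s dims L by simp
  have e2: "z \<cdot> l \<cdot> \<sigma>' = nul (cod \<nu>) (cod r)" using reassoc[OF L(4), of \<sigma>'] L S' s' dims dS by simp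
  \<comment> \<open>The components of \<open>c\<close> in the pullback are S \<rightarrow> M1
    \<rightarrow> M and S \<rightarrow> N2 \<rightarrow> B; they agree in M2 since both become 0
    there.\<close>
  obtain c where c: "arr c" "dom c = cod \<nu>" "cod c = dom \<mu>" "\<mu> \<cdot> c = k \<cdot> \<sigma>" "\<beta> \<cdot> c = l \<cdot> \<sigma>'"
    by (rule pullback_factor[OF pb, of "k \<cdot> \<sigma>" "l \<cdot> \<sigma>'"]) (use K L S S' s s' dims e1 e2 dS in auto)
  define n where "n = \<nu> \<cdot> i"
  define m where "m = r \<cdot> \<mu>"
  have n: "arr n" "dom n = dom i" "cod n = cod \<nu>" "is_mono \<A> n" "n = \<alpha> \<cdot> j"
    using PO I S mono_comp[OF I(5) S(5)] by (simp_all add: n_def)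
  have \<mu>e: "is_epi \<A> \<mu>" using LA(6) .
  have m: "arr m" "dom m = dom \<mu>" "cod m = cod r" "is_epi \<A> m" "m = z \<cdot> \<beta>"
    using PB K epi_comp[OF LA(6) K(6)] by (simp_all add: m_def)
  \<comment> \<open>A map killed by \<open>c\<close> is killed by \<sigma> and \<sigma>', as
    \<open>k\<close> and \<open>l\<close> are mono. The first fact makes it factor through N, the
    second through the kernel N1 of \<open>p\<close>.\<close>
  have ker: "is_kernel \<A> c n"
  proof (rule kernelI)
    show "c \<cdot> n = nul (dom n) (cod c)"
    proof (rule pullback_unique[OF pb])
      have "\<mu> \<cdot> c \<cdot> n = k \<cdot> \<sigma> \<cdot> n" by (rule square[OF c(4)]) (use c n K S s dims PB dS in auto)
      also have "\<sigma> \<cdot> n = nul (dom n) (cod \<sigma>)" using reassoc[OF S(4), of i] S I PO n by (simp add: n_def)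
      finally show "\<mu> \<cdot> c \<cdot> n = \<mu> \<cdot> nul (dom n) (cod c)" using c n(1-3) J K S s dims PB by simp
      have "\<beta> \<cdot> c \<cdot> n = l \<cdot> \<sigma>' \<cdot> n" by (rule square[OF c(5)]) (use c n L S' s' dims PB dS in auto)
      also have "\<sigma>' \<cdot> n = nul (dom n) (cod \<sigma>')" using reassoc[OF S'(4), of j] S' J PO n dims by simp
      finally show "\<beta> \<cdot> c \<cdot> n = \<beta> \<cdot> nul (dom n) (cod c)" using c n(1-3) J L S' s' dims PB by simp
    qed (use c n(1-3) I J PB in auto)
    fix w assume w: "arr w" "cod w = dom c" "c \<cdot> w = nul (dom w) (cod c)"
    have "k \<cdot> \<sigma> \<cdot> w = \<mu> \<cdot> c \<cdot> w" by (rule square[OF c(4)[symmetric]]) (use c w K S s dims PB dS in auto)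
    then have "k \<cdot> \<sigma> \<cdot> w = nul (dom w) (cod k)" using c w PB K by simp
    then have "\<sigma> \<cdot> w = nul (dom w) (cod \<sigma>)" using mono_nul[OF K(5), of "\<sigma> \<cdot> w"] S w c s dims by simp
    then obtain x where x: "arr x" "dom x = dom w" "cod x = dom \<nu>" "\<nu> \<cdot> x = w"
      by (rule_tac kernel_factor[OF S(7), of w]) (use w c dS in auto)
    have "l \<cdot> \<sigma>' \<cdot> w = \<beta> \<cdot> c \<cdot> w" by (rule square[OF c(5)[symmetric]]) (use c w L S' s' dims PB dS in auto)
    then have "l \<cdot> \<sigma>' \<cdot> w = nul (dom w) (cod l)" using c w PB L by simp
    then have "\<sigma>' \<cdot> w = nul (dom w) (cod \<sigma>')" using mono_nul[OF L(5), of "\<sigma>' \<cdot> w"] S' w c s' dims dS by simp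
    moreover have "\<sigma>' \<cdot> \<nu> \<cdot> x = p \<cdot> x" by (rule reassoc[OF s'(3)]) (use x S' PO dS in auto)
    ultimately have "p \<cdot> x = nul (dom x) (cod p)" using x s' by simp
    then obtain y where y: "arr y" "dom y = dom x" "cod y = dom i" "i \<cdot> y = x"
      by (rule_tac kernel_factor[OF I(7), of x]) (use x PO I in auto)
    then show "\<exists>u. arr u \<and> dom u = dom w \<and> cod u = dom n \<and> n \<cdot> u = w"
      using x I PO(1-8,10-12) n(2) by (intro exI[of _ y]) (simp add: n_def)
  qed (use c n in auto)
  \<comment> \<open>On the two halves N and A of the pushout, \<open>c\<close> passes through the
    epimorphisms to N2 and M1. A map that kills \<open>c\<close> therefore kills the kernels
    \<theta> of \<mu> and \<kappa> of \<beta>.\<close>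
  have cn: "c \<cdot> \<nu> = \<theta> \<cdot> p"
  proof (rule pullback_unique[OF pb])
    have "\<mu> \<cdot> c \<cdot> \<nu> = k \<cdot> \<sigma> \<cdot> \<nu>" by (rule square[OF c(4)]) (use c K S s dims PB dS in auto)
    moreover have "\<mu> \<cdot> \<theta> \<cdot> p = nul (dom \<theta>) (cod \<mu>) \<cdot> p" by (rule reassoc[OF LA(4)]) (use LA la I dims in auto)
    ultimately show "\<mu> \<cdot> c \<cdot> \<nu> = \<mu> \<cdot> \<theta> \<cdot> p" using c K S s dims PB LA la I PO by simp
    have "\<beta> \<cdot> c \<cdot> \<nu> = l \<cdot> \<sigma>' \<cdot> \<nu>" by (rule square[OF c(5)]) (use c L S' s' dims PB dS PO in auto)
    moreover have "\<beta> \<cdot> \<theta> \<cdot> p = l \<cdot> p" by (rule reassoc[OF la(3)]) (use LA la I dims PB in auto)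
    ultimately show "\<beta> \<cdot> c \<cdot> \<nu> = \<beta> \<cdot> \<theta> \<cdot> p" using s' by simp
  qed (use c PO LA la I dims PB in auto)
  have ca: "c \<cdot> \<alpha> = \<kappa> \<cdot> q"
  proof (rule pullback_unique[OF pb])
    have "\<beta> \<cdot> c \<cdot> \<alpha> = l \<cdot> \<sigma>' \<cdot> \<alpha>" by (rule square[OF c(5)]) (use c L S' s' dims PB dS PO in auto)
    moreover have "\<beta> \<cdot> \<kappa> \<cdot> q = nul (dom \<kappa>) (cod \<beta>) \<cdot> q" by (rule reassoc[OF KA(4)]) (use KA ka J dims in auto)
    ultimately show "\<beta> \<cdot> c \<cdot> \<alpha> = \<beta> \<cdot> \<kappa> \<cdot> q" using c L S' s' dims PB KA ka J PO by simp
    have "\<mu> \<cdot> c \<cdot> \<alpha> = k \<cdot> \<sigma> \<cdot> \<alpha>" by (rule square[OF c(4)]) (use c K S s dims PB dS PO in auto)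
    moreover have "\<mu> \<cdot> \<kappa> \<cdot> q = k \<cdot> q" by (rule reassoc[OF ka(3)]) (use KA ka J dims PB in auto)
    ultimately show "\<mu> \<cdot> c \<cdot> \<alpha> = \<mu> \<cdot> \<kappa> \<cdot> q" using s by simp
  qed (use c PO KA ka J dims PB in auto)
  have cok: "is_cokernel \<A> c m"
  proof (rule cokernelI[OF m(4)])
    have "m \<cdot> c = r \<cdot> k \<cdot> \<sigma>" using c K PB(1-8) by (simp add: m_def)
    then show "m \<cdot> c = nul (dom c) (cod m)" using e1 c m by simp
    fix h assume h: "arr h" "dom h = cod c" "h \<cdot> c = nul (dom c) (cod h)"
    have "h \<cdot> \<theta> \<cdot> p = h \<cdot> c \<cdot> \<nu>" using cn by simp
    also have "\<dots> = nul (dom c) (cod h) \<cdot> \<nu>" by (rule reassoc[OF h(3)]) (use h c PO in auto)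
    finally have "(h \<cdot> \<theta>) \<cdot> p = nul (dom p) (cod (h \<cdot> \<theta>))" using h c PO LA la I dims by simp
    then have "h \<cdot> \<theta> = nul (dom \<theta>) (cod h)" using epi_nul[OF I(6), of "h \<cdot> \<theta>"] h c LA la dims I by simp
    then obtain h' where h': "arr h'" "dom h' = cod \<mu>" "cod h' = cod h" "h' \<cdot> \<mu> = h"
      by (rule_tac cokernel_factor[OF LA(8), of h]) (use h c LA in auto)
    have "h \<cdot> \<kappa> \<cdot> q = h \<cdot> c \<cdot> \<alpha>" using ca by simp
    also have "\<dots> = nul (dom c) (cod h) \<cdot> \<alpha>" by (rule reassoc[OF h(3)]) (use h c PO in auto)
    finally have "(h \<cdot> \<kappa>) \<cdot> q = nul (dom q) (cod (h \<cdot> \<kappa>))" using h c PO KA ka J dims PB by simp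
    then have "h \<cdot> \<kappa> = nul (dom \<kappa>) (cod h)" using epi_nul[OF J(6), of "h \<cdot> \<kappa>"] h c KA ka dims J PB by simp
    moreover have "h' \<cdot> \<mu> \<cdot> \<kappa> = h \<cdot> \<kappa>" by (rule reassoc[OF h'(4)]) (use h' KA PB in auto)
    ultimately have "h' \<cdot> k = nul (dom k) (cod h')" using ka h' by simp
    then obtain y where y: "arr y" "dom y = cod r" "cod y = cod h'" "y \<cdot> r = h'"
      by (rule_tac cokernel_factor[OF K(8), of h']) (use h' PB K in auto)
    have "y \<cdot> r \<cdot> \<mu> = h' \<cdot> \<mu>" by (rule reassoc[OF y(4)]) (use y K PB in auto)
    then show "\<exists>u. arr u \<and> dom u = cod m \<and> cod u = cod h \<and> u \<cdot> m = h"
      using y h' m(3) PB(1-8) K by (intro exI[of _ y]) (simp add: m_def)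
  qed (use c m in auto)
  let ?T = "\<lambda>X. {((f, g), (a, b)). (f, g) \<in> ext_pairs \<A> (cod k) (cod i) X \<and>
       (a, b) \<in> ext_pairs \<A> (cod l) (cod j) X \<and> f \<cdot> i = a \<cdot> j \<and> g \<cdot> a = k \<cdot> q \<and> b \<cdot> f = l \<cdot> p \<and> r \<cdot> g = z \<cdot> b}"
  have "card (fillings \<A> c m X) = card (?T X)" for X
  proof -
    \<comment> \<open>Restricting \<open>s\<close> to N and A and projecting \<open>t\<close> to M
      and B recovers the two sequences that cross in X.\<close>
    define \<Phi> where "\<Phi> = (\<lambda>(s, t). ((s \<cdot> \<nu>, \<mu> \<cdot> t), (s \<cdot> \<alpha>, \<beta> \<cdot> t)))"
    have "bij_betw \<Phi> (fillings \<A> c m X) (?T X)"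
    proof (rule bij_betw_imageI[OF inj_onI subset_antisym[OF subsetI subsetI]])
      fix x y assume xy: "x \<in> fillings \<A> c m X" "y \<in> fillings \<A> c m X" "\<Phi> x = \<Phi> y"
      obtain s t s' t' where st: "x = (s, t)" "y = (s', t')" by fastforce
      note F = fillingD[OF xy(1)[unfolded st]] and F' = fillingD[OF xy(2)[unfolded st]]
      have e: "s \<cdot> \<nu> = s' \<cdot> \<nu>" "\<mu> \<cdot> t = \<mu> \<cdot> t'" "s \<cdot> \<alpha> = s' \<cdot> \<alpha>" "\<beta> \<cdot> t = \<beta> \<cdot> t'"
        using xy(3) by (auto simp: st \<Phi>_def)
      have "s = s'" by (rule pushout_unique[OF po _ _ _ _ _ e(1,3)]) (use F F' c in auto)
      moreover have "t = t'" by (rule pullback_unique[OF pb _ _ _ _ _ e(2,4)]) (use F F' c in auto)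
      ultimately show "x = y" using st by simp
    next
      fix y assume "y \<in> \<Phi> ` fillings \<A> c m X"
      then obtain s t where st: "(s, t) \<in> fillings \<A> c m X" "y = ((s \<cdot> \<nu>, \<mu> \<cdot> t), (s \<cdot> \<alpha>, \<beta> \<cdot> t))"
        by (auto simp: \<Phi>_def)
      note F = fillingD[OF st(1)]
      have d: "dom s = cod \<nu>" "cod t = dom \<mu>" using F c by auto
      have "(\<mu> \<cdot> t) \<cdot> s = k \<cdot> \<sigma>" "(\<beta> \<cdot> t) \<cdot> s = l \<cdot> \<sigma>'" using F c d PB by auto
      note gs = this
      have rg: "r \<cdot> \<mu> \<cdot> t = m \<cdot> t" "z \<cdot> \<beta> \<cdot> t = m \<cdot> t"
        using reassoc[OF m_def[symmetric], of t] reassoc[OF m(5)[symmetric], of t] F d PB K L dims by auto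
      have "ses \<A> (s \<cdot> \<nu>) (\<mu> \<cdot> t)"
        by (rule ses_compose_quotient[OF F(8) s(1) kr _ _ _ _ _ rg(1) gs(1)]) (use F d PB K s dims in auto)
      then have 1: "(s \<cdot> \<nu>, \<mu> \<cdot> t) \<in> ext_pairs \<A> (cod k) (cod i) X"
        using F d PB K PO by (intro ext_pairsI) auto
      have "ses \<A> (s \<cdot> \<alpha>) (\<beta> \<cdot> t)"
        by (rule ses_compose_quotient[OF F(8) s'(1) lo _ _ _ _ _ rg(2) gs(2)]) (use F d PB L s' dims PO in auto)
      then have 2: "(s \<cdot> \<alpha>, \<beta> \<cdot> t) \<in> ext_pairs \<A> (cod l) (cod j) X"
        using F d PB L PO by (intro ext_pairsI) auto
      have 3: "(s \<cdot> \<nu>) \<cdot> i = (s \<cdot> \<alpha>) \<cdot> j" using F d PO by simp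
      have "(\<mu> \<cdot> t) \<cdot> s \<cdot> \<alpha> = k \<cdot> \<sigma> \<cdot> \<alpha>"
        by (rule square[OF gs(1)]) (use F d PB PO K S s dims dS in auto)
      then have 4: "(\<mu> \<cdot> t) \<cdot> s \<cdot> \<alpha> = k \<cdot> q" using s by simp
      have "(\<beta> \<cdot> t) \<cdot> s \<cdot> \<nu> = l \<cdot> \<sigma>' \<cdot> \<nu>"
        by (rule square[OF gs(2)]) (use F d PB PO L S' s' dims dS in auto)
      then have 5: "(\<beta> \<cdot> t) \<cdot> s \<cdot> \<nu> = l \<cdot> p" using s' by simp
      show "y \<in> ?T X" unfolding st(2) using 1 2 3 4 5 rg by simp
    next
      fix y assume y: "y \<in> ?T X"
      obtain f g a b where yy: "y = ((f, g), (a, b))" by (metis surj_pair)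
      have fg: "(f, g) \<in> ext_pairs \<A> (cod k) (cod i) X" and ab: "(a, b) \<in> ext_pairs \<A> (cod l) (cod j) X"
        and e: "f \<cdot> i = a \<cdot> j" "g \<cdot> a = k \<cdot> q" "b \<cdot> f = l \<cdot> p" "r \<cdot> g = z \<cdot> b" using y yy by auto
      note Fg = ext_pairsD[OF fg] and Ab = ext_pairsD[OF ab]
      note SF = ses_simps[OF Fg(7)] and SA = ses_simps[OF Ab(7)]
      obtain s where st: "arr s" "cod s = X" "dom s = cod \<nu>" "s \<cdot> \<nu> = f" "s \<cdot> \<alpha> = a"
        by (rule pushout_factor[OF po, of f a]) (use Fg Ab e in auto)
      obtain t where t: "arr t" "dom t = X" "cod t = dom \<mu>" "\<mu> \<cdot> t = g" "\<beta> \<cdot> t = b"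
        by (rule pullback_factor[OF pb, of g b]) (use Fg Ab e K L in auto)
      have gs: "g \<cdot> s = k \<cdot> \<sigma>"
      proof (rule pushout_unique[OF po])
        show "(g \<cdot> s) \<cdot> \<nu> = (k \<cdot> \<sigma>) \<cdot> \<nu>" using st Fg SF(4) K S s dims PO by simp
        show "(g \<cdot> s) \<cdot> \<alpha> = (k \<cdot> \<sigma>) \<cdot> \<alpha>" using st Fg K S s dims PO e dS by simp
      qed (use st Fg K S s dims dS in auto)
      have bs: "b \<cdot> s = l \<cdot> \<sigma>'"
      proof (rule pushout_unique[OF po])
        show "(b \<cdot> s) \<cdot> \<alpha> = (l \<cdot> \<sigma>') \<cdot> \<alpha>" using st Ab SA(4) L S' s' dims PO dS by simp
        show "(b \<cdot> s) \<cdot> \<nu> = (l \<cdot> \<sigma>') \<cdot> \<nu>" using st Ab L S' s' dims PO e dS by simp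
      qed (use st Ab L S' s' dims dS in auto)
      have ts: "t \<cdot> s = c"
      proof (rule pullback_unique[OF pb])
        show "\<mu> \<cdot> t \<cdot> s = \<mu> \<cdot> c" using reassoc[OF t(4), of s] t st PB gs c by simp
        show "\<beta> \<cdot> t \<cdot> s = \<beta> \<cdot> c" using reassoc[OF t(5), of s] t st PB bs c by simp
      qed (use t st c in auto)
      have mt: "m \<cdot> t = r \<cdot> g" using t PB(1-8) K by (simp add: m_def)
      \<comment> \<open>A map killed by \<open>s\<close> is killed by \<sigma>, because
        \<open>k\<close> is mono; so it comes from N, where \<open>s\<close> is the monomorphism
        \<open>f\<close>.\<close>
      have smono: "is_mono \<A> s"
      proof (rule monoI[OF st(1)])
        fix w assume w: "arr w" "cod w = dom s" "s \<cdot> w = nul (dom w) (cod s)"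
        have "k \<cdot> \<sigma> \<cdot> w = g \<cdot> s \<cdot> w" by (rule square[OF gs[symmetric]]) (use w st Fg K S s dims dS in auto)
        then have "k \<cdot> \<sigma> \<cdot> w = nul (dom w) (cod k)" using w st Fg by simp
        then have "\<sigma> \<cdot> w = nul (dom w) (cod \<sigma>)" using mono_nul[OF K(5), of "\<sigma> \<cdot> w"] S w s dims dS st by simp
        then obtain x where x: "arr x" "dom x = dom w" "cod x = dom \<nu>" "\<nu> \<cdot> x = w"
          by (rule_tac kernel_factor[OF S(7), of w]) (use w st dS in auto)
        have "s \<cdot> \<nu> \<cdot> x = f \<cdot> x" by (rule reassoc[OF st(4)]) (use x st PO in auto)
        then have "f \<cdot> x = nul (dom x) (cod f)" using w x st Fg by simp
        then have "x = nul (dom x) (dom \<nu>)" using mono_nul[OF SF(5), of x] x PO Fg by simp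
        then have "\<nu> \<cdot> x = nul (dom x) (cod \<nu>)" using x(1-3) w(1) PO comp_nul[of \<nu> "dom w" "dom \<nu>"] by simp
        then show "w = nul (dom w) (dom s)" using x st by simp
      qed
      \<comment> \<open>A map that kills \<open>s\<close> kills \<open>f\<close> and so factors
        through \<open>g\<close>; as it also kills \<open>a\<close>, the factor vanishes on M1 and
        passes to M2.\<close>
      have "is_cokernel \<A> s (r \<cdot> g)"
      proof (rule cokernelI)
        show "is_epi \<A> (r \<cdot> g)" using epi_comp[OF SF(6) K(6)] Fg K by simp
        have "(r \<cdot> g) \<cdot> s = r \<cdot> k \<cdot> \<sigma>" using gs st Fg K by simp
        then show "(r \<cdot> g) \<cdot> s = nul (dom s) (cod (r \<cdot> g))" using e1 st Fg K by simp
        fix h assume h: "arr h" "dom h = cod s" "h \<cdot> s = nul (dom s) (cod h)"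
        have "h \<cdot> s \<cdot> \<nu> = nul (dom s) (cod h) \<cdot> \<nu>" by (rule reassoc[OF h(3)]) (use h st PO in auto)
        then have "h \<cdot> f = nul (dom f) (cod h)" using st h PO Fg by simp
        then obtain h' where h': "arr h'" "dom h' = cod g" "cod h' = cod h" "h' \<cdot> g = h"
          by (rule_tac cokernel_factor[OF SF(8), of h]) (use h st Fg in auto)
        have "h \<cdot> s \<cdot> \<alpha> = nul (dom s) (cod h) \<cdot> \<alpha>" by (rule reassoc[OF h(3)]) (use h st PO in auto)
        then have ha: "h \<cdot> a = nul (dom a) (cod h)" using st h PO Ab by simp
        have "h' \<cdot> g \<cdot> a = h \<cdot> a" by (rule reassoc[OF h'(4)]) (use h' Fg Ab in auto)
        then have "(h' \<cdot> k) \<cdot> q = nul (dom q) (cod (h' \<cdot> k))" using ha e h' Fg Ab K J dims by simp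
        then have "h' \<cdot> k = nul (dom k) (cod h')" using epi_nul[OF J(6), of "h' \<cdot> k"] h' Fg K dims J by simp
        then obtain x where x: "arr x" "dom x = cod r" "cod x = cod h'" "x \<cdot> r = h'"
          by (rule_tac cokernel_factor[OF K(8), of h']) (use h' Fg K in auto)
        have "x \<cdot> r \<cdot> g = h' \<cdot> g" by (rule reassoc[OF x(4)]) (use x K Fg in auto)
        then show "\<exists>u. arr u \<and> dom u = cod (r \<cdot> g) \<and> cod u = cod h \<and> u \<cdot> r \<cdot> g = h"
          using x h' K Fg by (intro exI[of _ x]) simp
      qed (use st Fg K in auto)
      then have "ses \<A> s (m \<cdot> t)" using mono_cokernel_ses[OF smono] mt by simp
      then have "(s, t) \<in> fillings \<A> c m X" using st t ts c by (intro fillingI) auto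
      moreover have "y = \<Phi> (s, t)" using st t yy by (simp add: \<Phi>_def)
      ultimately show "y \<in> \<Phi> ` fillings \<A> c m X" by blast
    qed
    then show ?thesis by (rule bij_betw_same_card)
  qed
  then show ?thesis using that[OF ker cok] n m by simp
qed

end

lemma isomorphic_dual [simp]: "abelian_category \<A> \<Longrightarrow> isomorphic (dual_cat \<A>) X Y = isomorphic \<A> X Y"
proof -
  assume "abelian_category \<A>"
  then interpret abelian_category \<A> .
  have "isomorphic (dual_cat \<A>) X Y = isomorphic \<A> Y X" by (simp add: isomorphic_def)
  then show ?thesis using isomorphic_sym by blast
qed

lemma iso_class_dual [simp]: "abelian_category \<A> \<Longrightarrow> iso_class (dual_cat \<A>) X = iso_class \<A> X"
  by (simp add: iso_class_def)

lemma Iso_dual [simp]: "abelian_category \<A> \<Longrightarrow> Iso (dual_cat \<A>) = Iso \<A>"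
  by (simp add: Iso_def)

lemma ext_pairs_dual_iff: "(f, g) \<in> ext_pairs (dual_cat \<A>) M N X \<longleftrightarrow> (g, f) \<in> ext_pairs \<A> N M X"
  by (auto simp: ext_pairs_iff)

abbreviation aut :: "('o, 'm) preadd_cat \<Rightarrow> 'o \<Rightarrow> rat" where
  "aut \<A> X \<equiv> of_nat (card (Aut_set \<A> X))"

context hom_finite
begin

section \<open>Counts weighted by automorphism groups\<close>

lemma finite_Aut: "X \<in> Ob \<A> \<Longrightarrow> finite (Aut_set \<A> X)"
  using finite_subset[OF _ finite_Hom[of X X], of "Aut_set \<A> X"] by (auto simp: Aut_set_def)

lemma aut_pos: "X \<in> Ob \<A> \<Longrightarrow> aut \<A> X > 0"
proof -
  assume X: "X \<in> Ob \<A>"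
  then have "Ident \<A> X \<in> Aut_set \<A> X" by (simp add: Aut_set_def Hom_iff)
  then show ?thesis using finite_Aut[OF X] by (auto simp: card_gt_0_iff)
qed

lemma finite_ext_pairs: "finite (ext_pairs \<A> M N X)"
proof (cases "M \<in> Ob \<A> \<and> N \<in> Ob \<A> \<and> X \<in> Ob \<A>")
  case True
  have "ext_pairs \<A> M N X \<subseteq> Hom N X \<times> Hom X M" by (auto simp: ext_pairs_iff)
  then show ?thesis by (rule finite_subset) (use True finite_Hom in auto)
next
  case False
  then have "ext_pairs \<A> M N X = {}" using Hom_Ob by (auto simp: ext_pairs_iff)
  then show ?thesis by simp
qed

text \<open>Only the class of \<open>Y\<close> contributes, and there the isomorphisms are as many
  as the automorphisms. Kernels give isomorphisms from the representative, cokernels and images give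
  isomorphisms to it.\<close>

lemma torsor_sum:
  assumes F: "finite F" "F \<subseteq> Iso \<A>" and Y: "Y \<in> Ob \<A>" "iso_class \<A> Y \<in> F"
    and D: "\<And>x. x \<in> F \<Longrightarrow> d x = card (isos \<A> Y (rep x)) \<or> d x = card (isos \<A> (rep x) Y)"
  shows "(\<Sum>x \<in> F. of_nat (d x) / aut \<A> (rep x)) = 1"
proof -
  have "of_nat (d x) / aut \<A> (rep x) = (if x = iso_class \<A> Y then 1 else 0)" if x: "x \<in> F" for x
  proof -
    have r: "rep x \<in> Ob \<A>" "iso_class \<A> (rep x) = x" using rep_props F x by auto
    show ?thesis
    proof (cases "isomorphic \<A> Y (rep x)")
      case True
      then have "d x = card (Aut_set \<A> (rep x))"
        using D[OF x] card_isos_left[OF True] card_isos_right[OF isomorphic_sym[OF True]] by auto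
      moreover have "x = iso_class \<A> Y" using True r Y iso_class_eq_iff by metis
      ultimately show ?thesis using aut_pos[OF r(1)] by simp
    next
      case False
      then have F': "\<not> isomorphic \<A> (rep x) Y" using isomorphic_sym by blast
      have "d x = 0" using D[OF x] isos_empty[OF False] isos_empty[OF F'] by auto
      moreover have "x \<noteq> iso_class \<A> Y" using False r Y iso_class_eq_iff by metis
      ultimately show ?thesis by simp
    qed
  qed
  then show ?thesis using F Y by (simp add: sum.delta)
qed

text \<open>Flags \<open>C \<subseteq> Y \<subseteq> E\<close> with subquotients \<open>C\<close>, \<open>B\<close>, \<open>A\<close>, counted by the quotient \<open>X = E / C\<close>
  or by the middle term \<open>Y\<close>.\<close>

definition flag_rel :: "('m \<times> 'm) \<times> ('m \<times> 'm) \<Rightarrow> ('m \<times> 'm) \<times> ('m \<times> 'm) \<Rightarrow> bool" where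
  "flag_rel = (\<lambda>((b, p), (c, e)) ((y, a), (c', b')). y \<cdot> c' = c \<and> a = p \<cdot> e \<and> b \<cdot> b' = e \<cdot> y)"

text \<open>The flag is determined by E \<rightarrow> X and B \<rightarrow> X: its middle term is
  the preimage of B, that is the kernel of p e, and the other arrows are then forced. What remains
  is the choice of a kernel with domain \<open>rep x\<close>, of total mass 1.\<close>

lemma flag_fiber:
  assumes bp: "(b, p) \<in> ext_pairs \<A> A B X" and ce: "(c, e) \<in> ext_pairs \<A> X C E"
    and F: "finite F" "F \<subseteq> Iso \<A>" "\<And>f g. ses \<A> f g \<Longrightarrow> cod f = E \<Longrightarrow> iso_class \<A> (dom f) \<in> F"
  shows "(\<Sum>x \<in> F. of_nat (card {q \<in> ext_pairs \<A> A (rep x) E \<times> ext_pairs \<A> B C (rep x). flag_rel ((b, p), (c, e)) q}) /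
    aut \<A> (rep x)) = 1"
proof -
  note P = ext_pairsD[OF bp] and C = ext_pairsD[OF ce]
  note SP = ses_simps[OF P(7)] and SC = ses_simps[OF C(7)]
  obtain k0 where k0: "is_kernel \<A> (p \<cdot> e) k0" using ex_kernel P C by (metis comp_simps(1))
  have pe: "arr (p \<cdot> e)" "dom (p \<cdot> e) = E" "cod (p \<cdot> e) = A" "is_epi \<A> (p \<cdot> e)"
    using P C epi_comp[OF SC(6) SP(6)] by simp_all
  have ker_ses: "ses \<A> k (p \<cdot> e)" if "is_kernel \<A> (p \<cdot> e) k" for k using epi_kernel_ses pe that by blast
  note K0 = kernel_simps[OF k0]
  show ?thesis
  proof (rule torsor_sum[OF F(1,2)])
    show "dom k0 \<in> Ob \<A>" using K0 by simp
    show "iso_class \<A> (dom k0) \<in> F" using F(3)[OF ker_ses[OF k0]] K0 pe by simp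
    fix x assume x: "x \<in> F"
    let ?Y = "rep x"
    let ?D = "{q \<in> ext_pairs \<A> A ?Y E \<times> ext_pairs \<A> B C ?Y. flag_rel ((b, p), (c, e)) q}"
    have "bij_betw (fst \<circ> fst) ?D {k. is_kernel \<A> (p \<cdot> e) k \<and> dom k = ?Y}"
    proof (rule bij_betw_imageI[OF inj_onI subset_antisym[OF subsetI subsetI]])
      fix u v assume uv: "u \<in> ?D" "v \<in> ?D" "(fst \<circ> fst) u = (fst \<circ> fst) v"
      obtain y a c' b' y' a' c'' b'' where s: "u = ((y, a), (c', b'))" "v = ((y', a'), (c'', b''))" by (metis surj_pair)
      have y: "y' = y" using uv s by simp
      have m: "(y, a) \<in> ext_pairs \<A> A ?Y E" "(c', b') \<in> ext_pairs \<A> B C ?Y" "(c'', b'') \<in> ext_pairs \<A> B C ?Y"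
        and r: "y \<cdot> c' = c" "a = p \<cdot> e" "b \<cdot> b' = e \<cdot> y" "y \<cdot> c'' = c" "a' = p \<cdot> e" "b \<cdot> b'' = e \<cdot> y"
        using uv s y by (auto simp: flag_rel_def)
      note Y = ext_pairsD[OF m(1)] and D1 = ext_pairsD[OF m(2)] and D2 = ext_pairsD[OF m(3)]
      have "c' = c''"
        by (rule mono_cancel[OF ses_simps(5)[OF Y(7)]]) (use r(1,4) D1 D2 Y in auto)
      moreover have "b' = b''"
        by (rule mono_cancel[OF SP(5)]) (use r(3,6) D1 D2 P in auto)
      ultimately show "u = v" using s y r by simp
    next
      fix k assume "k \<in> (fst \<circ> fst) ` ?D"
      then obtain a cb where "((k, a), cb) \<in> ?D" by auto
      then have "(k, p \<cdot> e) \<in> ext_pairs \<A> A ?Y E" by (auto simp: flag_rel_def split: prod.splits)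
      then show "k \<in> {k. is_kernel \<A> (p \<cdot> e) k \<and> dom k = ?Y}"
        using ext_pairsD(2,7)[of k "p \<cdot> e"] ses_simps(7)[of k "p \<cdot> e"] by auto
    next
      fix y assume "y \<in> {k. is_kernel \<A> (p \<cdot> e) k \<and> dom k = ?Y}"
      then have y: "is_kernel \<A> (p \<cdot> e) y" "dom y = ?Y" by auto
      note Y = kernel_simps[OF y(1)] and SY = ker_ses[OF y(1)]
      have "p \<cdot> e \<cdot> y = nul (dom (e \<cdot> y)) (cod p)" using Y P C by simp
      then obtain b' where b': "arr b'" "dom b' = dom y" "cod b' = dom b" "b \<cdot> b' = e \<cdot> y"
        by (rule_tac kernel_factor[OF SP(7), of "e \<cdot> y"]) (use Y P C in auto)
      \<comment> \<open>The middle term is the pullback of B along \<open>e\<close>, so the kernel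
        of \<open>e\<close> lifts to the kernel \<open>c'\<close> of \<open>b'\<close>.\<close>
      have pb: "is_pullback \<A> e b y b'"
        unfolding is_pullback_def
      proof (intro conjI ballI impI)
        fix u v assume uv: "arr u" "arr v" "dom u = dom v \<and> cod u = dom e \<and> cod v = dom b \<and> e \<cdot> u = b \<cdot> v"
        then have "p \<cdot> e \<cdot> u = p \<cdot> b \<cdot> v" by simp
        also have "\<dots> = nul (dom b) (cod p) \<cdot> v" by (rule reassoc[OF SP(4)]) (use uv P in auto)
        finally have "(p \<cdot> e) \<cdot> u = nul (dom u) (cod (p \<cdot> e))" using uv P C by simp
        then obtain w where w: "arr w" "dom w = dom u" "cod w = dom y" "y \<cdot> w = u"
          by (rule_tac kernel_factor[OF y(1), of u]) (use uv P C in auto)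
        have "b \<cdot> b' \<cdot> w = e \<cdot> y \<cdot> w" by (rule square[OF b'(4)]) (use b' w P C Y in auto)
        then have "b \<cdot> b' \<cdot> w = b \<cdot> v" using w uv by simp
        then have bw: "b' \<cdot> w = v" by (rule mono_cancel[OF SP(5)]) (use b' w P C Y uv in auto)
        show "\<exists>!w. w \<in> Hom (dom u) (dom y) \<and> y \<cdot> w = u \<and> b' \<cdot> w = v"
        proof (rule ex1I[of _ w])
          show "w \<in> Hom (dom u) (dom y) \<and> y \<cdot> w = u \<and> b' \<cdot> w = v" using w bw by (simp add: Hom_iff)
          fix w' assume "w' \<in> Hom (dom u) (dom y) \<and> y \<cdot> w' = u \<and> b' \<cdot> w' = v"
          then show "w' = w" using mono_cancel[OF kernel_mono[OF y(1)], of w' w] w by (simp add: Hom_iff)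
        qed
      qed (use b' Y P C in auto)
      obtain c' where c': "ses \<A> c' b'" "dom c' = dom c" "y \<cdot> c' = c" using pullback_ses[OF C(7) pb] by metis
      have "cod c' = dom y" using ses_simps(3)[OF c'(1)] b' by simp
      then have "((y, p \<cdot> e), (c', b')) \<in> ?D"
        using c' b' y SY Y P C pe by (auto simp: flag_rel_def intro!: ext_pairsI)
      then show "y \<in> (fst \<circ> fst) ` ?D" by (rule rev_image_eqI) simp
    qed
    then have "card ?D = card {k. is_kernel \<A> (p \<cdot> e) k \<and> dom k = ?Y}" by (rule bij_betw_same_card)
    then show "card ?D = card (isos \<A> (dom k0) ?Y) \<or> card ?D = card (isos \<A> ?Y (dom k0))"
      using kernel_torsor[OF k0] by simp
  qed
qed

text \<open>Dual to \<open>flag_fiber\<close>: now X is to be found as the quotient of E by C.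
  Duality reverses a flag, so the two pairs and the arrows inside each pair change places.\<close>

lemma flag_fiber':
  assumes ya: "(y, a) \<in> ext_pairs \<A> A Y E" and cb: "(c', b') \<in> ext_pairs \<A> B C Y"
    and F: "finite F" "F \<subseteq> Iso \<A>" "\<And>f g. ses \<A> f g \<Longrightarrow> cod f = E \<Longrightarrow> iso_class \<A> (cod g) \<in> F"
  shows "(\<Sum>x \<in> F. of_nat (card {q \<in> ext_pairs \<A> A B (rep x) \<times> ext_pairs \<A> (rep x) C E. flag_rel q ((y, a), (c', b'))}) /
    aut \<A> (rep x)) = 1"
proof -
  interpret D: hom_finite "dual_cat \<A>" by (rule hom_finite_dual) unfold_locales
  have ab: "abelian_category \<A>" by unfold_locales
  have eq: "card {q \<in> ext_pairs (dual_cat \<A>) C X E \<times> ext_pairs (dual_cat \<A>) B A X. D.flag_rel ((b', c'), (a, y)) q} =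
    card {q \<in> ext_pairs \<A> A B X \<times> ext_pairs \<A> X C E. flag_rel q ((y, a), (c', b'))}" for X
    by (rule bij_betw_same_card[of "\<lambda>((e, c), (p, b)). ((b, p), (c, e))"],
        rule bij_betw_byWitness[where f' = "\<lambda>((b, p), (c, e)). ((e, c), (p, b))"])
      (auto simp: ext_pairs_dual_iff D.flag_rel_def flag_rel_def)
  have "(\<Sum>x \<in> F. of_nat (card {q \<in> ext_pairs (dual_cat \<A>) C (rep x) E \<times> ext_pairs (dual_cat \<A>) B A (rep x).
    D.flag_rel ((b', c'), (a, y)) q}) / aut (dual_cat \<A>) (rep x)) = 1"
  proof (rule D.flag_fiber[OF _ _ F(1)])
    show "iso_class (dual_cat \<A>) (Dom (dual_cat \<A>) f) \<in> F" if "ses (dual_cat \<A>) f g" "Cod (dual_cat \<A>) f = E" for f g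
      using F(3)[of g f] that ses_simps(3)[of g f] ab by simp
  qed (use ya cb F(2) ab in \<open>simp_all add: ext_pairs_dual_iff\<close>)
  then show ?thesis by (simp add: eq)
qed

text \<open>Associativity of the Hall product before division by automorphism groups. Both sides
  count flags, the left one by their quotient E / C, the right one by their middle term.\<close>

lemma flag_sum:
  assumes F: "finite F" "F \<subseteq> Iso \<A>"
    and E: "\<And>f g. ses \<A> f g \<Longrightarrow> cod f = E \<Longrightarrow> iso_class \<A> (dom f) \<in> F \<and> iso_class \<A> (cod g) \<in> F"
  shows "(\<Sum>x \<in> F. of_nat (card (ext_pairs \<A> A B (rep x)) * card (ext_pairs \<A> (rep x) C E)) / aut \<A> (rep x)) =
    (\<Sum>y \<in> F. of_nat (card (ext_pairs \<A> A (rep y) E) * card (ext_pairs \<A> B C (rep y))) / aut \<A> (rep y))"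
proof -
  have "(\<Sum>x \<in> F. of_nat (card (ext_pairs \<A> A B (rep x) \<times> ext_pairs \<A> (rep x) C E)) / aut \<A> (rep x)) =
    (\<Sum>y \<in> F. 1 * of_nat (card (ext_pairs \<A> A (rep y) E \<times> ext_pairs \<A> B C (rep y))) / aut \<A> (rep y))"
  proof (rule double_count[where N = "\<lambda>p q. if flag_rel p q then 1 else 0", OF F(1) F(1)])
    fix x p assume "x \<in> F" "p \<in> ext_pairs \<A> A B (rep x) \<times> ext_pairs \<A> (rep x) C E"
    then show "(\<Sum>y \<in> F. of_nat (\<Sum>q \<in> ext_pairs \<A> A (rep y) E \<times> ext_pairs \<A> B C (rep y). if flag_rel p q then 1 else 0) /
        aut \<A> (rep y)) = 1"
      using flag_fiber[OF _ _ F] E by (auto simp: sum_indicator_card finite_ext_pairs)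
  next
    fix y q assume "y \<in> F" "q \<in> ext_pairs \<A> A (rep y) E \<times> ext_pairs \<A> B C (rep y)"
    then show "(\<Sum>x \<in> F. of_nat (\<Sum>p \<in> ext_pairs \<A> A B (rep x) \<times> ext_pairs \<A> (rep x) C E. if flag_rel p q then 1 else 0) /
        aut \<A> (rep x)) = 1"
      using flag_fiber'[OF _ _ F] E by (auto simp: sum_indicator_card finite_ext_pairs)
  qed (simp_all add: finite_ext_pairs)
  then show ?thesis by (simp add: card_cartesian_product)
qed

text \<open>An extension of \<open>cod k\<close> by Z restricts along \<open>k\<close> to an
  extension of \<open>dom k\<close> by Z, with arrows \<open>j\<close> and \<open>q\<close>.
  Conversely, to extend a given (j, q) over \<open>cod k\<close> is to fill the 2-extension with
  arrows \<open>j\<close>, \<open>k \<cdot> q\<close>, \<open>r\<close>. If these fillings always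
  have mass C, the two masses of extensions differ by the factor C. This takes the place of the long
  exact sequence.\<close>

lemma ext_sum_mult:
  assumes kr: "ses \<A> k r"
    and F: "finite F" "F \<subseteq> Iso \<A>" and G: "finite G" "G \<subseteq> Iso \<A>"
    and FG: "\<And>f g x. x \<in> F \<Longrightarrow> ses \<A> f g \<Longrightarrow> cod f = rep x \<Longrightarrow> iso_class \<A> (dom f) \<in> G"
    and C: "\<And>j q. ses \<A> j q \<Longrightarrow> dom j = Z \<Longrightarrow> cod q = dom k \<Longrightarrow> is_kernel \<A> (k \<cdot> q) j \<Longrightarrow> is_cokernel \<A> (k \<cdot> q) r \<Longrightarrow>
      (\<Sum>x \<in> F. of_nat (card (fillings \<A> (k \<cdot> q) r (rep x))) / aut \<A> (rep x)) = C"
  shows "(\<Sum>x \<in> F. of_nat (card (ext_pairs \<A> (cod k) Z (rep x))) / aut \<A> (rep x)) =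
    C * (\<Sum>x \<in> G. of_nat (card (ext_pairs \<A> (dom k) Z (rep x))) / aut \<A> (rep x))"
proof -
  note K = ses_simps[OF kr]
  have krp: "(k, r) \<in> ext_pairs \<A> (cod r) (dom k) (cod k)" using kr by (intro ext_pairsI) auto
  \<comment> \<open>The number of ways to see \<open>jq\<close> as the restriction of
    \<open>ug\<close>; the objects X and Y are recovered as codomains.\<close>
  define N where "N = (\<lambda>X Y ug jq. card {sa \<in> ext_pairs \<A> (cod r) Y X. flag_rel ((k, r), ug) (sa, jq)})"
  have "(\<Sum>x \<in> F. of_nat (card (ext_pairs \<A> (cod k) Z (rep x))) / aut \<A> (rep x)) =
    (\<Sum>y \<in> G. C * of_nat (card (ext_pairs \<A> (dom k) Z (rep y))) / aut \<A> (rep y))"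
  proof (rule double_count[where N = "\<lambda>ug jq. N (cod (fst ug)) (cod (fst jq)) ug jq", OF F(1) G(1)])
    fix x ug assume x: "x \<in> F" and ug: "ug \<in> ext_pairs \<A> (cod k) Z (rep x)"
    have cu: "cod (fst ug) = rep x" using ug ext_pairsD(3)[of "fst ug" "snd ug"] by simp
    have e: "(\<Sum>jq \<in> ext_pairs \<A> (dom k) Z Y. N (cod (fst ug)) (cod (fst jq)) ug jq) =
      card {q \<in> ext_pairs \<A> (cod r) Y (rep x) \<times> ext_pairs \<A> (dom k) Z Y. flag_rel ((k, r), ug) q}" for Y
    proof -
      have "(\<Sum>jq \<in> ext_pairs \<A> (dom k) Z Y. N (cod (fst ug)) (cod (fst jq)) ug jq) =
        (\<Sum>jq \<in> ext_pairs \<A> (dom k) Z Y. card {sa \<in> ext_pairs \<A> (cod r) Y (rep x). flag_rel ((k, r), ug) (sa, jq)})"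
        by (rule sum.cong) (use cu in \<open>auto simp: N_def ext_pairs_iff Hom_iff\<close>)
      also have "\<dots> = card (SIGMA jq:ext_pairs \<A> (dom k) Z Y. {sa \<in> ext_pairs \<A> (cod r) Y (rep x). flag_rel ((k, r), ug) (sa, jq)})"
        by (simp add: finite_ext_pairs)
      also have "\<dots> = card {q \<in> ext_pairs \<A> (cod r) Y (rep x) \<times> ext_pairs \<A> (dom k) Z Y. flag_rel ((k, r), ug) q}"
        by (rule bij_betw_same_card[of "prod.swap"], rule bij_betw_byWitness[where f' = prod.swap]) auto
      finally show ?thesis .
    qed
    show "(\<Sum>y \<in> G. of_nat (\<Sum>jq \<in> ext_pairs \<A> (dom k) Z (rep y). N (cod (fst ug)) (cod (fst jq)) ug jq) / aut \<A> (rep y)) = 1"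
      unfolding e using flag_fiber[OF krp, of "fst ug" "snd ug" Z "rep x" G] ug G FG[OF x] by auto
  next
    fix y jq assume y: "y \<in> G" and jq: "jq \<in> ext_pairs \<A> (dom k) Z (rep y)"
    obtain j q where jq': "jq = (j, q)" by fastforce
    note J = ext_pairsD[OF jq[unfolded jq']]
    note SJ = ses_simps[OF J(7)]
    have kq: "arr (k \<cdot> q)" "dom (k \<cdot> q) = rep y" "cod (k \<cdot> q) = cod k" using J K by auto
    have ker: "is_kernel \<A> (k \<cdot> q) j"
    proof (rule kernelI[OF SJ(5)])
      show "(k \<cdot> q) \<cdot> j = nul (dom j) (cod (k \<cdot> q))" using J K SJ by simp
      fix h assume h: "arr h" "cod h = dom (k \<cdot> q)" "(k \<cdot> q) \<cdot> h = nul (dom h) (cod (k \<cdot> q))"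
      then have "q \<cdot> h = nul (dom h) (cod q)" using mono_nul[OF K(5), of "q \<cdot> h"] J K by simp
      then obtain u where "arr u" "dom u = dom h" "cod u = dom j" "j \<cdot> u = h"
        by (rule_tac kernel_factor[OF SJ(7), of h]) (use h kq J in auto)
      then show "\<exists>u. arr u \<and> dom u = dom h \<and> cod u = dom j \<and> j \<cdot> u = h" by blast
    qed (use J kq in auto)
    have cok: "is_cokernel \<A> (k \<cdot> q) r"
    proof (rule cokernelI[OF K(6)])
      show "r \<cdot> k \<cdot> q = nul (dom (k \<cdot> q)) (cod r)" using reassoc[OF K(4), of q] J K by simp
      fix h assume h: "arr h" "dom h = cod (k \<cdot> q)" "h \<cdot> k \<cdot> q = nul (dom (k \<cdot> q)) (cod h)"
      then have "h \<cdot> k = nul (dom k) (cod h)" using epi_nul[OF SJ(6), of "h \<cdot> k"] J K by simp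
      then obtain u where "arr u" "dom u = cod r" "cod u = cod h" "u \<cdot> r = h"
        by (rule_tac cokernel_factor[OF K(8), of h]) (use h kq J K in auto)
      then show "\<exists>u. arr u \<and> dom u = cod r \<and> cod u = cod h \<and> u \<cdot> r = h" by blast
    qed (use J K kq in auto)
    have e: "(\<Sum>ug \<in> ext_pairs \<A> (cod k) Z X. N (cod (fst ug)) (cod (fst jq)) ug jq) = card (fillings \<A> (k \<cdot> q) r X)" for X
    proof -
      have "(\<Sum>ug \<in> ext_pairs \<A> (cod k) Z X. N (cod (fst ug)) (cod (fst jq)) ug jq) =
        (\<Sum>ug \<in> ext_pairs \<A> (cod k) Z X. card {sa \<in> ext_pairs \<A> (cod r) (rep y) X. flag_rel ((k, r), ug) (sa, jq)})"
        by (rule sum.cong) (use J jq' in \<open>auto simp: N_def ext_pairs_iff Hom_iff\<close>)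
      also have "\<dots> = card (SIGMA ug:ext_pairs \<A> (cod k) Z X. {sa \<in> ext_pairs \<A> (cod r) (rep y) X. flag_rel ((k, r), ug) (sa, jq)})"
        by (simp add: finite_ext_pairs)
      \<comment> \<open>In an incidence \<open>u\<close> and \<open>a\<close> are determined by
        \<open>s\<close> and \<open>g\<close>, and the pair (s, g) is a filling.\<close>
      also have "\<dots> = card (fillings \<A> (k \<cdot> q) r X)"
      proof (rule bij_betw_same_card[of "\<lambda>((u, g), (s, a)). (s, g)"],
          rule bij_betw_byWitness[where f' = "\<lambda>(s, g). ((s \<cdot> j, g), (s, r \<cdot> g))"])
        let ?S = "SIGMA ug:ext_pairs \<A> (cod k) Z X. {sa \<in> ext_pairs \<A> (cod r) (rep y) X. flag_rel ((k, r), ug) (sa, jq)}"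
        show "\<forall>x \<in> ?S. (\<lambda>(s, g). ((s \<cdot> j, g), (s, r \<cdot> g))) ((\<lambda>((u, g), (s, a)). (s, g)) x) = x"
          by (auto simp: flag_rel_def jq')
        show "\<forall>x \<in> fillings \<A> (k \<cdot> q) r X. (\<lambda>((u, g), (s, a)). (s, g)) ((\<lambda>(s, g). ((s \<cdot> j, g), (s, r \<cdot> g))) x) = x"
          by auto
        show "(\<lambda>((u, g), (s, a)). (s, g)) ` ?S \<subseteq> fillings \<A> (k \<cdot> q) r X"
        proof
          fix v assume "v \<in> (\<lambda>((u, g), (s, a)). (s, g)) ` ?S"
          then obtain u g s a where v: "v = (s, g)" "(u, g) \<in> ext_pairs \<A> (cod k) Z X" "(s, a) \<in> ext_pairs \<A> (cod r) (rep y) X"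
            "flag_rel ((k, r), (u, g)) ((s, a), jq)" by auto
          note U = ext_pairsD[OF v(2)] and S = ext_pairsD[OF v(3)]
          show "v \<in> fillings \<A> (k \<cdot> q) r X" unfolding v(1)
            by (rule fillingI) (use v(4) U S kq jq' in \<open>auto simp: flag_rel_def\<close>)
        qed
        show "(\<lambda>(s, g). ((s \<cdot> j, g), (s, r \<cdot> g))) ` fillings \<A> (k \<cdot> q) r X \<subseteq> ?S"
        proof
          fix v assume "v \<in> (\<lambda>(s, g). ((s \<cdot> j, g), (s, r \<cdot> g))) ` fillings \<A> (k \<cdot> q) r X"
          then obtain s g where v: "v = ((s \<cdot> j, g), (s, r \<cdot> g))" "(s, g) \<in> fillings \<A> (k \<cdot> q) r X" by auto
          note f = fillingD[OF v(2)]
          have "ses \<A> (s \<cdot> j) g" by (rule filling_ses[OF ker cok]) (use f in auto)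
          then have "(s \<cdot> j, g) \<in> ext_pairs \<A> (cod k) Z X" using f J kq by (intro ext_pairsI) auto
          moreover have "(s, r \<cdot> g) \<in> ext_pairs \<A> (cod r) (rep y) X" using f kq K by (intro ext_pairsI) auto
          ultimately show "v \<in> ?S" using v f by (auto simp: flag_rel_def jq')
        qed
      qed
      finally show ?thesis .
    qed
    show "(\<Sum>x \<in> F. of_nat (\<Sum>ug \<in> ext_pairs \<A> (cod k) Z (rep x). N (cod (fst ug)) (cod (fst jq)) ug jq) / aut \<A> (rep x)) = C"
      unfolding e using C[OF J(7) _ _ ker cok] J by simp
  qed (simp_all add: finite_ext_pairs)
  then show ?thesis by (simp add: sum_distrib_left)
qed

text \<open>The dual: an extension of M by \<open>cod i\<close> is pushed out along \<open>p\<close>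
  to one by \<open>cod p\<close>, and the ways back are fillings of the 2-extension with arrows
  \<open>i\<close>, \<open>q \<cdot> p\<close>, \<open>j\<close>.\<close>

lemma ext_sum_mult':
  assumes ip: "ses \<A> i p"
    and F: "finite F" "F \<subseteq> Iso \<A>" and G: "finite G" "G \<subseteq> Iso \<A>"
    and FG: "\<And>f g x. x \<in> F \<Longrightarrow> ses \<A> f g \<Longrightarrow> cod f = rep x \<Longrightarrow> iso_class \<A> (cod g) \<in> G"
    and C: "\<And>q j. ses \<A> q j \<Longrightarrow> cod j = M \<Longrightarrow> dom q = cod p \<Longrightarrow> is_kernel \<A> (q \<cdot> p) i \<Longrightarrow> is_cokernel \<A> (q \<cdot> p) j \<Longrightarrow>
      (\<Sum>x \<in> F. of_nat (card (fillings \<A> (q \<cdot> p) j (rep x))) / aut \<A> (rep x)) = C"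
  shows "(\<Sum>x \<in> F. of_nat (card (ext_pairs \<A> M (cod i) (rep x))) / aut \<A> (rep x)) =
    C * (\<Sum>x \<in> G. of_nat (card (ext_pairs \<A> M (cod p) (rep x))) / aut \<A> (rep x))"
proof -
  interpret D: hom_finite "dual_cat \<A>" by (rule hom_finite_dual) unfold_locales
  have ab: "abelian_category \<A>" by unfold_locales
  have e: "card (ext_pairs (dual_cat \<A>) A B X) = card (ext_pairs \<A> B A X)" for A B X
    by (rule bij_betw_same_card[of prod.swap], rule bij_betw_byWitness[where f' = prod.swap]) (auto simp: ext_pairs_dual_iff)
  have f: "card (fillings (dual_cat \<A>) c n X) = card (fillings \<A> c m X)" if "is_kernel \<A> c n" "is_cokernel \<A> c m" for c n m X
    by (rule bij_betw_same_card[of prod.swap], rule bij_betw_byWitness[where f' = prod.swap]) (auto simp: fillings_dual[OF that])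
  have "(\<Sum>x \<in> F. of_nat (card (ext_pairs (dual_cat \<A>) (Cod (dual_cat \<A>) p) M (rep x))) / aut (dual_cat \<A>) (rep x)) =
    C * (\<Sum>x \<in> G. of_nat (card (ext_pairs (dual_cat \<A>) (Dom (dual_cat \<A>) p) M (rep x))) / aut (dual_cat \<A>) (rep x))"
  proof (rule D.ext_sum_mult[of p i, OF _ F(1) _ G(1)])
    show "iso_class (dual_cat \<A>) (Dom (dual_cat \<A>) f) \<in> G"
      if "x \<in> F" "ses (dual_cat \<A>) f g" "Cod (dual_cat \<A>) f = rep x" for f g x
      using FG[of x g f] that ses_simps(3)[of g f] ab by simp
    show "(\<Sum>x \<in> F. of_nat (card (fillings (dual_cat \<A>) (Comp (dual_cat \<A>) p q) i (rep x))) / aut (dual_cat \<A>) (rep x)) = C"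
      if "ses (dual_cat \<A>) j q" "Dom (dual_cat \<A>) j = M" "Cod (dual_cat \<A>) q = Dom (dual_cat \<A>) p"
        "is_kernel (dual_cat \<A>) (Comp (dual_cat \<A>) p q) j" "is_cokernel (dual_cat \<A>) (Comp (dual_cat \<A>) p q) i" for j q
      using C[of q j] f[of "q \<cdot> p" i j] that by simp
  qed (use ip F(2) G(2) ab in simp_all)
  then show ?thesis using ses_simps(3)[OF ip] by (simp add: e)
qed

section \<open>Three by three diagrams around a given cross\<close>

definition corner_rel :: "('m \<times> 'm) \<times> ('m \<times> 'm) \<Rightarrow> ('m \<times> 'm) \<times> ('m \<times> 'm) \<times> ('m \<times> 'm) \<times> ('m \<times> 'm) \<Rightarrow> bool" where
  "corner_rel = (\<lambda>((f, g), (a, b)) ((i, p), (j, q), (k, r), (l, z)).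
     f \<cdot> i = a \<cdot> j \<and> g \<cdot> a = k \<cdot> q \<and> b \<cdot> f = l \<cdot> p \<and> r \<cdot> g = z \<cdot> b)"

text \<open>Once the cross at X is fixed, the corners are N1 = ker(g a), M1 = im(g a), N2 = im(b f)
  and M2 = coker(g a). The arrows \<open>i\<close> and \<open>z\<close> are forced because
  \<open>f\<close> is mono and \<open>b\<close> is epi, so four independent choices remain.\<close>

lemma corner_card:
  assumes fg: "(f, g) \<in> ext_pairs \<A> M N X" and ab: "(a, b) \<in> ext_pairs \<A> B A X"
  shows "card {y \<in> ext_pairs \<A> N2 N1 N \<times> ext_pairs \<A> M1 N1 A \<times> ext_pairs \<A> M2 M1 M \<times> ext_pairs \<A> M2 N2 B.
      corner_rel ((f, g), (a, b)) y} =
    card {j. is_kernel \<A> (g \<cdot> a) j \<and> dom j = N1} *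
    card {(q, k). is_epi \<A> q \<and> is_mono \<A> k \<and> cod q = M1 \<and> dom k = M1 \<and> k \<cdot> q = g \<cdot> a} *
    card {(p, l). is_epi \<A> p \<and> is_mono \<A> l \<and> cod p = N2 \<and> dom l = N2 \<and> l \<cdot> p = b \<cdot> f} *
    card {r. is_cokernel \<A> (g \<cdot> a) r \<and> cod r = M2}"
    (is "card ?D = card ?K * card ?I * card ?J * card ?C")
proof -
  note Fg = ext_pairsD[OF fg] and Ab = ext_pairsD[OF ab]
  note SF = ses_simps[OF Fg(7)] and SA = ses_simps[OF Ab(7)]
  have ga: "arr (g \<cdot> a)" "dom (g \<cdot> a) = A" "cod (g \<cdot> a) = M" and bf: "arr (b \<cdot> f)" "dom (b \<cdot> f) = N" "cod (b \<cdot> f) = B"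
    using Fg Ab by auto
  define \<Psi> :: "('m \<times> 'm) \<times> ('m \<times> 'm) \<times> ('m \<times> 'm) \<times> ('m \<times> 'm) \<Rightarrow> 'm \<times> ('m \<times> 'm) \<times> ('m \<times> 'm) \<times> 'm"
    where "\<Psi> = (\<lambda>((i, p), (j, q), (k, r), (l, z)). (j, (q, k), (p, l), r))"
  have "bij_betw \<Psi> ?D (?K \<times> ?I \<times> ?J \<times> ?C)"
  proof (rule bij_betw_imageI[OF inj_onI subset_antisym[OF subsetI subsetI]])
    fix x y assume xy: "x \<in> ?D" "y \<in> ?D" "\<Psi> x = \<Psi> y"
    obtain i p j q k r l z where x: "x = ((i, p), (j, q), (k, r), (l, z))" by (metis surj_pair)
    obtain i' p' j' q' k' r' l' z' where y: "y = ((i', p'), (j', q'), (k', r'), (l', z'))" by (metis surj_pair)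
    have e: "p' = p" "j' = j" "q' = q" "k' = k" "r' = r" "l' = l" using xy(3) by (auto simp: \<Psi>_def x y)
    have m: "(i, p) \<in> ext_pairs \<A> N2 N1 N" "(i', p') \<in> ext_pairs \<A> N2 N1 N" "(l, z) \<in> ext_pairs \<A> M2 N2 B" "(l', z') \<in> ext_pairs \<A> M2 N2 B"
      and c: "f \<cdot> i = a \<cdot> j" "r \<cdot> g = z \<cdot> b" "f \<cdot> i' = a \<cdot> j'" "r' \<cdot> g = z' \<cdot> b"
      using xy(1,2) by (auto simp: x y corner_rel_def)
    have "i = i'" by (rule mono_cancel[OF SF(5)]) (use m[THEN ext_pairsD(1)] m[THEN ext_pairsD(2)] m[THEN ext_pairsD(3)] c e Fg in auto)
    moreover have "z = z'" by (rule epi_cancel[OF SA(6)]) (use m[THEN ext_pairsD(4)] m[THEN ext_pairsD(5)] m[THEN ext_pairsD(6)] c e Ab in auto)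
    ultimately show "x = y" using x y e by simp
  next
    fix v assume "v \<in> \<Psi> ` ?D"
    then obtain x where x': "x \<in> ?D" "v = \<Psi> x" by blast
    obtain i p j q k r l z where x: "x = ((i, p), (j, q), (k, r), (l, z))" by (metis surj_pair)
    have m: "(i, p) \<in> ext_pairs \<A> N2 N1 N" "(j, q) \<in> ext_pairs \<A> M1 N1 A" "(k, r) \<in> ext_pairs \<A> M2 M1 M" "(l, z) \<in> ext_pairs \<A> M2 N2 B"
      and c: "f \<cdot> i = a \<cdot> j" "g \<cdot> a = k \<cdot> q" "b \<cdot> f = l \<cdot> p" "r \<cdot> g = z \<cdot> b"
      using x' by (auto simp: x corner_rel_def)
    note I = ext_pairsD[OF m(1)] and J = ext_pairsD[OF m(2)] and K = ext_pairsD[OF m(3)] and L = ext_pairsD[OF m(4)]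
    note SI = ses_simps[OF I(7)] and SJ = ses_simps[OF J(7)] and SK = ses_simps[OF K(7)] and SL = ses_simps[OF L(7)]
    have "is_kernel \<A> (k \<cdot> q) j"
    proof (rule kernelI[OF SJ(5)])
      show "(k \<cdot> q) \<cdot> j = nul (dom j) (cod (k \<cdot> q))" using J K SJ by simp
      fix h assume h: "arr h" "cod h = dom (k \<cdot> q)" "(k \<cdot> q) \<cdot> h = nul (dom h) (cod (k \<cdot> q))"
      then have "q \<cdot> h = nul (dom h) (cod q)" using mono_nul[OF SK(5), of "q \<cdot> h"] J K by simp
      then obtain u where "arr u" "dom u = dom h" "cod u = dom j" "j \<cdot> u = h"
        by (rule_tac kernel_factor[OF SJ(7), of h]) (use h K J in auto)
      then show "\<exists>u. arr u \<and> dom u = dom h \<and> cod u = dom j \<and> j \<cdot> u = h" by blast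
    qed (use J K in auto)
    moreover have "is_cokernel \<A> (k \<cdot> q) r"
    proof (rule cokernelI[OF SK(6)])
      show "r \<cdot> k \<cdot> q = nul (dom (k \<cdot> q)) (cod r)" using reassoc[OF SK(4), of q] J K by simp
      fix h assume h: "arr h" "dom h = cod (k \<cdot> q)" "h \<cdot> k \<cdot> q = nul (dom (k \<cdot> q)) (cod h)"
      then have "h \<cdot> k = nul (dom k) (cod h)" using epi_nul[OF SJ(6), of "h \<cdot> k"] J K by simp
      then obtain u where "arr u" "dom u = cod r" "cod u = cod h" "u \<cdot> r = h"
        by (rule_tac cokernel_factor[OF SK(8), of h]) (use h J K in auto)
      then show "\<exists>u. arr u \<and> dom u = cod r \<and> cod u = cod h \<and> u \<cdot> r = h" by blast
    qed (use J K in auto)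
    ultimately show "v \<in> ?K \<times> ?I \<times> ?J \<times> ?C"
      unfolding x'(2) x using c I J K L SI(6) SJ(6) SK(5) SL(5) by (simp add: \<Psi>_def)
  next
    fix v assume v: "v \<in> ?K \<times> ?I \<times> ?J \<times> ?C"
    obtain j q k p l r where vv: "v = (j, (q, k), (p, l), r)" by (metis surj_pair)
    have j: "is_kernel \<A> (g \<cdot> a) j" "dom j = N1" and q: "is_epi \<A> q" "is_mono \<A> k" "cod q = M1" "dom k = M1" and kq: "k \<cdot> q = g \<cdot> a"
      and p: "is_epi \<A> p" "is_mono \<A> l" "cod p = N2" "dom l = N2" and lp: "l \<cdot> p = b \<cdot> f"
      and r: "is_cokernel \<A> (g \<cdot> a) r" "cod r = M2"
      using v vv by auto
    have ar: "arr q" "arr k" "arr p" "arr l" using q p by (auto simp: is_epi_def is_mono_def)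
    have d: "dom q = A" "cod k = M" "dom p = N" "cod l = B"
      using comp_simps(2,3)[of q k] comp_simps(2,3)[of p l] ar q p kq lp ga bf by simp_all
    note J = kernel_simps[OF j(1)] and R = cokernel_simps[OF r(1)]
    have O: "M1 \<in> Ob \<A>" "N2 \<in> Ob \<A>" using arr_Ob(2)[OF ar(1)] arr_Ob(2)[OF ar(3)] q p by auto
    have J': "cod j = A" "g \<cdot> a \<cdot> j = nul N1 M" "N1 \<in> Ob \<A>" using J ga j Fg Ab arr_Ob(1)[OF J(2)] by simp_all
    obtain i where i: "arr i" "dom i = N1" "cod i = N" "f \<cdot> i = a \<cdot> j"
      by (rule kernel_factor[OF SF(7), of "a \<cdot> j"]) (use J J' j Fg Ab in auto)
    have bfi: "b \<cdot> f \<cdot> i = nul N1 B"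
      using reassoc[OF SA(4), of j] i J J' j Ab by simp
    \<comment> \<open>N1 is the intersection of N and A in X, so the kernel of A \<rightarrow> M is
      at the same time the kernel of N \<rightarrow> B.\<close>
    have "is_kernel \<A> p i"
    proof (rule kernelI)
      show "is_mono \<A> i"
      proof (rule monoI[OF i(1)])
        fix w assume w: "arr w" "cod w = dom i" "i \<cdot> w = nul (dom w) (cod i)"
        have "f \<cdot> i \<cdot> w = a \<cdot> j \<cdot> w" by (rule square[OF i(4)]) (use w i J J' j Fg Ab in auto)
        then have "a \<cdot> j \<cdot> w = nul (dom w) (cod a)" using w i Fg Ab by simp
        then have "j \<cdot> w = nul (dom w) (cod j)" using mono_nul[OF SA(5), of "j \<cdot> w"] w i J J' j Ab by simp
        then show "w = nul (dom w) (dom i)" using mono_nul[OF kernel_mono[OF j(1)], of w] w i j by simp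
      qed
      have "l \<cdot> p \<cdot> i = b \<cdot> f \<cdot> i" by (rule square[OF lp]) (use i O ar d p Fg Ab in auto)
      then have "l \<cdot> p \<cdot> i = nul N1 B" using bfi by simp
      then show "p \<cdot> i = nul (dom i) (cod p)" using mono_nul[OF p(2), of "p \<cdot> i"] i O ar d p by simp
      fix w assume w: "arr w" "cod w = dom p" "p \<cdot> w = nul (dom w) (cod p)"
      have "l \<cdot> p \<cdot> w = b \<cdot> f \<cdot> w" by (rule square[OF lp]) (use w O ar d p Fg Ab in auto)
      then have "b \<cdot> f \<cdot> w = nul (dom w) (cod b)" using w O ar d p Ab by simp
      then obtain x where x: "arr x" "dom x = dom w" "cod x = A" "a \<cdot> x = f \<cdot> w"
        by (rule_tac kernel_factor[OF SA(7), of "f \<cdot> w"]) (use w d Fg Ab in auto)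
      have "g \<cdot> a \<cdot> x = nul (dom w) M" using reassoc[OF SF(4), of w] x w d Fg by simp
      then obtain y where y: "arr y" "dom y = dom x" "cod y = N1" "j \<cdot> y = x"
        by (rule_tac kernel_factor[OF j(1), of x]) (use x ga j Fg Ab in auto)
      have "f \<cdot> i \<cdot> y = a \<cdot> j \<cdot> y" by (rule square[OF i(4)]) (use y i J J' j Fg Ab in auto)
      then have "f \<cdot> i \<cdot> y = f \<cdot> w" using y x by simp
      then have "i \<cdot> y = w" by (rule mono_cancel[OF SF(5)]) (use y x i w d Fg in auto)
      then show "\<exists>u. arr u \<and> dom u = dom w \<and> cod u = dom i \<and> i \<cdot> u = w" using y x i by auto
    qed (use ar i d in auto)
    then have ip: "(i, p) \<in> ext_pairs \<A> N2 N1 N" using epi_kernel_ses[OF p(1)] i p by (intro ext_pairsI) auto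
    have "is_kernel \<A> q j"
    proof (rule kernelI[OF kernel_mono[OF j(1)]])
      have "k \<cdot> q \<cdot> j = g \<cdot> a \<cdot> j" by (rule square[OF kq]) (use O ar d q J' J Fg Ab in auto)
      then have "k \<cdot> q \<cdot> j = nul N1 M" using J' by simp
      then show "q \<cdot> j = nul (dom j) (cod q)" using mono_nul[OF q(2), of "q \<cdot> j"] O ar d q J' J j by simp
      fix w assume w: "arr w" "cod w = dom q" "q \<cdot> w = nul (dom w) (cod q)"
      have "k \<cdot> q \<cdot> w = g \<cdot> a \<cdot> w" by (rule square[OF kq]) (use O ar d q w Fg Ab in auto)
      then have "(g \<cdot> a) \<cdot> w = nul (dom w) (cod (g \<cdot> a))" using w O ar d q Fg Ab by simp
      then obtain y where "arr y" "dom y = dom w" "cod y = dom j" "j \<cdot> y = w"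
        by (rule_tac kernel_factor[OF j(1), of w]) (use w d ga in auto)
      then show "\<exists>u. arr u \<and> dom u = dom w \<and> cod u = dom j \<and> j \<cdot> u = w" by blast
    qed (use ar d J J' in auto)
    then have jq: "(j, q) \<in> ext_pairs \<A> M1 N1 A" using epi_kernel_ses[OF q(1)] j J' q by (intro ext_pairsI) auto
    have R': "arr r" "dom r = M" "r \<cdot> g \<cdot> a = nul A M2" "M2 \<in> Ob \<A>" using R ga r Fg Ab arr_Ob(2)[OF R(2)] by simp_all
    have "is_cokernel \<A> k r"
    proof (rule cokernelI[OF cokernel_epi[OF r(1)]])
      have "(r \<cdot> k) \<cdot> q = nul (dom q) (cod (r \<cdot> k))" using R' kq r O ar d q by simp
      then show "r \<cdot> k = nul (dom k) (cod r)" using epi_nul[OF q(1), of "r \<cdot> k"] R' O ar d q by simp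
      fix h assume h: "arr h" "dom h = cod k" "h \<cdot> k = nul (dom k) (cod h)"
      have "h \<cdot> k \<cdot> q = nul (dom k) (cod h) \<cdot> q" by (rule reassoc[OF h(3)]) (use h O ar d q in auto)
      then have "h \<cdot> g \<cdot> a = nul (dom (g \<cdot> a)) (cod h)" using kq h O ar d q ga by simp
      then obtain y where "arr y" "dom y = cod r" "cod y = cod h" "y \<cdot> r = h"
        by (rule_tac cokernel_factor[OF r(1), of h]) (use h d ga in auto)
      then show "\<exists>u. arr u \<and> dom u = cod r \<and> cod u = cod h \<and> u \<cdot> r = h" by blast
    qed (use ar d R' in auto)
    then have kr: "(k, r) \<in> ext_pairs \<A> M2 M1 M" using mono_cokernel_ses[OF q(2)] d r q by (intro ext_pairsI) auto
    obtain z where z: "arr z" "dom z = B" "cod z = M2" "z \<cdot> b = r \<cdot> g"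
      by (rule cokernel_factor[OF SA(8), of "r \<cdot> g"]) (use R' r Fg Ab in auto)
    have repi: "is_epi \<A> (r \<cdot> g)" using epi_comp[OF SF(6) cokernel_epi[OF r(1)]] R' Fg by simp
    \<comment> \<open>Dually, M2 is the quotient of X by the sum of N and A, so the cokernel of A
      \<rightarrow> M is also the cokernel of N \<rightarrow> B.\<close>
    have "is_cokernel \<A> l z"
    proof (rule cokernelI)
      have "is_epi \<A> (z \<cdot> b)" using repi z by simp
      then show "is_epi \<A> z" using epi_right[of z b] z Ab by simp
      have "(z \<cdot> l) \<cdot> p = z \<cdot> b \<cdot> f" using lp z O ar d p by simp
      also have "\<dots> = r \<cdot> g \<cdot> f" by (rule square[OF z(4)]) (use z R' Fg Ab in auto)
      finally have "(z \<cdot> l) \<cdot> p = nul (dom p) (cod (z \<cdot> l))" using SF(4) R' z ar d Fg r by simp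
      then show "z \<cdot> l = nul (dom l) (cod z)" using epi_nul[OF p(1), of "z \<cdot> l"] z O ar d p by simp
      fix h assume h: "arr h" "dom h = cod l" "h \<cdot> l = nul (dom l) (cod h)"
      have "h \<cdot> l \<cdot> p = nul (dom l) (cod h) \<cdot> p" by (rule reassoc[OF h(3)]) (use h O ar d p in auto)
      then have "(h \<cdot> b) \<cdot> f = nul (dom f) (cod (h \<cdot> b))" using lp h O ar d p Fg Ab by simp
      then obtain h' where h': "arr h'" "dom h' = cod g" "cod h' = cod h" "h' \<cdot> g = h \<cdot> b"
        by (rule_tac cokernel_factor[OF SF(8), of "h \<cdot> b"]) (use h d Fg Ab in auto)
      have "h' \<cdot> g \<cdot> a = h \<cdot> b \<cdot> a" by (rule square[OF h'(4)]) (use h' h d Fg Ab in auto)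
      then have "h' \<cdot> g \<cdot> a = nul (dom (g \<cdot> a)) (cod h')" using SA(4) h h' d Ab ga by simp
      then obtain y where y: "arr y" "dom y = M2" "cod y = cod h" "y \<cdot> r = h'"
        by (rule_tac cokernel_factor[OF r(1), of h']) (use h' ga r Fg in auto)
      have "(y \<cdot> z) \<cdot> b = y \<cdot> r \<cdot> g" using y z Ab by simp
      also have "\<dots> = h' \<cdot> g" by (rule reassoc[OF y(4)]) (use y R' Fg r in auto)
      finally have "y \<cdot> z = h" by (rule_tac epi_cancel[OF SA(6)]) (use h' y z h d Ab in auto)
      then show "\<exists>u. arr u \<and> dom u = cod z \<and> cod u = cod h \<and> u \<cdot> z = h" using y z by auto
    qed (use ar d z in auto)
    then have lz: "(l, z) \<in> ext_pairs \<A> M2 N2 B" using mono_cokernel_ses[OF p(2)] d z p by (intro ext_pairsI) auto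
    have "((i, p), (j, q), (k, r), (l, z)) \<in> ?D"
      using ip jq kr lz i kq lp z by (simp add: corner_rel_def)
    then show "v \<in> \<Psi> ` ?D" by (rule rev_image_eqI) (simp add: \<Psi>_def vv)
  qed
  then have "card ?D = card (?K \<times> ?I \<times> ?J \<times> ?C)" by (rule bij_betw_same_card)
  then show ?thesis by (simp add: card_cartesian_product mult.assoc)
qed

end


section \<open>The Grothendieck monoid and the Euler form\<close>

lemma set_eqI_pair: "(\<And>x y. (x, y) \<in> A \<longleftrightarrow> (x, y) \<in> B) \<Longrightarrow> A = B"
  by auto

text \<open>The universal property of a biproduct as a product determines it up to isomorphism,
  which makes \<open>Iso_plus\<close> well defined, and it gives associativity without matrices of
  arrows.\<close>

definition is_product :: "('o, 'm) preadd_cat \<Rightarrow> 'o \<Rightarrow> 'o \<Rightarrow> 'o \<Rightarrow> 'm \<Rightarrow> 'm \<Rightarrow> bool" where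
  "is_product \<A> X Y S p q \<longleftrightarrow> p \<in> Hom_set \<A> S X \<and> q \<in> Hom_set \<A> S Y \<and>
     (\<forall>W \<in> Ob \<A>. \<forall>x \<in> Hom_set \<A> W X. \<forall>y \<in> Hom_set \<A> W Y.
        \<exists>!u. u \<in> Hom_set \<A> W S \<and> Comp \<A> p u = x \<and> Comp \<A> q u = y)"

text \<open>The direct summands of objects of class \<gamma>, up to isomorphism. An extension has
  the class of the direct sum of its ends, so subobjects and quotients of members are again members
  (\<open>constituents_ses\<close>). The set is finite in the profinitary case and serves as the
  index set of the sums below.\<close>

definition constituents :: "('o, 'm) preadd_cat \<Rightarrow> 'o set set \<Rightarrow> 'o set set" where
  "constituents \<A> \<gamma> = {a \<in> Iso \<A>. \<exists>b \<in> Iso \<A>. groth_class \<A> (Iso_plus \<A> a b) = \<gamma>}"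

abbreviation obj_class :: "('o, 'm) preadd_cat \<Rightarrow> 'o \<Rightarrow> 'o set set" where
  "obj_class \<A> X \<equiv> groth_class \<A> (iso_class \<A> X)"

context abelian_category
begin

section \<open>Products and sums of isomorphism classes\<close>

lemma productD:
  assumes "is_product \<A> X Y S p q"
  shows "arr p" "arr q" "dom p = S" "dom q = S" "cod p = X" "cod q = Y" "X \<in> Ob \<A>" "Y \<in> Ob \<A>" "S \<in> Ob \<A>"
  using assms by (auto simp: is_product_def Hom_iff)

lemma product_factor:
  assumes "is_product \<A> X Y S p q" "arr x" "arr y" "dom x = dom y" "cod x = X" "cod y = Y"
  obtains u where "arr u" "dom u = dom x" "cod u = S" "p \<cdot> u = x" "q \<cdot> u = y"
proof -
  have "x \<in> Hom (dom x) X" "y \<in> Hom (dom x) Y" "dom x \<in> Ob \<A>" using assms by (auto simp: Hom_iff)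
  then have "\<exists>!u. u \<in> Hom (dom x) S \<and> p \<cdot> u = x \<and> q \<cdot> u = y"
    using assms(1) unfolding is_product_def by blast
  then show ?thesis using that by (auto simp: Hom_iff)
qed

lemma product_unique:
  assumes "is_product \<A> X Y S p q" "arr u" "arr v" "dom u = dom v" "cod u = S" "cod v = S"
    "p \<cdot> u = p \<cdot> v" "q \<cdot> u = q \<cdot> v"
  shows "u = v"
proof -
  note P = productD[OF assms(1)]
  have "p \<cdot> u \<in> Hom (dom u) X" "q \<cdot> u \<in> Hom (dom u) Y" "dom u \<in> Ob \<A>" using assms P by (auto simp: Hom_iff)
  then have "\<exists>!w. w \<in> Hom (dom u) S \<and> p \<cdot> w = p \<cdot> u \<and> q \<cdot> w = q \<cdot> u"
    using assms(1) unfolding is_product_def by blast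
  then show ?thesis using assms by (auto simp: Hom_iff)
qed

lemma productI:
  assumes "arr p" "arr q" "dom p = S" "dom q = S" "cod p = X" "cod q = Y"
    and ex: "\<And>x y. arr x \<Longrightarrow> arr y \<Longrightarrow> dom x = dom y \<Longrightarrow> cod x = X \<Longrightarrow> cod y = Y \<Longrightarrow>
      \<exists>u. arr u \<and> dom u = dom x \<and> cod u = S \<and> p \<cdot> u = x \<and> q \<cdot> u = y"
    and un: "\<And>u v. arr u \<Longrightarrow> arr v \<Longrightarrow> dom u = dom v \<Longrightarrow> cod u = S \<Longrightarrow> cod v = S \<Longrightarrow> p \<cdot> u = p \<cdot> v \<Longrightarrow> q \<cdot> u = q \<cdot> v \<Longrightarrow> u = v"
  shows "is_product \<A> X Y S p q"
  unfolding is_product_def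
proof (intro conjI ballI)
  fix W x y assume "W \<in> Ob \<A>" "x \<in> Hom W X" "y \<in> Hom W Y"
  then have xy: "arr x" "arr y" "dom x = W" "dom y = W" "cod x = X" "cod y = Y" by (auto simp: Hom_iff)
  obtain u where u: "arr u" "dom u = dom x" "cod u = S" "p \<cdot> u = x" "q \<cdot> u = y" using ex[of x y] xy by auto
  show "\<exists>!u. u \<in> Hom W S \<and> p \<cdot> u = x \<and> q \<cdot> u = y"
  proof (rule ex1I[of _ u])
    show "u \<in> Hom W S \<and> p \<cdot> u = x \<and> q \<cdot> u = y" using u xy by (simp add: Hom_iff)
    fix v assume "v \<in> Hom W S \<and> p \<cdot> v = x \<and> q \<cdot> v = y"
    then show "v = u" using un[of v u] u xy by (simp add: Hom_iff)
  qed
qed (use assms in \<open>auto simp: Hom_iff\<close>)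

lemma biproduct_product:
  assumes "is_biproduct \<A> X Y S"
  obtains p q where "is_product \<A> X Y S p q"
proof -
  obtain i j p q where "i \<in> Hom X S" "j \<in> Hom Y S" "p \<in> Hom S X" "q \<in> Hom S Y"
    and S: "S \<in> Ob \<A>" "p \<cdot> i = Ident \<A> X" "q \<cdot> j = Ident \<A> Y" "q \<cdot> i = nul X Y"
      "p \<cdot> j = nul Y X" "Plus \<A> (i \<cdot> p) (j \<cdot> q) = Ident \<A> S"
    using assms unfolding is_biproduct_def by auto
  then have h: "arr i" "arr j" "arr p" "arr q" "dom i = X" "dom j = Y" "cod i = S" "cod j = S"
      "dom p = S" "dom q = S" "cod p = X" "cod q = Y"
    by (auto simp: Hom_iff)
  then have O: "X \<in> Ob \<A>" "Y \<in> Ob \<A>" using arr_Ob by metis+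
  have "is_product \<A> X Y S p q"
  proof (rule productI)
    fix x y assume xy: "arr x" "arr y" "dom x = dom y" "cod x = X" "cod y = Y"
    define w where "w = Plus \<A> (i \<cdot> x) (j \<cdot> y)"
    have w: "arr w" "dom w = dom x" "cod w = S" using xy h by (simp_all add: w_def)
    have pw: "p \<cdot> w = x"
      using xy h S O comp_plus[of "i \<cdot> x" "j \<cdot> y" p] by (simp add: w_def reassoc[OF S(2)] reassoc[OF S(5)])
    have qw: "q \<cdot> w = y"
      using xy h S O comp_plus[of "i \<cdot> x" "j \<cdot> y" q] by (simp add: w_def reassoc[OF S(3)] reassoc[OF S(4)])
    show "\<exists>u. arr u \<and> dom u = dom x \<and> cod u = S \<and> p \<cdot> u = x \<and> q \<cdot> u = y" using w pw qw by blast
  next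
    fix u v assume u: "arr u" "arr v" "dom u = dom v" "cod u = S" "cod v = S" "p \<cdot> u = p \<cdot> v" "q \<cdot> u = q \<cdot> v"
    have "Plus \<A> (i \<cdot> p) (j \<cdot> q) \<cdot> u = Plus \<A> (i \<cdot> p) (j \<cdot> q) \<cdot> v"
      using plus_comp[of u "i \<cdot> p" "j \<cdot> q"] plus_comp[of v "i \<cdot> p" "j \<cdot> q"] u h by simp
    then show "u = v" using S u by simp
  qed (use h in auto)
  then show ?thesis using that by blast
qed

lemma product_isomorphic:
  assumes P: "is_product \<A> X Y S p q" "is_product \<A> X' Y' S' p' q'" and "isomorphic \<A> X X'" "isomorphic \<A> Y Y'"
  shows "isomorphic \<A> S S'"
proof -
  note D = productD[OF P(1)] and D' = productD[OF P(2)]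
  obtain x x' where x: "arr x" "dom x = X" "cod x = X'" "arr x'" "dom x' = X'" "cod x' = X" "x' \<cdot> x = Ident \<A> X" "x \<cdot> x' = Ident \<A> X'"
    using iso_between[OF assms(3)] by metis
  obtain y y' where y: "arr y" "dom y = Y" "cod y = Y'" "arr y'" "dom y' = Y'" "cod y' = Y" "y' \<cdot> y = Ident \<A> Y" "y \<cdot> y' = Ident \<A> Y'"
    using iso_between[OF assms(4)] by metis
  obtain u where u: "arr u" "dom u = dom (x \<cdot> p)" "cod u = S'" "p' \<cdot> u = x \<cdot> p" "q' \<cdot> u = y \<cdot> q"
    by (rule product_factor[OF P(2), of "x \<cdot> p" "y \<cdot> q"]) (use D x y in auto)
  obtain v where v: "arr v" "dom v = dom (x' \<cdot> p')" "cod v = S" "p \<cdot> v = x' \<cdot> p'" "q \<cdot> v = y' \<cdot> q'"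
    by (rule product_factor[OF P(1), of "x' \<cdot> p'" "y' \<cdot> q'"]) (use D' x y in auto)
  have d: "dom u = S" "dom v = S'" using u v x D D' by auto
  have "v \<cdot> u = Ident \<A> S"
  proof (rule product_unique[OF P(1)])
    have "p \<cdot> v \<cdot> u = x' \<cdot> p' \<cdot> u" by (rule square[OF v(4)]) (use u v x D D' d in auto)
    also have "\<dots> = p" using u(4) reassoc[OF x(7), of p] x D by simp
    finally show "p \<cdot> v \<cdot> u = p \<cdot> Ident \<A> S" using D by simp
    have "q \<cdot> v \<cdot> u = y' \<cdot> q' \<cdot> u" by (rule square[OF v(5)]) (use u v y D D' d in auto)
    also have "\<dots> = q" using u(5) reassoc[OF y(7), of q] y D by simp
    finally show "q \<cdot> v \<cdot> u = q \<cdot> Ident \<A> S" using D by simp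
  qed (use u v d D in auto)
  moreover have "u \<cdot> v = Ident \<A> S'"
  proof (rule product_unique[OF P(2)])
    have "p' \<cdot> u \<cdot> v = x \<cdot> p \<cdot> v" by (rule square[OF u(4)]) (use u v x D D' d in auto)
    also have "\<dots> = p'" using v(4) reassoc[OF x(8), of p'] x D' by simp
    finally show "p' \<cdot> u \<cdot> v = p' \<cdot> Ident \<A> S'" using D' by simp
    have "q' \<cdot> u \<cdot> v = y \<cdot> q \<cdot> v" by (rule square[OF u(5)]) (use u v y D D' d in auto)
    also have "\<dots> = q'" using v(5) reassoc[OF y(8), of q'] y D' by simp
    finally show "q' \<cdot> u \<cdot> v = q' \<cdot> Ident \<A> S'" using D' by simp
  qed (use u v d D' in auto)
  ultimately have "is_isom \<A> u" using u v d by (intro is_isomI[of u v]) auto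
  then show ?thesis unfolding isomorphic_def using u d by (auto simp: Hom_iff)
qed

lemma product_sym:
  assumes "is_product \<A> X Y S p q" shows "is_product \<A> Y X S q p"
proof (rule productI)
  note D = productD[OF assms]
  fix x y assume xy: "arr x" "arr y" "dom x = dom y" "cod x = Y" "cod y = X"
  obtain u where "arr u" "dom u = dom y" "cod u = S" "p \<cdot> u = y" "q \<cdot> u = x"
    by (rule product_factor[OF assms, of y x]) (use xy in auto)
  then show "\<exists>u. arr u \<and> dom u = dom x \<and> cod u = S \<and> q \<cdot> u = x \<and> p \<cdot> u = y" using xy by auto
qed (use productD[OF assms] product_unique[OF assms] in auto)

text \<open>The object of the product (X Y) Z is itself a product of X with Y Z, so no isomorphism
  between different bracketings has to be constructed.\<close>

lemma product_assoc:
  assumes P: "is_product \<A> X Y S p q" and Q: "is_product \<A> S Z T r t" and R: "is_product \<A> Y Z U a b"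
  obtains w where "is_product \<A> X U T (p \<cdot> r) w"
proof -
  note DP = productD[OF P] and DQ = productD[OF Q] and DR = productD[OF R]
  obtain w where w: "arr w" "dom w = T" "cod w = U" "a \<cdot> w = q \<cdot> r" "b \<cdot> w = t"
    by (rule product_factor[OF R, of "q \<cdot> r" t]) (use DP DQ in auto)
  have "is_product \<A> X U T (p \<cdot> r) w"
  proof (rule productI)
    fix x y assume xy: "arr x" "arr y" "dom x = dom y" "cod x = X" "cod y = U"
    obtain s where s: "arr s" "dom s = dom x" "cod s = S" "p \<cdot> s = x" "q \<cdot> s = a \<cdot> y"
      by (rule product_factor[OF P, of x "a \<cdot> y"]) (use xy DR in auto)
    obtain u where u: "arr u" "dom u = dom s" "cod u = T" "r \<cdot> u = s" "t \<cdot> u = b \<cdot> y"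
      by (rule product_factor[OF Q, of s "b \<cdot> y"]) (use xy s DR in auto)
    have "w \<cdot> u = y"
    proof (rule product_unique[OF R])
      have "a \<cdot> w \<cdot> u = q \<cdot> r \<cdot> u" by (rule square[OF w(4)]) (use w u DP DQ DR in auto)
      then show "a \<cdot> w \<cdot> u = a \<cdot> y" using u s by simp
      show "b \<cdot> w \<cdot> u = b \<cdot> y" using reassoc[OF w(5), of u] w u DQ DR by simp
    qed (use w u s xy in auto)
    moreover have "(p \<cdot> r) \<cdot> u = x" using u s DP DQ by simp
    ultimately show "\<exists>u. arr u \<and> dom u = dom x \<and> cod u = T \<and> (p \<cdot> r) \<cdot> u = x \<and> w \<cdot> u = y" using u s by auto
  next
    fix u v assume u: "arr u" "arr v" "dom u = dom v" "cod u = T" "cod v = T" "(p \<cdot> r) \<cdot> u = (p \<cdot> r) \<cdot> v" "w \<cdot> u = w \<cdot> v"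
    have "q \<cdot> r \<cdot> u = a \<cdot> w \<cdot> u" by (rule square[OF w(4)[symmetric]]) (use w u DP DQ DR in auto)
    moreover have "q \<cdot> r \<cdot> v = a \<cdot> w \<cdot> v" by (rule square[OF w(4)[symmetric]]) (use w u DP DQ DR in auto)
    ultimately have "q \<cdot> r \<cdot> u = q \<cdot> r \<cdot> v" using u by simp
    moreover have "p \<cdot> r \<cdot> u = p \<cdot> r \<cdot> v" using u DP DQ by simp
    ultimately have ru: "r \<cdot> u = r \<cdot> v" by (rule_tac product_unique[OF P]) (use u DQ in auto)
    have "t \<cdot> u = b \<cdot> w \<cdot> u" "t \<cdot> v = b \<cdot> w \<cdot> v" using reassoc[OF w(5)] w u DR by auto
    then have "t \<cdot> u = t \<cdot> v" using u by simp
    then show "u = v" by (rule product_unique[OF Q u(1-5) ru])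
  qed (use w DP DQ in auto)
  then show ?thesis using that by blast
qed

lemma product_zero:
  assumes "is_zero_object \<A> Z" "X \<in> Ob \<A>"
  shows "is_product \<A> X Z X (Ident \<A> X) (nul X Z)"
proof -
  have Z: "Z \<in> Ob \<A>" using assms by (simp add: is_zero_object_def)
  have un: "f = g" if "f \<in> Hom W Z" "g \<in> Hom W Z" for f g W
  proof -
    have "W \<in> Ob \<A>" using that Hom_Ob by blast
    then have "\<exists>!f. f \<in> Hom W Z" using assms(1) by (simp add: is_zero_object_def)
    then show ?thesis using that by blast
  qed
  show ?thesis
  proof (rule productI)
    fix x y assume xy: "arr x" "arr y" "dom x = dom y" "cod x = X" "cod y = Z"
    have "nul X Z \<cdot> x = y" by (rule un[of _ "dom x"]) (use xy assms Z in \<open>auto simp: Hom_iff\<close>)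
    then show "\<exists>u. arr u \<and> dom u = dom x \<and> cod u = X \<and> Ident \<A> X \<cdot> u = x \<and> nul X Z \<cdot> u = y" using xy by auto
  qed (use assms Z in auto)
qed

lemma product_ses:
  assumes P: "is_product \<A> X Y S p q"
  obtains k where "ses \<A> k p" "dom k = Y"
proof -
  note D = productD[OF P]
  obtain i where i: "arr i" "dom i = dom (Ident \<A> X)" "cod i = S" "p \<cdot> i = Ident \<A> X" "q \<cdot> i = nul X Y"
    by (rule product_factor[OF P, of "Ident \<A> X" "nul X Y"]) (use D in auto)
  obtain k where k: "arr k" "dom k = dom (nul Y X)" "cod k = S" "p \<cdot> k = nul Y X" "q \<cdot> k = Ident \<A> Y"
    by (rule product_factor[OF P, of "nul Y X" "Ident \<A> Y"]) (use D in auto)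
  have "is_epi \<A> (p \<cdot> i)" using i D by (simp add: iso_epi)
  then have e: "is_epi \<A> p" using epi_right[of p i] i D by simp
  have "is_kernel \<A> p k"
  proof (rule kernelI)
    have "is_mono \<A> (q \<cdot> k)" using k D by (simp add: iso_mono)
    then show "is_mono \<A> k" using mono_left[of q k] k D by simp
    fix h assume h: "arr h" "cod h = dom p" "p \<cdot> h = nul (dom h) (cod p)"
    have "k \<cdot> q \<cdot> h = h"
    proof (rule product_unique[OF P])
      have "p \<cdot> k \<cdot> q \<cdot> h = nul Y X \<cdot> q \<cdot> h" by (rule reassoc[OF k(4)]) (use k h D in auto)
      then show "p \<cdot> k \<cdot> q \<cdot> h = p \<cdot> h" using h D by simp
      have "q \<cdot> k \<cdot> q \<cdot> h = Ident \<A> Y \<cdot> q \<cdot> h" by (rule reassoc[OF k(5)]) (use k h D in auto)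
      then show "q \<cdot> k \<cdot> q \<cdot> h = q \<cdot> h" using h D by simp
    qed (use k h D in auto)
    then show "\<exists>u. arr u \<and> dom u = dom h \<and> cod u = dom k \<and> k \<cdot> u = h" using k h D by (intro exI[of _ "q \<cdot> h"]) auto
  qed (use k D in auto)
  then have "ses \<A> k p" using epi_kernel_ses e by blast
  then show ?thesis using that k D by auto
qed

text \<open>The square formed by \<open>g\<close>, the induced map \<open>h\<close> and the two
  projections is a pullback, so \<open>h\<close> has the same kernel object as \<open>g\<close>.
  This makes the Grothendieck relation compatible with sums.\<close>

lemma product_ses_congr:
  assumes fg: "ses \<A> f g" and P: "is_product \<A> (cod f) Z S p q" and Q: "is_product \<A> (cod g) Z S' p' q'"
  obtains k h where "ses \<A> k h" "dom k = dom f" "cod k = S" "cod h = S'"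
proof -
  note F = ses_simps[OF fg] and DP = productD[OF P] and DQ = productD[OF Q]
  obtain h where h: "arr h" "dom h = S" "cod h = S'" "p' \<cdot> h = g \<cdot> p" "q' \<cdot> h = q"
    by (rule product_factor[OF Q, of "g \<cdot> p" q]) (use F DP in auto)
  have "is_pullback \<A> g p' p h"
    unfolding is_pullback_def
  proof (intro conjI ballI impI)
    fix x y assume "arr x" "arr y" "dom x = dom y \<and> cod x = dom g \<and> cod y = dom p' \<and> g \<cdot> x = p' \<cdot> y"
    then have xy: "arr x" "arr y" "dom x = dom y" "cod x = dom g" "cod y = S'" "g \<cdot> x = p' \<cdot> y" using DQ by auto
    obtain u where u: "arr u" "dom u = dom x" "cod u = S" "p \<cdot> u = x" "q \<cdot> u = q' \<cdot> y"
      by (rule product_factor[OF P, of x "q' \<cdot> y"]) (use xy F DQ in auto)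
    have hu: "h \<cdot> u = y"
    proof (rule product_unique[OF Q])
      have "p' \<cdot> h \<cdot> u = g \<cdot> p \<cdot> u" by (rule square[OF h(4)]) (use h u F DP DQ in auto)
      then show "p' \<cdot> h \<cdot> u = p' \<cdot> y" using u xy by simp
      show "q' \<cdot> h \<cdot> u = q' \<cdot> y" using reassoc[OF h(5), of u] h u DQ by simp
    qed (use h u xy in auto)
    show "\<exists>!u. u \<in> Hom (dom x) (dom p) \<and> p \<cdot> u = x \<and> h \<cdot> u = y"
    proof (rule ex1I[of _ u])
      show "u \<in> Hom (dom x) (dom p) \<and> p \<cdot> u = x \<and> h \<cdot> u = y" using u hu DP by (simp add: Hom_iff)
      fix v assume "v \<in> Hom (dom x) (dom p) \<and> p \<cdot> v = x \<and> h \<cdot> v = y"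
      then have v: "arr v" "dom v = dom x" "cod v = S" "p \<cdot> v = x" "h \<cdot> v = y" using DP by (auto simp: Hom_iff)
      have "q \<cdot> v = q' \<cdot> y" using reassoc[OF h(5), of v] v h DQ by simp
      then show "v = u" using product_unique[OF P, of v u] u v by simp
    qed
  qed (use F DP DQ h in auto)
  then obtain k where "ses \<A> k h" "dom k = dom f" using pullback_ses[OF fg] by metis
  then show ?thesis using that h ses_simps(3) by metis
qed

lemma zero_object_class:
  assumes "is_zero_object \<A> Z" shows "iso_class \<A> Z = zero_class \<A>"
proof -
  let ?Z = "SOME Z. is_zero_object \<A> Z"
  have Z': "is_zero_object \<A> ?Z" using ex_zero_object by (rule someI_ex)
  have O: "Z \<in> Ob \<A>" "?Z \<in> Ob \<A>" using assms Z' by (auto simp: is_zero_object_def)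
  have un: "f = g" if "is_zero_object \<A> V" "f \<in> Hom W V" "g \<in> Hom W V" for f g V W
  proof -
    have "W \<in> Ob \<A>" using that Hom_Ob by blast
    then have "\<exists>!f. f \<in> Hom W V" using that(1) by (simp add: is_zero_object_def)
    then show ?thesis using that by blast
  qed
  have "is_isom \<A> (nul Z ?Z)"
    by (rule is_isomI[of _ "nul ?Z Z"])
      (use O in simp_all, rule un[OF assms, of _ Z], use O in \<open>simp_all add: Hom_iff\<close>,
       rule un[OF Z', of _ ?Z], use O in \<open>simp_all add: Hom_iff\<close>)
  then have "isomorphic \<A> Z ?Z" unfolding isomorphic_def using O by (auto simp: Hom_iff)
  then show ?thesis unfolding zero_class_def using iso_class_eq_iff O by blast
qed

lemma zero_class_Iso: "zero_class \<A> \<in> Iso \<A>"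
proof -
  obtain Z where "is_zero_object \<A> Z" using ex_zero_object by blast
  then show ?thesis using zero_object_class[of Z] iso_class_in_Iso[of Z] by (auto simp: is_zero_object_def)
qed

lemma zero_object_of_class:
  assumes "X \<in> Ob \<A>" "iso_class \<A> X = zero_class \<A>"
  shows "is_zero_object \<A> X"
proof -
  obtain Z where Z: "is_zero_object \<A> Z" using ex_zero_object by blast
  then have O: "Z \<in> Ob \<A>" by (simp add: is_zero_object_def)
  have r: "X \<in> Ob \<A>" "isomorphic \<A> Z X"
    using assms zero_object_class[OF Z] iso_class_eq_iff[of Z X] O by simp_all
  obtain u v where u: "arr u" "dom u = Z" "cod u = X" "arr v" "dom v = X" "cod v = Z"
    "v \<cdot> u = Ident \<A> Z" "u \<cdot> v = Ident \<A> X"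
    using iso_between[OF r(2)] by metis
  show ?thesis
    unfolding is_zero_object_def
  proof (intro conjI ballI)
    fix Y assume Y: "Y \<in> Ob \<A>"
    have uz: "\<exists>!f. f \<in> Hom Y Z" "\<exists>!f. f \<in> Hom Z Y" using Z Y by (auto simp: is_zero_object_def)
    show "\<exists>!f. f \<in> Hom Y X"
    proof (rule ex1I)
      show "nul Y X \<in> Hom Y X" using Y r nul_Hom by blast
      fix f assume f: "f \<in> Hom Y X"
      then have "v \<cdot> f \<in> Hom Y Z" "nul Y Z \<in> Hom Y Z" using u Y O by (auto simp: Hom_iff)
      then have e: "v \<cdot> f = nul Y Z" using uz by blast
      have "u \<cdot> v \<cdot> f = f" using reassoc[OF u(8), of f] f u by (auto simp: Hom_iff)
      then show "f = nul Y X" using e u Y by simp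
    qed
    show "\<exists>!f. f \<in> Hom X Y"
    proof (rule ex1I)
      show "nul X Y \<in> Hom X Y" using Y r nul_Hom by blast
      fix f assume f: "f \<in> Hom X Y"
      then have f': "arr f" "dom f = X" "cod f = Y" by (auto simp: Hom_iff)
      then have "f \<cdot> u \<in> Hom Z Y" "nul Z Y \<in> Hom Z Y" using u Y O by (auto simp: Hom_iff)
      then have "f \<cdot> u = nul Z Y" using uz by blast
      then have "f \<cdot> u \<cdot> v = nul Z Y \<cdot> v" by (rule reassoc) (use u f' in auto)
      then show "f = nul X Y" using u f' Y by simp
    qed
  qed (rule r)
qed

lemma rep_zero_object: "is_zero_object \<A> (rep (zero_class \<A>))"
  using zero_object_of_class rep_props[OF zero_class_Iso] by blast

lemma ex_product:
  assumes "X \<in> Ob \<A>" "Y \<in> Ob \<A>"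
  obtains S p q where "is_product \<A> X Y S p q" "is_biproduct \<A> X Y S"
  using ex_biproduct[OF assms] biproduct_product by metis

text \<open>By \<open>product_isomorphic\<close> the definite description does not depend on the
  members chosen in the two classes.\<close>

lemma Iso_plus_product:
  assumes "is_product \<A> X Y S p q"
  shows "Iso_plus \<A> (iso_class \<A> X) (iso_class \<A> Y) = iso_class \<A> S"
  unfolding Iso_plus_def
proof (rule the_equality)
  note D = productD[OF assms]
  obtain S' p' q' where S': "is_product \<A> X Y S' p' q'" "is_biproduct \<A> X Y S'" using ex_product D by metis
  have "isomorphic \<A> S S'" using product_isomorphic[OF assms S'(1)] isomorphic_refl D by blast
  then have "iso_class \<A> S = iso_class \<A> S'" using iso_class_eq_iff D productD(9)[OF S'(1)] by blast
  moreover have "X \<in> iso_class \<A> X" "Y \<in> iso_class \<A> Y" using D isomorphic_refl by (auto simp: iso_class_def)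
  ultimately show "\<exists>X \<in> iso_class \<A> X. \<exists>Y \<in> iso_class \<A> Y. \<exists>T. is_biproduct \<A> X Y T \<and> iso_class \<A> S = iso_class \<A> T"
    using S'(2) by blast
  fix c assume "\<exists>X \<in> iso_class \<A> X. \<exists>Y \<in> iso_class \<A> Y. \<exists>T. is_biproduct \<A> X Y T \<and> c = iso_class \<A> T"
  then obtain X' Y' T where T: "isomorphic \<A> X X'" "isomorphic \<A> Y Y'" "is_biproduct \<A> X' Y' T" "c = iso_class \<A> T"
    by (auto simp: iso_class_def)
  obtain p'' q'' where T': "is_product \<A> X' Y' T p'' q''" using biproduct_product[OF T(3)] by blast
  have "isomorphic \<A> S T" using product_isomorphic[OF assms T' T(1,2)] .
  then show "c = iso_class \<A> S" using T(4) iso_class_eq_iff D productD(9)[OF T'] by blast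
qed

lemma Iso_cases:
  assumes "a \<in> Iso \<A>" obtains X where "X \<in> Ob \<A>" "a = iso_class \<A> X"
  using assms by (auto simp: Iso_def)

lemma Iso_plus_closed: "a \<in> Iso \<A> \<Longrightarrow> b \<in> Iso \<A> \<Longrightarrow> Iso_plus \<A> a b \<in> Iso \<A>"
  by (elim Iso_cases) (metis ex_product Iso_plus_product productD(9) iso_class_in_Iso)

lemma Iso_plus_comm:
  assumes "a \<in> Iso \<A>" "b \<in> Iso \<A>" shows "Iso_plus \<A> a b = Iso_plus \<A> b a"
proof -
  obtain X Y where X: "X \<in> Ob \<A>" "a = iso_class \<A> X" "Y \<in> Ob \<A>" "b = iso_class \<A> Y" using assms Iso_cases by metis
  obtain S p q where "is_product \<A> X Y S p q" using ex_product X by metis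
  then show ?thesis using Iso_plus_product product_sym X by metis
qed

lemma Iso_plus_assoc:
  assumes "a \<in> Iso \<A>" "b \<in> Iso \<A>" "c \<in> Iso \<A>"
  shows "Iso_plus \<A> (Iso_plus \<A> a b) c = Iso_plus \<A> a (Iso_plus \<A> b c)"
proof -
  obtain X Y Z where X: "X \<in> Ob \<A>" "a = iso_class \<A> X" "Y \<in> Ob \<A>" "b = iso_class \<A> Y" "Z \<in> Ob \<A>" "c = iso_class \<A> Z"
    using assms Iso_cases by metis
  obtain S p q where S: "is_product \<A> X Y S p q" using ex_product X by metis
  obtain U a' b' where U: "is_product \<A> Y Z U a' b'" using ex_product X by metis
  obtain T r t where T: "is_product \<A> S Z T r t" using ex_product X productD(9)[OF S] by metis
  obtain w where "is_product \<A> X U T (p \<cdot> r) w" using product_assoc[OF S T U] by blast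
  then show ?thesis using Iso_plus_product S U T X by metis
qed

lemma Iso_plus_zero: "a \<in> Iso \<A> \<Longrightarrow> Iso_plus \<A> a (zero_class \<A>) = a"
proof -
  assume "a \<in> Iso \<A>"
  then obtain X where X: "X \<in> Ob \<A>" "a = iso_class \<A> X" using Iso_cases by blast
  obtain Z where Z: "is_zero_object \<A> Z" using ex_zero_object by blast
  show ?thesis using Iso_plus_product[OF product_zero[OF Z X(1)]] X zero_object_class[OF Z] by simp
qed

section \<open>The Grothendieck congruence\<close>

lemma Ext_objectsI:
  assumes "ses \<A> f g" shows "iso_class \<A> (cod f) \<in> Ext_objects \<A> (cod g) (dom f)"
proof -
  have "short_exact \<A> (dom f) (cod f) (cod g) (f, g)"
    using assms ses_simps(1-3)[OF assms] by (simp add: short_exact_iff Hom_iff)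
  moreover have "cod f \<in> Ob \<A>" using ses_simps(1)[OF assms] by simp
  ultimately show ?thesis unfolding Ext_objects_def by (intro CollectI exI conjI) auto
qed

lemma Ext_objectsE:
  assumes "a \<in> Ext_objects \<A> M N"
  obtains f g where "ses \<A> f g" "dom f = N" "cod g = M" "a = iso_class \<A> (cod f)"
  using assms unfolding Ext_objects_def by (auto simp: short_exact_iff Hom_iff)

definition ext_rel :: "('o set \<times> 'o set) set" where
  "ext_rel = {(a, b). \<exists>M \<in> Ob \<A>. \<exists>N \<in> Ob \<A>. a \<in> Ext_objects \<A> M N \<and> b \<in> Ext_objects \<A> M N}"

lemma groth_rel_ext: "groth_rel \<A> = ext_rel\<^sup>+"
  by (simp add: groth_rel_def ext_rel_def)

lemma ext_relI:
  assumes "ses \<A> f g" "ses \<A> f' g'" "dom f = dom f'" "cod g = cod g'"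
  shows "(iso_class \<A> (cod f), iso_class \<A> (cod f')) \<in> ext_rel"
proof -
  have "iso_class \<A> (cod f) \<in> Ext_objects \<A> (cod g) (dom f)" "iso_class \<A> (cod f') \<in> Ext_objects \<A> (cod g) (dom f)"
    using Ext_objectsI[OF assms(1)] Ext_objectsI[OF assms(2)] assms(3,4) by simp_all
  moreover have "cod g \<in> Ob \<A>" "dom f \<in> Ob \<A>" using ses_simps(1,2)[OF assms(1)] by simp_all
  ultimately show ?thesis unfolding ext_rel_def by blast
qed

lemma ext_relE:
  assumes "(a, b) \<in> ext_rel"
  obtains f g f' g' where "ses \<A> f g" "ses \<A> f' g'" "dom f = dom f'" "cod g = cod g'"
    "a = iso_class \<A> (cod f)" "b = iso_class \<A> (cod f')"
  using assms unfolding ext_rel_def by (auto elim!: Ext_objectsE)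

lemma ext_rel_Iso: "(a, b) \<in> ext_rel \<Longrightarrow> a \<in> Iso \<A> \<and> b \<in> Iso \<A>"
  by (erule ext_relE) (auto dest: ses_simps(1))

lemma ses_zero:
  assumes "X \<in> Ob \<A>" "is_zero_object \<A> Z"
  obtains f g where "ses \<A> f g" "dom f = Z" "cod f = X" "cod g = X"
  using product_ses[OF product_zero[OF assms(2,1)]] that assms(1) ses_simps(3) by (metis ident_simps(2,3))

lemma groth_rel_equiv: "equiv (Iso \<A>) (groth_rel \<A>)"
proof (intro equivI refl_onI)
  have "ext_rel \<subseteq> Iso \<A> \<times> Iso \<A>" using ext_rel_Iso by auto
  then show "groth_rel \<A> \<subseteq> Iso \<A> \<times> Iso \<A>" unfolding groth_rel_ext by (rule trancl_subset_Sigma)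
  have "sym ext_rel" by (auto simp: ext_rel_def sym_def)
  then show "sym (groth_rel \<A>)" unfolding groth_rel_ext by (rule sym_trancl)
  show "trans (groth_rel \<A>)" unfolding groth_rel_ext by (rule trans_trancl)
  fix a assume "a \<in> Iso \<A>"
  then obtain X where X: "X \<in> Ob \<A>" "a = iso_class \<A> X" using Iso_cases by blast
  \<comment> \<open>\<open>groth_rel\<close> is a transitive closure only; reflexivity comes from
    the sequence 0 \<rightarrow> X \<rightarrow> X.\<close>
  obtain Z where "is_zero_object \<A> Z" using ex_zero_object by blast
  then obtain f g where "ses \<A> f g" "cod f = X" using ses_zero X by metis
  then show "(a, a) \<in> groth_rel \<A>" unfolding groth_rel_ext using ext_relI[of f g f g] X by auto
qed

lemma groth_class_eq_iff: "a \<in> Iso \<A> \<Longrightarrow> b \<in> Iso \<A> \<Longrightarrow> groth_class \<A> a = groth_class \<A> b \<longleftrightarrow> (a, b) \<in> groth_rel \<A>"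
  unfolding groth_class_def using eq_equiv_class_iff[OF groth_rel_equiv] by blast

lemma ext_rel_congr:
  assumes "(a, b) \<in> ext_rel" "c \<in> Iso \<A>"
  shows "(Iso_plus \<A> a c, Iso_plus \<A> b c) \<in> ext_rel"
proof -
  obtain f g f' g' where s: "ses \<A> f g" "ses \<A> f' g'" "dom f = dom f'" "cod g = cod g'"
    "a = iso_class \<A> (cod f)" "b = iso_class \<A> (cod f')" using assms(1) by (rule ext_relE)
  obtain Z where Z: "Z \<in> Ob \<A>" "c = iso_class \<A> Z" using assms Iso_cases by blast
  have O: "cod f \<in> Ob \<A>" "cod f' \<in> Ob \<A>" "cod g \<in> Ob \<A>" using ses_simps(1,2)[OF s(1)] ses_simps(1)[OF s(2)] by auto
  obtain S p q where S: "is_product \<A> (cod f) Z S p q" using ex_product O Z by metis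
  obtain S' p' q' where S': "is_product \<A> (cod f') Z S' p' q'" using ex_product O Z by metis
  obtain T r t where T: "is_product \<A> (cod g) Z T r t" using ex_product O Z by metis
  obtain k h where k: "ses \<A> k h" "dom k = dom f" "cod k = S" "cod h = T" using product_ses_congr[OF s(1) S T] by blast
  have T': "is_product \<A> (cod g') Z T r t" using T s(4) by simp
  obtain k' h' where k': "ses \<A> k' h'" "dom k' = dom f'" "cod k' = S'" "cod h' = T" using product_ses_congr[OF s(2) S' T'] by blast
  show ?thesis using ext_relI[OF k(1) k'(1)] k k' s Iso_plus_product[OF S] Iso_plus_product[OF S'] Z by simp
qed

lemma groth_rel_congr:
  assumes "(a, b) \<in> groth_rel \<A>" "c \<in> Iso \<A>"
  shows "(Iso_plus \<A> a c, Iso_plus \<A> b c) \<in> groth_rel \<A>"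
  using assms(1) unfolding groth_rel_ext
proof (induction rule: trancl_induct)
  case (base y) then show ?case using ext_rel_congr assms(2) by blast
next
  case (step y z) then show ?case using ext_rel_congr[OF step(2) assms(2)] by (meson trancl_into_trancl)
qed

lemma groth_carrier: "carrier (groth_monoid \<A>) = groth_class \<A> ` Iso \<A>"
  by (auto simp: groth_monoid_def quotient_def groth_class_def)

lemma groth_class_carrier: "a \<in> Iso \<A> \<Longrightarrow> groth_class \<A> a \<in> carrier (groth_monoid \<A>)"
  by (simp add: groth_carrier)

lemma groth_mult:
  assumes "a \<in> Iso \<A>" "b \<in> Iso \<A>"
  shows "groth_class \<A> a \<otimes>\<^bsub>groth_monoid \<A>\<^esub> groth_class \<A> b = groth_class \<A> (Iso_plus \<A> a b)"
proof -
  have self: "a \<in> groth_class \<A> a" "b \<in> groth_class \<A> b"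
    unfolding groth_class_def using equiv_class_self[OF groth_rel_equiv] assms by auto
  have "(THE \<epsilon>. \<exists>a' \<in> groth_class \<A> a. \<exists>b' \<in> groth_class \<A> b. \<epsilon> = groth_class \<A> (Iso_plus \<A> a' b')) = groth_class \<A> (Iso_plus \<A> a b)"
  proof (rule the_equality)
    show "\<exists>a' \<in> groth_class \<A> a. \<exists>b' \<in> groth_class \<A> b. groth_class \<A> (Iso_plus \<A> a b) = groth_class \<A> (Iso_plus \<A> a' b')"
      using self by blast
    fix \<epsilon> assume "\<exists>a' \<in> groth_class \<A> a. \<exists>b' \<in> groth_class \<A> b. \<epsilon> = groth_class \<A> (Iso_plus \<A> a' b')"
    then obtain a' b' where ab: "(a, a') \<in> groth_rel \<A>" "(b, b') \<in> groth_rel \<A>" "\<epsilon> = groth_class \<A> (Iso_plus \<A> a' b')"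
      by (auto simp: groth_class_def)
    have I: "a' \<in> Iso \<A>" "b' \<in> Iso \<A>" using ab equiv_type[OF groth_rel_equiv] by auto
    \<comment> \<open>The congruence property is known in the first argument; commutativity supplies
      the second.\<close>
    have "(Iso_plus \<A> a b, Iso_plus \<A> a' b) \<in> groth_rel \<A>" using groth_rel_congr ab assms by blast
    moreover have "(Iso_plus \<A> b a', Iso_plus \<A> b' a') \<in> groth_rel \<A>" using groth_rel_congr ab I by blast
    ultimately have "(Iso_plus \<A> a b, Iso_plus \<A> a' b') \<in> groth_rel \<A>"
      using Iso_plus_comm[of b a'] Iso_plus_comm[of b' a'] I assms groth_rel_equiv
      by (metis equiv_def transD)
    then show "\<epsilon> = groth_class \<A> (Iso_plus \<A> a b)"
      unfolding ab(3) using groth_class_eq_iff Iso_plus_closed I assms by metis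
  qed
  then show ?thesis by (simp add: groth_monoid_def)
qed

lemma groth_one: "\<one>\<^bsub>groth_monoid \<A>\<^esub> = groth_class \<A> (zero_class \<A>)"
  by (simp add: groth_monoid_def)

lemma groth_comm_monoid: "comm_monoid (groth_monoid \<A>)"
proof (rule comm_monoidI)
  fix x y assume "x \<in> carrier (groth_monoid \<A>)" "y \<in> carrier (groth_monoid \<A>)"
  then show "x \<otimes>\<^bsub>groth_monoid \<A>\<^esub> y = y \<otimes>\<^bsub>groth_monoid \<A>\<^esub> x"
    by (auto simp: groth_carrier groth_mult) (metis Iso_plus_comm)+
qed (auto simp: groth_carrier groth_mult groth_one Iso_plus_closed zero_class_Iso Iso_plus_assoc
      Iso_plus_comm[of "zero_class \<A>"] Iso_plus_zero)

text \<open>The split sequence has the same ends, so the middle term is identified with the direct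
  sum.\<close>

lemma obj_class_ses:
  assumes "ses \<A> f g"
  shows "obj_class \<A> (cod f) = obj_class \<A> (cod g) \<otimes>\<^bsub>groth_monoid \<A>\<^esub> obj_class \<A> (dom f)"
proof -
  have O: "cod g \<in> Ob \<A>" "dom f \<in> Ob \<A>" "cod f \<in> Ob \<A>" using ses_simps(1,2)[OF assms] by auto
  obtain S p q where S: "is_product \<A> (cod g) (dom f) S p q" using ex_product O by metis
  obtain k where k: "ses \<A> k p" "dom k = dom f" using product_ses[OF S] by blast
  have "cod k = S" "cod p = cod g" using ses_simps(3)[OF k(1)] productD[OF S] by auto
  then have "(iso_class \<A> (cod f), iso_class \<A> S) \<in> groth_rel \<A>"
    unfolding groth_rel_ext using ext_relI[OF assms k(1)] k by auto
  then have "obj_class \<A> (cod f) = obj_class \<A> S" using groth_class_eq_iff O productD(9)[OF S] by simp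
  also have "\<dots> = groth_class \<A> (Iso_plus \<A> (iso_class \<A> (cod g)) (iso_class \<A> (dom f)))" using Iso_plus_product[OF S] by simp
  finally show ?thesis using groth_mult O by simp
qed

lemma constituents_ses:
  assumes "ses \<A> f g" "iso_class \<A> (cod f) \<in> constituents \<A> \<gamma>"
  shows "iso_class \<A> (dom f) \<in> constituents \<A> \<gamma>" "iso_class \<A> (cod g) \<in> constituents \<A> \<gamma>"
proof -
  interpret G: comm_monoid "groth_monoid \<A>" by (rule groth_comm_monoid)
  have O: "iso_class \<A> (cod g) \<in> Iso \<A>" "iso_class \<A> (dom f) \<in> Iso \<A>" "iso_class \<A> (cod f) \<in> Iso \<A>"
    using ses_simps(1,2)[OF assms(1)] by auto
  obtain b where b: "b \<in> Iso \<A>" "groth_class \<A> (Iso_plus \<A> (iso_class \<A> (cod f)) b) = \<gamma>" using assms(2) by (auto simp: constituents_def)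
  have 1: "\<gamma> = (obj_class \<A> (cod g) \<otimes>\<^bsub>groth_monoid \<A>\<^esub> obj_class \<A> (dom f)) \<otimes>\<^bsub>groth_monoid \<A>\<^esub> groth_class \<A> b"
    using b groth_mult[OF O(3) b(1)] obj_class_ses[OF assms(1)] by simp
  have c: "obj_class \<A> (cod g) \<in> carrier (groth_monoid \<A>)" "obj_class \<A> (dom f) \<in> carrier (groth_monoid \<A>)"
    "groth_class \<A> b \<in> carrier (groth_monoid \<A>)" using O b groth_class_carrier by auto
  have "\<gamma> = obj_class \<A> (dom f) \<otimes>\<^bsub>groth_monoid \<A>\<^esub> (obj_class \<A> (cod g) \<otimes>\<^bsub>groth_monoid \<A>\<^esub> groth_class \<A> b)"
    unfolding 1 using c by (simp add: G.m_ac)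
  then have "\<gamma> = groth_class \<A> (Iso_plus \<A> (iso_class \<A> (dom f)) (Iso_plus \<A> (iso_class \<A> (cod g)) b))"
    using groth_mult O b Iso_plus_closed by simp
  then show "iso_class \<A> (dom f) \<in> constituents \<A> \<gamma>" unfolding constituents_def using O b Iso_plus_closed by auto
  have "\<gamma> = obj_class \<A> (cod g) \<otimes>\<^bsub>groth_monoid \<A>\<^esub> (obj_class \<A> (dom f) \<otimes>\<^bsub>groth_monoid \<A>\<^esub> groth_class \<A> b)"
    unfolding 1 using c by (simp add: G.m_ac)
  then have "\<gamma> = groth_class \<A> (Iso_plus \<A> (iso_class \<A> (cod g)) (Iso_plus \<A> (iso_class \<A> (dom f)) b))"
    using groth_mult O b Iso_plus_closed by simp
  then show "iso_class \<A> (cod g) \<in> constituents \<A> \<gamma>" unfolding constituents_def using O b Iso_plus_closed by auto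
qed

lemma constituents_self: "a \<in> Iso \<A> \<Longrightarrow> a \<in> constituents \<A> (groth_class \<A> a)"
  unfolding constituents_def using zero_class_Iso Iso_plus_zero[of a] by (auto intro!: bexI[of _ "zero_class \<A>"])

lemma constituents_Iso: "constituents \<A> \<gamma> \<subseteq> Iso \<A>"
  by (auto simp: constituents_def)

end

context hom_finite
begin

text \<open>A retract is determined up to isomorphism by the idempotent \<open>i \<cdot> p\<close>:
  if two idempotents agree, \<open>q \<cdot> i\<close> and \<open>p \<cdot> j\<close> are inverse to
  each other. There are only finitely many endomorphisms of X.\<close>

lemma finite_retracts:
  assumes "X \<in> Ob \<A>"
  shows "finite {a \<in> Iso \<A>. \<exists>i \<in> Hom (rep a) X. \<exists>p \<in> Hom X (rep a). p \<cdot> i = Ident \<A> (rep a)}"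
proof -
  let ?D = "{a \<in> Iso \<A>. \<exists>i \<in> Hom (rep a) X. \<exists>p \<in> Hom X (rep a). p \<cdot> i = Ident \<A> (rep a)}"
  have "\<forall>a \<in> ?D. \<exists>ip. fst ip \<in> Hom (rep a) X \<and> snd ip \<in> Hom X (rep a) \<and> snd ip \<cdot> fst ip = Ident \<A> (rep a)" by auto
  from bchoice[OF this] obtain F where "\<forall>a \<in> ?D. fst (F a) \<in> Hom (rep a) X \<and> snd (F a) \<in> Hom X (rep a) \<and> snd (F a) \<cdot> fst (F a) = Ident \<A> (rep a)"
    by blast
  note F = this[rule_format]
  have "inj_on (\<lambda>a. fst (F a) \<cdot> snd (F a)) ?D"
  proof (rule inj_onI)
    fix a b assume ab: "a \<in> ?D" "b \<in> ?D" "fst (F a) \<cdot> snd (F a) = fst (F b) \<cdot> snd (F b)"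
    define i where "i = fst (F a)" define p where "p = snd (F a)"
    define j where "j = fst (F b)" define q where "q = snd (F b)"
    have i: "arr i" "dom i = rep a" "cod i = X" "arr p" "dom p = X" "cod p = rep a" "p \<cdot> i = Ident \<A> (rep a)"
      using F[OF ab(1)] by (auto simp: i_def p_def Hom_iff)
    have j: "arr j" "dom j = rep b" "cod j = X" "arr q" "dom q = X" "cod q = rep b" "q \<cdot> j = Ident \<A> (rep b)"
      using F[OF ab(2)] by (auto simp: j_def q_def Hom_iff)
    have e: "i \<cdot> p = j \<cdot> q" using ab by (simp add: i_def p_def j_def q_def)
    have r: "rep a \<in> Ob \<A>" "rep b \<in> Ob \<A>" "iso_class \<A> (rep a) = a" "iso_class \<A> (rep b) = b" using ab rep_props by auto
    have "j \<cdot> q \<cdot> i = i \<cdot> p \<cdot> i" by (rule square[OF e[symmetric]]) (use i j in auto)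
    then have "p \<cdot> j \<cdot> q \<cdot> i = Ident \<A> (rep a)" using i r by simp
    then have 1: "(p \<cdot> j) \<cdot> q \<cdot> i = Ident \<A> (rep a)" using i j by simp
    have "i \<cdot> p \<cdot> j = j \<cdot> q \<cdot> j" by (rule square[OF e]) (use i j in auto)
    then have "q \<cdot> i \<cdot> p \<cdot> j = Ident \<A> (rep b)" using j r by simp
    then have 2: "(q \<cdot> i) \<cdot> p \<cdot> j = Ident \<A> (rep b)" using i j by simp
    have "is_isom \<A> (q \<cdot> i)" by (rule is_isomI[of _ "p \<cdot> j"]) (use 1 2 i j in \<open>simp_all del: comp_assoc\<close>)
    then have "isomorphic \<A> (rep a) (rep b)" unfolding isomorphic_def using i j by (auto simp: Hom_iff)
    then show "a = b" using r iso_class_eq_iff by metis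
  qed
  moreover have "(\<lambda>a. fst (F a) \<cdot> snd (F a)) ` ?D \<subseteq> Hom X X" using F by (fastforce simp: Hom_iff)
  then have "finite ((\<lambda>a. fst (F a) \<cdot> snd (F a)) ` ?D)" using finite_Hom[OF assms assms] finite_subset by blast
  ultimately show ?thesis using finite_imageD by blast
qed

end

locale hall_category = abelian_category \<A> for \<A> :: "('o, 'm) preadd_cat" +
  assumes profinitary: "profinitary \<A>" and hereditary: "hereditary \<A>"

sublocale hall_category \<subseteq> hom_finite
  by unfold_locales (use profinitary in \<open>simp add: profinitary_def\<close>)

context hall_category
begin

text \<open>A member is a retract of one of the finitely many objects of class \<gamma>.\<close>

lemma finite_constituents:
  assumes "\<gamma> \<in> carrier (groth_monoid \<A>)"
  shows "finite (constituents \<A> \<gamma>)"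
proof -
  let ?D = "\<lambda>X. {a \<in> Iso \<A>. \<exists>i \<in> Hom (rep a) X. \<exists>p \<in> Hom X (rep a). p \<cdot> i = Ident \<A> (rep a)}"
  let ?G = "{x \<in> Iso \<A>. groth_class \<A> x = \<gamma>}"
  have "constituents \<A> \<gamma> \<subseteq> (\<Union>x \<in> ?G. ?D (rep x))"
  proof
    fix a assume "a \<in> constituents \<A> \<gamma>"
    then obtain b where ab: "a \<in> Iso \<A>" "b \<in> Iso \<A>" "groth_class \<A> (Iso_plus \<A> a b) = \<gamma>" by (auto simp: constituents_def)
    define x where "x = Iso_plus \<A> a b"
    have x: "x \<in> ?G" using ab Iso_plus_closed by (simp add: x_def)
    obtain S p q where S: "is_product \<A> (rep a) (rep b) S p q" using ex_product rep_props ab by metis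
    note D = productD[OF S]
    have "iso_class \<A> S = x" using Iso_plus_product[OF S] rep_props ab by (simp add: x_def)
    then have "isomorphic \<A> S (rep x)" using rep_iso_class[of S] D by simp
    then obtain u v where u: "arr u" "dom u = S" "cod u = rep x" "arr v" "dom v = rep x" "cod v = S" "v \<cdot> u = Ident \<A> S"
      using iso_between by metis
    obtain i where i: "arr i" "dom i = dom (Ident \<A> (rep a))" "cod i = S" "p \<cdot> i = Ident \<A> (rep a)"
      by (rule product_factor[OF S, of "Ident \<A> (rep a)" "nul (rep a) (rep b)"]) (use D in auto)
    have "v \<cdot> u \<cdot> i = i" using reassoc[OF u(7), of i] u i by simp
    then have "(p \<cdot> v) \<cdot> u \<cdot> i = Ident \<A> (rep a)" using u i D by simp
    moreover have "u \<cdot> i \<in> Hom (rep a) (rep x)" "p \<cdot> v \<in> Hom (rep x) (rep a)" using u i D by (auto simp: Hom_iff)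
    ultimately show "a \<in> (\<Union>x \<in> ?G. ?D (rep x))" using ab x by blast
  qed
  moreover have "finite ?G" using profinitary assms by (simp add: profinitary_def)
  moreover have "finite (?D (rep x))" if "x \<in> ?G" for x using finite_retracts[of "rep x"] rep_props(1)[of x] that by simp
  ultimately show ?thesis using finite_subset[of "constituents \<A> \<gamma>"] finite_UN_I[of ?G "\<lambda>x. ?D (rep x)"] by simp
qed

section \<open>The Euler form and its multiplicativity\<close>

definition euler :: "'o \<Rightarrow> 'o \<Rightarrow> rat" where
  "euler M N = of_nat (card (yoneda_Ext \<A> 1 M N)) / of_nat (card (Hom M N))"

lemma fillings_sum_euler:
  assumes "is_kernel \<A> c n" "is_cokernel \<A> c m" "finite F" "F \<subseteq> Iso \<A>"
    "\<And>X. X \<in> Ob \<A> \<Longrightarrow> fillings \<A> c m X \<noteq> {} \<Longrightarrow> iso_class \<A> X \<in> F"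
  shows "(\<Sum>x \<in> F. of_nat (card (fillings \<A> c m (rep x))) / aut \<A> (rep x)) = euler (cod m) (dom n)"
  unfolding euler_def card_fillings_yoneda[OF hereditary assms(1,2), symmetric]
  by (rule filling_sum[OF assms(1,2) _ assms(3-5)]) (use finite_Hom in auto)

text \<open>Riedtmann's formula summed over the middle terms: extensions are the fillings of the
  2-extension with zero middle map.\<close>

lemma ext_sum_euler:
  assumes "M \<in> Ob \<A>" "N \<in> Ob \<A>" "finite F" "F \<subseteq> Iso \<A>"
    and F: "\<And>X. X \<in> Ob \<A> \<Longrightarrow> ext_pairs \<A> M N X \<noteq> {} \<Longrightarrow> iso_class \<A> X \<in> F"
  shows "(\<Sum>x \<in> F. of_nat (card (ext_pairs \<A> M N (rep x))) / aut \<A> (rep x)) = euler M N"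
proof -
  have e: "fillings \<A> (nul N M) (Ident \<A> M) X = ext_pairs \<A> M N X" for X
  proof (rule set_eqI_pair)
    fix s t
    show "(s, t) \<in> fillings \<A> (nul N M) (Ident \<A> M) X \<longleftrightarrow> (s, t) \<in> ext_pairs \<A> M N X"
    proof
      assume "(s, t) \<in> fillings \<A> (nul N M) (Ident \<A> M) X"
      from fillingD[OF this] show "(s, t) \<in> ext_pairs \<A> M N X" using assms(1,2) by (intro ext_pairsI) simp_all
    next
      assume "(s, t) \<in> ext_pairs \<A> M N X"
      note e = ext_pairsD[OF this]
      show "(s, t) \<in> fillings \<A> (nul N M) (Ident \<A> M) X"
        using e ses_simps(4)[OF e(7)] by (intro fillingI) simp_all
    qed
  qed
  have k: "is_kernel \<A> (nul N M) (Ident \<A> N)" "is_cokernel \<A> (nul N M) (Ident \<A> M)"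
    using assms(1,2) by (auto intro!: kernelI cokernelI iso_mono iso_epi)
  show ?thesis using fillings_sum_euler[OF k assms(3,4)] F assms(1,2) by (simp add: e)
qed

lemma finite_groth_fiber: "\<gamma> \<in> carrier (groth_monoid \<A>) \<Longrightarrow> finite {x \<in> Iso \<A>. groth_class \<A> x = \<gamma>}"
  using profinitary by (simp add: profinitary_def)

text \<open>The cardinality of an infinite set is 0 by convention, so positivity includes the
  finiteness of Ext^1. It is read off from the weighted count, a finite sum to which the direct sum
  contributes a positive term.\<close>

lemma euler_pos:
  assumes "M \<in> Ob \<A>" "N \<in> Ob \<A>" shows "euler M N > 0"
proof -
  obtain S p q where S: "is_product \<A> M N S p q" using ex_product assms by metis
  obtain k where k: "ses \<A> k p" "dom k = N" using product_ses[OF S] by blast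
  note D = productD[OF S] and K = ses_simps[OF k(1)]
  define \<gamma> where "\<gamma> = obj_class \<A> M \<otimes>\<^bsub>groth_monoid \<A>\<^esub> obj_class \<A> N"
  interpret G: comm_monoid "groth_monoid \<A>" by (rule groth_comm_monoid)
  have \<gamma>: "\<gamma> \<in> carrier (groth_monoid \<A>)" unfolding \<gamma>_def using assms groth_class_carrier by simp
  let ?F = "{x \<in> Iso \<A>. groth_class \<A> x = \<gamma>}"
  have "(\<Sum>x \<in> ?F. of_nat (card (ext_pairs \<A> M N (rep x))) / aut \<A> (rep x)) = euler M N"
  proof (rule ext_sum_euler[OF assms finite_groth_fiber[OF \<gamma>]])
    fix X assume "X \<in> Ob \<A>" "ext_pairs \<A> M N X \<noteq> {}"
    then obtain f g where "(f, g) \<in> ext_pairs \<A> M N X" by auto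
    note e = ext_pairsD[OF this]
    show "iso_class \<A> X \<in> ?F" using obj_class_ses[OF e(7)] e by (simp add: \<gamma>_def)
  qed auto
  moreover have "(\<Sum>x \<in> ?F. of_nat (card (ext_pairs \<A> M N (rep x))) / aut \<A> (rep x)) > (0 :: rat)"
  proof (rule sum_pos2[OF finite_groth_fiber[OF \<gamma>], of "iso_class \<A> S"])
    show "iso_class \<A> S \<in> ?F" using obj_class_ses[OF k(1)] k K D by (simp add: \<gamma>_def)
    let ?S = "rep (iso_class \<A> S)"
    obtain u v where u: "arr u" "dom u = S" "cod u = ?S" "arr v" "dom v = ?S" "cod v = S" "v \<cdot> u = Ident \<A> S" "u \<cdot> v = Ident \<A> ?S"
      "is_isom \<A> u"
      using iso_between[OF rep_iso_class[of S]] D by metis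
    have "ses \<A> (u \<cdot> k) (p \<cdot> v)" by (rule ses_isom_mid[OF k(1)]) (use u K D in auto)
    then have "(u \<cdot> k, p \<cdot> v) \<in> ext_pairs \<A> M N ?S" using u k K D by (intro ext_pairsI) auto
    then have "card (ext_pairs \<A> M N ?S) > 0" using finite_ext_pairs by (auto simp: card_gt_0_iff)
    moreover have "aut \<A> ?S > 0" using aut_pos rep_props(1) D by simp
    ultimately show "(0 :: rat) < of_nat (card (ext_pairs \<A> M N ?S)) / aut \<A> ?S" by simp
    show "(0 :: rat) \<le> of_nat (card (ext_pairs \<A> M N (rep x))) / aut \<A> (rep x)" for x by simp
  qed
  ultimately show ?thesis by simp
qed

lemma fillings_obj_class:
  assumes "(s, t) \<in> fillings \<A> c m X"
  shows "obj_class \<A> X = obj_class \<A> (cod (m \<cdot> t)) \<otimes>\<^bsub>groth_monoid \<A>\<^esub> obj_class \<A> (dom c)"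
  using fillingD[OF assms] obj_class_ses by metis

text \<open>All sums run over the constituents of the one class of \<open>cod k\<close> plus Z. The
  fillings that compare them belong to 2-extensions of \<open>cod r\<close> by Z, whence the factor
  \<open>euler (cod r) Z\<close>.\<close>

lemma euler_ses_left:
  assumes kr: "ses \<A> k r" and Z: "Z \<in> Ob \<A>"
  shows "euler (cod k) Z = euler (cod r) Z * euler (dom k) Z"
proof -
  interpret G: comm_monoid "groth_monoid \<A>" by (rule groth_comm_monoid)
  note K = ses_simps[OF kr]
  have O: "cod k \<in> Ob \<A>" "cod r \<in> Ob \<A>" "dom k \<in> Ob \<A>" using K by auto
  define \<gamma> where "\<gamma> = obj_class \<A> (cod k) \<otimes>\<^bsub>groth_monoid \<A>\<^esub> obj_class \<A> Z"
  have \<gamma>: "\<gamma> \<in> carrier (groth_monoid \<A>)" unfolding \<gamma>_def using O Z groth_class_carrier by simp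
  let ?F = "constituents \<A> \<gamma>"
  note F = finite_constituents[OF \<gamma>] constituents_Iso
  have self: "iso_class \<A> X \<in> ?F" if "X \<in> Ob \<A>" "obj_class \<A> X = \<gamma>" for X
    using that constituents_self[of "iso_class \<A> X"] by simp
  have c: "obj_class \<A> X \<in> carrier (groth_monoid \<A>)" if "X \<in> Ob \<A>" for X using groth_class_carrier that by simp
  have "(\<Sum>x \<in> ?F. of_nat (card (ext_pairs \<A> (cod k) Z (rep x))) / aut \<A> (rep x)) = euler (cod k) Z"
  proof (rule ext_sum_euler[OF O(1) Z F])
    fix X assume X: "X \<in> Ob \<A>" "ext_pairs \<A> (cod k) Z X \<noteq> {}"
    then obtain f g where "(f, g) \<in> ext_pairs \<A> (cod k) Z X" by auto
    note e = ext_pairsD[OF this]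
    show "iso_class \<A> X \<in> ?F" using obj_class_ses[OF e(7)] e by (intro self) (auto simp: \<gamma>_def)
  qed
  moreover have "(\<Sum>x \<in> ?F. of_nat (card (ext_pairs \<A> (cod k) Z (rep x))) / aut \<A> (rep x)) =
    euler (cod r) Z * (\<Sum>x \<in> ?F. of_nat (card (ext_pairs \<A> (dom k) Z (rep x))) / aut \<A> (rep x))"
  proof (rule ext_sum_mult[OF kr F F])
    fix f g x assume x: "x \<in> ?F" "ses \<A> f g" "cod f = rep x"
    have "iso_class \<A> (rep x) = x" using rep_props(2) x(1) constituents_Iso by blast
    then show "iso_class \<A> (dom f) \<in> ?F" using constituents_ses(1)[OF x(2), of \<gamma>] x by simp
  next
    fix j q assume j: "ses \<A> j q" "dom j = Z" "cod q = dom k" "is_kernel \<A> (k \<cdot> q) j" "is_cokernel \<A> (k \<cdot> q) r"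
    note J = ses_simps[OF j(1)]
    show "(\<Sum>x \<in> ?F. of_nat (card (fillings \<A> (k \<cdot> q) r (rep x))) / aut \<A> (rep x)) = euler (cod r) Z"
      unfolding j(2)[symmetric]
    proof (rule fillings_sum_euler[OF j(4,5) F])
      fix X assume X: "X \<in> Ob \<A>" "fillings \<A> (k \<cdot> q) r X \<noteq> {}"
      then obtain s t where st: "(s, t) \<in> fillings \<A> (k \<cdot> q) r X" by auto
      note f = fillingD[OF st]
      have d: "cod (r \<cdot> t) = cod r" "dom (k \<cdot> q) = cod j" using f J K j by auto
      have "obj_class \<A> X = obj_class \<A> (cod r) \<otimes>\<^bsub>groth_monoid \<A>\<^esub> (obj_class \<A> (dom k) \<otimes>\<^bsub>groth_monoid \<A>\<^esub> obj_class \<A> Z)"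
        using fillings_obj_class[OF st] d obj_class_ses[OF j(1)] j by simp
      also have "\<dots> = \<gamma>" unfolding \<gamma>_def obj_class_ses[OF kr] using c O Z by (simp add: G.m_assoc)
      finally show "iso_class \<A> X \<in> ?F" using X self by blast
    qed
  qed
  moreover have "(\<Sum>x \<in> ?F. of_nat (card (ext_pairs \<A> (dom k) Z (rep x))) / aut \<A> (rep x)) = euler (dom k) Z"
  proof (rule ext_sum_euler[OF O(3) Z F])
    fix X assume X: "X \<in> Ob \<A>" "ext_pairs \<A> (dom k) Z X \<noteq> {}"
    then obtain f g where "(f, g) \<in> ext_pairs \<A> (dom k) Z X" by auto
    note e = ext_pairsD[OF this]
    \<comment> \<open>The class of an extension of \<open>dom k\<close> by Z need not be \<gamma>,
      but becomes \<gamma> after adding \<open>cod r\<close>; so the extension is a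
      constituent.\<close>
    have "\<gamma> = obj_class \<A> X \<otimes>\<^bsub>groth_monoid \<A>\<^esub> obj_class \<A> (cod r)"
      using obj_class_ses[OF e(7)] obj_class_ses[OF kr] e c O Z by (simp add: \<gamma>_def G.m_ac)
    then show "iso_class \<A> X \<in> ?F"
      unfolding constituents_def using X O groth_mult[of "iso_class \<A> X" "iso_class \<A> (cod r)"] by auto
  qed
  ultimately show ?thesis by simp
qed

lemma euler_ses_right:
  assumes ip: "ses \<A> i p" and M: "M \<in> Ob \<A>"
  shows "euler M (cod i) = euler M (dom i) * euler M (cod p)"
proof -
  interpret G: comm_monoid "groth_monoid \<A>" by (rule groth_comm_monoid)
  note K = ses_simps[OF ip]
  have O: "cod i \<in> Ob \<A>" "cod p \<in> Ob \<A>" "dom i \<in> Ob \<A>" using K by auto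
  define \<gamma> where "\<gamma> = obj_class \<A> M \<otimes>\<^bsub>groth_monoid \<A>\<^esub> obj_class \<A> (cod i)"
  have \<gamma>: "\<gamma> \<in> carrier (groth_monoid \<A>)" unfolding \<gamma>_def using O M groth_class_carrier by simp
  let ?F = "constituents \<A> \<gamma>"
  note F = finite_constituents[OF \<gamma>] constituents_Iso
  have self: "iso_class \<A> X \<in> ?F" if "X \<in> Ob \<A>" "obj_class \<A> X = \<gamma>" for X
    using that constituents_self[of "iso_class \<A> X"] by simp
  have c: "obj_class \<A> X \<in> carrier (groth_monoid \<A>)" if "X \<in> Ob \<A>" for X using groth_class_carrier that by simp
  have "(\<Sum>x \<in> ?F. of_nat (card (ext_pairs \<A> M (cod i) (rep x))) / aut \<A> (rep x)) = euler M (cod i)"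
  proof (rule ext_sum_euler[OF M O(1) F])
    fix X assume X: "X \<in> Ob \<A>" "ext_pairs \<A> M (cod i) X \<noteq> {}"
    then obtain f g where "(f, g) \<in> ext_pairs \<A> M (cod i) X" by auto
    note e = ext_pairsD[OF this]
    show "iso_class \<A> X \<in> ?F" using obj_class_ses[OF e(7)] e by (intro self) (auto simp: \<gamma>_def)
  qed
  moreover have "(\<Sum>x \<in> ?F. of_nat (card (ext_pairs \<A> M (cod i) (rep x))) / aut \<A> (rep x)) =
    euler M (dom i) * (\<Sum>x \<in> ?F. of_nat (card (ext_pairs \<A> M (cod p) (rep x))) / aut \<A> (rep x))"
  proof (rule ext_sum_mult'[OF ip F F])
    fix f g x assume x: "x \<in> ?F" "ses \<A> f g" "cod f = rep x"
    have "iso_class \<A> (rep x) = x" using rep_props(2) x(1) constituents_Iso by blast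
    then show "iso_class \<A> (cod g) \<in> ?F" using constituents_ses(2)[OF x(2), of \<gamma>] x by simp
  next
    fix q j assume j: "ses \<A> q j" "cod j = M" "dom q = cod p" "is_kernel \<A> (q \<cdot> p) i" "is_cokernel \<A> (q \<cdot> p) j"
    note J = ses_simps[OF j(1)]
    show "(\<Sum>x \<in> ?F. of_nat (card (fillings \<A> (q \<cdot> p) j (rep x))) / aut \<A> (rep x)) = euler M (dom i)"
      unfolding j(2)[symmetric]
    proof (rule fillings_sum_euler[OF j(4,5) F])
      fix X assume X: "X \<in> Ob \<A>" "fillings \<A> (q \<cdot> p) j X \<noteq> {}"
      then obtain s t where st: "(s, t) \<in> fillings \<A> (q \<cdot> p) j X" by auto
      note f = fillingD[OF st]
      have d: "cod (j \<cdot> t) = M" "dom (q \<cdot> p) = cod i" using f J K j by auto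
      show "iso_class \<A> X \<in> ?F" using fillings_obj_class[OF st] X self by (simp add: d \<gamma>_def)
    qed
  qed
  moreover have "(\<Sum>x \<in> ?F. of_nat (card (ext_pairs \<A> M (cod p) (rep x))) / aut \<A> (rep x)) = euler M (cod p)"
  proof (rule ext_sum_euler[OF M O(2) F])
    fix X assume X: "X \<in> Ob \<A>" "ext_pairs \<A> M (cod p) X \<noteq> {}"
    then obtain f g where "(f, g) \<in> ext_pairs \<A> M (cod p) X" by auto
    note e = ext_pairsD[OF this]
    have "\<gamma> = obj_class \<A> X \<otimes>\<^bsub>groth_monoid \<A>\<^esub> obj_class \<A> (dom i)"
      using obj_class_ses[OF e(7)] obj_class_ses[OF ip] e c O M by (simp add: \<gamma>_def G.m_ac)
    then show "iso_class \<A> X \<in> ?F"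
      unfolding constituents_def using X O groth_mult[of "iso_class \<A> X" "iso_class \<A> (dom i)"] by auto
  qed
  ultimately show ?thesis by simp
qed

lemma ses_cod_isomorphic:
  assumes "ses \<A> f g" "isomorphic \<A> (cod f) X"
  obtains f' g' where "ses \<A> f' g'" "dom f' = dom f" "cod f' = X" "cod g' = cod g"
proof -
  note S = ses_simps[OF assms(1)]
  obtain u v where u: "arr u" "dom u = cod f" "cod u = X" "arr v" "dom v = X" "cod v = cod f" "v \<cdot> u = Ident \<A> (cod f)" "u \<cdot> v = Ident \<A> X"
    "is_isom \<A> u" "is_isom \<A> v"
    by (rule iso_between[OF assms(2)])
  have "ses \<A> (u \<cdot> f) (g \<cdot> v)" by (rule ses_isom_mid[OF assms(1) u(9)]) (use u in auto)
  then show ?thesis using that[of "u \<cdot> f" "g \<cdot> v"] u S by simp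
qed

text \<open>Two extensions with the same ends have the same Euler numbers by multiplicativity, and
  this passes to the transitive closure. Invariance under isomorphism is included, since the
  sequences are first transported to have X and Y themselves as middle terms.\<close>

lemma euler_groth_rel:
  assumes "(a, b) \<in> groth_rel \<A>" "Z \<in> Ob \<A>"
  shows "\<forall>X \<in> Ob \<A>. \<forall>Y \<in> Ob \<A>. iso_class \<A> X = a \<longrightarrow> iso_class \<A> Y = b \<longrightarrow> euler X Z = euler Y Z \<and> euler Z X = euler Z Y"
proof -
  have base: "euler X Z = euler Y Z \<and> euler Z X = euler Z Y"
    if ab: "(iso_class \<A> X, iso_class \<A> Y) \<in> ext_rel" and XY: "X \<in> Ob \<A>" "Y \<in> Ob \<A>" for X Y
  proof -
    obtain f g f' g' where s: "ses \<A> f g" "ses \<A> f' g'" "dom f = dom f'" "cod g = cod g'"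
      "iso_class \<A> X = iso_class \<A> (cod f)" "iso_class \<A> Y = iso_class \<A> (cod f')" using ab by (rule ext_relE)
    have "isomorphic \<A> (cod f) X" "isomorphic \<A> (cod f') Y"
      using s XY iso_class_eq_iff[of "cod f" X] iso_class_eq_iff[of "cod f'" Y] ses_simps(1)[OF s(1)] ses_simps(1)[OF s(2)] by auto
    note iso = this
    obtain h k where h: "ses \<A> h k" "dom h = dom f" "cod h = X" "cod k = cod g"
      by (rule ses_cod_isomorphic[OF s(1) iso(1)])
    obtain h' k' where h': "ses \<A> h' k'" "dom h' = dom f'" "cod h' = Y" "cod k' = cod g'"
      by (rule ses_cod_isomorphic[OF s(2) iso(2)])
    show ?thesis
      using euler_ses_left[OF h(1) assms(2)] euler_ses_left[OF h'(1) assms(2)]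
        euler_ses_right[OF h(1) assms(2)] euler_ses_right[OF h'(1) assms(2)] h h' s by simp
  qed
  from assms(1) show ?thesis unfolding groth_rel_ext
  proof (induction rule: trancl_induct)
    case (base b) then show ?case using \<open>\<And>Y X. \<lbrakk>(iso_class \<A> X, iso_class \<A> Y) \<in> ext_rel; X \<in> Ob \<A>; Y \<in> Ob \<A>\<rbrakk> \<Longrightarrow> euler X Z = euler Y Z \<and> euler Z X = euler Z Y\<close> by blast
  next
    case (step b c)
    obtain W where W: "W \<in> Ob \<A>" "iso_class \<A> W = b" using ext_rel_Iso[OF step(2)] Iso_cases by metis
    show ?case
    proof (intro ballI impI)
      fix X Y assume "X \<in> Ob \<A>" "Y \<in> Ob \<A>" "iso_class \<A> X = a" "iso_class \<A> Y = c"
      then show "euler X Z = euler Y Z \<and> euler Z X = euler Z Y"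
        using step(3) W \<open>\<And>Y X. \<lbrakk>(iso_class \<A> X, iso_class \<A> Y) \<in> ext_rel; X \<in> Ob \<A>; Y \<in> Ob \<A>\<rbrakk> \<Longrightarrow> euler X Z = euler Y Z \<and> euler Z X = euler Z Y\<close>[of W Y] step(2) by auto
    qed
  qed
qed

lemma euler_char_eq:
  assumes "M \<in> Ob \<A>" "N \<in> Ob \<A>"
  shows "euler_char \<A> (obj_class \<A> M) (obj_class \<A> N) = euler M N"
proof -
  have wd: "euler M N = euler M' N'" if "M' \<in> Ob \<A>" "N' \<in> Ob \<A>" "obj_class \<A> M' = obj_class \<A> M" "obj_class \<A> N' = obj_class \<A> N" for M' N'
  proof -
    have "(iso_class \<A> M', iso_class \<A> M) \<in> groth_rel \<A>" "(iso_class \<A> N', iso_class \<A> N) \<in> groth_rel \<A>"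
      using that assms groth_class_eq_iff by auto
    then have "euler M' N' = euler M N'" "euler M N' = euler M N"
      using euler_groth_rel that assms by metis+
    then show ?thesis by simp
  qed
  show ?thesis
    unfolding euler_char_def euler_def[symmetric]
  proof (rule the_equality)
    show "\<forall>M' \<in> Ob \<A>. \<forall>N' \<in> Ob \<A>. obj_class \<A> M' = obj_class \<A> M \<and> obj_class \<A> N' = obj_class \<A> N \<longrightarrow> euler M N = euler M' N'"
      using wd by blast
  qed (use assms in blast)
qed

lemma euler_bicharacter: "bicharacter (groth_monoid \<A>) (euler_char \<A>)"
proof -
  have rep: "\<exists>X \<in> Ob \<A>. \<alpha> = obj_class \<A> X" if "\<alpha> \<in> carrier (groth_monoid \<A>)" for \<alpha>
    using that by (auto simp: groth_carrier Iso_def)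
  \<comment> \<open>Products in the monoid are realised by split sequences, to which the
    multiplicativity of \<open>euler\<close> applies.\<close>
  have mult: "\<exists>S f g. S \<in> Ob \<A> \<and> obj_class \<A> X \<otimes>\<^bsub>groth_monoid \<A>\<^esub> obj_class \<A> Y = obj_class \<A> S \<and> ses \<A> f g \<and> cod f = S \<and> cod g = X \<and> dom f = Y"
    if "X \<in> Ob \<A>" "Y \<in> Ob \<A>" for X Y
  proof -
    note O = that
    obtain S p q where S: "is_product \<A> X Y S p q" using ex_product[OF O] by metis
    obtain k where k: "ses \<A> k p" "dom k = Y" using product_ses[OF S] by blast
    show ?thesis using k obj_class_ses[OF k(1)] productD[OF S] ses_simps[OF k(1)] by metis
  qed
  show ?thesis
    unfolding bicharacter_def
  proof (intro conjI ballI)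
    fix \<alpha> \<beta> assume "\<alpha> \<in> carrier (groth_monoid \<A>)" "\<beta> \<in> carrier (groth_monoid \<A>)"
    then obtain X Y where "X \<in> Ob \<A>" "\<alpha> = obj_class \<A> X" "Y \<in> Ob \<A>" "\<beta> = obj_class \<A> Y" using rep by metis
    then show "euler_char \<A> \<alpha> \<beta> \<noteq> 0" using euler_char_eq euler_pos by (metis less_irrefl)
  next
    fix \<alpha> \<beta> \<gamma> assume "\<alpha> \<in> carrier (groth_monoid \<A>)" "\<beta> \<in> carrier (groth_monoid \<A>)" "\<gamma> \<in> carrier (groth_monoid \<A>)"
    then obtain X Y Z where X: "X \<in> Ob \<A>" "\<alpha> = obj_class \<A> X" "Y \<in> Ob \<A>" "\<beta> = obj_class \<A> Y" "Z \<in> Ob \<A>" "\<gamma> = obj_class \<A> Z"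
      using rep by metis
    obtain S f g where S: "S \<in> Ob \<A>" "\<alpha> \<otimes>\<^bsub>groth_monoid \<A>\<^esub> \<beta> = obj_class \<A> S" "ses \<A> f g" "cod f = S" "cod g = X" "dom f = Y"
      using mult X by metis
    show "euler_char \<A> (\<alpha> \<otimes>\<^bsub>groth_monoid \<A>\<^esub> \<beta>) \<gamma> = euler_char \<A> \<alpha> \<gamma> * euler_char \<A> \<beta> \<gamma>"
      using euler_ses_left[OF S(3), of Z] S X euler_char_eq by simp
    obtain S f g where S: "S \<in> Ob \<A>" "\<beta> \<otimes>\<^bsub>groth_monoid \<A>\<^esub> \<gamma> = obj_class \<A> S" "ses \<A> f g" "cod f = S" "cod g = Y" "dom f = Z"
      using mult X by metis
    show "euler_char \<A> \<alpha> (\<beta> \<otimes>\<^bsub>groth_monoid \<A>\<^esub> \<gamma>) = euler_char \<A> \<alpha> \<beta> * euler_char \<A> \<alpha> \<gamma>"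
      using euler_ses_right[OF S(3), of X] S X euler_char_eq by (simp add: mult.commute)
  qed
qed

end


section \<open>Structure constants of the Hall algebra\<close>

text \<open>Serves to pass between the support of a coefficient, over which products and coproducts
  are summed, and the constituents of a class, over which diagrams are counted.\<close>

lemma sum_eq_on_support:
  fixes f :: "'x \<Rightarrow> 'y::comm_monoid_add"
  assumes "finite S" "finite T" "\<And>x. x \<in> S \<Longrightarrow> x \<notin> T \<Longrightarrow> f x = 0" "\<And>x. x \<in> T \<Longrightarrow> x \<notin> S \<Longrightarrow> f x = 0"
  shows "sum f S = sum f T"
proof -
  have "sum f S = sum f (S \<inter> T)" by (rule sum.mono_neutral_right) (use assms in auto)
  also have "\<dots> = sum f T" by (rule sum.mono_neutral_left) (use assms in auto)
  finally show ?thesis .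
qed

lemma sum_product4:
  fixes f g h k :: "'x \<Rightarrow> 'y::semiring_0"
  shows "(\<Sum>(w, x, y, z) \<in> A \<times> B \<times> C \<times> D. f w * (g x * (h y * k z))) = sum f A * (sum g B * (sum h C * sum k D))"
proof -
  have "(\<Sum>(w, x, y, z) \<in> A \<times> B \<times> C \<times> D. f w * (g x * (h y * k z))) =
    (\<Sum>w \<in> A. \<Sum>x \<in> B. \<Sum>y \<in> C. \<Sum>z \<in> D. f w * (g x * (h y * k z)))"
    by (simp add: sum.cartesian_product)
  then show ?thesis by (simp add: sum_distrib_left[symmetric] sum_distrib_right[symmetric])
qed

definition ext_num :: "('o, 'm) preadd_cat \<Rightarrow> 'o set \<Rightarrow> 'o set \<Rightarrow> 'o set \<Rightarrow> rat" where
  "ext_num \<A> a b c = of_nat (card (ext_pairs \<A> (rep a) (rep b) (rep c)))"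

abbreviation autr :: "('o, 'm) preadd_cat \<Rightarrow> 'o set \<Rightarrow> rat" where
  "autr \<A> a \<equiv> aut \<A> (rep a)"

definition prod_coeff :: "('o, 'm) preadd_cat \<Rightarrow> 'o set \<times> 'o set \<Rightarrow> 'o set \<Rightarrow> rat" where
  "prod_coeff \<A> p c = (if c \<in> Iso \<A> then hall_number \<A> (rep (fst p)) (rep (snd p)) (rep c) else 0)"

definition coprod_coeff :: "('o, 'm) preadd_cat \<Rightarrow> 'o set \<Rightarrow> 'o set \<times> 'o set \<Rightarrow> rat" where
  "coprod_coeff \<A> c = (\<lambda>(a, b). if a \<in> Iso \<A> \<and> b \<in> Iso \<A> then dual_hall_number \<A> (rep a) (rep b) (rep c) else 0)"

context abelian_category
begin

text \<open>The vanishing criterion that makes the product graded and confines its sums to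
  constituents.\<close>

lemma ext_num_nonzero:
  assumes "ext_num \<A> a b c \<noteq> 0" "a \<in> Iso \<A>" "b \<in> Iso \<A>" "c \<in> Iso \<A>"
  shows "groth_class \<A> c = groth_class \<A> a \<otimes>\<^bsub>groth_monoid \<A>\<^esub> groth_class \<A> b"
    "c \<in> constituents \<A> \<gamma> \<Longrightarrow> a \<in> constituents \<A> \<gamma>" "c \<in> constituents \<A> \<gamma> \<Longrightarrow> b \<in> constituents \<A> \<gamma>"
proof -
  have "ext_pairs \<A> (rep a) (rep b) (rep c) \<noteq> {}" using assms(1) by (auto simp: ext_num_def)
  then obtain f g where fg: "(f, g) \<in> ext_pairs \<A> (rep a) (rep b) (rep c)" by auto
  note e = ext_pairsD[OF fg]
  show "groth_class \<A> c = groth_class \<A> a \<otimes>\<^bsub>groth_monoid \<A>\<^esub> groth_class \<A> b"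
    using obj_class_ses[OF e(7)] e rep_props assms(2-4) by simp
  show "c \<in> constituents \<A> \<gamma> \<Longrightarrow> a \<in> constituents \<A> \<gamma>" "c \<in> constituents \<A> \<gamma> \<Longrightarrow> b \<in> constituents \<A> \<gamma>"
    using constituents_ses[OF e(7), of \<gamma>] e rep_props assms(2-4) by simp_all
qed

end

context hom_finite
begin

section \<open>Coefficients expressed by numbers of extensions\<close>

lemma prod_coeff_eq:
  "prod_coeff \<A> (a, b) c = (if c \<in> Iso \<A> then ext_num \<A> a b c / (autr \<A> a * autr \<A> b) else 0)"
  by (simp add: prod_coeff_def hall_number_def ext_num_def ext_pairs_def)

lemma autr_pos: "a \<in> Iso \<A> \<Longrightarrow> autr \<A> a > 0"
  using aut_pos rep_props(1) by blast

text \<open>The orders of Aut A and Aut B cancel. The first tensor factor of a coproduct is the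
  subobject, while the first factor of a product is the quotient; this is the origin of the
  reversals of order below.\<close>

lemma coprod_coeff_eq:
  assumes "c \<in> Iso \<A>"
  shows "coprod_coeff \<A> c (a, b) = (if a \<in> Iso \<A> \<and> b \<in> Iso \<A> then ext_num \<A> b a c / autr \<A> c else 0)"
proof (cases "a \<in> Iso \<A> \<and> b \<in> Iso \<A>")
  case True
  then have "autr \<A> a > 0" "autr \<A> b > 0" using autr_pos by blast+
  then show ?thesis using True
    by (simp add: coprod_coeff_def dual_hall_number_def hall_number_def ext_num_def ext_pairs_def)
qed (auto simp: coprod_coeff_def)

text \<open>An extension by the zero object is an isomorphism onto the quotient; the arrow out of
  the zero object leaves no choice.\<close>

lemma ext_num_zero_right:
  assumes "a \<in> Iso \<A>" "c \<in> Iso \<A>"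
  shows "ext_num \<A> a (zero_class \<A>) c = (if a = c then autr \<A> a else 0)"
proof -
  let ?Z = "rep (zero_class \<A>)"
  have R: "rep a \<in> Ob \<A>" "rep c \<in> Ob \<A>" "?Z \<in> Ob \<A>" using assms rep_props zero_class_Iso by auto
  have uz: "f = g" if "f \<in> Hom ?Z X" "g \<in> Hom ?Z X" for f g X
    using that rep_zero_object Hom_Ob[OF that(1)] unfolding is_zero_object_def by blast
  have zz: "w = nul (dom w) ?Z" if "arr w" "cod w = ?Z" for w
  proof -
    have "w \<in> Hom (dom w) ?Z" "nul (dom w) ?Z \<in> Hom (dom w) ?Z" "dom w \<in> Ob \<A>" using that R by (auto simp: Hom_iff)
    then show ?thesis using rep_zero_object unfolding is_zero_object_def by blast
  qed
  have "bij_betw snd (ext_pairs \<A> (rep a) ?Z (rep c)) (isos \<A> (rep c) (rep a))"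
  proof (rule bij_betw_imageI[OF inj_onI subset_antisym[OF subsetI subsetI]])
    fix x y assume xy: "x \<in> ext_pairs \<A> (rep a) ?Z (rep c)" "y \<in> ext_pairs \<A> (rep a) ?Z (rep c)" "snd x = snd y"
    then have "fst x = fst y" by (intro uz[of _ "rep c"]) (auto simp: ext_pairs_def short_exact_def split: prod.splits)
    then show "x = y" using xy by (simp add: prod_eq_iff)
  next
    fix g assume "g \<in> snd ` ext_pairs \<A> (rep a) ?Z (rep c)"
    then obtain f where f: "(f, g) \<in> ext_pairs \<A> (rep a) ?Z (rep c)" by auto
    note e = ext_pairsD[OF f] and S = ses_simps[OF ext_pairsD(7)[OF f]]
    have "is_mono \<A> g"
    proof (rule monoI[OF e(4)])
      fix w assume w: "arr w" "cod w = dom g" "g \<cdot> w = nul (dom w) (cod g)"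
      then obtain u where u: "arr u" "dom u = dom w" "cod u = dom f" "f \<cdot> u = w"
        by (rule_tac kernel_factor[OF S(7), of w]) (use e in auto)
      have "u = nul (dom u) ?Z" using zz[of u] u e by simp
      then have "f \<cdot> u = nul (dom w) (cod f)" using u e w by (metis arr_Ob(1) comp_nul)
      then show "w = nul (dom w) (dom g)" using u e by simp
    qed
    then show "g \<in> isos \<A> (rep c) (rep a)" using mono_epi_isom S(6) e by (simp add: isos_iff)
  next
    fix g assume "g \<in> isos \<A> (rep c) (rep a)"
    then have g: "arr g" "dom g = rep c" "cod g = rep a" "is_isom \<A> g" by (auto simp: isos_iff)
    have "is_kernel \<A> g (nul ?Z (rep c))"
    proof (rule kernelI)
      show "is_mono \<A> (nul ?Z (rep c))"
      proof (rule monoI)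
        fix w assume "arr w" "cod w = dom (nul ?Z (rep c))"
        then show "w = nul (dom w) (dom (nul ?Z (rep c)))" using zz[of w] R by simp
      qed (use R in simp)
      fix h assume h: "arr h" "cod h = dom g" "g \<cdot> h = nul (dom h) (cod g)"
      then have "h = nul (dom h) (rep c)" using mono_nul[OF iso_mono[OF g(4)], of h] g by simp
      then show "\<exists>u. arr u \<and> dom u = dom h \<and> cod u = dom (nul ?Z (rep c)) \<and> nul ?Z (rep c) \<cdot> u = h"
        using R h by (intro exI[of _ "nul (dom h) ?Z"]) auto
    qed (use g R in auto)
    then have "ses \<A> (nul ?Z (rep c)) g" using epi_kernel_ses iso_epi g by blast
    then have "(nul ?Z (rep c), g) \<in> ext_pairs \<A> (rep a) ?Z (rep c)" using R g by (intro ext_pairsI) auto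
    then show "g \<in> snd ` ext_pairs \<A> (rep a) ?Z (rep c)" by (rule rev_image_eqI) simp
  qed
  then have 1: "ext_num \<A> a (zero_class \<A>) c = of_nat (card (isos \<A> (rep c) (rep a)))"
    unfolding ext_num_def using bij_betw_same_card by metis
  show ?thesis
  proof (cases "a = c")
    case True then show ?thesis using 1 card_isos_left isomorphic_refl R by simp
  next
    case False
    then have "\<not> isomorphic \<A> (rep c) (rep a)" using iso_class_eq_iff R rep_props assms by metis
    then show ?thesis using 1 isos_empty False by simp
  qed
qed

lemma zero_class_dual: "zero_class (dual_cat \<A>) = zero_class \<A>"
proof -
  have ab: "abelian_category \<A>" by unfold_locales
  have "is_zero_object (dual_cat \<A>) = is_zero_object \<A>" by (rule ext) simp
  then show ?thesis unfolding zero_class_def by (simp add: ab)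
qed

lemma ext_num_zero_left:
  assumes "a \<in> Iso \<A>" "c \<in> Iso \<A>"
  shows "ext_num \<A> (zero_class \<A>) a c = (if a = c then autr \<A> a else 0)"
proof -
  interpret D: hom_finite "dual_cat \<A>" by (rule hom_finite_dual) unfold_locales
  have ab: "abelian_category \<A>" by unfold_locales
  have e: "card (ext_pairs (dual_cat \<A>) A B X) = card (ext_pairs \<A> B A X)" for A B X
    by (rule bij_betw_same_card[of prod.swap], rule bij_betw_byWitness[where f' = prod.swap]) (auto simp: ext_pairs_dual_iff)
  show ?thesis using D.ext_num_zero_right[of a c] assms ab by (simp add: ext_num_def e zero_class_dual)
qed

lemma autr_zero: "autr \<A> (zero_class \<A>) = 1"
proof -
  let ?Z = "rep (zero_class \<A>)"
  have O: "?Z \<in> Ob \<A>" using rep_props zero_class_Iso by auto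
  have "\<exists>!f. f \<in> Hom ?Z ?Z" using rep_zero_object O by (simp add: is_zero_object_def)
  then have "Aut_set \<A> ?Z = {Ident \<A> ?Z}" using O by (auto simp: Aut_set_def Hom_iff)
  then show ?thesis by simp
qed

text \<open>A monomorphism into a zero object forces its domain to be zero. This makes the counit
  multiplicative and the unit group-like.\<close>

lemma ext_num_into_zero:
  assumes "a \<in> Iso \<A>" "b \<in> Iso \<A>"
  shows "ext_num \<A> a b (zero_class \<A>) = (if a = zero_class \<A> \<and> b = zero_class \<A> then 1 else 0)"
proof (cases "b = zero_class \<A>")
  case True
  then show ?thesis using ext_num_zero_right[OF assms(1) zero_class_Iso] autr_zero by auto
next
  case False
  let ?Z = "rep (zero_class \<A>)"
  have O: "?Z \<in> Ob \<A>" using rep_props zero_class_Iso by auto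
  have "ext_pairs \<A> (rep a) (rep b) ?Z = {}"
  proof (rule ccontr)
    assume "ext_pairs \<A> (rep a) (rep b) ?Z \<noteq> {}"
    then obtain f g where fg: "(f, g) \<in> ext_pairs \<A> (rep a) (rep b) ?Z" by auto
    note e = ext_pairsD[OF fg] and S = ses_simps[OF ext_pairsD(7)[OF fg]]
    have uz: "u = v" if "u \<in> Hom ?Z X" "v \<in> Hom ?Z X" for u v X
      using that rep_zero_object Hom_Ob[OF that(1)] unfolding is_zero_object_def by blast
    have uz': "u = v" if "u \<in> Hom X ?Z" "v \<in> Hom X ?Z" for u v X
      using that rep_zero_object Hom_Ob[OF that(1)] unfolding is_zero_object_def by blast
    have "f = nul (rep b) ?Z" by (rule uz'[of _ "rep b"]) (use e O in \<open>auto simp: Hom_iff\<close>)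
    then have "f \<cdot> Ident \<A> (rep b) = f \<cdot> nul (rep b) (rep b)" using e O by simp
    then have "Ident \<A> (rep b) = nul (rep b) (rep b)" by (rule_tac mono_cancel[OF S(5)]) (use e in auto)
    moreover have "nul (rep b) ?Z \<cdot> nul ?Z (rep b) = Ident \<A> ?Z"
      by (rule uz[of _ ?Z]) (use e O in \<open>auto simp: Hom_iff\<close>)
    ultimately have "is_isom \<A> (nul (rep b) ?Z)" using e O by (intro is_isomI[of _ "nul ?Z (rep b)"]) auto
    then have "isomorphic \<A> (rep b) ?Z" unfolding isomorphic_def using e O by (auto simp: Hom_iff)
    then have "iso_class \<A> (rep b) = iso_class \<A> ?Z" using iso_class_eq_iff e O by simp
    then show False using False rep_props assms zero_class_Iso by simp
  qed
  then show ?thesis using False by (simp add: ext_num_def)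
qed

end

context hall_category
begin

section \<open>Finiteness, grading and associativity of the coefficients\<close>

lemma groth_closed: "a \<in> Iso \<A> \<Longrightarrow> b \<in> Iso \<A> \<Longrightarrow>
  groth_class \<A> a \<otimes>\<^bsub>groth_monoid \<A>\<^esub> groth_class \<A> b \<in> carrier (groth_monoid \<A>)"
  by (simp add: groth_mult groth_class_carrier Iso_plus_closed)

lemma prod_coeff_nonzero:
  assumes "prod_coeff \<A> (a, b) c \<noteq> 0" "a \<in> Iso \<A>" "b \<in> Iso \<A>"
  shows "c \<in> Iso \<A>" "groth_class \<A> c = groth_class \<A> a \<otimes>\<^bsub>groth_monoid \<A>\<^esub> groth_class \<A> b"
proof -
  show "c \<in> Iso \<A>" using assms(1) by (simp add: prod_coeff_def split: if_splits)
  then show "groth_class \<A> c = groth_class \<A> a \<otimes>\<^bsub>groth_monoid \<A>\<^esub> groth_class \<A> b"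
    using ext_num_nonzero(1)[of a b c] assms by (auto simp: prod_coeff_eq)
qed

lemma finite_prod_coeff:
  assumes "a \<in> Iso \<A>" "b \<in> Iso \<A>"
  shows "finite {c. prod_coeff \<A> (a, b) c \<noteq> 0}"
  by (rule finite_subset[OF _ finite_groth_fiber[OF groth_closed[OF assms]]])
    (use prod_coeff_nonzero assms in auto)

lemma coprod_coeff_nonzero:
  assumes "coprod_coeff \<A> c (a, b) \<noteq> 0" "c \<in> Iso \<A>"
  shows "a \<in> Iso \<A>" "b \<in> Iso \<A>" "groth_class \<A> c = groth_class \<A> a \<otimes>\<^bsub>groth_monoid \<A>\<^esub> groth_class \<A> b"
    "c \<in> constituents \<A> \<gamma> \<Longrightarrow> a \<in> constituents \<A> \<gamma>" "c \<in> constituents \<A> \<gamma> \<Longrightarrow> b \<in> constituents \<A> \<gamma>"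
proof -
  show ab: "a \<in> Iso \<A>" "b \<in> Iso \<A>" using assms by (auto simp: coprod_coeff_def split: if_splits)
  have n: "ext_num \<A> b a c \<noteq> 0" using assms ab by (auto simp: coprod_coeff_eq)
  interpret G: comm_monoid "groth_monoid \<A>" by (rule groth_comm_monoid)
  show "groth_class \<A> c = groth_class \<A> a \<otimes>\<^bsub>groth_monoid \<A>\<^esub> groth_class \<A> b"
    using ext_num_nonzero(1)[OF n ab(2,1) assms(2)] ab by (simp add: G.m_comm groth_class_carrier)
  show "c \<in> constituents \<A> \<gamma> \<Longrightarrow> a \<in> constituents \<A> \<gamma>" "c \<in> constituents \<A> \<gamma> \<Longrightarrow> b \<in> constituents \<A> \<gamma>"
    using ext_num_nonzero(2,3)[OF n ab(2,1) assms(2)] by auto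
qed

lemma finite_coprod_coeff:
  assumes "c \<in> Iso \<A>"
  shows "finite {p. coprod_coeff \<A> c p \<noteq> 0}"
proof (rule finite_subset)
  let ?F = "constituents \<A> (groth_class \<A> c)"
  show "{p. coprod_coeff \<A> c p \<noteq> 0} \<subseteq> ?F \<times> ?F"
    using coprod_coeff_nonzero(4,5)[OF _ assms] constituents_self[OF assms] by auto
  show "finite (?F \<times> ?F)" using finite_constituents groth_class_carrier[OF assms] by simp
qed

lemma ext_num_assoc:
  assumes "a \<in> Iso \<A>" "b \<in> Iso \<A>" "c \<in> Iso \<A>" "e \<in> Iso \<A>"
  shows "(\<Sum>x \<in> constituents \<A> (groth_class \<A> e). ext_num \<A> a b x * ext_num \<A> x c e / autr \<A> x) =
    (\<Sum>x \<in> constituents \<A> (groth_class \<A> e). ext_num \<A> a x e * ext_num \<A> b c x / autr \<A> x)"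
proof -
  let ?F = "constituents \<A> (groth_class \<A> e)"
  have "iso_class \<A> (dom f) \<in> ?F \<and> iso_class \<A> (cod g) \<in> ?F" if "ses \<A> f g" "cod f = rep e" for f g
    using constituents_ses[OF that(1), of "groth_class \<A> e"] that rep_props[OF assms(4)] constituents_self[OF assms(4)] by simp
  then show ?thesis
    using flag_sum[OF finite_constituents[OF groth_class_carrier[OF assms(4)]] constituents_Iso, of "rep e" "rep a" "rep b" "rep c"]
    by (simp add: ext_num_def)
qed

text \<open>Both sides are \<open>ext_num_assoc\<close> divided by the orders of the three outer
  automorphism groups. As \<open>S\<close> and \<open>T\<close> may be any finite sets of classes
  containing the supports, they can be exchanged for the constituents of the class of
  \<open>e\<close>.\<close>

lemma prod_coeff_assoc:
  assumes I: "a \<in> Iso \<A>" "b \<in> Iso \<A>" "c \<in> Iso \<A>"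
    and S: "finite S" "S \<subseteq> Iso \<A>" "{x. prod_coeff \<A> (a, b) x \<noteq> 0} \<subseteq> S"
    and T: "finite T" "T \<subseteq> Iso \<A>" "{x. prod_coeff \<A> (b, c) x \<noteq> 0} \<subseteq> T"
  shows "(\<Sum>x \<in> S. prod_coeff \<A> (a, b) x * prod_coeff \<A> (x, c) e) = (\<Sum>x \<in> T. prod_coeff \<A> (b, c) x * prod_coeff \<A> (a, x) e)"
proof (cases "e \<in> Iso \<A>")
  case e: True
  let ?F = "constituents \<A> (groth_class \<A> e)"
  note F = finite_constituents[OF groth_class_carrier[OF e]] subsetD[OF constituents_Iso]
  have "(\<Sum>x \<in> S. prod_coeff \<A> (a, b) x * prod_coeff \<A> (x, c) e) = (\<Sum>x \<in> ?F. prod_coeff \<A> (a, b) x * prod_coeff \<A> (x, c) e)"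
  proof (rule sum_eq_on_support[OF S(1) F(1)])
    fix x assume x: "x \<in> S" "x \<notin> ?F"
    then have "ext_num \<A> x c e = 0" using ext_num_nonzero(2)[of x c e] constituents_self[OF e] I S e by blast
    then show "prod_coeff \<A> (a, b) x * prod_coeff \<A> (x, c) e = 0" by (simp add: prod_coeff_eq)
  qed (use S in auto)
  also have "\<dots> = (\<Sum>x \<in> ?F. ext_num \<A> a b x * ext_num \<A> x c e / autr \<A> x) / (autr \<A> a * autr \<A> b * autr \<A> c)"
    unfolding sum_divide_distrib by (rule sum.cong) (use e F(2) in \<open>auto simp: prod_coeff_eq mult_ac\<close>)
  also have "\<dots> = (\<Sum>x \<in> ?F. ext_num \<A> a x e * ext_num \<A> b c x / autr \<A> x) / (autr \<A> a * autr \<A> b * autr \<A> c)"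
    using ext_num_assoc[OF I e] by simp
  also have "\<dots> = (\<Sum>x \<in> ?F. prod_coeff \<A> (b, c) x * prod_coeff \<A> (a, x) e)"
    unfolding sum_divide_distrib by (rule sum.cong) (use e F(2) in \<open>auto simp: prod_coeff_eq mult_ac\<close>)
  also have "\<dots> = (\<Sum>x \<in> T. prod_coeff \<A> (b, c) x * prod_coeff \<A> (a, x) e)"
  proof (rule sum_eq_on_support[OF F(1) T(1)])
    fix x assume x: "x \<in> T" "x \<notin> ?F"
    then have "ext_num \<A> a x e = 0" using ext_num_nonzero(3)[of a x e] constituents_self[OF e] I T e by blast
    then show "prod_coeff \<A> (b, c) x * prod_coeff \<A> (a, x) e = 0" by (simp add: prod_coeff_eq)
  qed (use T in auto)
  finally show ?thesis .
qed (simp add: prod_coeff_def)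

text \<open>The flag count that gives associativity, with the three factors in reversed
  order.\<close>

lemma coprod_coeff_coassoc:
  assumes c: "c \<in> Iso \<A>" and F: "F = constituents \<A> (groth_class \<A> c)"
  shows "(\<Sum>w \<in> F. coprod_coeff \<A> c (w, z) * coprod_coeff \<A> w (x, y)) = (\<Sum>w \<in> F. coprod_coeff \<A> c (x, w) * coprod_coeff \<A> w (y, z))"
proof (cases "x \<in> Iso \<A> \<and> y \<in> Iso \<A> \<and> z \<in> Iso \<A>")
  case True
  then have I: "z \<in> Iso \<A>" "y \<in> Iso \<A>" "x \<in> Iso \<A>" by auto
  have FI: "w \<in> F \<Longrightarrow> w \<in> Iso \<A>" for w using constituents_Iso F by blast
  have "(\<Sum>w \<in> F. coprod_coeff \<A> c (w, z) * coprod_coeff \<A> w (x, y)) = (\<Sum>w \<in> F. ext_num \<A> z w c * ext_num \<A> y x w / autr \<A> w) / autr \<A> c"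
    unfolding sum_divide_distrib by (rule sum.cong) (use I c FI in \<open>auto simp: coprod_coeff_eq mult_ac\<close>)
  also have "\<dots> = (\<Sum>w \<in> F. ext_num \<A> z y w * ext_num \<A> w x c / autr \<A> w) / autr \<A> c"
    using ext_num_assoc[OF I c] F by simp
  also have "\<dots> = (\<Sum>w \<in> F. coprod_coeff \<A> c (x, w) * coprod_coeff \<A> w (y, z))"
    unfolding sum_divide_distrib by (rule sum.cong) (use I c FI in \<open>auto simp: coprod_coeff_eq mult_ac\<close>)
  finally show ?thesis .
next
  case False
  then show ?thesis by (auto simp: coprod_coeff_def intro!: sum.neutral)
qed

text \<open>Three by three diagrams counted in two ways. Over a cross at X the border consists of
  four independent choices of mass 1 each (\<open>corner_card\<close>, \<open>torsor_sum\<close>).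
  Over a given border the completions are the fillings of a 2-extension of M2 by N1
  (\<open>corner_fillings\<close>), and their mass is the Euler number.\<close>

lemma ext_num_green:
  assumes I: "m \<in> Iso \<A>" "n \<in> Iso \<A>" "a \<in> Iso \<A>" "b \<in> Iso \<A>"
    and F: "F = constituents \<A> (groth_class \<A> m \<otimes>\<^bsub>groth_monoid \<A>\<^esub> groth_class \<A> n)"
  shows "(\<Sum>x \<in> F. ext_num \<A> m n x * ext_num \<A> b a x / autr \<A> x) =
    (\<Sum>(n1, m1, n2, m2) \<in> F \<times> F \<times> F \<times> F. euler (rep m2) (rep n1) *
      (ext_num \<A> n2 n1 n * ext_num \<A> m1 n1 a * ext_num \<A> m2 m1 m * ext_num \<A> m2 n2 b) /
      (autr \<A> n1 * autr \<A> m1 * autr \<A> n2 * autr \<A> m2))"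
proof -
  define \<gamma> where "\<gamma> = groth_class \<A> m \<otimes>\<^bsub>groth_monoid \<A>\<^esub> groth_class \<A> n"
  have \<gamma>: "\<gamma> \<in> carrier (groth_monoid \<A>)" unfolding \<gamma>_def using groth_closed I by blast
  have finF: "finite F" "F \<subseteq> Iso \<A>" using finite_constituents[OF \<gamma>] constituents_Iso F by (auto simp: \<gamma>_def)
  have Fses: "iso_class \<A> (dom f) \<in> F" "iso_class \<A> (cod g) \<in> F" if "ses \<A> f g" "iso_class \<A> (cod f) \<in> F" for f g
    using constituents_ses[OF that(1)] that(2) F by auto
  let ?M = "rep m" and ?N = "rep n" and ?A = "rep a" and ?B = "rep b"
  \<comment> \<open>\<open>P x\<close> holds the crosses at x, \<open>Q y\<close> the border
    sequences with corners y.\<close>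
  define P where "P = (\<lambda>x. ext_pairs \<A> ?M ?N (rep x) \<times> ext_pairs \<A> ?B ?A (rep x))"
  define Q where "Q = (\<lambda>(n1, m1, n2, m2). ext_pairs \<A> (rep n2) (rep n1) ?N \<times> ext_pairs \<A> (rep m1) (rep n1) ?A \<times>
    ext_pairs \<A> (rep m2) (rep m1) ?M \<times> ext_pairs \<A> (rep m2) (rep n2) ?B)"
  define v where "v = (\<lambda>(n1, m1, n2, m2). autr \<A> n1 * autr \<A> m1 * autr \<A> n2 * autr \<A> m2)"
  define \<chi> where "\<chi> = (\<lambda>(n1 :: 'o set, m1 :: 'o set, n2 :: 'o set, m2). euler (rep m2) (rep n1))"
  have "(\<Sum>x \<in> F. of_nat (card (P x)) / autr \<A> x) = (\<Sum>y \<in> F \<times> F \<times> F \<times> F. \<chi> y * of_nat (card (Q y)) / v y)"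
  proof (rule double_count[where N = "\<lambda>p q. if corner_rel p q then 1 else 0"])
    show "finite F" "finite (F \<times> F \<times> F \<times> F)" using finF by auto
    show "finite (P x)" for x by (simp add: P_def finite_ext_pairs)
    show "finite (Q y)" for y by (cases y) (simp add: Q_def finite_ext_pairs)
    fix x p assume x: "x \<in> F" and p: "p \<in> P x"
    obtain f g a' b' where pp: "p = ((f, g), (a', b'))" by (metis surj_pair)
    have fg: "(f, g) \<in> ext_pairs \<A> ?M ?N (rep x)" and ab: "(a', b') \<in> ext_pairs \<A> ?B ?A (rep x)"
      using p pp by (auto simp: P_def)
    note Fg = ext_pairsD[OF fg] and Ab = ext_pairsD[OF ab]
    note SF = ses_simps[OF Fg(7)] and SA = ses_simps[OF Ab(7)]
    have xx: "iso_class \<A> (rep x) = x" using rep_props(2) x finF by blast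
    have inF: "iso_class \<A> ?M \<in> F" "iso_class \<A> ?N \<in> F" "iso_class \<A> ?A \<in> F" "iso_class \<A> ?B \<in> F"
      using Fses[OF Fg(7)] Fses[OF Ab(7)] Fg Ab xx x by simp_all
    have ga: "arr (g \<cdot> a')" "dom (g \<cdot> a') = ?A" "cod (g \<cdot> a') = ?M" and bf: "arr (b' \<cdot> f)" "dom (b' \<cdot> f) = ?N" "cod (b' \<cdot> f) = ?B"
      using Fg Ab by auto
    define K where "K = (\<lambda>y. card {j. is_kernel \<A> (g \<cdot> a') j \<and> dom j = rep y})"
    define Im where "Im = (\<lambda>y. card {(q, k). is_epi \<A> q \<and> is_mono \<A> k \<and> cod q = rep y \<and> dom k = rep y \<and> k \<cdot> q = g \<cdot> a'})"
    define Jm where "Jm = (\<lambda>y. card {(q, k). is_epi \<A> q \<and> is_mono \<A> k \<and> cod q = rep y \<and> dom k = rep y \<and> k \<cdot> q = b' \<cdot> f})"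
    define C where "C = (\<lambda>y. card {r. is_cokernel \<A> (g \<cdot> a') r \<and> cod r = rep y})"
    \<comment> \<open>The kernel object is a subobject of A, hence a constituent, so its class is an
      index of the sum; similarly for the images and the cokernel below.\<close>
    have "(\<Sum>y \<in> F. of_nat (K y) / autr \<A> y) = 1"
    proof -
      obtain k0 where k0: "is_kernel \<A> (g \<cdot> a') k0" using ex_kernel ga by blast
      note k = kernel_simps[OF k0]
      obtain c where "is_cokernel \<A> k0 c" using ex_cokernel k(2) by blast
      then have "ses \<A> k0 c" using mono_cokernel_ses kernel_mono[OF k0] by blast
      then have "iso_class \<A> (dom k0) \<in> F" using Fses(1) inF k ga by simp
      then show ?thesis
        by (intro torsor_sum[OF finF, of "dom k0"]) (use k kernel_torsor[OF k0] in \<open>auto simp: K_def\<close>)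
    qed
    moreover have em: "(\<Sum>y \<in> F. of_nat (card {(q, k). is_epi \<A> q \<and> is_mono \<A> k \<and> cod q = rep y \<and> dom k = rep y \<and> k \<cdot> q = h}) / autr \<A> y) = 1"
      if h: "arr h" "iso_class \<A> (dom h) \<in> F" for h
    proof -
      obtain e k where e: "is_epi \<A> e" "is_mono \<A> k" "arr e" "arr k" "cod e = dom k" "k \<cdot> e = h"
        using epi_mono_factorization[OF h(1)] by metis
      obtain k' where "is_kernel \<A> e k'" using ex_kernel e(3) by blast
      then have s: "ses \<A> k' e" using epi_kernel_ses e(1) by blast
      have "dom h = dom e" using e by auto
      then have "iso_class \<A> (cod e) \<in> F" using Fses(2)[OF s] h ses_simps(3)[OF s] by simp
      then show ?thesis
        by (intro torsor_sum[OF finF, of "cod e"]) (use e epi_mono_torsor[OF e(1,2,5,6)] in auto)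
    qed
    moreover have "(\<Sum>y \<in> F. of_nat (C y) / autr \<A> y) = 1"
    proof -
      obtain r0 where r0: "is_cokernel \<A> (g \<cdot> a') r0" using ex_cokernel ga by blast
      note r = cokernel_simps[OF r0]
      obtain k where "is_kernel \<A> r0 k" using ex_kernel r(2) by blast
      then have s: "ses \<A> k r0" using epi_kernel_ses cokernel_epi[OF r0] by blast
      then have "iso_class \<A> (cod r0) \<in> F" using Fses(2)[OF s] ses_simps(3)[OF s] inF r ga by simp
      then show ?thesis
        by (intro torsor_sum[OF finF, of "cod r0"]) (use r cokernel_torsor[OF r0] in \<open>auto simp: C_def\<close>)
    qed
    \<comment> \<open>Each of the four choices has mass 1, and as they are independent the mass of
      the fibre is their product.\<close>
    ultimately have "(\<Sum>y \<in> F. of_nat (K y) / autr \<A> y) * ((\<Sum>y \<in> F. of_nat (Im y) / autr \<A> y) *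
        ((\<Sum>y \<in> F. of_nat (Jm y) / autr \<A> y) * (\<Sum>y \<in> F. of_nat (C y) / autr \<A> y))) = 1"
      using em[OF ga(1)] em[OF bf(1)] ga bf inF by (simp add: Im_def Jm_def)
    then have 1: "(\<Sum>(n1, m1, n2, m2) \<in> F \<times> F \<times> F \<times> F. of_nat (K n1) / autr \<A> n1 * (of_nat (Im m1) / autr \<A> m1 *
        (of_nat (Jm n2) / autr \<A> n2 * (of_nat (C m2) / autr \<A> m2)))) = 1"
      by (simp only: sum_product4)
    have "(\<Sum>y \<in> F \<times> F \<times> F \<times> F. of_nat (\<Sum>q \<in> Q y. if corner_rel p q then 1 else 0) / v y) =
      (\<Sum>(n1, m1, n2, m2) \<in> F \<times> F \<times> F \<times> F. of_nat (K n1) / autr \<A> n1 * (of_nat (Im m1) / autr \<A> m1 *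
        (of_nat (Jm n2) / autr \<A> n2 * (of_nat (C m2) / autr \<A> m2))))"
    proof (rule sum.cong[OF refl])
      fix y assume "y \<in> F \<times> F \<times> F \<times> F"
      obtain n1 m1 n2 m2 where y: "y = (n1, m1, n2, m2)" by (metis surj_pair)
      have "(\<Sum>q \<in> Q y. if corner_rel p q then 1 else 0) = card {q \<in> Q y. corner_rel p q}"
        by (rule sum_indicator_card) (simp add: y Q_def finite_ext_pairs)
      also have "\<dots> = K n1 * Im m1 * Jm n2 * C m2"
        unfolding K_def Im_def Jm_def C_def y Q_def pp using corner_card[OF fg ab] by simp
      finally show "of_nat (\<Sum>q \<in> Q y. if corner_rel p q then 1 else 0) / v y = (case y of (n1, m1, n2, m2) \<Rightarrow>
        of_nat (K n1) / autr \<A> n1 * (of_nat (Im m1) / autr \<A> m1 * (of_nat (Jm n2) / autr \<A> n2 * (of_nat (C m2) / autr \<A> m2))))"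
        by (simp add: y v_def)
    qed
    then show "(\<Sum>y \<in> F \<times> F \<times> F \<times> F. of_nat (\<Sum>q \<in> Q y. if corner_rel p q then 1 else 0) / v y) = 1" using 1 by simp
  next
    fix y q assume "y \<in> F \<times> F \<times> F \<times> F" and q: "q \<in> Q y"
    obtain n1 m1 n2 m2 where y: "y = (n1, m1, n2, m2)" by (metis surj_pair)
    obtain i p j q' k r l z where qq: "q = ((i, p), (j, q'), (k, r), (l, z))" by (metis surj_pair)
    have m: "(i, p) \<in> ext_pairs \<A> (rep n2) (rep n1) ?N" "(j, q') \<in> ext_pairs \<A> (rep m1) (rep n1) ?A"
      "(k, r) \<in> ext_pairs \<A> (rep m2) (rep m1) ?M" "(l, z) \<in> ext_pairs \<A> (rep m2) (rep n2) ?B"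
      using q by (auto simp: qq y Q_def)
    note I' = ext_pairsD[OF m(1)] and J = ext_pairsD[OF m(2)] and K = ext_pairsD[OF m(3)] and L = ext_pairsD[OF m(4)]
    obtain c n' m' where c: "is_kernel \<A> c n'" "is_cokernel \<A> c m'" "dom n' = dom i" "cod m' = cod r"
      and cc: "\<And>X. card (fillings \<A> c m' X) = card {((f, g), (a, b)). (f, g) \<in> ext_pairs \<A> (cod k) (cod i) X \<and>
       (a, b) \<in> ext_pairs \<A> (cod l) (cod j) X \<and> f \<cdot> i = a \<cdot> j \<and> g \<cdot> a = k \<cdot> q' \<and> b \<cdot> f = l \<cdot> p \<and> r \<cdot> g = z \<cdot> b}"
      by (rule corner_fillings[OF I'(7) J(7) K(7) L(7)]) (use I' J K L in auto)
    have e: "(\<Sum>p \<in> P x. if corner_rel p q then 1 else 0) = card (fillings \<A> c m' (rep x))" for x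
    proof -
      have "(\<Sum>p \<in> P x. if corner_rel p q then 1 else 0) = card {p \<in> P x. corner_rel p q}"
        by (rule sum_indicator_card) (simp add: P_def finite_ext_pairs)
      also have "{p \<in> P x. corner_rel p q} = {((f, g), (a, b)). (f, g) \<in> ext_pairs \<A> (cod k) (cod i) (rep x) \<and>
       (a, b) \<in> ext_pairs \<A> (cod l) (cod j) (rep x) \<and> f \<cdot> i = a \<cdot> j \<and> g \<cdot> a = k \<cdot> q' \<and> b \<cdot> f = l \<cdot> p \<and> r \<cdot> g = z \<cdot> b}"
        using I' J K L by (auto simp: P_def qq corner_rel_def)
      finally show ?thesis using cc by simp
    qed
    have fin: "finite (fillings \<A> c m' X)" if "X \<in> Ob \<A>" for X
    proof (rule finite_subset)
      show "fillings \<A> c m' X \<subseteq> Hom (dom c) X \<times> Hom X (cod c)" by (auto simp: fillings_def)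
      show "finite (Hom (dom c) X \<times> Hom X (cod c))" using finite_Hom that kernel_simps(1)[OF c(1)] by simp
    qed
    have "(\<Sum>x \<in> F. of_nat (card (fillings \<A> c m' (rep x))) / autr \<A> x) = euler (cod m') (dom n')"
    proof (rule fillings_sum_euler[OF c(1,2) finF])
      fix X assume X: "X \<in> Ob \<A>" "fillings \<A> c m' X \<noteq> {}"
      \<comment> \<open>Through \<open>cc\<close>, the existence of a filling means that X is an
        extension of m by n, which fixes its class.\<close>
      then have "card (fillings \<A> c m' X) \<noteq> 0" using fin by simp
      then obtain f g where "(f, g) \<in> ext_pairs \<A> (cod k) (cod i) X" unfolding cc by (auto simp: card_eq_0_iff)
      note u = ext_pairsD[OF this]
      have "obj_class \<A> X = \<gamma>" using obj_class_ses[OF u(7)] u I' K rep_props I by (simp add: \<gamma>_def)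
      then show "iso_class \<A> X \<in> F" using constituents_self[of "iso_class \<A> X"] X F by (simp add: \<gamma>_def)
    qed
    then show "(\<Sum>x \<in> F. of_nat (\<Sum>p \<in> P x. if corner_rel p q then 1 else 0) / autr \<A> x) = \<chi> y"
      unfolding e using c I' K by (simp add: \<chi>_def y)
  qed
  then show ?thesis
    by (simp add: P_def Q_def v_def \<chi>_def ext_num_def card_cartesian_product case_prod_unfold mult.assoc)
qed

text \<open>Green's formula with the automorphism factors distributed over the coefficients. The
  Euler number is that of m2 and n1, the inner factors that are interchanged when two coproducts are
  multiplied.\<close>

lemma coeff_green:
  assumes I: "m \<in> Iso \<A>" "n \<in> Iso \<A>"
    and S: "finite S" "S \<subseteq> Iso \<A>" "{x. prod_coeff \<A> (m, n) x \<noteq> 0} \<subseteq> S"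
    and T: "finite T" "\<And>m1 n1 m2 n2. coprod_coeff \<A> m (m1, m2) \<noteq> 0 \<Longrightarrow> coprod_coeff \<A> n (n1, n2) \<noteq> 0 \<Longrightarrow>
      ((m1, n1), (m2, n2)) \<in> T"
  shows "(\<Sum>x \<in> S. prod_coeff \<A> (m, n) x * coprod_coeff \<A> x (a, b)) =
    (\<Sum>((m1, n1), (m2, n2)) \<in> T. euler_char \<A> (groth_class \<A> m2) (groth_class \<A> n1) *
      (coprod_coeff \<A> m (m1, m2) * coprod_coeff \<A> n (n1, n2)) * (prod_coeff \<A> (m1, n1) a * prod_coeff \<A> (m2, n2) b))"
    (is "?L = ?R")
proof (cases "a \<in> Iso \<A> \<and> b \<in> Iso \<A>")
  case False
  then show ?thesis
    by (auto simp: coprod_coeff_def prod_coeff_def intro!: sum.neutral)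
next
  case True
  then have I': "a \<in> Iso \<A>" "b \<in> Iso \<A>" by auto
  define F where "F = constituents \<A> (groth_class \<A> m \<otimes>\<^bsub>groth_monoid \<A>\<^esub> groth_class \<A> n)"
  define E where "E = (\<lambda>(n1, m1, n2, m2). euler (rep m2) (rep n1) *
      (ext_num \<A> n2 n1 n * ext_num \<A> m1 n1 a * ext_num \<A> m2 m1 m * ext_num \<A> m2 n2 b) /
      (autr \<A> n1 * autr \<A> m1 * autr \<A> n2 * autr \<A> m2))"
  define G where "G = (\<lambda>((m1, n1), (m2, n2)). euler_char \<A> (groth_class \<A> m2) (groth_class \<A> n1) *
      (coprod_coeff \<A> m (m1, m2) * coprod_coeff \<A> n (n1, n2)) * (prod_coeff \<A> (m1, n1) a * prod_coeff \<A> (m2, n2) b))"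
  have finF: "finite F" "F \<subseteq> Iso \<A>" using finite_constituents[OF groth_closed[OF I]] constituents_Iso by (auto simp: F_def)
  interpret G: comm_monoid "groth_monoid \<A>" by (rule groth_comm_monoid)
  \<comment> \<open>Both m and n are constituents of the class of their sum, hence so are all
    factors of their coproducts.\<close>
  have mn: "m \<in> F" "n \<in> F" unfolding F_def constituents_def using I groth_mult[OF I] groth_mult[OF I(2,1)]
    by (auto simp: groth_class_carrier G.m_comm)
  have xF: "x \<in> F" if "x \<in> Iso \<A>" "groth_class \<A> x = groth_class \<A> m \<otimes>\<^bsub>groth_monoid \<A>\<^esub> groth_class \<A> n" for x
    using constituents_self[OF that(1)] that(2) by (simp add: F_def)
  have "?L = (\<Sum>x \<in> F. prod_coeff \<A> (m, n) x * coprod_coeff \<A> x (a, b))"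
    by (rule sum_eq_on_support[OF S(1) finF(1)])
      (use xF prod_coeff_nonzero[OF _ I] S in \<open>auto simp del: mult_eq_0_iff simp: mult_eq_0_iff\<close>)
  also have "\<dots> = (\<Sum>x \<in> F. ext_num \<A> m n x * ext_num \<A> b a x / autr \<A> x) / (autr \<A> m * autr \<A> n)"
    unfolding sum_divide_distrib
  proof (rule sum.cong[OF refl])
    fix x assume "x \<in> F"
    then have "x \<in> Iso \<A>" using finF by blast
    then show "prod_coeff \<A> (m, n) x * coprod_coeff \<A> x (a, b) = ext_num \<A> m n x * ext_num \<A> b a x / autr \<A> x / (autr \<A> m * autr \<A> n)"
      using I' by (simp add: prod_coeff_eq coprod_coeff_eq mult_ac)
  qed
  also have "\<dots> = (\<Sum>y \<in> F \<times> F \<times> F \<times> F. E y) / (autr \<A> m * autr \<A> n)"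
    using ext_num_green[OF I I' F_def] by (simp add: E_def)
  also have "\<dots> = (\<Sum>y \<in> (F \<times> F) \<times> (F \<times> F). G y)"
    unfolding sum_divide_distrib
  proof (rule sum.reindex_bij_witness[where i = "\<lambda>((m1, n1), (m2, n2)). (n1, m1, n2, m2)" and j = "\<lambda>(n1, m1, n2, m2). ((m1, n1), (m2, n2))"])
    fix y assume y: "y \<in> F \<times> F \<times> F \<times> F"
    obtain n1 m1 n2 m2 where yy: "y = (n1, m1, n2, m2)" by (metis surj_pair)
    have J: "n1 \<in> Iso \<A>" "m1 \<in> Iso \<A>" "n2 \<in> Iso \<A>" "m2 \<in> Iso \<A>" using y yy finF by auto
    have eu: "euler (rep m2) (rep n1) = euler_char \<A> (groth_class \<A> m2) (groth_class \<A> n1)"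
      using euler_char_eq[of "rep m2" "rep n1"] rep_props J by simp
    show "G ((\<lambda>(n1, m1, n2, m2). ((m1, n1), (m2, n2))) y) = E y / (autr \<A> m * autr \<A> n)"
      unfolding yy using I I' J eu by (simp add: prod_coeff_eq coprod_coeff_eq E_def G_def mult_ac)
  qed auto
  also have "\<dots> = (\<Sum>y \<in> T. G y)"
  proof (rule sum_eq_on_support)
    show "finite ((F \<times> F) \<times> (F \<times> F))" using finF by simp
    show "finite T" by (rule T)
    fix y assume y: "y \<in> (F \<times> F) \<times> (F \<times> F)" "y \<notin> T"
    obtain m1 n1 m2 n2 where yy: "y = ((m1, n1), (m2, n2))" by (metis surj_pair)
    have "coprod_coeff \<A> m (m1, m2) = 0 \<or> coprod_coeff \<A> n (n1, n2) = 0" using T(2) y yy by blast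
    then show "G y = 0" by (auto simp: yy G_def)
  next
    fix y assume y: "y \<in> T" "y \<notin> (F \<times> F) \<times> (F \<times> F)"
    obtain m1 n1 m2 n2 where yy: "y = ((m1, n1), (m2, n2))" by (metis surj_pair)
    have "coprod_coeff \<A> m (m1, m2) = 0 \<or> coprod_coeff \<A> n (n1, n2) = 0"
    proof (rule ccontr)
      assume "\<not> ?thesis"
      then have "m1 \<in> F" "m2 \<in> F" "n1 \<in> F" "n2 \<in> F"
        using coprod_coeff_nonzero(4,5)[OF _ I(1)] coprod_coeff_nonzero(4,5)[OF _ I(2)] mn unfolding F_def by blast+
      then show False using y yy by simp
    qed
    then show "G y = 0" by (auto simp: yy G_def)
  qed
  also have "\<dots> = ?R" by (simp add: G_def)
  finally show ?thesis .
qed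

end


section \<open>Matrices acting on finitely supported functions\<close>

definition fin_supp :: "'x set \<Rightarrow> ('x \<Rightarrow> rat) set" where
  "fin_supp I = {u. finite {x. u x \<noteq> 0} \<and> {x. u x \<noteq> 0} \<subseteq> I}"

text \<open>The first index of the matrix is the input basis. The function is total, but a sum over
  an infinite support is 0, so linearity holds only for finitely supported vectors.\<close>

definition mat_op :: "('x \<Rightarrow> 'y \<Rightarrow> rat) \<Rightarrow> ('x \<Rightarrow> rat) \<Rightarrow> 'y \<Rightarrow> rat" where
  "mat_op \<kappa> u = (\<lambda>z. \<Sum>x | u x \<noteq> 0. u x * \<kappa> x z)"

definition kron :: "('x \<Rightarrow> 'z \<Rightarrow> rat) \<Rightarrow> ('y \<Rightarrow> 'w \<Rightarrow> rat) \<Rightarrow> 'x \<times> 'y \<Rightarrow> 'z \<times> 'w \<Rightarrow> rat" where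
  "kron \<kappa> \<mu> p = \<kappa> (fst p) \<otimes>\<^sub>\<rat> \<mu> (snd p)"

definition linear_on :: "('x \<Rightarrow> rat) set \<Rightarrow> (('x \<Rightarrow> rat) \<Rightarrow> 'y \<Rightarrow> rat) \<Rightarrow> bool" where
  "linear_on S f \<longleftrightarrow> (\<forall>u \<in> S. \<forall>v \<in> S. f (u + v) = f u + f v) \<and> (\<forall>c. \<forall>u \<in> S. f (qscale c u) = qscale c (f u))"

abbreviation is_linear :: "(('x \<Rightarrow> rat) \<Rightarrow> 'y \<Rightarrow> rat) \<Rightarrow> bool" where
  "is_linear \<equiv> Vector_Spaces.linear qscale qscale"

lemma qvec_vector_space: "vector_space (qscale :: rat \<Rightarrow> ('x \<Rightarrow> rat) \<Rightarrow> 'x \<Rightarrow> rat)"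
  by unfold_locales

lemma is_linear_iff: "is_linear f \<longleftrightarrow> linear_on UNIV f"
  unfolding Vector_Spaces.linear_iff linear_on_def by (simp add: qvec_vector_space)

lemma linear_on_subset: "linear_on S f \<Longrightarrow> T \<subseteq> S \<Longrightarrow> linear_on T f"
  unfolding linear_on_def by blast

lemma linear_on_zero: "linear_on S f \<Longrightarrow> 0 \<in> S \<Longrightarrow> f 0 = 0"
proof -
  assume "linear_on S f" "0 \<in> S"
  then have "f (qscale 0 0) = qscale 0 (f 0)" unfolding linear_on_def by blast
  then show ?thesis by simp
qed

text \<open>Membership in the span is carried through the induction, as linearity is assumed only
  there.\<close>

lemma linear_on_span_eq:
  assumes "linear_on (qvec.span B) f" "linear_on (qvec.span B) g" "\<And>b. b \<in> B \<Longrightarrow> f b = g b" "t \<in> qvec.span B"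
  shows "f t = g t"
proof -
  have "t \<in> qvec.span B \<and> f t = g t"
  proof (rule qvec.span_induct[where P = "\<lambda>t. t \<in> qvec.span B \<and> f t = g t", OF assms(4)])
    show "qvec.subspace {t. t \<in> qvec.span B \<and> f t = g t}"
      unfolding qvec.subspace_def
      using assms(1,2) linear_on_zero[OF assms(1) qvec.span_zero] linear_on_zero[OF assms(2) qvec.span_zero]
      by (auto simp: linear_on_def qvec.span_zero qvec.span_add qvec.span_scale)
  qed (use assms(3) in \<open>auto simp: qvec.span_base\<close>)
  then show ?thesis by simp
qed

lemma linear_on_span_into:
  assumes "linear_on (qvec.span B) f" "qvec.subspace V" "\<And>b. b \<in> B \<Longrightarrow> f b \<in> V" "t \<in> qvec.span B"
  shows "f t \<in> V"
proof -
  have "t \<in> qvec.span B \<and> f t \<in> V"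
  proof (rule qvec.span_induct[where P = "\<lambda>t. t \<in> qvec.span B \<and> f t \<in> V", OF assms(4)])
    show "qvec.subspace {t. t \<in> qvec.span B \<and> f t \<in> V}"
      unfolding qvec.subspace_def
      using assms(1,2) linear_on_zero[OF assms(1) qvec.span_zero]
      by (auto simp: linear_on_def qvec.span_zero qvec.span_add qvec.span_scale qvec.subspace_def)
  qed (use assms(3) in \<open>auto simp: qvec.span_base\<close>)
  then show ?thesis by simp
qed

text \<open>\<open>tensor_map\<close> and \<open>braiding\<close> choose among linear maps on the
  whole function space. Such maps exist because a map given on a subspace extends from a basis of
  it.\<close>

lemma linear_extension:
  fixes f :: "('x \<Rightarrow> rat) \<Rightarrow> 'y \<Rightarrow> rat"
  assumes S: "qvec.subspace S" and f: "linear_on S f"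
  obtains L where "is_linear L" "\<And>u. u \<in> S \<Longrightarrow> L u = f u"
proof -
  interpret P: vector_space_pair "qscale :: rat \<Rightarrow> ('x \<Rightarrow> rat) \<Rightarrow> 'x \<Rightarrow> rat" "qscale :: rat \<Rightarrow> ('y \<Rightarrow> rat) \<Rightarrow> 'y \<Rightarrow> rat"
    by unfold_locales
  obtain B where B: "B \<subseteq> S" "qvec.independent B" "S \<subseteq> qvec.span B" by (rule qvec.basis_exists[of S])
  have SB: "S = qvec.span B" using qvec.span_minimal[OF B(1) S] B(3) by (rule antisym[rotated])
  define L where "L = P.construct B f"
  have L: "is_linear L" unfolding L_def by (rule P.linear_construct[OF B(2)])
  have "L u = f u" if "u \<in> S" for u
  proof (rule linear_on_span_eq[of B])
    show "linear_on (qvec.span B) L" using L[unfolded is_linear_iff] by (rule linear_on_subset) simp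
    show "linear_on (qvec.span B) f" using f unfolding SB .
    show "L b = f b" if "b \<in> B" for b unfolding L_def by (rule P.construct_basis[OF B(2) that])
    show "u \<in> qvec.span B" using that unfolding SB .
  qed
  then show ?thesis using that L by blast
qed

section \<open>Tensor products of function spaces\<close>

lemma tensor_apply [simp]: "(u \<otimes>\<^sub>\<rat> v) (x, y) = u x * v y"
  by (simp add: tensor_def)

lemma tensor_add_left: "(u + u') \<otimes>\<^sub>\<rat> v = u \<otimes>\<^sub>\<rat> v + u' \<otimes>\<^sub>\<rat> v"
  by (auto simp: fun_eq_iff algebra_simps)

lemma tensor_add_right: "u \<otimes>\<^sub>\<rat> (v + v') = u \<otimes>\<^sub>\<rat> v + u \<otimes>\<^sub>\<rat> v'"
  by (auto simp: fun_eq_iff algebra_simps)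

lemma tensor_scale_left: "qscale c u \<otimes>\<^sub>\<rat> v = qscale c (u \<otimes>\<^sub>\<rat> v)"
  by (auto simp: fun_eq_iff qscale_def)

lemma tensor_scale_right: "u \<otimes>\<^sub>\<rat> qscale c v = qscale c (u \<otimes>\<^sub>\<rat> v)"
  by (auto simp: fun_eq_iff qscale_def)

lemma is_linear_tensor_left: "linear_on UNIV (\<lambda>u. u \<otimes>\<^sub>\<rat> v)"
  by (simp add: linear_on_def tensor_add_left tensor_scale_left)

lemma is_linear_tensor_right: "linear_on UNIV (\<lambda>v. u \<otimes>\<^sub>\<rat> v)"
  by (simp add: linear_on_def tensor_add_right tensor_scale_right)

lemma tensor_in_space: "u \<in> S \<Longrightarrow> v \<in> T \<Longrightarrow> u \<otimes>\<^sub>\<rat> v \<in> tensor_space S T"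
  unfolding tensor_space_def by (rule qvec.span_base) blast

lemma tensor_space_subspace: "qvec.subspace (tensor_space S T)"
  unfolding tensor_space_def by (rule qvec.subspace_span)

lemma tensor_space_span:
  "tensor_space (qvec.span A) (qvec.span B) = qvec.span {a \<otimes>\<^sub>\<rat> b |a b. a \<in> A \<and> b \<in> B}" (is "?L = qvec.span ?G")
proof
  show "qvec.span ?G \<subseteq> ?L"
    unfolding tensor_space_def by (rule qvec.span_mono) (auto intro: qvec.span_base)
  have 1: "u \<otimes>\<^sub>\<rat> b \<in> qvec.span ?G" if "u \<in> qvec.span A" "b \<in> B" for u b
    by (rule linear_on_span_into[OF linear_on_subset[OF is_linear_tensor_left] _ _ that(1)])
      (use that(2) in \<open>auto intro: qvec.span_base\<close>)
  have 2: "u \<otimes>\<^sub>\<rat> v \<in> qvec.span ?G" if "u \<in> qvec.span A" "v \<in> qvec.span B" for u v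
    by (rule linear_on_span_into[OF linear_on_subset[OF is_linear_tensor_right] _ _ that(2)])
      (use 1 that(1) in auto)
  show "?L \<subseteq> qvec.span ?G"
    unfolding tensor_space_def by (rule qvec.span_minimal) (use 2 in auto)
qed

lemma subspace_fin_supp: "qvec.subspace (fin_supp I)"
proof (rule qvec.subspaceI)
  show "0 \<in> fin_supp I" by (simp add: fin_supp_def)
  fix u v :: "'a \<Rightarrow> rat" and c assume u: "u \<in> fin_supp I"
  have "{x. (qscale c u) x \<noteq> 0} \<subseteq> {x. u x \<noteq> 0}" by (auto simp: qscale_def)
  then show "qscale c u \<in> fin_supp I" using u finite_subset unfolding fin_supp_def by blast
  assume v: "v \<in> fin_supp I"
  have "{x. (u + v) x \<noteq> 0} \<subseteq> {x. u x \<noteq> 0} \<union> {x. v x \<noteq> 0}" by auto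
  moreover have "finite ({x. u x \<noteq> 0} \<union> {x. v x \<noteq> 0})" using u v by (auto simp: fin_supp_def)
  ultimately show "u + v \<in> fin_supp I" using u v finite_subset unfolding fin_supp_def by blast
qed

lemma fin_supp_UNIV: "u \<in> fin_supp I \<Longrightarrow> u \<in> fin_supp UNIV"
  by (simp add: fin_supp_def)

lemma tensor_fin_supp:
  assumes "u \<in> fin_supp I" "v \<in> fin_supp J"
  shows "u \<otimes>\<^sub>\<rat> v \<in> fin_supp (I \<times> J)"
proof -
  have "{p. (u \<otimes>\<^sub>\<rat> v) p \<noteq> 0} = {x. u x \<noteq> 0} \<times> {x. v x \<noteq> 0}" by auto
  then show ?thesis using assms by (auto simp: fin_supp_def)
qed

lemma tensor_space_fin_supp:
  assumes "S \<subseteq> fin_supp I" "T \<subseteq> fin_supp J"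
  shows "tensor_space S T \<subseteq> fin_supp (I \<times> J)"
  unfolding tensor_space_def
  by (rule qvec.span_minimal[OF _ subspace_fin_supp]) (use assms tensor_fin_supp in blast)

section \<open>Matrix operators and Kronecker products\<close>

lemma mat_op_sum:
  assumes "finite S" "{x. u x \<noteq> 0} \<subseteq> S"
  shows "mat_op \<kappa> u z = (\<Sum>x \<in> S. u x * \<kappa> x z)"
  unfolding mat_op_def by (rule sum.mono_neutral_left) (use assms in auto)

lemma mat_op_linear: "linear_on (fin_supp UNIV) (mat_op \<kappa>)"
  unfolding linear_on_def
proof (intro conjI ballI allI)
  fix u v :: "'a \<Rightarrow> rat" and c assume u: "u \<in> fin_supp UNIV"
  show "mat_op \<kappa> (qscale c u) = qscale c (mat_op \<kappa> u)"
  proof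
    fix z
    have "mat_op \<kappa> (qscale c u) z = (\<Sum>x | u x \<noteq> 0. qscale c u x * \<kappa> x z)"
      by (rule mat_op_sum) (use u in \<open>auto simp: fin_supp_def qscale_def\<close>)
    then show "mat_op \<kappa> (qscale c u) z = qscale c (mat_op \<kappa> u) z"
      by (simp add: mat_op_def qscale_def sum_distrib_left mult.assoc)
  qed
  assume v: "v \<in> fin_supp UNIV"
  show "mat_op \<kappa> (u + v) = mat_op \<kappa> u + mat_op \<kappa> v"
  proof
    fix z
    let ?S = "{x. u x \<noteq> 0} \<union> {x. v x \<noteq> 0}"
    have fin: "finite ?S" using u v by (auto simp: fin_supp_def)
    have "mat_op \<kappa> (u + v) z = (\<Sum>x \<in> ?S. (u + v) x * \<kappa> x z)" by (rule mat_op_sum[OF fin]) auto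
    moreover have "mat_op \<kappa> u z = (\<Sum>x \<in> ?S. u x * \<kappa> x z)" by (rule mat_op_sum[OF fin]) auto
    moreover have "mat_op \<kappa> v z = (\<Sum>x \<in> ?S. v x * \<kappa> x z)" by (rule mat_op_sum[OF fin]) auto
    ultimately show "mat_op \<kappa> (u + v) z = (mat_op \<kappa> u + mat_op \<kappa> v) z"
      by (simp add: sum.distrib[symmetric] algebra_simps)
  qed
qed

lemma mat_op_linear_on: "S \<subseteq> fin_supp I \<Longrightarrow> linear_on S (mat_op \<kappa>)"
  using linear_on_subset[OF mat_op_linear] fin_supp_UNIV by blast

lemma mat_op_fin_supp:
  assumes "u \<in> fin_supp I" "\<And>x. x \<in> I \<Longrightarrow> \<kappa> x \<in> fin_supp J"
  shows "mat_op \<kappa> u \<in> fin_supp J"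
proof -
  have *: "{z. mat_op \<kappa> u z \<noteq> 0} \<subseteq> (\<Union>x \<in> {x. u x \<noteq> 0}. {z. \<kappa> x z \<noteq> 0})"
  proof
    fix z assume "z \<in> {z. mat_op \<kappa> u z \<noteq> 0}"
    then have "(\<Sum>x | u x \<noteq> 0. u x * \<kappa> x z) \<noteq> 0" by (simp add: mat_op_def)
    then obtain x where "u x \<noteq> 0" "u x * \<kappa> x z \<noteq> 0" by (metis (mono_tags, lifting) mem_Collect_eq sum.neutral)
    then show "z \<in> (\<Union>x \<in> {x. u x \<noteq> 0}. {z. \<kappa> x z \<noteq> 0})" by auto
  qed
  moreover have "finite (\<Union>x \<in> {x. u x \<noteq> 0}. {z. \<kappa> x z \<noteq> 0})"
    using assms by (intro finite_UN_I) (auto simp: fin_supp_def)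
  moreover have "(\<Union>x \<in> {x. u x \<noteq> 0}. {z. \<kappa> x z \<noteq> 0}) \<subseteq> J" using assms by (auto simp: fin_supp_def)
  ultimately show ?thesis using finite_subset unfolding fin_supp_def by blast
qed

lemma mat_op_comp:
  assumes u: "u \<in> fin_supp I" and \<kappa>: "\<And>x. x \<in> I \<Longrightarrow> \<kappa> x \<in> fin_supp UNIV"
  shows "mat_op \<mu> (mat_op \<kappa> u) = mat_op (\<lambda>x. mat_op \<mu> (\<kappa> x)) u"
proof
  fix z
  let ?U = "{x. u x \<noteq> 0}" and ?S = "\<Union>x \<in> {x. u x \<noteq> 0}. {y. \<kappa> x y \<noteq> 0}"
  have fU: "finite ?U" "?U \<subseteq> I" using u by (auto simp: fin_supp_def)
  have fS: "finite ?S" using fU \<kappa> by (intro finite_UN_I) (auto simp: fin_supp_def)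
  have sub: "{y. mat_op \<kappa> u y \<noteq> 0} \<subseteq> ?S"
  proof
    fix y assume "y \<in> {y. mat_op \<kappa> u y \<noteq> 0}"
    then have "(\<Sum>x | u x \<noteq> 0. u x * \<kappa> x y) \<noteq> 0" by (simp add: mat_op_def)
    then obtain x where "u x \<noteq> 0" "u x * \<kappa> x y \<noteq> 0" by (metis (mono_tags, lifting) mem_Collect_eq sum.neutral)
    then show "y \<in> ?S" by auto
  qed
  have "mat_op \<mu> (mat_op \<kappa> u) z = (\<Sum>y \<in> ?S. (\<Sum>x \<in> ?U. u x * \<kappa> x y) * \<mu> y z)"
    by (subst mat_op_sum[OF fS sub]) (simp add: mat_op_def)
  also have "\<dots> = (\<Sum>x \<in> ?U. u x * (\<Sum>y \<in> ?S. \<kappa> x y * \<mu> y z))"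
    by (simp add: sum_distrib_left sum_distrib_right mult.assoc) (rule sum.swap)
  also have "\<dots> = (\<Sum>x \<in> ?U. u x * mat_op \<mu> (\<kappa> x) z)"
    by (rule sum.cong[OF refl]) (use fS in \<open>auto intro!: arg_cong[of _ _ "(*) _"] mat_op_sum[symmetric]\<close>)
  finally show "mat_op \<mu> (mat_op \<kappa> u) z = mat_op (\<lambda>x. mat_op \<mu> (\<kappa> x)) u z"
    by (simp add: mat_op_def[of "\<lambda>x. mat_op \<mu> (\<kappa> x)"])
qed

lemma basis_vector_apply: "basis_vector a b = (if b = a then 1 else 0)"
  by (simp add: basis_vector_def)

lemma basis_vector_fin_supp: "a \<in> I \<Longrightarrow> basis_vector a \<in> fin_supp I"
  by (auto simp: fin_supp_def basis_vector_apply)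

lemma mat_op_basis_vector: "u \<in> fin_supp I \<Longrightarrow> mat_op basis_vector u = u"
proof
  fix z assume u: "u \<in> fin_supp I"
  have "mat_op basis_vector u z = (\<Sum>x | u x \<noteq> 0. if x = z then u x else 0)"
    unfolding mat_op_def by (rule sum.cong) (auto simp: basis_vector_apply)
  also have "\<dots> = u z" using u by (simp add: fin_supp_def sum.delta)
  finally show "mat_op basis_vector u z = u z" .
qed

lemma mat_op_at_basis_vector: "mat_op \<kappa> (basis_vector a) = \<kappa> a"
proof
  fix z
  have "mat_op \<kappa> (basis_vector a) z = (\<Sum>x \<in> {a}. basis_vector a x * \<kappa> x z)" by (rule mat_op_sum) (auto simp: basis_vector_apply)
  then show "mat_op \<kappa> (basis_vector a) z = \<kappa> a z" by (simp add: basis_vector_apply)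
qed

lemma kron_apply: "kron \<kappa> \<mu> (x, y) = \<kappa> x \<otimes>\<^sub>\<rat> \<mu> y"
  by (simp add: kron_def)

lemma mat_op_kron:
  fixes \<kappa> :: "'x \<Rightarrow> 'z \<Rightarrow> rat" and \<mu> :: "'y \<Rightarrow> 'w \<Rightarrow> rat"
  assumes "u \<in> fin_supp I" "v \<in> fin_supp J"
  shows "mat_op (kron \<kappa> \<mu>) (u \<otimes>\<^sub>\<rat> v) = mat_op \<kappa> u \<otimes>\<^sub>\<rat> mat_op \<mu> v"
proof
  fix p :: "'z \<times> 'w"
  obtain z w where p: "p = (z, w)" by fastforce
  have fin: "finite {x. u x \<noteq> 0}" "finite {x. v x \<noteq> 0}" using assms by (auto simp: fin_supp_def)
  have "mat_op (kron \<kappa> \<mu>) (u \<otimes>\<^sub>\<rat> v) p = (\<Sum>q \<in> {x. u x \<noteq> 0} \<times> {x. v x \<noteq> 0}. (u \<otimes>\<^sub>\<rat> v) q * kron \<kappa> \<mu> q p)"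
    by (rule mat_op_sum) (use fin in auto)
  also have "\<dots> = (\<Sum>x | u x \<noteq> 0. \<Sum>y | v y \<noteq> 0. (u x * \<kappa> x z) * (v y * \<mu> y w))"
    unfolding sum.cartesian_product by (rule sum.cong) (auto simp: kron_apply p)
  also have "\<dots> = mat_op \<kappa> u z * mat_op \<mu> v w"
    by (simp add: mat_op_def sum_product)
  finally show "mat_op (kron \<kappa> \<mu>) (u \<otimes>\<^sub>\<rat> v) p = (mat_op \<kappa> u \<otimes>\<^sub>\<rat> mat_op \<mu> v) p" by (simp add: p)
qed

text \<open>\<open>tensor_map\<close> is chosen among globally defined linear maps, but on the tensor space of two spaces
  of finitely supported functions it is the Kronecker product of matrices.\<close>

lemma tensor_map_mat:
  fixes f :: "('x \<Rightarrow> rat) \<Rightarrow> 'z \<Rightarrow> rat" and g :: "('y \<Rightarrow> rat) \<Rightarrow> 'w \<Rightarrow> rat"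
  assumes S: "S \<subseteq> fin_supp I" and T: "T \<subseteq> fin_supp J"
    and f: "\<And>u. u \<in> S \<Longrightarrow> f u = mat_op \<kappa> u" and g: "\<And>v. v \<in> T \<Longrightarrow> g v = mat_op \<mu> v"
    and t: "t \<in> tensor_space S T"
  shows "tensor_map S T f g t = mat_op (kron \<kappa> \<mu>) t"
proof -
  have lin: "linear_on (tensor_space S T) (mat_op (kron \<kappa> \<mu>))"
    using mat_op_linear_on[OF tensor_space_fin_supp[OF S T]] .
  obtain L :: "('x \<times> 'y \<Rightarrow> rat) \<Rightarrow> 'z \<times> 'w \<Rightarrow> rat"
    where L: "is_linear L" "\<And>t. t \<in> tensor_space S T \<Longrightarrow> L t = mat_op (kron \<kappa> \<mu>) t"
    using linear_extension[OF tensor_space_subspace lin] by blast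
  have val: "mat_op (kron \<kappa> \<mu>) (u \<otimes>\<^sub>\<rat> v) = f u \<otimes>\<^sub>\<rat> g v" if "u \<in> S" "v \<in> T" for u v
    using mat_op_kron[of u I v J] that S T f g by auto
  define Q where "Q = (\<lambda>L :: ('x \<times> 'y \<Rightarrow> rat) \<Rightarrow> 'z \<times> 'w \<Rightarrow> rat. is_linear L \<and> (\<forall>u \<in> S. \<forall>v \<in> T. L (u \<otimes>\<^sub>\<rat> v) = f u \<otimes>\<^sub>\<rat> g v))"
  \<comment> \<open>The extension \<open>L\<close> witnesses the specification behind the choice,
    and on the tensor space that specification leaves no freedom.\<close>
  have "Q L" unfolding Q_def using L val tensor_in_space by metis
  then have "Q (SOME L. Q L)" by (rule someI[of Q])
  then have q: "Q (tensor_map S T f g)" by (simp add: tensor_map_def Q_def)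
  show ?thesis
  proof (rule linear_on_span_eq[OF _ _ _ t[unfolded tensor_space_def]])
    have "linear_on UNIV (tensor_map S T f g)" using q unfolding Q_def is_linear_iff by (rule conjunct1)
    then show "linear_on (qvec.span {u \<otimes>\<^sub>\<rat> v |u v. u \<in> S \<and> v \<in> T}) (tensor_map S T f g)"
      by (rule linear_on_subset) simp
    show "linear_on (qvec.span {u \<otimes>\<^sub>\<rat> v |u v. u \<in> S \<and> v \<in> T}) (mat_op (kron \<kappa> \<mu>))"
      using lin by (simp add: tensor_space_def)
  qed (use q val in \<open>auto simp: Q_def\<close>)
qed

lemma mat_op_kron_space:
  assumes S: "S \<subseteq> fin_supp I" and T: "T \<subseteq> fin_supp J"
    and f: "\<And>u. u \<in> S \<Longrightarrow> mat_op \<kappa> u \<in> S'" and g: "\<And>v. v \<in> T \<Longrightarrow> mat_op \<mu> v \<in> T'"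
    and t: "t \<in> tensor_space S T"
  shows "mat_op (kron \<kappa> \<mu>) t \<in> tensor_space S' T'"
proof (rule linear_on_span_into[OF _ tensor_space_subspace _ t[unfolded tensor_space_def]])
  show "linear_on (qvec.span {u \<otimes>\<^sub>\<rat> v |u v. u \<in> S \<and> v \<in> T}) (mat_op (kron \<kappa> \<mu>))"
    using mat_op_linear_on[OF tensor_space_fin_supp[OF S T]] by (simp add: tensor_space_def)
  fix b assume "b \<in> {u \<otimes>\<^sub>\<rat> v |u v. u \<in> S \<and> v \<in> T}"
  then obtain u v where "b = u \<otimes>\<^sub>\<rat> v" "u \<in> S" "v \<in> T" by blast
  then show "mat_op (kron \<kappa> \<mu>) b \<in> tensor_space S' T'"
    using mat_op_kron[of u I v J \<kappa> \<mu>] tensor_in_space[OF f g] S T by (metis subsetD)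
qed

section \<open>Rebracketing and slices of tensors\<close>

lemma assoc_right_tensor: "assoc_right ((u \<otimes>\<^sub>\<rat> v) \<otimes>\<^sub>\<rat> w) = u \<otimes>\<^sub>\<rat> (v \<otimes>\<^sub>\<rat> w)"
  by (auto simp: assoc_right_def fun_eq_iff)

lemma assoc_left_tensor: "assoc_left (u \<otimes>\<^sub>\<rat> (v \<otimes>\<^sub>\<rat> w)) = (u \<otimes>\<^sub>\<rat> v) \<otimes>\<^sub>\<rat> w"
  by (auto simp: assoc_left_def fun_eq_iff)

lemma assoc_linear: "linear_on S assoc_right" "linear_on T assoc_left"
  by (auto simp: linear_on_def assoc_right_def assoc_left_def fun_eq_iff qscale_def)

lemma tensor_space_triple_left:
  assumes "qvec.subspace W"
  shows "tensor_space (tensor_space U V) W = qvec.span {(u \<otimes>\<^sub>\<rat> v) \<otimes>\<^sub>\<rat> w |u v w. u \<in> U \<and> v \<in> V \<and> w \<in> W}"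
proof -
  note span = qvec.span_eq_iff[THEN iffD2, OF assms]
  have "tensor_space (tensor_space U V) W = qvec.span {a \<otimes>\<^sub>\<rat> b |a b. a \<in> {u \<otimes>\<^sub>\<rat> v |u v. u \<in> U \<and> v \<in> V} \<and> b \<in> W}"
    using tensor_space_span[of "{u \<otimes>\<^sub>\<rat> v |u v. u \<in> U \<and> v \<in> V}" W] unfolding span by (simp only: tensor_space_def[of U V])
  also have "{a \<otimes>\<^sub>\<rat> b |a b. a \<in> {u \<otimes>\<^sub>\<rat> v |u v. u \<in> U \<and> v \<in> V} \<and> b \<in> W} = {(u \<otimes>\<^sub>\<rat> v) \<otimes>\<^sub>\<rat> w |u v w. u \<in> U \<and> v \<in> V \<and> w \<in> W}"
    by blast
  finally show ?thesis .
qed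

lemma tensor_space_triple_right:
  assumes "qvec.subspace U"
  shows "tensor_space U (tensor_space V W) = qvec.span {u \<otimes>\<^sub>\<rat> (v \<otimes>\<^sub>\<rat> w) |u v w. u \<in> U \<and> v \<in> V \<and> w \<in> W}"
proof -
  note span = qvec.span_eq_iff[THEN iffD2, OF assms]
  have "tensor_space U (tensor_space V W) = qvec.span {a \<otimes>\<^sub>\<rat> b |a b. a \<in> U \<and> b \<in> {u \<otimes>\<^sub>\<rat> v |u v. u \<in> V \<and> v \<in> W}}"
    using tensor_space_span[of U "{u \<otimes>\<^sub>\<rat> v |u v. u \<in> V \<and> v \<in> W}"] unfolding span by (simp only: tensor_space_def[of V W])
  also have "{a \<otimes>\<^sub>\<rat> b |a b. a \<in> U \<and> b \<in> {u \<otimes>\<^sub>\<rat> v |u v. u \<in> V \<and> v \<in> W}} = {u \<otimes>\<^sub>\<rat> (v \<otimes>\<^sub>\<rat> w) |u v w. u \<in> U \<and> v \<in> V \<and> w \<in> W}"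
    by blast
  finally show ?thesis .
qed

lemma assoc_right_space:
  assumes "qvec.subspace U" "qvec.subspace W" "t \<in> tensor_space (tensor_space U V) W"
  shows "assoc_right t \<in> tensor_space U (tensor_space V W)"
proof (rule linear_on_span_into[OF assoc_linear(1) tensor_space_subspace _ assms(3)[unfolded tensor_space_triple_left[OF assms(2)]]])
  fix b assume "b \<in> {(u \<otimes>\<^sub>\<rat> v) \<otimes>\<^sub>\<rat> w |u v w. u \<in> U \<and> v \<in> V \<and> w \<in> W}"
  then obtain u v w where "b = (u \<otimes>\<^sub>\<rat> v) \<otimes>\<^sub>\<rat> w" "u \<in> U" "v \<in> V" "w \<in> W" by blast
  then show "assoc_right b \<in> tensor_space U (tensor_space V W)" by (simp add: assoc_right_tensor tensor_in_space)
qed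

lemma assoc_left_space:
  assumes "qvec.subspace U" "qvec.subspace W" "t \<in> tensor_space U (tensor_space V W)"
  shows "assoc_left t \<in> tensor_space (tensor_space U V) W"
proof (rule linear_on_span_into[OF assoc_linear(2) tensor_space_subspace _ assms(3)[unfolded tensor_space_triple_right[OF assms(1)]]])
  fix b assume "b \<in> {u \<otimes>\<^sub>\<rat> (v \<otimes>\<^sub>\<rat> w) |u v w. u \<in> U \<and> v \<in> V \<and> w \<in> W}"
  then obtain u v w where "b = u \<otimes>\<^sub>\<rat> (v \<otimes>\<^sub>\<rat> w)" "u \<in> U" "v \<in> V" "w \<in> W" by blast
  then show "assoc_left b \<in> tensor_space (tensor_space U V) W" by (simp add: assoc_left_tensor tensor_in_space)
qed

text \<open>The identity tensored with \<mu> acts on each row of \<open>t\<close> separately, which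
  reduces sums over pairs to sums over one index.\<close>

lemma mat_op_kron_slice_right:
  assumes "t \<in> fin_supp K"
  shows "mat_op (kron basis_vector \<mu>) t (a, z) = mat_op \<mu> (\<lambda>y. t (a, y)) z"
proof -
  let ?S = "{p. t p \<noteq> 0}"
  have fin: "finite ?S" using assms by (simp add: fin_supp_def)
  have "mat_op (kron basis_vector \<mu>) t (a, z) = (\<Sum>p \<in> (insert a (fst ` ?S)) \<times> (snd ` ?S). t p * kron basis_vector \<mu> p (a, z))"
    by (rule mat_op_sum) (use fin in \<open>force+\<close>)
  also have "\<dots> = (\<Sum>x \<in> insert a (fst ` ?S). \<Sum>y \<in> snd ` ?S. t (x, y) * kron basis_vector \<mu> (x, y) (a, z))"
    by (simp add: sum.cartesian_product)
  also have "\<dots> = (\<Sum>x \<in> insert a (fst ` ?S). if x = a then \<Sum>y \<in> snd ` ?S. t (a, y) * \<mu> y z else 0)"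
    by (rule sum.cong) (auto simp: kron_apply basis_vector_apply)
  also have "\<dots> = (\<Sum>y \<in> snd ` ?S. t (a, y) * \<mu> y z)"
    using fin by (subst sum.delta) auto
  also have "\<dots> = mat_op \<mu> (\<lambda>y. t (a, y)) z"
    by (rule mat_op_sum[symmetric]) (use fin in \<open>force+\<close>)
  finally show ?thesis .
qed

lemma mat_op_kron_slice_left:
  assumes "t \<in> fin_supp K"
  shows "mat_op (kron \<kappa> basis_vector) t (z, b) = mat_op \<kappa> (\<lambda>x. t (x, b)) z"
proof -
  let ?S = "{p. t p \<noteq> 0}"
  have fin: "finite ?S" using assms by (simp add: fin_supp_def)
  have "mat_op (kron \<kappa> basis_vector) t (z, b) = (\<Sum>p \<in> (fst ` ?S) \<times> insert b (snd ` ?S). t p * kron \<kappa> basis_vector p (z, b))"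
    by (rule mat_op_sum) (use fin in \<open>force+\<close>)
  also have "\<dots> = (\<Sum>x \<in> fst ` ?S. \<Sum>y \<in> insert b (snd ` ?S). t (x, y) * kron \<kappa> basis_vector (x, y) (z, b))"
    by (simp add: sum.cartesian_product)
  also have "\<dots> = (\<Sum>x \<in> fst ` ?S. \<Sum>y \<in> insert b (snd ` ?S). if y = b then t (x, b) * \<kappa> x z else 0)"
    by (intro sum.cong refl) (auto simp: kron_apply basis_vector_apply)
  also have "\<dots> = (\<Sum>x \<in> fst ` ?S. t (x, b) * \<kappa> x z)"
    using fin by (intro sum.cong refl, subst sum.delta) auto
  also have "\<dots> = mat_op \<kappa> (\<lambda>x. t (x, b)) z"
    by (rule mat_op_sum[symmetric]) (use fin in \<open>force+\<close>)
  finally show ?thesis .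
qed

lemma slice_fin_supp:
  assumes "t \<in> fin_supp (I \<times> J)"
  shows "(\<lambda>x. t (x, b)) \<in> fin_supp I" "(\<lambda>y. t (a, y)) \<in> fin_supp J"
proof -
  have fin: "finite {p. t p \<noteq> 0}" "{p. t p \<noteq> 0} \<subseteq> I \<times> J" using assms by (auto simp: fin_supp_def)
  have "{x. t (x, b) \<noteq> 0} \<subseteq> fst ` {p. t p \<noteq> 0}" "{y. t (a, y) \<noteq> 0} \<subseteq> snd ` {p. t p \<noteq> 0}" by force+
  then show "(\<lambda>x. t (x, b)) \<in> fin_supp I" "(\<lambda>y. t (a, y)) \<in> fin_supp J"
    using fin finite_subset[OF _ finite_imageI[OF fin(1)]] by (auto simp: fin_supp_def)
qed

text \<open>Green's form, when \<open>w\<close> is the order of the automorphism group.\<close>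

definition wform :: "('x \<Rightarrow> rat) \<Rightarrow> ('x \<Rightarrow> rat) \<Rightarrow> ('x \<Rightarrow> rat) \<Rightarrow> rat" where
  "wform w u v = (\<Sum>x | u x \<noteq> 0. u x * v x / w x)"

lemma wform_sum:
  assumes "finite S" "{x. u x \<noteq> 0} \<subseteq> S"
  shows "wform w u v = (\<Sum>x \<in> S. u x * v x / w x)"
  unfolding wform_def by (rule sum.mono_neutral_left) (use assms in auto)

lemma wform_sym:
  assumes "u \<in> fin_supp I" "v \<in> fin_supp J"
  shows "wform w u v = wform w v u"
proof -
  let ?S = "{x. u x \<noteq> 0} \<union> {x. v x \<noteq> 0}"
  have fin: "finite ?S" using assms by (auto simp: fin_supp_def)
  show ?thesis using wform_sum[OF fin, of u w v] wform_sum[OF fin, of v w u] by (auto simp: mult.commute)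
qed

lemma wform_add_right: "wform w u (v + v') = wform w u v + wform w u v'"
  by (simp add: wform_def sum.distrib[symmetric] algebra_simps add_divide_distrib)

lemma wform_scale_right: "wform w u (qscale c v) = c * wform w u v"
  by (simp add: wform_def qscale_def sum_distrib_left mult_ac)

lemma wform_zero_right [simp]: "wform w u 0 = 0"
  by (simp add: wform_def)

lemma wform_span_right:
  assumes "\<And>b. b \<in> B \<Longrightarrow> wform w u b = 0" "v \<in> qvec.span B"
  shows "wform w u v = 0"
proof -
  have "v \<in> {v. wform w u v = 0}"
    by (rule qvec.span_induct[OF assms(2)])
      (use assms(1) in \<open>auto simp: qvec.subspace_def wform_add_right wform_scale_right\<close>)
  then show ?thesis by simp
qed

text \<open>The form is linear in its second argument by construction; for the first argument
  symmetry is used, which requires finite supports.\<close>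

lemma wform_span_left:
  assumes "\<And>b. b \<in> B \<Longrightarrow> wform w b u = 0" "v \<in> qvec.span B" "B \<subseteq> fin_supp I" "u \<in> fin_supp J"
  shows "wform w v u = 0"
proof -
  have "v \<in> fin_supp I" using assms(2,3) qvec.span_minimal[OF assms(3) subspace_fin_supp] by blast
  moreover have "wform w u v = 0"
    by (rule wform_span_right[OF _ assms(2)]) (use assms wform_sym in \<open>metis subsetD\<close>)
  ultimately show ?thesis using wform_sym assms(4) by metis
qed

lemma wform_definite:
  assumes "u \<in> fin_supp I" "\<And>x. x \<in> I \<Longrightarrow> w x > 0" "wform w u u = 0"
  shows "u = 0"
proof (rule ccontr)
  assume "u \<noteq> 0"
  then obtain x where x: "u x \<noteq> 0" by (auto simp: fun_eq_iff)
  have fin: "finite {x. u x \<noteq> 0}" and I: "{x. u x \<noteq> 0} \<subseteq> I" using assms by (auto simp: fin_supp_def)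
  have "wform w u u > 0"
    unfolding wform_def
    by (rule sum_pos2[OF fin, of x]) (use x I assms(2) in \<open>auto intro!: divide_pos_pos divide_nonneg_pos simp: zero_less_mult_iff less_le subset_iff\<close>)
  then show False using assms(3) by simp
qed

lemma wform_tensor:
  assumes "u \<in> fin_supp I" "v \<in> fin_supp J"
  shows "wform (\<lambda>(x, y). w x * w y) (u \<otimes>\<^sub>\<rat> v) (u' \<otimes>\<^sub>\<rat> v') = wform w u u' * wform w v v'"
proof -
  have fin: "finite {x. u x \<noteq> 0}" "finite {x. v x \<noteq> 0}" using assms by (auto simp: fin_supp_def)
  have "wform (\<lambda>(x, y). w x * w y) (u \<otimes>\<^sub>\<rat> v) (u' \<otimes>\<^sub>\<rat> v') =
    (\<Sum>p \<in> {x. u x \<noteq> 0} \<times> {x. v x \<noteq> 0}. (u \<otimes>\<^sub>\<rat> v) p * (u' \<otimes>\<^sub>\<rat> v') p / (case p of (x, y) \<Rightarrow> w x * w y))"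
    by (rule wform_sum) (use fin in auto)
  also have "\<dots> = (\<Sum>x | u x \<noteq> 0. \<Sum>y | v y \<noteq> 0. (u x * u' x / w x) * (v y * v' y / w y))"
    unfolding sum.cartesian_product by (rule sum.cong) (auto simp: mult_ac)
  also have "\<dots> = wform w u u' * wform w v v'" by (simp add: wform_def sum_product)
  finally show ?thesis .
qed


section \<open>Braided bialgebras given by structure constants\<close>

lemma sum_fun_apply: "(\<Sum>i \<in> F. f i :: 'x \<Rightarrow> rat) x = (\<Sum>i \<in> F. f i x)"
  by (induction F rule: infinite_finite_induct) auto

lemma linear_on_comp:
  assumes "linear_on S f" "\<And>u. u \<in> S \<Longrightarrow> f u \<in> T" "linear_on T g"
  shows "linear_on S (\<lambda>u. g (f u))"
  using assms unfolding linear_on_def by auto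

lemma linear_on_ident: "linear_on S (\<lambda>u. u)"
  by (simp add: linear_on_def)

lemma mat_op_nonzero:
  assumes "mat_op \<kappa> u z \<noteq> 0"
  obtains x where "u x \<noteq> 0" "\<kappa> x z \<noteq> 0"
proof -
  have "(\<Sum>x | u x \<noteq> 0. u x * \<kappa> x z) \<noteq> 0" using assms by (simp add: mat_op_def)
  then obtain x where "u x \<noteq> 0" "u x * \<kappa> x z \<noteq> 0" by (metis (mono_tags, lifting) mem_Collect_eq sum.neutral)
  then show ?thesis using that by auto
qed

lemma fin_supp_span: "fin_supp K = qvec.span (basis_vector ` K)"
proof
  show "qvec.span (basis_vector ` K) \<subseteq> fin_supp K"
    by (rule qvec.span_minimal[OF _ subspace_fin_supp]) (auto intro: basis_vector_fin_supp)
  show "fin_supp K \<subseteq> qvec.span (basis_vector ` K)"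
  proof
    fix u assume u: "u \<in> fin_supp K"
    have "mat_op basis_vector u = (\<Sum>x | u x \<noteq> 0. qscale (u x) (basis_vector x))"
      by (rule ext) (simp only: sum_fun_apply qscale_def mat_op_def)
    also have "\<dots> \<in> qvec.span (basis_vector ` K)"
      using u by (intro qvec.span_sum qvec.span_scale qvec.span_base) (auto simp: fin_supp_def)
    finally show "u \<in> qvec.span (basis_vector ` K)" unfolding mat_op_basis_vector[OF u] .
  qed
qed

text \<open>By this, bialgebra identities reduce to basis vectors, that is to the identities between
  coefficients assumed in \<open>structure_constants\<close>.\<close>

lemma fin_supp_linear_eq:
  assumes "linear_on (fin_supp K) f" "linear_on (fin_supp K) g"
    "\<And>x. x \<in> K \<Longrightarrow> f (basis_vector x) = g (basis_vector x)" "t \<in> fin_supp K"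
  shows "f t = g t"
  using linear_on_span_eq[of "basis_vector ` K" f g t] assms unfolding fin_supp_span[symmetric] by blast

lemma tensor_basis_vector: "basis_vector a \<otimes>\<^sub>\<rat> basis_vector b = basis_vector (a, b)"
  by (auto simp: fun_eq_iff basis_vector_apply)

lemma assoc_basis_vector:
  "assoc_right (basis_vector ((a, b), c)) = basis_vector (a, (b, c))"
  "assoc_left (basis_vector (a, (b, c))) = basis_vector ((a, b), c)"
  by (simp_all flip: tensor_basis_vector add: assoc_right_tensor assoc_left_tensor)

lemma assoc_fin_supp:
  "t \<in> fin_supp ((I \<times> J) \<times> K) \<Longrightarrow> assoc_right t \<in> fin_supp (I \<times> (J \<times> K))"
  "s \<in> fin_supp (I \<times> (J \<times> K)) \<Longrightarrow> assoc_left s \<in> fin_supp ((I \<times> J) \<times> K)"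
proof -
  have 1: "qvec.span (basis_vector ` K) = fin_supp K" for K by (simp add: fin_supp_span)
  assume "t \<in> fin_supp ((I \<times> J) \<times> K)"
  then have t: "t \<in> qvec.span (basis_vector ` ((I \<times> J) \<times> K))" by (simp add: 1)
  show "assoc_right t \<in> fin_supp (I \<times> (J \<times> K))"
    by (rule linear_on_span_into[OF assoc_linear(1) subspace_fin_supp _ t])
      (auto simp: assoc_basis_vector intro!: basis_vector_fin_supp)
next
  have 1: "qvec.span (basis_vector ` K) = fin_supp K" for K by (simp add: fin_supp_span)
  assume "s \<in> fin_supp (I \<times> (J \<times> K))"
  then have s: "s \<in> qvec.span (basis_vector ` (I \<times> (J \<times> K)))" by (simp add: 1)
  show "assoc_left s \<in> fin_supp ((I \<times> J) \<times> K)"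
    by (rule linear_on_span_into[OF assoc_linear(2) subspace_fin_supp _ s])
      (auto simp: assoc_basis_vector intro!: basis_vector_fin_supp)
qed

text \<open>In \<open>dual\<close> the factors are reversed: the coproduct is adjoint to the opposite product.\<close>

locale structure_constants = comm_monoid \<Gamma> for \<Gamma> :: "'g monoid" +
  fixes \<chi> :: "'g \<Rightarrow> 'g \<Rightarrow> rat" and I :: "'x set" and deg :: "'x \<Rightarrow> 'g" and z :: 'x
    and pm :: "'x \<times> 'x \<Rightarrow> 'x \<Rightarrow> rat" and dm :: "'x \<Rightarrow> 'x \<times> 'x \<Rightarrow> rat" and w :: "'x \<Rightarrow> rat"
  assumes bichar: "bicharacter \<Gamma> \<chi>"
    and z_in: "z \<in> I" and deg_z: "deg z = \<one>\<^bsub>\<Gamma>\<^esub>" and deg_carrier: "a \<in> I \<Longrightarrow> deg a \<in> carrier \<Gamma>"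
    and pm_fin: "p \<in> I \<times> I \<Longrightarrow> pm p \<in> fin_supp I"
    and dm_fin: "c \<in> I \<Longrightarrow> dm c \<in> fin_supp (I \<times> I)"
    and pm_deg: "a \<in> I \<Longrightarrow> b \<in> I \<Longrightarrow> pm (a, b) c \<noteq> 0 \<Longrightarrow> deg c = deg a \<otimes>\<^bsub>\<Gamma>\<^esub> deg b"
    and dm_deg: "c \<in> I \<Longrightarrow> dm c (a, b) \<noteq> 0 \<Longrightarrow> deg c = deg a \<otimes>\<^bsub>\<Gamma>\<^esub> deg b"
    and pm_unit: "a \<in> I \<Longrightarrow> pm (z, a) = basis_vector a" "a \<in> I \<Longrightarrow> pm (a, z) = basis_vector a"
    and pm_counit: "a \<in> I \<Longrightarrow> b \<in> I \<Longrightarrow> pm (a, b) z = (if a = z \<and> b = z then 1 else 0)"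
    and dm_unit: "dm z = basis_vector (z, z)"
    and dm_counit: "c \<in> I \<Longrightarrow> dm c (z, a) = (if a = c then 1 else 0)"
      "c \<in> I \<Longrightarrow> dm c (a, z) = (if a = c then 1 else 0)"
    and pm_assoc: "a \<in> I \<Longrightarrow> b \<in> I \<Longrightarrow> c \<in> I \<Longrightarrow>
      mat_op pm (kron pm basis_vector ((a, b), c)) = mat_op pm (kron basis_vector pm (a, (b, c)))"
    and dm_coassoc: "c \<in> I \<Longrightarrow>
      assoc_right (mat_op (kron dm basis_vector) (dm c)) = mat_op (kron basis_vector dm) (dm c)"
    and green: "a \<in> I \<Longrightarrow> b \<in> I \<Longrightarrow> mat_op dm (pm (a, b)) = mat_op (kron pm pm)
      (mat_op (\<lambda>((a, b), (c, d)). qscale (\<chi> (deg b) (deg c)) (basis_vector ((a, c), (b, d)))) (kron dm dm (a, b)))"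
    and w_pos: "a \<in> I \<Longrightarrow> w a > 0"
    and dual: "a \<in> I \<Longrightarrow> b \<in> I \<Longrightarrow> c \<in> I \<Longrightarrow> dm c (a, b) / (w a * w b) = pm (b, a) c / w c"
begin

abbreviation comp :: "'g \<Rightarrow> ('x \<Rightarrow> rat) set" where
  "comp \<gamma> \<equiv> {u \<in> fin_supp I. \<forall>a. u a \<noteq> 0 \<longrightarrow> deg a = \<gamma>}"

definition H :: "('g, 'x) bialg" where
  "H = \<lparr>space = fin_supp I, component = comp, product = mat_op pm, unity = basis_vector z,
     coproduct = mat_op dm, counit = (\<lambda>u. u z)\<rparr>"

lemma H_simps [simp]:
  "space H = fin_supp I" "component H = comp" "product H = mat_op pm" "unity H = basis_vector z"
  "coproduct H = mat_op dm" "counit H = (\<lambda>u. u z)"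
  by (simp_all add: H_def)

text \<open>Gradedness of a subspace is expressed as stability under these projections: such a
  subspace is the direct sum of its homogeneous parts
  (\<open>direct_sum_homogeneous\<close>).\<close>

definition pr :: "'g \<Rightarrow> ('x \<Rightarrow> rat) \<Rightarrow> 'x \<Rightarrow> rat" where
  "pr \<gamma> u = (\<lambda>a. if deg a = \<gamma> then u a else 0)"

text \<open>The matrix of the braiding applied to the two middle factors.\<close>

abbreviation mk :: "('x \<times> 'x) \<times> ('x \<times> 'x) \<Rightarrow> ('x \<times> 'x) \<times> ('x \<times> 'x) \<Rightarrow> rat" where
  "mk \<equiv> \<lambda>((a, b), (c, d)). qscale (\<chi> (deg b) (deg c)) (basis_vector ((a, c), (b, d)))"

lemma subspace_comp: "qvec.subspace (comp \<gamma>)"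
proof (rule qvec.subspaceI)
  show "0 \<in> comp \<gamma>" by (simp add: fin_supp_def)
  fix u v c assume u: "u \<in> comp \<gamma>"
  show "qscale c u \<in> comp \<gamma>" using u qvec.subspace_scale[OF subspace_fin_supp[of I]] by (auto simp: qscale_def)
  assume v: "v \<in> comp \<gamma>"
  have "deg a = \<gamma>" if "(u + v) a \<noteq> 0" for a using u v that by (cases "u a = 0") auto
  then show "u + v \<in> comp \<gamma>" using u v qvec.subspace_add[OF subspace_fin_supp[of I]] by blast
qed

lemma unity_comp: "basis_vector z \<in> comp \<one>\<^bsub>\<Gamma>\<^esub>"
  using basis_vector_fin_supp[OF z_in] deg_z by (auto simp: basis_vector_apply)

lemma pr_linear: "linear_on S (pr \<gamma>)"
  by (auto simp: linear_on_def pr_def fun_eq_iff qscale_def)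

lemma pr_homogeneous: "u \<in> comp \<alpha> \<Longrightarrow> pr \<gamma> u = (if \<alpha> = \<gamma> then u else 0)"
  by (auto simp: pr_def fun_eq_iff)

lemma pr_comp: "u \<in> fin_supp I \<Longrightarrow> pr \<gamma> u \<in> comp \<gamma>"
  by (auto simp: pr_def fin_supp_def elim!: rev_finite_subset split: if_splits)

lemma pr_sum:
  assumes "u \<in> fin_supp I"
  shows "u = (\<Sum>\<gamma> \<in> deg ` {a. u a \<noteq> 0}. pr \<gamma> u)"
proof
  fix a
  have fin: "finite (deg ` {a. u a \<noteq> 0})" using assms by (simp add: fin_supp_def)
  have "(\<Sum>\<gamma> \<in> deg ` {a. u a \<noteq> 0}. pr \<gamma> u a) = (\<Sum>\<gamma> \<in> deg ` {a. u a \<noteq> 0}. if deg a = \<gamma> then u a else 0)"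
    by (simp add: pr_def)
  also have "\<dots> = u a" using fin by (auto simp: sum.delta)
  finally show "u a = (\<Sum>\<gamma> \<in> deg ` {a. u a \<noteq> 0}. pr \<gamma> u) a" by (simp add: sum_fun_apply)
qed

lemma span_homogeneous:
  assumes W: "W \<subseteq> fin_supp I" "\<And>u \<gamma>. u \<in> W \<Longrightarrow> pr \<gamma> u \<in> W" "qvec.subspace W"
  shows "W = qvec.span (\<Union>\<gamma> \<in> carrier \<Gamma>. W \<inter> comp \<gamma>)"
proof
  show "qvec.span (\<Union>\<gamma> \<in> carrier \<Gamma>. W \<inter> comp \<gamma>) \<subseteq> W"
    by (rule qvec.span_minimal[OF _ W(3)]) blast
  show "W \<subseteq> qvec.span (\<Union>\<gamma> \<in> carrier \<Gamma>. W \<inter> comp \<gamma>)"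
  proof
    fix u assume u: "u \<in> W"
    then have uI: "u \<in> fin_supp I" using W by blast
    have "(\<Sum>\<gamma> \<in> deg ` {a. u a \<noteq> 0}. pr \<gamma> u) \<in> qvec.span (\<Union>\<gamma> \<in> carrier \<Gamma>. W \<inter> comp \<gamma>)"
    proof (rule qvec.span_sum, rule qvec.span_base)
      fix \<gamma> assume "\<gamma> \<in> deg ` {a. u a \<noteq> 0}"
      then have "\<gamma> \<in> carrier \<Gamma>" using uI deg_carrier by (auto simp: fin_supp_def)
      then show "pr \<gamma> u \<in> (\<Union>\<gamma> \<in> carrier \<Gamma>. W \<inter> comp \<gamma>)" using W(2)[OF u] pr_comp[OF uI] by blast
    qed
    then show "u \<in> qvec.span (\<Union>\<gamma> \<in> carrier \<Gamma>. W \<inter> comp \<gamma>)" using pr_sum[OF uI] by simp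
  qed
qed

lemma direct_sum_homogeneous:
  assumes W: "W \<subseteq> fin_supp I" "\<And>u \<gamma>. u \<in> W \<Longrightarrow> pr \<gamma> u \<in> W" "qvec.subspace W"
  shows "direct_sum_of (carrier \<Gamma>) (\<lambda>\<gamma>. W \<inter> comp \<gamma>) W"
  unfolding direct_sum_of_def
proof (intro conjI ballI allI impI)
  show "qvec.subspace (W \<inter> comp \<gamma>)" for \<gamma> by (rule qvec.subspace_inter[OF W(3) subspace_comp])
  show "W = qvec.span (\<Union>\<gamma> \<in> carrier \<Gamma>. W \<inter> comp \<gamma>)" by (rule span_homogeneous[OF W])
  fix F :: "'g set" and f i
  assume F: "finite F \<and> F \<subseteq> carrier \<Gamma> \<and> (\<forall>i \<in> F. f i \<in> W \<inter> comp i) \<and> (\<Sum>i \<in> F. f i) = 0" and i: "i \<in> F"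
  show "f i = 0"
  proof (rule ccontr)
    assume "f i \<noteq> 0"
    then obtain a where a: "f i a \<noteq> 0" by (auto simp: fun_eq_iff)
    then have da: "deg a = i" using F i by auto
    have "f j a = 0" if "j \<in> F - {i}" for j using F that da by auto
    then have "(\<Sum>j \<in> F. f j a) = f i a" using F i by (simp add: sum.remove[of F i])
    then show False using a F sum_fun_apply[of f F a] by simp
  qed
qed

section \<open>Product and coproduct on finitely supported functions\<close>

abbreviation mul :: "('x \<Rightarrow> rat) \<Rightarrow> ('x \<Rightarrow> rat) \<Rightarrow> 'x \<Rightarrow> rat" where
  "mul u v \<equiv> mat_op pm (u \<otimes>\<^sub>\<rat> v)"

lemma mul_fin_supp: "u \<in> fin_supp I \<Longrightarrow> v \<in> fin_supp I \<Longrightarrow> mul u v \<in> fin_supp I"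
  by (rule mat_op_fin_supp[OF tensor_fin_supp pm_fin])

lemma mul_comp:
  assumes "u \<in> comp \<alpha>" "v \<in> comp \<beta>"
  shows "mul u v \<in> comp (\<alpha> \<otimes>\<^bsub>\<Gamma>\<^esub> \<beta>)"
proof -
  have "deg c = \<alpha> \<otimes>\<^bsub>\<Gamma>\<^esub> \<beta>" if c: "mul u v c \<noteq> 0" for c
  proof -
    obtain p where p: "(u \<otimes>\<^sub>\<rat> v) p \<noteq> 0" "pm p c \<noteq> 0" using c by (rule mat_op_nonzero)
    obtain a b where ab: "p = (a, b)" by fastforce
    then have "u a \<noteq> 0" "v b \<noteq> 0" using p by auto
    moreover from this have "a \<in> I" "b \<in> I" using assms by (auto simp: fin_supp_def)
    ultimately show ?thesis using pm_deg[of a b c] assms p ab by auto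
  qed
  then show ?thesis using mul_fin_supp assms by blast
qed

lemma linear_product_coproduct: "linear_on (fin_supp (I \<times> I)) (mat_op pm)" "linear_on (fin_supp I) (mat_op dm)"
  by (rule mat_op_linear_on, rule order_refl)+

lemma kron_pm_fin:
  "p \<in> (I \<times> I) \<times> I \<Longrightarrow> kron pm basis_vector p \<in> fin_supp (I \<times> I)"
  "q \<in> I \<times> (I \<times> I) \<Longrightarrow> kron basis_vector pm q \<in> fin_supp (I \<times> I)"
  "r \<in> (I \<times> I) \<times> (I \<times> I) \<Longrightarrow> kron pm pm r \<in> fin_supp (I \<times> I)"
  using pm_fin by (cases p; cases q; cases r; auto simp: kron_apply intro!: tensor_fin_supp basis_vector_fin_supp)+

lemma kron_dm_fin:
  "p \<in> I \<times> I \<Longrightarrow> kron dm basis_vector p \<in> fin_supp ((I \<times> I) \<times> I)"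
  "p \<in> I \<times> I \<Longrightarrow> kron basis_vector dm p \<in> fin_supp (I \<times> (I \<times> I))"
  "p \<in> I \<times> I \<Longrightarrow> kron dm dm p \<in> fin_supp ((I \<times> I) \<times> (I \<times> I))"
  using dm_fin by (cases p; auto simp: kron_apply intro!: tensor_fin_supp basis_vector_fin_supp)+

lemma mk_fin: "r \<in> (I \<times> I) \<times> (I \<times> I) \<Longrightarrow> mk r \<in> fin_supp ((I \<times> I) \<times> (I \<times> I))"
  by (auto intro!: qvec.subspace_scale[OF subspace_fin_supp] basis_vector_fin_supp)

lemma mul_assoc_tensor:
  assumes "t \<in> fin_supp ((I \<times> I) \<times> I)"
  shows "mat_op pm (mat_op (kron pm basis_vector) t) = mat_op pm (mat_op (kron basis_vector pm) (assoc_right t))"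
proof (rule fin_supp_linear_eq[OF _ _ _ assms])
  show "linear_on (fin_supp ((I \<times> I) \<times> I)) (\<lambda>t. mat_op pm (mat_op (kron pm basis_vector) t))"
    by (rule linear_on_comp[OF mat_op_linear_on[OF order_refl] mat_op_fin_supp[OF _ kron_pm_fin(1)] linear_product_coproduct(1)])
  show "linear_on (fin_supp ((I \<times> I) \<times> I)) (\<lambda>t. mat_op pm (mat_op (kron basis_vector pm) (assoc_right t)))"
    by (rule linear_on_comp[OF assoc_linear(1) assoc_fin_supp(1) linear_on_comp[OF mat_op_linear_on[OF order_refl] mat_op_fin_supp[OF _ kron_pm_fin(2)] linear_product_coproduct(1)]])
  show "mat_op pm (mat_op (kron pm basis_vector) (basis_vector x)) =
      mat_op pm (mat_op (kron basis_vector pm) (assoc_right (basis_vector x)))" if x: "x \<in> (I \<times> I) \<times> I" for x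
  proof -
    obtain a b c where "x = ((a, b), c)" "a \<in> I" "b \<in> I" "c \<in> I" using x by auto
    then show ?thesis using pm_assoc[of a b c] by (simp add: mat_op_at_basis_vector assoc_basis_vector)
  qed
qed

lemma mul_assoc:
  assumes "u \<in> fin_supp I" "v \<in> fin_supp I" "x \<in> fin_supp I"
  shows "mul (mul u v) x = mul u (mul v x)"
proof -
  have uv: "u \<otimes>\<^sub>\<rat> v \<in> fin_supp (I \<times> I)" "v \<otimes>\<^sub>\<rat> x \<in> fin_supp (I \<times> I)" using assms tensor_fin_supp by auto
  have "mat_op pm (mat_op (kron pm basis_vector) ((u \<otimes>\<^sub>\<rat> v) \<otimes>\<^sub>\<rat> x)) =
      mat_op pm (mat_op (kron basis_vector pm) (assoc_right ((u \<otimes>\<^sub>\<rat> v) \<otimes>\<^sub>\<rat> x)))"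
    by (rule mul_assoc_tensor[OF tensor_fin_supp[OF uv(1) assms(3)]])
  then show ?thesis
    unfolding assoc_right_tensor mat_op_kron[OF uv(1) assms(3)] mat_op_kron[OF assms(1) uv(2)]
      mat_op_basis_vector[OF assms(1)] mat_op_basis_vector[OF assms(3)] .
qed

lemma linear_mul:
  assumes "u \<in> fin_supp I"
  shows "linear_on (fin_supp I) (\<lambda>v. mul u v)" "linear_on (fin_supp I) (\<lambda>v. mul v u)"
  by (rule linear_on_comp[OF linear_on_subset[OF is_linear_tensor_right] tensor_fin_supp[OF assms] linear_product_coproduct(1)],
    simp_all)
    (rule linear_on_comp[OF linear_on_subset[OF is_linear_tensor_left] tensor_fin_supp[OF _ assms] linear_product_coproduct(1)],
    simp_all)

lemma mul_unity:
  assumes "u \<in> fin_supp I"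
  shows "mul (basis_vector z) u = u" "mul u (basis_vector z) = u"
proof -
  note lz = linear_mul[OF basis_vector_fin_supp[OF z_in]]
  show "mul (basis_vector z) u = u"
    by (rule fin_supp_linear_eq[OF lz(1) linear_on_ident _ assms])
      (simp add: tensor_basis_vector mat_op_at_basis_vector pm_unit)
  show "mul u (basis_vector z) = u"
    by (rule fin_supp_linear_eq[OF lz(2) linear_on_ident _ assms])
      (simp add: tensor_basis_vector mat_op_at_basis_vector pm_unit)
qed

lemma counit_mul:
  assumes "u \<in> fin_supp I" "v \<in> fin_supp I"
  shows "mul u v z = u z * v z"
proof -
  let ?S = "insert (z, z) {p. (u \<otimes>\<^sub>\<rat> v) p \<noteq> 0}"
  have fin: "finite ?S" and sub: "?S \<subseteq> I \<times> I"
    using tensor_fin_supp[OF assms] z_in by (auto simp: fin_supp_def)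
  have "mul u v z = (\<Sum>p \<in> ?S. (u \<otimes>\<^sub>\<rat> v) p * pm p z)" by (rule mat_op_sum[OF fin]) auto
  also have "\<dots> = (\<Sum>p \<in> ?S. if p = (z, z) then u z * v z else 0)"
  proof (rule sum.cong[OF refl])
    fix p assume p: "p \<in> ?S"
    obtain a b where ab: "p = (a, b)" by fastforce
    then have "(a, b) \<in> I \<times> I" using p sub by blast
    then have "a \<in> I" "b \<in> I" by auto
    then show "(u \<otimes>\<^sub>\<rat> v) p * pm p z = (if p = (z, z) then u z * v z else 0)" using pm_counit[of a b] ab by simp
  qed
  also have "\<dots> = u z * v z" using fin by (simp only: sum.delta) simp
  finally show ?thesis .
qed

lemma coproduct_fin_supp: "u \<in> fin_supp I \<Longrightarrow> mat_op dm u \<in> fin_supp (I \<times> I)"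
  by (rule mat_op_fin_supp[OF _ dm_fin])

lemma coproduct_coassoc:
  assumes "u \<in> fin_supp I"
  shows "assoc_right (mat_op (kron dm basis_vector) (mat_op dm u)) = mat_op (kron basis_vector dm) (mat_op dm u)"
proof (rule fin_supp_linear_eq[OF _ _ _ assms])
  show "linear_on (fin_supp I) (\<lambda>u. assoc_right (mat_op (kron dm basis_vector) (mat_op dm u)))"
    by (rule linear_on_comp[OF linear_product_coproduct(2) coproduct_fin_supp
          linear_on_comp[OF mat_op_linear_on[OF order_refl] mat_op_fin_supp[OF _ kron_dm_fin(1)] assoc_linear(1)]])
  show "linear_on (fin_supp I) (\<lambda>u. mat_op (kron basis_vector dm) (mat_op dm u))"
    by (rule linear_on_comp[OF linear_product_coproduct(2) coproduct_fin_supp mat_op_linear_on[OF order_refl]])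
qed (simp add: mat_op_at_basis_vector dm_coassoc)

lemma coproduct_counit:
  assumes u: "u \<in> fin_supp I"
  shows "mat_op dm u (z, a) = u a" "mat_op dm u (a, z) = u a"
proof -
  have "mat_op dm u (z, a) = mat_op basis_vector u a"
    unfolding mat_op_def by (rule sum.cong[OF refl]) (use u dm_counit in \<open>auto simp: fin_supp_def basis_vector_apply\<close>)
  then show "mat_op dm u (z, a) = u a" by (simp add: mat_op_basis_vector[OF u])
  have "mat_op dm u (a, z) = mat_op basis_vector u a"
    unfolding mat_op_def by (rule sum.cong[OF refl]) (use u dm_counit in \<open>auto simp: fin_supp_def basis_vector_apply\<close>)
  then show "mat_op dm u (a, z) = u a" by (simp add: mat_op_basis_vector[OF u])
qed

lemma coproduct_mul:
  assumes "t \<in> fin_supp (I \<times> I)"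
  shows "mat_op dm (mat_op pm t) = mat_op (kron pm pm) (mat_op mk (mat_op (kron dm dm) t))"
proof (rule fin_supp_linear_eq[OF _ _ _ assms])
  show "linear_on (fin_supp (I \<times> I)) (\<lambda>t. mat_op dm (mat_op pm t))"
    by (rule linear_on_comp[OF linear_product_coproduct(1) mat_op_fin_supp[OF _ pm_fin] linear_product_coproduct(2)])
  show "linear_on (fin_supp (I \<times> I)) (\<lambda>t. mat_op (kron pm pm) (mat_op mk (mat_op (kron dm dm) t)))"
    by (rule linear_on_comp[OF mat_op_linear_on[OF order_refl] mat_op_fin_supp[OF _ kron_dm_fin(3)]
          linear_on_comp[OF mat_op_linear_on[OF order_refl] mat_op_fin_supp[OF _ mk_fin] mat_op_linear_on[OF order_refl]]])
qed (auto simp: mat_op_at_basis_vector green)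

end


section \<open>Graded subbialgebras\<close>

text \<open>The axioms in \<open>bialgebra_in\<close> are tested on tensor powers of
  \<open>space B\<close>, where the specifications of \<open>tensor_map\<close> and
  \<open>braiding\<close> determine them; hence the coproduct is required to have values in tensors
  over \<open>W\<close>. \<open>W_pr\<close> makes \<open>W\<close> a graded subobject.\<close>

locale sub_bialgebra = structure_constants +
  fixes W :: "('b \<Rightarrow> rat) set"
  assumes W_subspace: "qvec.subspace W" and W_sub: "W \<subseteq> fin_supp I"
    and W_unity: "basis_vector z \<in> W"
    and W_mul: "u \<in> W \<Longrightarrow> v \<in> W \<Longrightarrow> mul u v \<in> W"
    and W_coproduct: "u \<in> W \<Longrightarrow> mat_op dm u \<in> tensor_space W W"
    and W_pr: "u \<in> W \<Longrightarrow> pr \<gamma> u \<in> W"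
begin

abbreviation WW :: "('b \<times> 'b \<Rightarrow> rat) set" where "WW \<equiv> tensor_space W W"

lemma WW_sub: "WW \<subseteq> fin_supp (I \<times> I)"
  by (rule tensor_space_fin_supp[OF W_sub W_sub])

lemma WI: "u \<in> W \<Longrightarrow> u \<in> fin_supp I"
  using W_sub by blast

lemma WWI: "t \<in> WW \<Longrightarrow> t \<in> fin_supp (I \<times> I)"
  using WW_sub by blast

lemma W_span: "W = qvec.span (\<Union>\<gamma> \<in> carrier \<Gamma>. W \<inter> comp \<gamma>)"
  by (rule span_homogeneous[OF W_sub W_pr W_subspace])

text \<open>Reduces statements on the tensor square to homogeneous tensors, for which the braiding
  is specified.\<close>

lemma WW_span: "WW = qvec.span {u \<otimes>\<^sub>\<rat> v |u v. \<exists>\<alpha> \<in> carrier \<Gamma>. \<exists>\<beta> \<in> carrier \<Gamma>. u \<in> W \<inter> comp \<alpha> \<and> v \<in> W \<inter> comp \<beta>}"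
proof -
  have "WW = tensor_space (qvec.span (\<Union>\<gamma> \<in> carrier \<Gamma>. W \<inter> comp \<gamma>)) (qvec.span (\<Union>\<gamma> \<in> carrier \<Gamma>. W \<inter> comp \<gamma>))"
    by (rule arg_cong2[OF W_span W_span])
  also have "\<dots> = qvec.span {u \<otimes>\<^sub>\<rat> v |u v. u \<in> (\<Union>\<gamma> \<in> carrier \<Gamma>. W \<inter> comp \<gamma>) \<and> v \<in> (\<Union>\<gamma> \<in> carrier \<Gamma>. W \<inter> comp \<gamma>)}"
    by (rule tensor_space_span)
  also have "{u \<otimes>\<^sub>\<rat> v |u v. u \<in> (\<Union>\<gamma> \<in> carrier \<Gamma>. W \<inter> comp \<gamma>) \<and> v \<in> (\<Union>\<gamma> \<in> carrier \<Gamma>. W \<inter> comp \<gamma>)} =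
      {u \<otimes>\<^sub>\<rat> v |u v. \<exists>\<alpha> \<in> carrier \<Gamma>. \<exists>\<beta> \<in> carrier \<Gamma>. u \<in> W \<inter> comp \<alpha> \<and> v \<in> W \<inter> comp \<beta>}"
  proof -
    have "(u \<in> (\<Union>\<gamma> \<in> C. K \<gamma>) \<and> v \<in> (\<Union>\<gamma> \<in> C. K \<gamma>)) \<longleftrightarrow> (\<exists>\<alpha> \<in> C. \<exists>\<beta> \<in> C. u \<in> K \<alpha> \<and> v \<in> K \<beta>)"
      for u v and C :: "'a set" and K :: "'a \<Rightarrow> ('b \<Rightarrow> rat) set" by blast
    then show ?thesis by (simp only:)
  qed
  finally show ?thesis .
qed

abbreviation B :: "('a, 'b) bialg" where "B \<equiv> sub_bialg H W"

lemma B_simps [simp]: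
  "space B = W" "component B = (\<lambda>\<gamma>. W \<inter> comp \<gamma>)" "product B = mat_op pm" "unity B = basis_vector z"
  "coproduct B = mat_op dm" "counit B = (\<lambda>u. u z)"
  by (simp_all add: sub_bialg_def)

lemma graded_B: "graded_space \<Gamma> B"
  unfolding graded_space_def B_simps by (rule direct_sum_homogeneous[OF W_sub W_pr W_subspace])

lemma linear_WW: "linear_on WW (mat_op \<kappa>)"
  by (rule mat_op_linear_on[OF WW_sub])

lemma linear_W: "linear_on W (mat_op \<kappa>)"
  by (rule mat_op_linear_on[OF W_sub])

lemma id_W: "u \<in> W \<Longrightarrow> id u = mat_op basis_vector u"
  using mat_op_basis_vector[OF WI] by simp

lemma algebra_B: "algebra_in \<Gamma> B"
  unfolding algebra_in_def B_simps
proof (intro conjI ballI)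
  show "graded_space \<Gamma> B" by (rule graded_B)
  show "graded_morphism \<Gamma> (graded_tensor \<Gamma> B B) B (mat_op pm)"
    unfolding graded_morphism_def graded_tensor_def B_simps gspace.simps
  proof (intro conjI ballI allI)
    show "mat_op pm (u + v) = mat_op pm u + mat_op pm v" if "u \<in> WW" "v \<in> WW" for u v
      using linear_WW that unfolding linear_on_def by blast
    show "mat_op pm (qscale c u) = qscale c (mat_op pm u)" if "u \<in> WW" for c u
      using linear_WW that unfolding linear_on_def by blast
    fix \<gamma> assume "\<gamma> \<in> carrier \<Gamma>"
    let ?T = "{u \<otimes>\<^sub>\<rat> v |u v. \<exists>\<alpha> \<in> carrier \<Gamma>. \<exists>\<beta> \<in> carrier \<Gamma>. \<alpha> \<otimes>\<^bsub>\<Gamma>\<^esub> \<beta> = \<gamma> \<and> u \<in> W \<inter> comp \<alpha> \<and> v \<in> W \<inter> comp \<beta>}"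
    have TW: "qvec.span ?T \<subseteq> WW" unfolding tensor_space_def by (rule qvec.span_mono) blast
    have *: "mat_op pm b \<in> W \<inter> comp \<gamma>" if b: "b \<in> ?T" for b
    proof -
      obtain u v \<alpha> \<beta> where "b = u \<otimes>\<^sub>\<rat> v" "\<alpha> \<otimes>\<^bsub>\<Gamma>\<^esub> \<beta> = \<gamma>" "u \<in> W" "u \<in> comp \<alpha>" "v \<in> W" "v \<in> comp \<beta>"
        using b by blast
      then show ?thesis using W_mul mul_comp[of u \<alpha> v \<beta>] by blast
    qed
    show "mat_op pm ` qvec.span ?T \<subseteq> W \<inter> comp \<gamma>"
      using linear_on_span_into[OF linear_on_subset[OF linear_WW TW] qvec.subspace_inter[OF W_subspace subspace_comp] *]
      by (rule image_subsetI)
  qed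
  show "basis_vector z \<in> W \<inter> comp \<one>\<^bsub>\<Gamma>\<^esub>" using W_unity unity_comp by blast
  show "mat_op pm (tensor_map WW W (mat_op pm) id t) = mat_op pm (tensor_map W WW id (mat_op pm) (assoc_right t))"
    if t: "t \<in> tensor_space WW W" for t
  proof -
    have 1: "tensor_map WW W (mat_op pm) id t = mat_op (kron pm basis_vector) t"
      by (rule tensor_map_mat[OF WW_sub W_sub refl id_W t])
    have 2: "tensor_map W WW id (mat_op pm) (assoc_right t) = mat_op (kron basis_vector pm) (assoc_right t)"
      by (rule tensor_map_mat[OF W_sub WW_sub id_W refl assoc_right_space[OF W_subspace W_subspace t]])
    show ?thesis unfolding 1 2
      by (rule mul_assoc_tensor) (use tensor_space_fin_supp[OF WW_sub W_sub] t in blast)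
  qed
  show "mul (basis_vector z) u = u" "mul u (basis_vector z) = u" if "u \<in> W" for u
    using mul_unity[OF WI[OF that]] by auto
qed

text \<open>The counit as a matrix into the unit object, so that \<open>tensor_map_mat\<close>
  applies to it.\<close>

definition cu :: "'b \<Rightarrow> unit \<Rightarrow> rat" where
  "cu a = (\<lambda>_. if a = z then 1 else 0)"

lemma counit_map_mat:
  assumes "u \<in> fin_supp I"
  shows "counit_map B u = mat_op cu u"
proof
  fix x
  have "mat_op cu u x = mat_op basis_vector u z"
    unfolding mat_op_def by (rule sum.cong[OF refl]) (auto simp: cu_def basis_vector_apply)
  then show "counit_map B u x = mat_op cu u x" by (simp add: mat_op_basis_vector[OF assms] counit_map_def)
qed

lemma mat_op_cu: "u \<in> fin_supp I \<Longrightarrow> mat_op cu u x = u z"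
  using counit_map_mat[of u, symmetric] by (simp add: counit_map_def)

text \<open>Projection to total degree \<gamma>. It sends each spanning homogeneous tensor over
  \<open>W\<close> to itself or to 0 and fixes the coproduct of an element of degree \<gamma>; so
  that coproduct is a sum of tensors over \<open>W\<close> of total degree \<gamma>, as gradedness
  demands.\<close>

definition prT :: "'a \<Rightarrow> ('b \<times> 'b \<Rightarrow> rat) \<Rightarrow> 'b \<times> 'b \<Rightarrow> rat" where
  "prT \<gamma> t = (\<lambda>(a, b). if deg a \<otimes>\<^bsub>\<Gamma>\<^esub> deg b = \<gamma> then t (a, b) else 0)"

lemma prT_tensor:
  assumes "u \<in> comp \<alpha>" "v \<in> comp \<beta>"
  shows "prT \<gamma> (u \<otimes>\<^sub>\<rat> v) = (if \<alpha> \<otimes>\<^bsub>\<Gamma>\<^esub> \<beta> = \<gamma> then u \<otimes>\<^sub>\<rat> v else 0)"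
proof
  fix p :: "'b \<times> 'b"
  obtain a b where p: "p = (a, b)" by fastforce
  show "prT \<gamma> (u \<otimes>\<^sub>\<rat> v) p = (if \<alpha> \<otimes>\<^bsub>\<Gamma>\<^esub> \<beta> = \<gamma> then u \<otimes>\<^sub>\<rat> v else 0) p"
    using assms by (cases "u a = 0 \<or> v b = 0") (auto simp: p prT_def)
qed

lemma coalgebra_B: "coalgebra_in \<Gamma> B"
  unfolding coalgebra_in_def B_simps
proof (intro conjI ballI)
  show "graded_space \<Gamma> B" by (rule graded_B)
  show "graded_morphism \<Gamma> B (graded_tensor \<Gamma> B B) (mat_op dm)"
    unfolding graded_morphism_def graded_tensor_def B_simps gspace.simps
  proof (intro conjI ballI allI)
    show "mat_op dm (u + v) = mat_op dm u + mat_op dm v" if "u \<in> W" "v \<in> W" for u v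
      using linear_W that unfolding linear_on_def by blast
    show "mat_op dm (qscale c u) = qscale c (mat_op dm u)" if "u \<in> W" for c u
      using linear_W that unfolding linear_on_def by blast
    fix \<gamma> assume \<gamma>: "\<gamma> \<in> carrier \<Gamma>"
    let ?T = "{u \<otimes>\<^sub>\<rat> v |u v. \<exists>\<alpha> \<in> carrier \<Gamma>. \<exists>\<beta> \<in> carrier \<Gamma>. \<alpha> \<otimes>\<^bsub>\<Gamma>\<^esub> \<beta> = \<gamma> \<and> u \<in> W \<inter> comp \<alpha> \<and> v \<in> W \<inter> comp \<beta>}"
    let ?S = "{u \<otimes>\<^sub>\<rat> v |u v. \<exists>\<alpha> \<in> carrier \<Gamma>. \<exists>\<beta> \<in> carrier \<Gamma>. u \<in> W \<inter> comp \<alpha> \<and> v \<in> W \<inter> comp \<beta>}"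
    have lin: "linear_on (qvec.span ?S) (prT \<gamma>)"
      by (auto simp: linear_on_def prT_def fun_eq_iff qscale_def)
    have base: "prT \<gamma> b \<in> qvec.span ?T" if b: "b \<in> ?S" for b
    proof -
      obtain u v \<alpha> \<beta> where uv: "b = u \<otimes>\<^sub>\<rat> v" "\<alpha> \<in> carrier \<Gamma>" "\<beta> \<in> carrier \<Gamma>" "u \<in> W" "u \<in> comp \<alpha>" "v \<in> W" "v \<in> comp \<beta>"
        using b by blast
      show ?thesis
      proof (cases "\<alpha> \<otimes>\<^bsub>\<Gamma>\<^esub> \<beta> = \<gamma>")
        case True
        then have "b \<in> ?T" using uv by blast
        then show ?thesis using prT_tensor[OF uv(5,7), of \<gamma>] True uv(1) by (simp add: qvec.span_base)
      next
        case False
        then show ?thesis using prT_tensor[OF uv(5,7), of \<gamma>] uv(1) by (simp add: qvec.span_zero)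
      qed
    qed
    show "mat_op dm ` (W \<inter> comp \<gamma>) \<subseteq> qvec.span ?T"
    proof (rule image_subsetI)
      fix u assume u: "u \<in> W \<inter> comp \<gamma>"
      have "prT \<gamma> (mat_op dm u) = mat_op dm u"
      proof
        fix p :: "'b \<times> 'b"
        obtain a b where p: "p = (a, b)" by fastforce
        have "deg a \<otimes>\<^bsub>\<Gamma>\<^esub> deg b = \<gamma>" if nz: "mat_op dm u (a, b) \<noteq> 0"
        proof -
          obtain c where c: "u c \<noteq> 0" "dm c (a, b) \<noteq> 0" using nz by (rule mat_op_nonzero)
          then have "c \<in> I" "deg c = \<gamma>" using u by (auto simp: fin_supp_def)
          then show ?thesis using dm_deg c by metis
        qed
        then show "prT \<gamma> (mat_op dm u) p = mat_op dm u p" by (auto simp: prT_def p)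
      qed
      moreover have "mat_op dm u \<in> qvec.span ?S" using W_coproduct[of u] u unfolding WW_span by blast
      from linear_on_span_into[OF lin qvec.subspace_span base this] have "prT \<gamma> (mat_op dm u) \<in> qvec.span ?T" .
      ultimately show "mat_op dm u \<in> qvec.span ?T" by simp
    qed
  qed
  show "graded_morphism \<Gamma> B (unit_object \<Gamma>) (counit_map B)"
    unfolding graded_morphism_def B_simps unit_object_def gspace.simps
  proof (intro conjI ballI allI)
    show "counit_map B (u + v) = counit_map B u + counit_map B v" for u v
      by (auto simp: counit_map_def fun_eq_iff)
    show "counit_map B (qscale c u) = qscale c (counit_map B u)" for c u
      by (auto simp: counit_map_def fun_eq_iff qscale_def)
    show "counit_map B ` (W \<inter> comp \<gamma>) \<subseteq> (if \<gamma> = \<one>\<^bsub>\<Gamma>\<^esub> then UNIV else {0})" for \<gamma>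
    proof (cases "\<gamma> = \<one>\<^bsub>\<Gamma>\<^esub>")
      case False
      then have "u z = 0" if "u \<in> comp \<gamma>" for u using that deg_z by force
      then show ?thesis using False by (auto simp: counit_map_def fun_eq_iff)
    qed simp
  qed
  fix u assume u: "u \<in> W"
  note uI = WI[OF u] and Du = W_coproduct[OF u]
  have 1: "tensor_map W W (mat_op dm) id (mat_op dm u) = mat_op (kron dm basis_vector) (mat_op dm u)"
    by (rule tensor_map_mat[OF W_sub W_sub refl id_W Du])
  have 2: "tensor_map W W id (mat_op dm) (mat_op dm u) = mat_op (kron basis_vector dm) (mat_op dm u)"
    by (rule tensor_map_mat[OF W_sub W_sub id_W refl Du])
  have 3: "tensor_map W W (counit_map B) id (mat_op dm u) = mat_op (kron cu basis_vector) (mat_op dm u)"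
    by (rule tensor_map_mat[OF W_sub W_sub counit_map_mat[OF WI] id_W Du])
  have 4: "tensor_map W W id (counit_map B) (mat_op dm u) = mat_op (kron basis_vector cu) (mat_op dm u)"
    by (rule tensor_map_mat[OF W_sub W_sub id_W counit_map_mat[OF WI] Du])
  show "assoc_right (tensor_map W W (mat_op dm) id (mat_op dm u)) = tensor_map W W id (mat_op dm) (mat_op dm u)"
    unfolding 1 2 by (rule coproduct_coassoc[OF uI])
  note fin = coproduct_fin_supp[OF uI]
  show "left_unitor (tensor_map W W (counit_map B) id (mat_op dm u)) = u"
    unfolding 3 left_unitor_def mat_op_kron_slice_left[OF fin] mat_op_cu[OF slice_fin_supp(1)[OF fin]]
    by (simp add: coproduct_counit[OF uI])
  show "right_unitor (tensor_map W W id (counit_map B) (mat_op dm u)) = u"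
    unfolding 4 right_unitor_def mat_op_kron_slice_right[OF fin] mat_op_cu[OF slice_fin_supp(2)[OF fin]]
    by (simp add: coproduct_counit[OF uI])
qed

section \<open>The braiding as a matrix\<close>

abbreviation bk :: "'b \<times> 'b \<Rightarrow> 'b \<times> 'b \<Rightarrow> rat" where
  "bk \<equiv> \<lambda>(x, y). qscale (\<chi> (deg x) (deg y)) (basis_vector (y, x))"

lemma bk_fin: "p \<in> I \<times> I \<Longrightarrow> bk p \<in> fin_supp (I \<times> I)"
  by (auto intro!: qvec.subspace_scale[OF subspace_fin_supp] basis_vector_fin_supp)

lemma mat_op_bk:
  assumes "t \<in> fin_supp K"
  shows "mat_op bk t (y, x) = \<chi> (deg x) (deg y) * t (x, y)"
proof -
  let ?S = "insert (x, y) {p. t p \<noteq> 0}"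
  have fin: "finite ?S" using assms by (simp add: fin_supp_def)
  have "mat_op bk t (y, x) = (\<Sum>p \<in> ?S. t p * bk p (y, x))" by (rule mat_op_sum[OF fin]) auto
  also have "\<dots> = (\<Sum>p \<in> ?S. if p = (x, y) then \<chi> (deg x) (deg y) * t (x, y) else 0)"
    by (rule sum.cong[OF refl]) (auto simp: qscale_def basis_vector_apply split: if_splits)
  also have "\<dots> = \<chi> (deg x) (deg y) * t (x, y)" using fin by (simp only: sum.delta) simp
  finally show ?thesis .
qed

lemma mat_op_bk_tensor:
  assumes "u \<in> comp \<alpha>" "v \<in> comp \<beta>"
  shows "mat_op bk (u \<otimes>\<^sub>\<rat> v) = qscale (\<chi> \<alpha> \<beta>) (v \<otimes>\<^sub>\<rat> u)"
proof
  fix p :: "'b \<times> 'b"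
  obtain y x where p: "p = (y, x)" by fastforce
  have fin: "u \<otimes>\<^sub>\<rat> v \<in> fin_supp (I \<times> I)" using assms tensor_fin_supp by blast
  show "mat_op bk (u \<otimes>\<^sub>\<rat> v) p = qscale (\<chi> \<alpha> \<beta>) (v \<otimes>\<^sub>\<rat> u) p"
    unfolding p mat_op_bk[OF fin] using assms by (cases "u x = 0 \<or> v y = 0") (auto simp: qscale_def)
qed

lemma mat_op_bk_WW: "t \<in> WW \<Longrightarrow> mat_op bk t \<in> WW"
proof -
  assume t: "t \<in> WW"
  let ?S = "{u \<otimes>\<^sub>\<rat> v |u v. \<exists>\<alpha> \<in> carrier \<Gamma>. \<exists>\<beta> \<in> carrier \<Gamma>. u \<in> W \<inter> comp \<alpha> \<and> v \<in> W \<inter> comp \<beta>}"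
  have lin: "linear_on (qvec.span ?S) (mat_op bk)" using linear_WW[of bk] unfolding WW_span .
  show ?thesis
  proof (rule linear_on_span_into[OF lin tensor_space_subspace _ t[unfolded WW_span]])
    fix b assume "b \<in> ?S"
    then obtain u v \<alpha> \<beta> where uv: "b = u \<otimes>\<^sub>\<rat> v" "u \<in> W" "u \<in> comp \<alpha>" "v \<in> W" "v \<in> comp \<beta>"
      by blast
    show "mat_op bk b \<in> WW" unfolding uv(1) mat_op_bk_tensor[OF uv(3,5)]
      by (rule qvec.subspace_scale[OF tensor_space_subspace tensor_in_space[OF uv(4,2)]])
  qed
qed

text \<open>As for \<open>tensor_map\<close>: homogeneous tensors span the tensor square, so the
  specification determines the chosen map there.\<close>

lemma braiding_mat:
  assumes t: "t \<in> WW"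
  shows "braiding \<Gamma> \<chi> B B t = mat_op bk t"
proof -
  let ?S = "{u \<otimes>\<^sub>\<rat> v |u v. \<exists>\<alpha> \<in> carrier \<Gamma>. \<exists>\<beta> \<in> carrier \<Gamma>. u \<in> W \<inter> comp \<alpha> \<and> v \<in> W \<inter> comp \<beta>}"
  define Q where "Q = (\<lambda>L :: ('b \<times> 'b \<Rightarrow> rat) \<Rightarrow> 'b \<times> 'b \<Rightarrow> rat. is_linear L \<and>
    (\<forall>\<gamma> \<in> carrier \<Gamma>. \<forall>\<delta> \<in> carrier \<Gamma>. \<forall>u \<in> W \<inter> comp \<gamma>. \<forall>v \<in> W \<inter> comp \<delta>. L (u \<otimes>\<^sub>\<rat> v) = qscale (\<chi> \<gamma> \<delta>) (v \<otimes>\<^sub>\<rat> u)))"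
  obtain L :: "('b \<times> 'b \<Rightarrow> rat) \<Rightarrow> 'b \<times> 'b \<Rightarrow> rat"
    where L: "is_linear L" "\<And>t. t \<in> WW \<Longrightarrow> L t = mat_op bk t"
    using linear_extension[OF tensor_space_subspace linear_WW] by blast
  have "Q L" unfolding Q_def
  proof (intro conjI ballI L(1))
    fix \<gamma> \<delta> u v assume "u \<in> W \<inter> comp \<gamma>" "v \<in> W \<inter> comp \<delta>"
    then show "L (u \<otimes>\<^sub>\<rat> v) = qscale (\<chi> \<gamma> \<delta>) (v \<otimes>\<^sub>\<rat> u)"
      using L(2)[OF tensor_in_space] mat_op_bk_tensor[of u \<gamma> v \<delta>] by simp
  qed
  then have "Q (SOME L. Q L)" by (rule someI[of Q])
  then have q: "Q (braiding \<Gamma> \<chi> B B)" unfolding braiding_def B_simps Q_def .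
  have lin: "linear_on (qvec.span ?S) (braiding \<Gamma> \<chi> B B)"
    using q[unfolded Q_def is_linear_iff, THEN conjunct1] by (rule linear_on_subset) simp
  have lin': "linear_on (qvec.span ?S) (mat_op bk)" using linear_WW[of bk] unfolding WW_span .
  show ?thesis
  proof (rule linear_on_span_eq[OF lin lin' _ t[unfolded WW_span]])
    fix b assume "b \<in> ?S"
    then obtain u v \<alpha> \<beta> where uv: "b = u \<otimes>\<^sub>\<rat> v" "\<alpha> \<in> carrier \<Gamma>" "\<beta> \<in> carrier \<Gamma>"
      "u \<in> W \<inter> comp \<alpha>" "v \<in> W \<inter> comp \<beta>"
      by blast
    have "braiding \<Gamma> \<chi> B B b = qscale (\<chi> \<alpha> \<beta>) (v \<otimes>\<^sub>\<rat> u)"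
      using q[unfolded Q_def, THEN conjunct2] uv by blast
    then show "braiding \<Gamma> \<chi> B B b = mat_op bk b" using mat_op_bk_tensor[of u \<alpha> v \<beta>] uv by simp
  qed
qed

text \<open>The braiding of the first two of three factors, in the bracketing that arises when
  \<open>middle_braiding\<close> splits off the outermost left factor.\<close>

abbreviation ck :: "'b \<times> ('b \<times> 'b) \<Rightarrow> 'b \<times> ('b \<times> 'b) \<Rightarrow> rat" where
  "ck \<equiv> \<lambda>(b, (c, d)). qscale (\<chi> (deg b) (deg c)) (basis_vector (c, (b, d)))"

lemma ck_fin: "p \<in> I \<times> (I \<times> I) \<Longrightarrow> ck p \<in> fin_supp (I \<times> (I \<times> I))"
  by (auto intro!: qvec.subspace_scale[OF subspace_fin_supp] basis_vector_fin_supp)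

lemma inner_braiding:
  assumes r: "r \<in> tensor_space W WW"
  shows "assoc_right (tensor_map WW W (braiding \<Gamma> \<chi> B B) id (assoc_left r)) = mat_op ck r"
    "mat_op ck r \<in> tensor_space W WW"
proof -
  note al = assoc_left_space[OF W_subspace W_subspace r]
  have 1: "tensor_map WW W (braiding \<Gamma> \<chi> B B) id (assoc_left r) = mat_op (kron bk basis_vector) (assoc_left r)"
    by (rule tensor_map_mat[OF WW_sub W_sub braiding_mat id_W al])
  have sp: "mat_op (kron bk basis_vector) (assoc_left r) \<in> tensor_space WW W"
    by (rule mat_op_kron_space[OF WW_sub W_sub _ _ al]) (simp_all add: mat_op_bk_WW mat_op_basis_vector[OF WI])
  have rI: "r \<in> fin_supp (I \<times> (I \<times> I))" using tensor_space_fin_supp[OF W_sub WW_sub] r by blast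
  have kfin: "kron bk basis_vector p \<in> fin_supp ((I \<times> I) \<times> I)" if "p \<in> (I \<times> I) \<times> I" for p
  proof -
    obtain q c where p: "p = (q, c)" "q \<in> I \<times> I" "c \<in> I" using \<open>p \<in> (I \<times> I) \<times> I\<close> by blast
    show ?thesis unfolding p(1) kron_apply by (rule tensor_fin_supp[OF bk_fin[OF p(2)] basis_vector_fin_supp[OF p(3)]])
  qed
  have eq: "assoc_right (mat_op (kron bk basis_vector) (assoc_left r)) = mat_op ck r"
  proof (rule fin_supp_linear_eq[OF _ _ _ rI])
    show "linear_on (fin_supp (I \<times> (I \<times> I))) (\<lambda>r. assoc_right (mat_op (kron bk basis_vector) (assoc_left r)))"
      by (rule linear_on_comp[OF assoc_linear(2) assoc_fin_supp(2)
            linear_on_comp[OF mat_op_linear_on[OF order_refl] mat_op_fin_supp[OF _ kfin] assoc_linear(1)]])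
    show "linear_on (fin_supp (I \<times> (I \<times> I))) (mat_op ck)" by (rule mat_op_linear_on[OF order_refl])
    fix x assume "x \<in> I \<times> (I \<times> I)"
    then obtain b c d where x: "x = (b, (c, d))" by blast
    show "assoc_right (mat_op (kron bk basis_vector) (assoc_left (basis_vector x))) = mat_op ck (basis_vector x)"
      unfolding x assoc_basis_vector mat_op_at_basis_vector kron_apply prod.case tensor_scale_left tensor_basis_vector
      by (auto simp: assoc_right_def qscale_def basis_vector_apply)
  qed
  show "assoc_right (tensor_map WW W (braiding \<Gamma> \<chi> B B) id (assoc_left r)) = mat_op ck r"
    unfolding 1 by (rule eq)
  show "mat_op ck r \<in> tensor_space W WW"
    using assoc_right_space[OF W_subspace W_subspace sp] unfolding eq .
qed

text \<open>On basis vectors the rebracketings cancel and leave \<open>mk\<close>. Membership in the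
  tensor space is recorded for the subsequent \<open>tensor_map\<close> of the two products.\<close>

lemma middle_braiding_mat:
  assumes s: "s \<in> tensor_space WW WW"
  shows "middle_braiding \<Gamma> \<chi> B s = mat_op mk s" "mat_op mk s \<in> tensor_space WW WW"
proof -
  note ar = assoc_right_space[OF W_subspace tensor_space_subspace s]
  have W3_sub: "tensor_space W WW \<subseteq> fin_supp (I \<times> (I \<times> I))" by (rule tensor_space_fin_supp[OF W_sub WW_sub])
  have 1: "tensor_map W (tensor_space W WW) id
      (assoc_right \<circ> tensor_map WW W (braiding \<Gamma> \<chi> B B) id \<circ> assoc_left) (assoc_right s) =
      mat_op (kron basis_vector ck) (assoc_right s)"
    by (rule tensor_map_mat[OF W_sub W3_sub id_W _ ar]) (assumption, unfold o_apply, rule inner_braiding(1))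
  have sp: "mat_op (kron basis_vector ck) (assoc_right s) \<in> tensor_space W (tensor_space W WW)"
    by (rule mat_op_kron_space[OF W_sub W3_sub _ inner_braiding(2) ar]) (subst mat_op_basis_vector[OF WI], assumption, assumption)
  have sI: "s \<in> fin_supp ((I \<times> I) \<times> (I \<times> I))" using tensor_space_fin_supp[OF WW_sub WW_sub] s by blast
  have kfin: "kron basis_vector ck p \<in> fin_supp (I \<times> (I \<times> (I \<times> I)))" if "p \<in> I \<times> (I \<times> (I \<times> I))" for p
  proof -
    obtain a q where p: "p = (a, q)" "a \<in> I" "q \<in> I \<times> (I \<times> I)" using \<open>p \<in> I \<times> (I \<times> (I \<times> I))\<close> by blast
    show ?thesis unfolding p(1) kron_apply by (rule tensor_fin_supp[OF basis_vector_fin_supp[OF p(2)] ck_fin[OF p(3)]])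
  qed
  have eq: "assoc_left (mat_op (kron basis_vector ck) (assoc_right s)) = mat_op mk s"
  proof (rule fin_supp_linear_eq[OF _ _ _ sI])
    show "linear_on (fin_supp ((I \<times> I) \<times> (I \<times> I))) (\<lambda>s. assoc_left (mat_op (kron basis_vector ck) (assoc_right s)))"
      by (rule linear_on_comp[OF assoc_linear(1) assoc_fin_supp(1)
            linear_on_comp[OF mat_op_linear_on[OF order_refl] mat_op_fin_supp[OF _ kfin] assoc_linear(2)]])
    show "linear_on (fin_supp ((I \<times> I) \<times> (I \<times> I))) (mat_op mk)" by (rule mat_op_linear_on[OF order_refl])
    fix x assume "x \<in> (I \<times> I) \<times> (I \<times> I)"
    then obtain a b c d where x: "x = ((a, b), (c, d))" by blast
    show "assoc_left (mat_op (kron basis_vector ck) (assoc_right (basis_vector x))) = mat_op mk (basis_vector x)"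
      unfolding x assoc_basis_vector mat_op_at_basis_vector kron_apply prod.case tensor_scale_right tensor_basis_vector
      by (auto simp: assoc_left_def qscale_def basis_vector_apply)
  qed
  show "middle_braiding \<Gamma> \<chi> B s = mat_op mk s"
    unfolding middle_braiding_def comp_def[of assoc_left] comp_def[of _ assoc_right] B_simps
    using 1 eq by (simp add: comp_def)
  show "mat_op mk s \<in> tensor_space WW WW"
    using assoc_left_space[OF W_subspace tensor_space_subspace sp] unfolding eq .
qed

theorem bialgebra_B: "bialgebra_in \<Gamma> \<chi> B"
  unfolding bialgebra_in_def
proof (intro conjI algebra_B coalgebra_B bichar ballI)
  show "comm_monoid \<Gamma>" by (rule comm_monoid_axioms)
  fix t assume "t \<in> tensor_space (space B) (space B)"
  then have t: "t \<in> WW" by simp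
  have 1: "tensor_map W W (mat_op dm) (mat_op dm) t = mat_op (kron dm dm) t"
    by (rule tensor_map_mat[OF W_sub W_sub refl refl t])
  have s: "mat_op (kron dm dm) t \<in> tensor_space WW WW"
    by (rule mat_op_kron_space[OF W_sub W_sub W_coproduct W_coproduct t])
  have 2: "tensor_map WW WW (mat_op pm) (mat_op pm) (mat_op mk (mat_op (kron dm dm) t)) =
      mat_op (kron pm pm) (mat_op mk (mat_op (kron dm dm) t))"
    by (rule tensor_map_mat[OF WW_sub WW_sub refl refl middle_braiding_mat(2)[OF s]])
  show "coproduct B (product B t) = tensor_map (tensor_space (space B) (space B)) (tensor_space (space B) (space B))
      (product B) (product B) (middle_braiding \<Gamma> \<chi> B (tensor_map (space B) (space B) (coproduct B) (coproduct B) t))"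
    unfolding B_simps 1 middle_braiding_mat(1)[OF s] 2 by (rule coproduct_mul[OF WWI[OF t]])
next
  show "coproduct B (unity B) = unity B \<otimes>\<^sub>\<rat> unity B"
    by (simp add: mat_op_at_basis_vector tensor_basis_vector dm_unit)
  show "counit B (product B (u \<otimes>\<^sub>\<rat> v)) = counit B u * counit B v" if "u \<in> space B" "v \<in> space B" for u v
    using that counit_mul WI by simp
  show "counit B (unity B) = 1" by (simp add: basis_vector_apply)
qed

end


section \<open>Subalgebras generated by homogeneous primitive elements\<close>

lemma linear_on_add: "linear_on S f \<Longrightarrow> u \<in> S \<Longrightarrow> v \<in> S \<Longrightarrow> f (u + v) = f u + f v"
  by (simp add: linear_on_def)

context structure_constants
begin

text \<open>Bracketed to the right, so that an induction peels off one primitive generator on the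
  left.\<close>

primrec words :: "('x \<Rightarrow> rat) set \<Rightarrow> nat \<Rightarrow> ('x \<Rightarrow> rat) set" where
  "words G 0 = {basis_vector z}"
| "words G (Suc n) = {mul g x |g x. g \<in> G \<and> x \<in> words G n}"

abbreviation ip :: "('x \<Rightarrow> rat) \<Rightarrow> ('x \<Rightarrow> rat) \<Rightarrow> rat" where
  "ip \<equiv> wform w"

text \<open>Adjointness of product and coproduct: \<open>dual\<close> summed over all coefficients.
  In the Hall algebra the factors are exchanged because the left factor of a product is the quotient
  and the left factor of a coproduct the subobject.\<close>

lemma ip_mul:
  assumes "x \<in> fin_supp I" "y \<in> fin_supp I" "c \<in> fin_supp I"
  shows "ip (mul x y) c = wform (\<lambda>(a, b). w a * w b) (y \<otimes>\<^sub>\<rat> x) (mat_op dm c)"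
proof -
  let ?X = "{a. x a \<noteq> 0}" and ?Y = "{a. y a \<noteq> 0}" and ?C = "{a. c a \<noteq> 0}"
  have fin: "finite ?X" "finite ?Y" "finite ?C" and sub: "?X \<subseteq> I" "?Y \<subseteq> I" "?C \<subseteq> I"
    using assms by (auto simp: fin_supp_def)
  have mul: "mul x y d = (\<Sum>a \<in> ?X. \<Sum>b \<in> ?Y. x a * y b * pm (a, b) d)" for d
  proof -
    have "mul x y d = (\<Sum>p \<in> ?X \<times> ?Y. (x \<otimes>\<^sub>\<rat> y) p * pm p d)"
      by (rule mat_op_sum) (use fin in auto)
    also have "\<dots> = (\<Sum>a \<in> ?X. \<Sum>b \<in> ?Y. x a * y b * pm (a, b) d)"
      unfolding sum.cartesian_product by (rule sum.cong) auto
    finally show ?thesis .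
  qed
  have "ip (mul x y) c = ip c (mul x y)"
    by (rule wform_sym[OF mul_fin_supp[OF assms(1,2)] assms(3)])
  also have "\<dots> = (\<Sum>d \<in> ?C. \<Sum>a \<in> ?X. \<Sum>b \<in> ?Y. c d * (x a * y b * pm (a, b) d) / w d)"
    unfolding wform_def mul by (simp add: sum_distrib_left sum_divide_distrib)
  also have "\<dots> = (\<Sum>d \<in> ?C. \<Sum>a \<in> ?X. \<Sum>b \<in> ?Y. y b * x a * (c d * dm d (b, a)) / (w b * w a))"
  proof (intro sum.cong refl)
    fix d a b assume "d \<in> ?C" "a \<in> ?X" "b \<in> ?Y"
    then have "d \<in> I" "a \<in> I" "b \<in> I" using sub by auto
    then have "dm d (b, a) / (w b * w a) = pm (a, b) d / w d" using dual by blast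
    then show "c d * (x a * y b * pm (a, b) d) / w d = y b * x a * (c d * dm d (b, a)) / (w b * w a)"
      by (metis (no_types, opaque_lifting) mult.assoc mult.commute times_divide_eq_right)
  qed
  also have "\<dots> = (\<Sum>b \<in> ?Y. \<Sum>a \<in> ?X. \<Sum>d \<in> ?C. y b * x a * (c d * dm d (b, a)) / (w b * w a))"
    by (subst sum.swap, subst (2) sum.swap, subst sum.swap) (rule refl)
  also have "\<dots> = (\<Sum>b \<in> ?Y. \<Sum>a \<in> ?X. y b * x a * mat_op dm c (b, a) / (w b * w a))"
    by (simp add: mat_op_def sum_distrib_left sum_divide_distrib)
  also have "\<dots> = (\<Sum>p \<in> ?Y \<times> ?X. (y \<otimes>\<^sub>\<rat> x) p * mat_op dm c p / (case p of (a, b) \<Rightarrow> w a * w b))"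
    unfolding sum.cartesian_product by (rule sum.cong) auto
  also have "\<dots> = wform (\<lambda>(a, b). w a * w b) (y \<otimes>\<^sub>\<rat> x) (mat_op dm c)"
    by (rule wform_sum[symmetric]) (use fin in auto)
  finally show ?thesis .
qed

lemma ip_unity:
  assumes "u \<in> fin_supp I"
  shows "ip (basis_vector z) u = u z / w z" "ip u (basis_vector z) = u z / w z"
proof -
  have "ip (basis_vector z) u = (\<Sum>x \<in> {z}. basis_vector z x * u x / w x)"
    by (rule wform_sum) (auto simp: basis_vector_apply)
  then show *: "ip (basis_vector z) u = u z / w z" by (simp add: basis_vector_apply)
  show "ip u (basis_vector z) = u z / w z"
    using wform_sym[OF assms basis_vector_fin_supp[OF z_in], of w] * by simp
qed

lemma ip_definite: "u \<in> fin_supp I \<Longrightarrow> ip u u = 0 \<Longrightarrow> u = 0"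
  by (rule wform_definite[of u I w]) (use w_pos in auto)

section \<open>Primitive elements\<close>

lemma Prim_iff: "v \<in> Prim H \<longleftrightarrow> v \<in> fin_supp I \<and> mat_op dm v = v \<otimes>\<^sub>\<rat> basis_vector z + basis_vector z \<otimes>\<^sub>\<rat> v"
  by (simp add: Prim_def)

lemma Prim_counit: "v \<in> Prim H \<Longrightarrow> v z = 0"
  using coproduct_counit(1)[of v z] by (simp add: Prim_iff basis_vector_apply)

text \<open>The coproduct of a primitive element has only its two extreme terms. Consequently a
  product of two elements of counit 0 is orthogonal to every primitive element.\<close>

lemma ip_mul_Prim:
  assumes "x \<in> fin_supp I" "y \<in> fin_supp I" "p \<in> Prim H"
  shows "ip (mul x y) p = ip y p * (x z / w z) + y z / w z * ip x p"
  using assms ip_mul[of x y p] ip_unity(2)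
  by (simp add: Prim_iff wform_add_right wform_tensor)

lemma subspace_Prim: "qvec.subspace (Prim H)"
proof (rule qvec.subspaceI)
  show "0 \<in> Prim H"
    using linear_on_zero[OF linear_product_coproduct(2) qvec.subspace_0[OF subspace_fin_supp]] qvec.subspace_0[OF subspace_fin_supp]
    by (auto simp: Prim_iff fun_eq_iff)
  fix u v c assume u: "u \<in> Prim H"
  show "qscale c u \<in> Prim H"
    using u qvec.subspace_scale[OF subspace_fin_supp[of I], of u c] linear_product_coproduct(2)
    by (simp add: Prim_iff linear_on_def tensor_scale_left tensor_scale_right qvec.scale_right_distrib)
  assume v: "v \<in> Prim H"
  show "u + v \<in> Prim H"
    using u v qvec.subspace_add[OF subspace_fin_supp[of I], of u v] linear_product_coproduct(2)
    by (simp add: Prim_iff linear_on_def tensor_add_left tensor_add_right)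
qed

end

locale primitive_generators = structure_constants +
  fixes G :: "('b \<Rightarrow> rat) set"
  assumes G_prim: "g \<in> G \<Longrightarrow> g \<in> Prim H"
    and G_hom: "g \<in> G \<Longrightarrow> \<exists>\<gamma> \<in> carrier \<Gamma>. g \<in> comp \<gamma>"
begin

abbreviation M :: "nat \<Rightarrow> ('b \<Rightarrow> rat) set" where "M \<equiv> words G"

text \<open>The prospective component of degree n. That these spaces form a direct sum is not
  formal; it comes from orthogonality in \<open>L_direct\<close>.\<close>

definition L :: "nat \<Rightarrow> ('b \<Rightarrow> rat) set" where
  "L n = qvec.span (M n)"

definition W :: "('b \<Rightarrow> rat) set" where
  "W = qvec.span (\<Union>n. M n)"

lemma GI: "g \<in> G \<Longrightarrow> g \<in> fin_supp I"
  using G_prim Prim_iff by blast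

lemma M_hom: "x \<in> M n \<Longrightarrow> \<exists>\<gamma> \<in> carrier \<Gamma>. x \<in> comp \<gamma>"
proof (induction n arbitrary: x)
  case 0
  then show ?case using unity_comp by auto
next
  case (Suc n)
  then obtain g y where gy: "x = mul g y" "g \<in> G" "y \<in> M n" by auto
  obtain \<gamma> where \<gamma>: "\<gamma> \<in> carrier \<Gamma>" "g \<in> comp \<gamma>" using G_hom[OF gy(2)] by blast
  obtain \<delta> where \<delta>: "\<delta> \<in> carrier \<Gamma>" "y \<in> comp \<delta>" using Suc.IH[OF gy(3)] by blast
  have "\<gamma> \<otimes>\<^bsub>\<Gamma>\<^esub> \<delta> \<in> carrier \<Gamma>" "x \<in> comp (\<gamma> \<otimes>\<^bsub>\<Gamma>\<^esub> \<delta>)"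
    using \<gamma>(1) \<delta>(1) mul_comp[OF \<gamma>(2) \<delta>(2)] gy(1) by simp_all
  then show ?case by (rule bexI[rotated])
qed

lemma MI: "x \<in> M n \<Longrightarrow> x \<in> fin_supp I"
  using M_hom by blast

lemma M_sub: "M n \<subseteq> fin_supp I"
  using MI by blast

lemma M_one: "M 1 = G"
proof -
  have "M 1 = {mul g (basis_vector z) |g. g \<in> G}" by auto
  also have "\<dots> = G" using mul_unity(2)[OF GI] by force
  finally show ?thesis .
qed

lemma M_mul: "x \<in> M m \<Longrightarrow> y \<in> M n \<Longrightarrow> mul x y \<in> M (m + n)"
proof (induction m arbitrary: x)
  case 0
  then show ?case using mul_unity(1)[OF MI] by simp
next
  case (Suc m)
  then obtain g x' where g: "x = mul g x'" "g \<in> G" "x' \<in> M m" by auto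
  have "mul x y = mul g (mul x' y)" unfolding g(1) by (rule mul_assoc[OF GI[OF g(2)] MI[OF g(3)] MI[OF Suc.prems(2)]])
  moreover have "mul x' y \<in> M (m + n)" by (rule Suc.IH[OF g(3) Suc.prems(2)])
  ultimately show ?case using g(2) by auto
qed

lemma L_subspace: "qvec.subspace (L n)"
  unfolding L_def by (rule qvec.subspace_span)

lemma W_subspace: "qvec.subspace W"
  unfolding W_def by (rule qvec.subspace_span)

lemma M_L: "x \<in> M n \<Longrightarrow> x \<in> L n"
  unfolding L_def by (rule qvec.span_base)

lemma L_W: "L n \<subseteq> W"
  unfolding L_def W_def by (rule qvec.span_mono) blast

lemma W_sub: "W \<subseteq> fin_supp I"
  unfolding W_def by (rule qvec.span_minimal[OF _ subspace_fin_supp]) (use MI in blast)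

lemma L_sub: "L n \<subseteq> fin_supp I"
  using L_W W_sub by blast

lemma bilinear_span:
  assumes "A \<subseteq> fin_supp I" "C \<subseteq> fin_supp I" "qvec.subspace V"
    and "\<And>a c. a \<in> A \<Longrightarrow> c \<in> C \<Longrightarrow> mul a c \<in> V"
    and u: "u \<in> qvec.span A" and v: "v \<in> qvec.span C"
  shows "mul u v \<in> V"
proof -
  have sA: "qvec.span A \<subseteq> fin_supp I" and sC: "qvec.span C \<subseteq> fin_supp I"
    using qvec.span_minimal[OF _ subspace_fin_supp] assms(1,2) by blast+
  have 1: "mul u c \<in> V" if c: "c \<in> C" for c
    by (rule linear_on_span_into[OF linear_on_subset[OF linear_mul(2) sA] assms(3) _ u])
      (use c assms in auto)
  show ?thesis
    by (rule linear_on_span_into[OF linear_on_subset[OF linear_mul(1) sC] assms(3) 1 v]) (use u sA in auto)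
qed

lemma L_mul: "u \<in> L m \<Longrightarrow> v \<in> L n \<Longrightarrow> mul u v \<in> L (m + n)"
  unfolding L_def[of m] L_def[of n]
  by (rule bilinear_span[OF M_sub M_sub L_subspace]) (use M_mul M_L in auto)

lemma W_mul: "u \<in> W \<Longrightarrow> v \<in> W \<Longrightarrow> mul u v \<in> W"
  unfolding W_def[THEN eq_reflection]
proof (rule bilinear_span[OF _ _ qvec.subspace_span])
  fix a c assume "a \<in> (\<Union>n. M n)" "c \<in> (\<Union>n. M n)"
  then have "mul a c \<in> (\<Union>n. M n)" using M_mul by blast
  then show "mul a c \<in> qvec.span (\<Union>n. M n)" by (rule qvec.span_base)
qed (use MI in auto)

text \<open>A homogeneous projection keeps or kills each homogeneous generator.\<close>

lemma pr_span:
  assumes "\<And>b. b \<in> S \<Longrightarrow> \<exists>\<gamma>. b \<in> comp \<gamma>" "u \<in> qvec.span S"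
  shows "pr \<gamma> u \<in> qvec.span S"
proof (rule linear_on_span_into[OF pr_linear qvec.subspace_span _ assms(2)])
  fix b assume b: "b \<in> S"
  obtain \<alpha> where "b \<in> comp \<alpha>" using assms(1)[OF b] by blast
  from pr_homogeneous[OF this, of \<gamma>] show "pr \<gamma> b \<in> qvec.span S"
    using qvec.span_base[OF b] qvec.span_zero[of S] by simp
qed

lemma L_pr: "u \<in> L n \<Longrightarrow> pr \<gamma> u \<in> L n"
  unfolding L_def by (rule pr_span) (use M_hom in blast)

lemma W_pr: "u \<in> W \<Longrightarrow> pr \<gamma> u \<in> W"
  unfolding W_def by (rule pr_span) (use M_hom in blast)

lemma W_gen: "subalgebra_gen H G = W"
proof
  have "G \<subseteq> W" using M_one M_L[of _ 1] L_W[of 1] by blast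
  moreover have "basis_vector z \<in> W" using M_L[of _ 0] L_W[of 0] by auto
  ultimately show "subalgebra_gen H G \<subseteq> W"
    unfolding subalgebra_gen_def H_simps using W_subspace W_sub W_mul by blast
  show "W \<subseteq> subalgebra_gen H G"
    unfolding subalgebra_gen_def H_simps
  proof (rule Inter_greatest)
    fix X assume "X \<in> {W. qvec.subspace W \<and> W \<subseteq> fin_supp I \<and> basis_vector z \<in> W \<and> G \<subseteq> W \<and>
      (\<forall>u \<in> W. \<forall>v \<in> W. mul u v \<in> W)}"
    then have X: "qvec.subspace X" "basis_vector z \<in> X" "G \<subseteq> X" "\<And>u v. u \<in> X \<Longrightarrow> v \<in> X \<Longrightarrow> mul u v \<in> X" by auto
    have "M n \<subseteq> X" for n by (induction n) (use X in auto)
    then show "W \<subseteq> X" unfolding W_def by (intro qvec.span_minimal[OF _ X(1)]) blast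
  qed
qed

definition DL :: "nat \<Rightarrow> ('b \<times> 'b \<Rightarrow> rat) set" where
  "DL n = {b \<otimes>\<^sub>\<rat> c |b c i. i \<le> n \<and> b \<in> M i \<and> c \<in> M (n - i)}"

lemma DL_sub: "DL n \<subseteq> fin_supp (I \<times> I)"
  unfolding DL_def using tensor_fin_supp[OF MI MI] by blast

lemma comp_fin: "u \<in> comp \<gamma> \<Longrightarrow> u \<in> fin_supp I"
  by blast

text \<open>The product of the braided tensor square: moving \<open>v\<close> past \<open>x\<close>
  costs the scalar \<open>\<chi> \<beta> \<gamma>\<close>.\<close>

lemma twisted_mul_tensor:
  assumes "u \<in> comp \<alpha>" "v \<in> comp \<beta>" "x \<in> comp \<gamma>" "y \<in> comp \<delta>"
  shows "mat_op (kron pm pm) (mat_op mk ((u \<otimes>\<^sub>\<rat> v) \<otimes>\<^sub>\<rat> (x \<otimes>\<^sub>\<rat> y))) = qscale (\<chi> \<beta> \<gamma>) (mul u x \<otimes>\<^sub>\<rat> mul v y)"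
proof -
  let ?t = "(u \<otimes>\<^sub>\<rat> v) \<otimes>\<^sub>\<rat> (x \<otimes>\<^sub>\<rat> y)"
  note fu = comp_fin[OF assms(1)] and fv = comp_fin[OF assms(2)] and fx = comp_fin[OF assms(3)] and fy = comp_fin[OF assms(4)]
  have t: "?t \<in> fin_supp ((I \<times> I) \<times> (I \<times> I))" by (intro tensor_fin_supp fu fv fx fy)
  have "mat_op mk ?t = qscale (\<chi> \<beta> \<gamma>) ((u \<otimes>\<^sub>\<rat> x) \<otimes>\<^sub>\<rat> (v \<otimes>\<^sub>\<rat> y))"
  proof
    fix q :: "('b \<times> 'b) \<times> ('b \<times> 'b)"
    obtain a c b d where q: "q = ((a, c), (b, d))" by (metis surj_pair)
    let ?S = "insert ((a, b), (c, d)) {p. ?t p \<noteq> 0}"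
    have fin: "finite ?S" using t by (simp add: fin_supp_def)
    have "mat_op mk ?t q = (\<Sum>p \<in> ?S. ?t p * mk p q)" by (rule mat_op_sum[OF fin]) auto
    also have "\<dots> = (\<Sum>p \<in> ?S. if p = ((a, b), (c, d)) then \<chi> (deg b) (deg c) * ?t ((a, b), (c, d)) else 0)"
      by (rule sum.cong[OF refl]) (auto simp: qscale_def basis_vector_apply q split: if_splits)
    also have "\<dots> = \<chi> (deg b) (deg c) * ?t ((a, b), (c, d))" using fin by (simp only: sum.delta) simp
    also have "\<dots> = qscale (\<chi> \<beta> \<gamma>) ((u \<otimes>\<^sub>\<rat> x) \<otimes>\<^sub>\<rat> (v \<otimes>\<^sub>\<rat> y)) q"
      using assms by (cases "v b = 0 \<or> x c = 0") (auto simp: qscale_def q)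
    finally show "mat_op mk ?t q = qscale (\<chi> \<beta> \<gamma>) ((u \<otimes>\<^sub>\<rat> x) \<otimes>\<^sub>\<rat> (v \<otimes>\<^sub>\<rat> y)) q" .
  qed
  moreover have "(u \<otimes>\<^sub>\<rat> x) \<otimes>\<^sub>\<rat> (v \<otimes>\<^sub>\<rat> y) \<in> fin_supp UNIV"
    by (rule fin_supp_UNIV[OF tensor_fin_supp[OF tensor_fin_supp[OF fu fx] tensor_fin_supp[OF fv fy]]])
  ultimately show ?thesis
    using mat_op_linear[of "kron pm pm"] mat_op_kron[OF tensor_fin_supp[OF fu fx] tensor_fin_supp[OF fv fy], of pm pm]
    by (simp add: linear_on_def)
qed

lemma linear_twisted:
  "linear_on (fin_supp ((I \<times> I) \<times> (I \<times> I))) (\<lambda>t. mat_op (kron pm pm) (mat_op mk t))"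
  by (rule linear_on_comp[OF mat_op_linear_on[OF order_refl] mat_op_fin_supp[OF _ mk_fin] mat_op_linear_on[OF order_refl]])

lemma coproduct_mul_elem:
  assumes "u \<in> fin_supp I" "v \<in> fin_supp I"
  shows "mat_op dm (mul u v) = mat_op (kron pm pm) (mat_op mk (mat_op dm u \<otimes>\<^sub>\<rat> mat_op dm v))"
  using coproduct_mul[OF tensor_fin_supp[OF assms]] mat_op_kron[OF assms, of dm dm] by simp

text \<open>The coproduct is multiplicative for the braided product of the tensor square. Each of
  the two terms in the coproduct of a generator adds one letter to one tensor factor, up to a scalar
  from the braiding.\<close>

lemma M_coproduct: "x \<in> M n \<Longrightarrow> mat_op dm x \<in> qvec.span (DL n)"
proof (induction n arbitrary: x)
  case 0
  then have "mat_op dm x = basis_vector z \<otimes>\<^sub>\<rat> basis_vector z"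
    by (simp add: mat_op_at_basis_vector tensor_basis_vector dm_unit)
  also have "\<dots> \<in> DL 0" unfolding DL_def by auto
  finally show ?case by (rule qvec.span_base)
next
  case (Suc n)
  then obtain g y where gy: "x = mul g y" "g \<in> G" "y \<in> M n" by auto
  obtain \<gamma> where \<gamma>: "g \<in> comp \<gamma>" using G_hom[OF gy(2)] by blast
  let ?e = "basis_vector z"
  let ?f = "\<lambda>s. mat_op (kron pm pm) (mat_op mk ((g \<otimes>\<^sub>\<rat> ?e + ?e \<otimes>\<^sub>\<rat> g) \<otimes>\<^sub>\<rat> s))"
  have pg: "mat_op dm g = g \<otimes>\<^sub>\<rat> ?e + ?e \<otimes>\<^sub>\<rat> g" using G_prim[OF gy(2)] by (simp add: Prim_iff)
  note gI = GI[OF gy(2)] and eI = basis_vector_fin_supp[OF z_in]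
  have rI: "g \<otimes>\<^sub>\<rat> ?e + ?e \<otimes>\<^sub>\<rat> g \<in> fin_supp (I \<times> I)" using coproduct_fin_supp[OF gI] pg by simp
  have sub: "qvec.span (DL n) \<subseteq> fin_supp (I \<times> I)" by (rule qvec.span_minimal[OF DL_sub subspace_fin_supp])
  have lin: "linear_on (qvec.span (DL n)) ?f"
  proof (rule linear_on_comp[OF linear_on_subset[OF is_linear_tensor_right subset_UNIV] _ linear_twisted])
    fix s assume "s \<in> qvec.span (DL n)"
    then show "(g \<otimes>\<^sub>\<rat> ?e + ?e \<otimes>\<^sub>\<rat> g) \<otimes>\<^sub>\<rat> s \<in> fin_supp ((I \<times> I) \<times> (I \<times> I))"
      using tensor_fin_supp[OF rI] sub by blast
  qed
  have "?f (mat_op dm y) \<in> qvec.span (DL (Suc n))"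
  proof (rule linear_on_span_into[OF lin qvec.subspace_span _ Suc.IH[OF gy(3)]])
    fix s assume "s \<in> DL n"
    then obtain b c i where s: "s = b \<otimes>\<^sub>\<rat> c" "i \<le> n" "b \<in> M i" "c \<in> M (n - i)" unfolding DL_def by blast
    obtain \<beta> where \<beta>: "b \<in> comp \<beta>" using M_hom[OF s(3)] by blast
    obtain \<delta> where \<delta>: "c \<in> comp \<delta>" using M_hom[OF s(4)] by blast
    have gb: "mul g b \<in> M (Suc i)" "mul g c \<in> M (Suc (n - i))" using gy(2) s(3,4) by auto
    have t1: "(g \<otimes>\<^sub>\<rat> ?e) \<otimes>\<^sub>\<rat> s \<in> fin_supp ((I \<times> I) \<times> (I \<times> I))" "(?e \<otimes>\<^sub>\<rat> g) \<otimes>\<^sub>\<rat> s \<in> fin_supp ((I \<times> I) \<times> (I \<times> I))"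
      unfolding s(1) by (intro tensor_fin_supp gI eI MI[OF s(3)] MI[OF s(4)])+
    have 1: "mul g b \<otimes>\<^sub>\<rat> c \<in> DL (Suc n)"
      unfolding DL_def using gb(1) s(2,4) by (intro CollectI exI[of _ "mul g b"] exI[of _ c] exI[of _ "Suc i"]) simp
    have 2: "b \<otimes>\<^sub>\<rat> mul g c \<in> DL (Suc n)"
      unfolding DL_def using gb(2) s(2,3) by (intro CollectI exI[of _ b] exI[of _ "mul g c"] exI[of _ i]) (simp add: Suc_diff_le)
    have "?f s = mat_op (kron pm pm) (mat_op mk ((g \<otimes>\<^sub>\<rat> ?e) \<otimes>\<^sub>\<rat> s)) + mat_op (kron pm pm) (mat_op mk ((?e \<otimes>\<^sub>\<rat> g) \<otimes>\<^sub>\<rat> s))"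
      using linear_on_add[OF linear_twisted t1] by (simp only: tensor_add_left)
    also have "\<dots> = qscale (\<chi> \<one>\<^bsub>\<Gamma>\<^esub> \<beta>) (mul g b \<otimes>\<^sub>\<rat> c) + qscale (\<chi> \<gamma> \<beta>) (b \<otimes>\<^sub>\<rat> mul g c)"
      unfolding s(1) twisted_mul_tensor[OF \<gamma> unity_comp \<beta> \<delta>] twisted_mul_tensor[OF unity_comp \<gamma> \<beta> \<delta>]
        mul_unity(1)[OF MI[OF s(3)]] mul_unity(1)[OF MI[OF s(4)]] by (rule refl)
    also have "\<dots> \<in> qvec.span (DL (Suc n))"
      by (intro qvec.span_add qvec.span_scale qvec.span_base 1 2)
    finally show "?f s \<in> qvec.span (DL (Suc n))" .
  qed
  then show ?case unfolding gy(1) coproduct_mul_elem[OF gI MI[OF gy(3)]] pg .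
qed

lemma L_coproduct: "u \<in> L n \<Longrightarrow> mat_op dm u \<in> qvec.span (\<Union>i \<le> n. tensor_space (L i) (L (n - i)))"
proof -
  assume u: "u \<in> L n"
  have lin: "linear_on (qvec.span (M n)) (mat_op dm)"
    by (rule mat_op_linear_on[OF L_sub[unfolded L_def]])
  have "mat_op dm u \<in> qvec.span (DL n)"
    using M_coproduct by (rule linear_on_span_into[OF lin qvec.subspace_span _ u[unfolded L_def]])
  moreover have "DL n \<subseteq> (\<Union>i \<le> n. tensor_space (L i) (L (n - i)))"
  proof
    fix s assume "s \<in> DL n"
    then obtain b c i where s: "s = b \<otimes>\<^sub>\<rat> c" "i \<le> n" "b \<in> M i" "c \<in> M (n - i)" unfolding DL_def by blast
    have "s \<in> tensor_space (L i) (L (n - i))" unfolding s(1) by (rule tensor_in_space[OF M_L[OF s(3)] M_L[OF s(4)]])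
    then show "s \<in> (\<Union>i \<le> n. tensor_space (L i) (L (n - i)))" using s(2) by blast
  qed
  then have "qvec.span (DL n) \<subseteq> qvec.span (\<Union>i \<le> n. tensor_space (L i) (L (n - i)))" by (rule qvec.span_mono)
  ultimately show ?thesis by (rule subsetD[rotated])
qed

lemma W_coproduct: "u \<in> W \<Longrightarrow> mat_op dm u \<in> tensor_space W W"
proof -
  assume u: "u \<in> W"
  have lin: "linear_on (qvec.span (\<Union>n. M n)) (mat_op dm)"
    by (rule mat_op_linear_on[OF W_sub[unfolded W_def]])
  show ?thesis
  proof (rule linear_on_span_into[OF lin tensor_space_subspace _ u[unfolded W_def]])
    fix b assume "b \<in> (\<Union>n. M n)"
    then obtain n where "b \<in> M n" by blast
    moreover have "qvec.span (DL n) \<subseteq> tensor_space W W"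
    proof (rule qvec.span_minimal[OF _ tensor_space_subspace], rule subsetI)
      fix s assume "s \<in> DL n"
      then obtain b c i where s: "s = b \<otimes>\<^sub>\<rat> c" "i \<le> n" "b \<in> M i" "c \<in> M (n - i)" unfolding DL_def by blast
      have "b \<in> W" "c \<in> W" using M_L[OF s(3)] M_L[OF s(4)] L_W by auto
      then show "s \<in> tensor_space W W" unfolding s(1) by (rule tensor_in_space)
    qed
    ultimately show "mat_op dm b \<in> tensor_space W W" using M_coproduct by blast
  qed
qed

lemma W_unity: "basis_vector z \<in> W"
  using M_L[of _ 0] L_W[of 0] by auto

sublocale sub_bialgebra \<Gamma> \<chi> I deg z pm dm w W
  by unfold_locales (use W_subspace W_sub W_unity W_mul W_coproduct W_pr in auto)

section \<open>Orthogonality of words of different lengths\<close>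

lemma M_counit: "x \<in> M n \<Longrightarrow> n > 0 \<Longrightarrow> x z = 0"
  using counit_mul[OF GI MI] Prim_counit[OF G_prim] by (cases n) auto

text \<open>A word of length at least 2 is a product of two elements of counit 0, hence orthogonal
  to the primitive element \<open>g\<close>; the empty word is orthogonal to it because
  \<open>g\<close> has counit 0.\<close>

lemma M_orth_one:
  assumes g: "g \<in> G" and d: "d \<in> M k" and k: "k \<noteq> 1"
  shows "ip g d = 0"
proof (cases k)
  case 0
  then show ?thesis using d ip_unity(2)[OF GI[OF g]] Prim_counit[OF G_prim[OF g]] by simp
next
  case (Suc l)
  then obtain h y where h: "d = mul h y" "h \<in> G" "y \<in> M l" using d by auto
  have "l > 0" using Suc k by simp
  then have "ip d g = 0"
    unfolding h(1) ip_mul_Prim[OF GI[OF h(2)] MI[OF h(3)] G_prim[OF g]]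
    using M_counit[OF h(3)] Prim_counit[OF G_prim[OF h(2)]] by simp
  then show ?thesis using wform_sym[OF GI[OF g] MI[OF d], of w] by simp
qed

text \<open>Adjointness moves the first letter \<open>g\<close> of \<open>x\<close> to the other
  side, where it is paired with one half of a splitting of \<open>y\<close>. A nonzero term needs a
  half of length 1 against \<open>g\<close> and, by induction, a half of length m against the
  remaining word; then the lengths agree.\<close>

lemma M_orth: "x \<in> M m \<Longrightarrow> y \<in> M n \<Longrightarrow> m \<noteq> n \<Longrightarrow> ip x y = 0"
proof (induction m arbitrary: x y n)
  case 0
  then show ?case using ip_unity(1)[OF MI[OF 0(2)]] M_counit[OF 0(2)] by simp
next
  case (Suc m)
  then obtain g x' where g: "x = mul g x'" "g \<in> G" "x' \<in> M m" by auto
  have "ip x y = wform (\<lambda>(a, b). w a * w b) (x' \<otimes>\<^sub>\<rat> g) (mat_op dm y)"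
    unfolding g(1) by (rule ip_mul[OF GI[OF g(2)] MI[OF g(3)] MI[OF Suc.prems(2)]])
  also have "\<dots> = 0"
  proof (rule wform_span_right[OF _ M_coproduct[OF Suc.prems(2)]])
    fix s assume "s \<in> DL n"
    then obtain b c i where s: "s = b \<otimes>\<^sub>\<rat> c" "i \<le> n" "b \<in> M i" "c \<in> M (n - i)" unfolding DL_def by blast
    have "ip x' b = 0 \<or> ip g c = 0"
      using Suc.IH[OF g(3) s(3)] M_orth_one[OF g(2) s(4)] Suc.prems(3) s(2) by (cases "m = i") auto
    then show "wform (\<lambda>(a, b). w a * w b) (x' \<otimes>\<^sub>\<rat> g) s = 0"
      unfolding s(1) wform_tensor[OF MI[OF g(3)] GI[OF g(2)]] by auto
  qed
  finally show ?case .
qed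

lemma L_orth:
  assumes "u \<in> L m" "v \<in> L n" "m \<noteq> n"
  shows "ip u v = 0"
proof -
  have "ip x v = 0" if x: "x \<in> M m" for x
    by (rule wform_span_right[OF _ assms(2)[unfolded L_def]]) (use M_orth[OF x] assms(3) in blast)
  then show ?thesis
    using wform_span_left[OF _ assms(1)[unfolded L_def] M_sub, of w v I] assms(2) L_sub by blast
qed

text \<open>Pairing a vanishing sum with \<open>f i\<close> leaves only the pairing of
  \<open>f i\<close> with itself, and the form is definite.\<close>

lemma L_direct: "direct_sum_of UNIV L W"
  unfolding direct_sum_of_def
proof (intro conjI ballI allI impI)
  show "qvec.subspace (L n)" for n by (rule L_subspace)
  show "W = qvec.span (\<Union>n \<in> UNIV. L n)"
  proof
    show "W \<subseteq> qvec.span (\<Union>n \<in> UNIV. L n)" unfolding W_def by (rule qvec.span_mono) (use M_L in blast)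
    show "qvec.span (\<Union>n \<in> UNIV. L n) \<subseteq> W" by (rule qvec.span_minimal[OF _ W_subspace]) (use L_W in blast)
  qed
  fix F and f :: "nat \<Rightarrow> 'b \<Rightarrow> rat" and i
  assume F: "finite F \<and> F \<subseteq> UNIV \<and> (\<forall>i \<in> F. f i \<in> L i) \<and> (\<Sum>i \<in> F. f i) = 0" and i: "i \<in> F"
  have add: "ip (f i) (\<Sum>j \<in> F. f j) = (\<Sum>j \<in> F. ip (f i) (f j))"
    by (induction F rule: infinite_finite_induct) (simp_all only: sum.infinite sum.empty sum.insert wform_zero_right wform_add_right not_False_eq_True)
  have "(\<Sum>j \<in> F. ip (f i) (f j)) = ip (f i) (f i)"
  proof -
    have "(\<Sum>j \<in> F - {i}. ip (f i) (f j)) = 0"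
      by (rule sum.neutral) (use F i L_orth in blast)
    then show ?thesis using F i by (simp add: sum.remove[of F i])
  qed
  then have "ip (f i) (f i) = 0" using add F by simp
  then show "f i = 0" using ip_definite F i L_sub by blast
qed

lemma G_Prim_span: "L 1 \<subseteq> Prim H"
  unfolding L_def M_one by (rule qvec.span_minimal[OF _ subspace_Prim]) (use G_prim in blast)

text \<open>The part \<open>p\<close> of a primitive element outside degree 1 is primitive again,
  being its difference from an element of \<open>L 1\<close>. It is orthogonal to words of length 1
  by the decomposition, to the unit by the counit and to longer words by \<open>ip_mul_Prim\<close>,
  hence to itself.\<close>

lemma Prim_B: "Prim B = L 1"
proof
  have "Prim B = Prim H \<inter> W" using W_sub by (auto simp: Prim_def)
  then show "L 1 \<subseteq> Prim B" using G_Prim_span L_W by blast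
  show "Prim B \<subseteq> L 1"
  proof
    fix v assume "v \<in> Prim B"
    then have v: "v \<in> Prim H" "v \<in> W" using W_sub by (auto simp: Prim_def)
    have "(\<Union>n. M n) = M 1 \<union> (\<Union>n \<in> - {1}. M n)" by (auto simp del: words.simps)
    then have "v \<in> qvec.span (M 1 \<union> (\<Union>n \<in> - {1}. M n))" using v(2) unfolding W_def by metis
    then obtain v1 p where vp: "v = v1 + p" "v1 \<in> qvec.span (M 1)" "p \<in> qvec.span (\<Union>n \<in> - {1}. M n)"
      unfolding qvec.span_Un by blast
    have v1: "v1 \<in> L 1" using vp(2) unfolding L_def .
    have p: "p \<in> Prim H"
      using qvec.subspace_diff[OF subspace_Prim v(1), of v1] v1 G_Prim_span vp(1) by auto
    have pW: "p \<in> W" using vp(3) unfolding W_def using qvec.span_mono[of "\<Union>n \<in> - {1}. M n" "\<Union>n. M n"] by blast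
    have pI: "p \<in> fin_supp I" using p Prim_iff by blast
    have orth: "ip x p = 0" if x: "x \<in> M n" for x n
    proof (cases "n = 1")
      case True
      show ?thesis by (rule wform_span_right[OF _ vp(3)]) (use M_orth[OF x] True in auto)
    next
      case False
      show ?thesis
      proof (cases n)
        case 0
        then show ?thesis using x ip_unity(1)[OF pI] Prim_counit[OF p] by simp
      next
        case (Suc l)
        then obtain h y where h: "x = mul h y" "h \<in> G" "y \<in> M l" using x by auto
        have "l > 0" using Suc False by simp
        then show ?thesis
          unfolding h(1) ip_mul_Prim[OF GI[OF h(2)] MI[OF h(3)] p]
          using M_counit[OF h(3)] Prim_counit[OF G_prim[OF h(2)]] by simp
      qed
    qed
    have "ip p p = 0"
    proof (rule wform_span_left[OF _ pW[unfolded W_def] _ pI])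
      show "(\<Union>n. M n) \<subseteq> fin_supp I" using MI by blast
    qed (use orth in blast)
    then have "p = 0" by (rule ip_definite[OF pI])
    then show "v \<in> L 1" using vp(1) v1 by simp
  qed
qed

lemma subalgebra_gen_B: "subalgebra_gen B (L 1) = W"
  unfolding subalgebra_gen_def B_simps
proof
  show "\<Inter> {X. qvec.subspace X \<and> X \<subseteq> W \<and> basis_vector z \<in> X \<and> L 1 \<subseteq> X \<and> (\<forall>u \<in> X. \<forall>v \<in> X. mul u v \<in> X)} \<subseteq> W"
    by (rule Inter_lower) (use W_subspace W_unity L_W W_mul in auto)
  show "W \<subseteq> \<Inter> {X. qvec.subspace X \<and> X \<subseteq> W \<and> basis_vector z \<in> X \<and> L 1 \<subseteq> X \<and> (\<forall>u \<in> X. \<forall>v \<in> X. mul u v \<in> X)}"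
  proof (rule Inter_greatest)
    fix X assume "X \<in> {X. qvec.subspace X \<and> X \<subseteq> W \<and> basis_vector z \<in> X \<and> L 1 \<subseteq> X \<and> (\<forall>u \<in> X. \<forall>v \<in> X. mul u v \<in> X)}"
    then have X: "qvec.subspace X" "basis_vector z \<in> X" "L 1 \<subseteq> X" "\<And>u v. u \<in> X \<Longrightarrow> v \<in> X \<Longrightarrow> mul u v \<in> X" by auto
    have G: "g \<in> X" if "g \<in> G" for g using X(3) M_L[of g 1] that unfolding M_one by blast
    have "M n \<subseteq> X" for n by (induction n) (use X G in auto)
    then show "W \<subseteq> X" unfolding W_def by (intro qvec.span_minimal[OF _ X(1)]) blast
  qed
qed

definition gr :: "nat \<Rightarrow> ('a, 'b) gspace" where
  "gr n = \<lparr>space = L n, component = (\<lambda>\<gamma>. L n \<inter> comp \<gamma>)\<rparr>"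

lemma nat_grading_B: "nat_grading \<Gamma> B gr"
  unfolding nat_grading_def B_simps gr_def gspace.simps
proof (intro conjI allI ballI impI)
  show "graded_subspace \<Gamma> \<lparr>space = L n, component = (\<lambda>\<gamma>. L n \<inter> comp \<gamma>)\<rparr> B" for n
    unfolding graded_subspace_def using graded_B L_W direct_sum_homogeneous[OF L_sub L_pr L_subspace]
    by (auto simp: graded_space_def)
  show "direct_sum_of UNIV (\<lambda>n. L n) W" by (rule L_direct)
  show "basis_vector z \<in> L 0" by (rule M_L) simp
  show "mul u v \<in> L (m + n)" if "u \<in> L m" "v \<in> L n" for m n u v by (rule L_mul[OF that])
  show "mat_op dm u \<in> qvec.span (\<Union>i \<le> n. tensor_space (L i) (L (n - i)))" if "u \<in> L n" for u n by (rule L_coproduct[OF that])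
  show "u z = 0" if n: "0 < n" and u: "u \<in> L n" for u n
  proof -
    \<comment> \<open>Pairing with the unit computes the counit up to the positive factor
      \<open>w z\<close>.\<close>
    have "ip u (basis_vector z) = 0" by (rule L_orth[OF u M_L[of _ 0]]) (use n in auto)
    then show ?thesis using ip_unity(2)[of u] w_pos[OF z_in] u L_sub[of n] by auto
  qed
qed

theorem nichols_subalgebra: "nichols_algebra \<Gamma> \<chi> (sub_bialg H (subalgebra_gen H G))"
  unfolding W_gen nichols_algebra_def nichols_algebra_of_def
  using bialgebra_B nat_grading_B Prim_B subalgebra_gen_B
  by (intro exI[of _ "gr 1"] conjI exI[of _ gr]) (auto simp: gr_def L_def)

end


section \<open>The Hall algebra as a braided bialgebra\<close>

lemma mat_op_tensor_basis_vector:
  assumes "u \<in> fin_supp I"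
  shows "mat_op \<kappa> (u \<otimes>\<^sub>\<rat> basis_vector c) e = (\<Sum>x | u x \<noteq> 0. u x * \<kappa> (x, c) e)"
    "mat_op \<kappa> (basis_vector c \<otimes>\<^sub>\<rat> u) e = (\<Sum>x | u x \<noteq> 0. u x * \<kappa> (c, x) e)"
proof -
  have fin: "finite {x. u x \<noteq> 0}" using assms by (simp add: fin_supp_def)
  have "mat_op \<kappa> (u \<otimes>\<^sub>\<rat> basis_vector c) e = (\<Sum>p \<in> {x. u x \<noteq> 0} \<times> {c}. (u \<otimes>\<^sub>\<rat> basis_vector c) p * \<kappa> p e)"
    by (rule mat_op_sum) (use fin in \<open>auto simp: basis_vector_apply split: if_splits\<close>)
  then show "mat_op \<kappa> (u \<otimes>\<^sub>\<rat> basis_vector c) e = (\<Sum>x | u x \<noteq> 0. u x * \<kappa> (x, c) e)"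
    by (simp add: sum.cartesian_product' basis_vector_apply)
  have "mat_op \<kappa> (basis_vector c \<otimes>\<^sub>\<rat> u) e = (\<Sum>p \<in> {c} \<times> {x. u x \<noteq> 0}. (basis_vector c \<otimes>\<^sub>\<rat> u) p * \<kappa> p e)"
    by (rule mat_op_sum) (use fin in \<open>auto simp: basis_vector_apply split: if_splits\<close>)
  then show "mat_op \<kappa> (basis_vector c \<otimes>\<^sub>\<rat> u) e = (\<Sum>x | u x \<noteq> 0. u x * \<kappa> (c, x) e)"
    by (simp add: sum.cartesian_product' basis_vector_apply)
qed

context hall_category
begin

section \<open>The axioms of structure constants for the Hall algebra\<close>

lemma prod_coeff_fin_supp: "a \<in> Iso \<A> \<Longrightarrow> b \<in> Iso \<A> \<Longrightarrow> prod_coeff \<A> (a, b) \<in> fin_supp (Iso \<A>)"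
  using finite_prod_coeff prod_coeff_nonzero(1) by (auto simp: fin_supp_def)

lemma coprod_coeff_fin_supp: "c \<in> Iso \<A> \<Longrightarrow> coprod_coeff \<A> c \<in> fin_supp (Iso \<A> \<times> Iso \<A>)"
  using finite_coprod_coeff coprod_coeff_nonzero(1,2) by (auto simp: fin_supp_def)

lemma prod_assoc_matrix:
  assumes I: "a \<in> Iso \<A>" "b \<in> Iso \<A>" "c \<in> Iso \<A>"
  shows "mat_op (prod_coeff \<A>) (kron (prod_coeff \<A>) basis_vector ((a, b), c)) =
    mat_op (prod_coeff \<A>) (kron basis_vector (prod_coeff \<A>) (a, (b, c)))"
proof
  fix e
  note ab = prod_coeff_fin_supp[OF I(1,2)] and bc = prod_coeff_fin_supp[OF I(2,3)]
  show "mat_op (prod_coeff \<A>) (kron (prod_coeff \<A>) basis_vector ((a, b), c)) e =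
    mat_op (prod_coeff \<A>) (kron basis_vector (prod_coeff \<A>) (a, (b, c))) e"
    unfolding kron_apply mat_op_tensor_basis_vector(1)[OF ab] mat_op_tensor_basis_vector(2)[OF bc]
    by (rule prod_coeff_assoc[OF I]) (use ab bc in \<open>auto simp: fin_supp_def\<close>)
qed

lemma coprod_coassoc_matrix:
  assumes c: "c \<in> Iso \<A>"
  shows "assoc_right (mat_op (kron (coprod_coeff \<A>) basis_vector) (coprod_coeff \<A> c)) =
    mat_op (kron basis_vector (coprod_coeff \<A>)) (coprod_coeff \<A> c)"
proof
  fix p :: "'o set \<times> ('o set \<times> 'o set)"
  obtain x y z where p: "p = (x, (y, z))" by (metis surj_pair)
  let ?F = "constituents \<A> (groth_class \<A> c)" and ?d = "coprod_coeff \<A>"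
  have fin: "finite ?F" by (rule finite_constituents[OF groth_class_carrier[OF c]])
  note fs = coprod_coeff_fin_supp[OF c]
  have l: "mat_op ?d (\<lambda>w. ?d c (w, z)) (x, y) = (\<Sum>w \<in> ?F. ?d c (w, z) * ?d w (x, y))"
    by (rule mat_op_sum[OF fin]) (use coprod_coeff_nonzero(4)[OF _ c] constituents_self[OF c] in blast)
  have r: "mat_op ?d (\<lambda>w. ?d c (x, w)) (y, z) = (\<Sum>w \<in> ?F. ?d c (x, w) * ?d w (y, z))"
    by (rule mat_op_sum[OF fin]) (use coprod_coeff_nonzero(5)[OF _ c] constituents_self[OF c] in blast)
  show "assoc_right (mat_op (kron ?d basis_vector) (?d c)) p = mat_op (kron basis_vector ?d) (?d c) p"
    unfolding p assoc_right_def prod.case mat_op_kron_slice_left[OF fs] mat_op_kron_slice_right[OF fs] l r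
    by (rule coprod_coeff_coassoc[OF c refl])
qed

lemma green_matrix:
  assumes I: "m \<in> Iso \<A>" "n \<in> Iso \<A>"
  shows "mat_op (coprod_coeff \<A>) (prod_coeff \<A> (m, n)) = mat_op (kron (prod_coeff \<A>) (prod_coeff \<A>))
    (mat_op (\<lambda>((a, b), (c, d)). qscale (euler_char \<A> (groth_class \<A> b) (groth_class \<A> c)) (basis_vector ((a, c), (b, d))))
      (kron (coprod_coeff \<A>) (coprod_coeff \<A>) (m, n)))"
proof
  fix p :: "'o set \<times> 'o set"
  obtain a b where p: "p = (a, b)" by fastforce
  let ?d = "coprod_coeff \<A>" and ?p = "prod_coeff \<A>"
    and ?\<chi> = "\<lambda>b c. euler_char \<A> (groth_class \<A> b) (groth_class \<A> c)"
  define mk where "mk = (\<lambda>((a, b), (c, d)). qscale (?\<chi> b c) (basis_vector ((a, c), (b, d)) :: ('o set \<times> 'o set) \<times> ('o set \<times> 'o set) \<Rightarrow> rat))"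
  \<comment> \<open>Coproducts are indexed by (m1, m2), (n1, n2), products by (m1, n1), (m2, n2);
    \<open>sw\<close> exchanges the inner entries, as the matrix of the braiding does.\<close>
  define sw where "sw = (\<lambda>((a :: 'o set, b :: 'o set), (c :: 'o set, d :: 'o set)). ((a, c), (b, d)))"
  define E where "E = (\<lambda>((m1, m2), (n1, n2)). ?\<chi> m2 n1 * (?d m (m1, m2) * ?d n (n1, n2)) * (?p (m1, n1) a * ?p (m2, n2) b))"
  note dm = coprod_coeff_fin_supp[OF I(1)] and dn = coprod_coeff_fin_supp[OF I(2)]
  let ?S = "{q. ?d m q \<noteq> 0} \<times> {q. ?d n q \<noteq> 0}"
  have fS: "finite ?S" using dm dn by (simp add: fin_supp_def)
  have f: "finite {x. ?p (m, n) x \<noteq> 0}" "{x. ?p (m, n) x \<noteq> 0} \<subseteq> Iso \<A>" using prod_coeff_fin_supp[OF I] by (auto simp: fin_supp_def)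
  have T: "((m1, n1), (m2, n2)) \<in> sw ` ?S" if "?d m (m1, m2) \<noteq> 0" "?d n (n1, n2) \<noteq> 0" for m1 n1 m2 n2
  proof -
    have "((m1, m2), (n1, n2)) \<in> ?S" using that by simp
    then show ?thesis by (rule rev_image_eqI) (simp add: sw_def)
  qed
  have "mat_op ?d (?p (m, n)) p = (\<Sum>x | ?p (m, n) x \<noteq> 0. ?p (m, n) x * ?d x (a, b))"
    by (simp add: mat_op_def p)
  also have "\<dots> = (\<Sum>((m1, n1), (m2, n2)) \<in> sw ` ?S. ?\<chi> m2 n1 * (?d m (m1, m2) * ?d n (n1, n2)) * (?p (m1, n1) a * ?p (m2, n2) b))"
    by (rule coeff_green[of m n "{x. ?p (m, n) x \<noteq> 0}" "sw ` ?S" a b, OF I f subset_refl finite_imageI[OF fS] T])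
  also have "\<dots> = sum E ?S"
    unfolding E_def by (subst sum.reindex) (auto simp: inj_on_def sw_def intro!: sum.cong)
  also have "\<dots> = (\<Sum>q \<in> ?S. (?d m \<otimes>\<^sub>\<rat> ?d n) q * mat_op (kron ?p ?p) (mk q) p)"
  proof (rule sum.cong[OF refl])
    fix q assume "q \<in> ?S"
    obtain m1 m2 n1 n2 where q: "q = ((m1, m2), (n1, n2))" by (metis surj_pair)
    have "mat_op (kron ?p ?p) (mk q) = qscale (?\<chi> m2 n1) (kron ?p ?p ((m1, n1), (m2, n2)))"
      using mat_op_linear[of "kron ?p ?p"] basis_vector_fin_supp[of "((m1, n1), (m2, n2))" UNIV]
      by (simp add: mk_def q linear_on_def mat_op_at_basis_vector)
    then show "E q = (?d m \<otimes>\<^sub>\<rat> ?d n) q * mat_op (kron ?p ?p) (mk q) p"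
      by (simp add: E_def q p kron_apply qscale_def)
  qed
  also have "\<dots> = mat_op (\<lambda>q. mat_op (kron ?p ?p) (mk q)) (?d m \<otimes>\<^sub>\<rat> ?d n) p"
    by (rule mat_op_sum[symmetric]) (use fS in auto)
  also have "\<dots> = mat_op (kron ?p ?p) (mat_op mk (?d m \<otimes>\<^sub>\<rat> ?d n)) p"
  proof -
    have "mk q \<in> fin_supp UNIV" for q
    proof -
      obtain m1 m2 n1 n2 where q: "q = ((m1, m2), (n1, n2))" by (metis surj_pair)
      show ?thesis unfolding q mk_def prod.case
        by (rule qvec.subspace_scale[OF subspace_fin_supp basis_vector_fin_supp]) simp
    qed
    then show ?thesis using mat_op_comp[OF tensor_fin_supp[OF dm dn], of mk "kron ?p ?p"] by simp
  qed
  finally show "mat_op ?d (?p (m, n)) p = mat_op (kron ?p ?p)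
    (mat_op (\<lambda>((a, b), (c, d)). qscale (?\<chi> b c) (basis_vector ((a, c), (b, d)))) (kron ?d ?d (m, n))) p"
    unfolding kron_apply mk_def .
qed

text \<open>The weight #Aut satisfies \<open>dual\<close> because both coefficients are the same
  number \<open>ext_num\<close>, divided by orders of automorphism groups; this is the origin of the
  weight in the form.\<close>

sublocale hall: structure_constants "groth_monoid \<A>" "euler_char \<A>" "Iso \<A>" "groth_class \<A>" "zero_class \<A>"
  "prod_coeff \<A>" "coprod_coeff \<A>" "autr \<A>"
proof -
  interpret G: comm_monoid "groth_monoid \<A>" by (rule groth_comm_monoid)
  note Z = zero_class_Iso
  show "structure_constants (groth_monoid \<A>) (euler_char \<A>) (Iso \<A>) (groth_class \<A>) (zero_class \<A>)
    (prod_coeff \<A>) (coprod_coeff \<A>) (autr \<A>)"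
  proof (unfold_locales, goal_cases)
    case 1 show ?case by (rule euler_bicharacter)
  next
    case 2 show ?case by (rule Z)
  next
    case 3 show ?case by (rule groth_one[symmetric])
  next
    case (4 a) then show ?case by (rule groth_class_carrier)
  next
    case (5 p) then show ?case using prod_coeff_fin_supp by (cases p) auto
  next
    case (6 c) then show ?case by (rule coprod_coeff_fin_supp)
  next
    case (7 a b c) then show ?case using prod_coeff_nonzero(2) by blast
  next
    case (8 c a b) then show ?case using coprod_coeff_nonzero(3) by blast
  next
    case (9 a) then show ?case
      using autr_pos[of a] by (auto simp: fun_eq_iff prod_coeff_eq ext_num_zero_left autr_zero basis_vector_apply)
  next
    case (10 a) then show ?case
      using autr_pos[of a] by (auto simp: fun_eq_iff prod_coeff_eq ext_num_zero_right autr_zero basis_vector_apply)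
  next
    case (11 a b) then show ?case by (simp add: prod_coeff_eq ext_num_into_zero Z autr_zero)
  next
    case 12 show ?case
      by (auto simp: fun_eq_iff coprod_coeff_eq[OF Z] ext_num_into_zero autr_zero basis_vector_apply Z)
  next
    case (13 c a) then show ?case
      using autr_pos[of c] by (auto simp: coprod_coeff_eq ext_num_zero_right Z)
  next
    case (14 c a) then show ?case
      using autr_pos[of c] by (auto simp: coprod_coeff_eq ext_num_zero_left Z)
  next
    case (15 a b c) then show ?case by (rule prod_assoc_matrix)
  next
    case (16 c) then show ?case by (rule coprod_coassoc_matrix)
  next
    case (17 a b) then show ?case by (rule green_matrix)
  next
    case (18 a) then show ?case by (rule autr_pos)
  next
    case (19 a b c) then show ?case
      by (simp add: coprod_coeff_eq prod_coeff_eq mult.commute)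
  qed
qed

lemma hall_algebra_eq: "hall_algebra \<A> = hall.H"
  unfolding hall_algebra_def hall.H_def hall_space_def fin_supp_def bialg.simps
  by (auto simp: fun_eq_iff mat_op_def prod_coeff_def coprod_coeff_def)

text \<open>A nonzero term of the coproduct comes from an extension with middle term X, whose ends
  are X and 0 by almost simplicity; so only the two trivial terms are left.\<close>

lemma almost_simple_Prim:
  assumes X: "almost_simple \<A> X"
  shows "basis_vector (iso_class \<A> X) \<in> Prim hall.H"
proof -
  let ?c = "iso_class \<A> X" and ?z = "zero_class \<A>"
  have O: "X \<in> Ob \<A>" and nz: "\<not> is_zero_object \<A> X" using X by (auto simp: almost_simple_def)
  have c: "?c \<in> Iso \<A>" by (rule iso_class_in_Iso[OF O])
  have cz: "?c \<noteq> ?z" using zero_object_of_class[OF O] nz by blast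
  have "coprod_coeff \<A> ?c p = (basis_vector ?c \<otimes>\<^sub>\<rat> basis_vector ?z + basis_vector ?z \<otimes>\<^sub>\<rat> basis_vector ?c) p" for p
  proof -
    obtain a b where p: "p = (a, b)" by fastforce
    consider "a = ?z" | "b = ?z" | "a \<noteq> ?z" "b \<noteq> ?z" by blast
    then show ?thesis
    proof cases
      case 1
      then show ?thesis using hall.dm_counit(1)[OF c, of b] cz by (auto simp: p basis_vector_apply)
    next
      case 2
      then show ?thesis using hall.dm_counit(2)[OF c, of a] cz by (auto simp: p basis_vector_apply)
    next
      case 3
      have "coprod_coeff \<A> ?c (a, b) = 0"
      proof (rule ccontr)
        assume nz: "coprod_coeff \<A> ?c (a, b) \<noteq> 0"
        then have I: "a \<in> Iso \<A>" "b \<in> Iso \<A>" using coprod_coeff_nonzero(1,2)[OF _ c] by auto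
        then have "ext_num \<A> b a ?c \<noteq> 0" using nz by (simp add: coprod_coeff_eq[OF c])
        then have "ext_pairs \<A> (rep b) (rep a) (rep ?c) \<noteq> {}" by (auto simp: ext_num_def)
        then obtain f g where fg: "(f, g) \<in> ext_pairs \<A> (rep b) (rep a) (rep ?c)" by auto
        note e = ext_pairsD[OF fg]
        have "?c \<in> Ext_objects \<A> (rep b) (rep a)"
          using Ext_objectsI[OF e(7)] e rep_props[OF c] by simp
        then have "{iso_class \<A> (rep b), iso_class \<A> (rep a)} = {?c, ?z}"
          using X rep_props(1)[OF I(1)] rep_props(1)[OF I(2)] unfolding almost_simple_def by blast
        then have "{b, a} = {?c, ?z}" using rep_props(2)[OF I(1)] rep_props(2)[OF I(2)] by simp
        then show False using 3 by (auto simp: doubleton_eq_iff)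
      qed
      then show ?thesis using 3 by (simp add: p basis_vector_apply)
    qed
  qed
  then have "coprod_coeff \<A> ?c = basis_vector ?c \<otimes>\<^sub>\<rat> basis_vector ?z + basis_vector ?z \<otimes>\<^sub>\<rat> basis_vector ?c" by (rule ext)
  then show ?thesis unfolding hall.Prim_iff mat_op_at_basis_vector using basis_vector_fin_supp[OF c] by (intro conjI)
qed

text \<open>The two subalgebras of the theorem differ only in their generators: classes of almost
  simple objects for the one, elements of one-dimensional homogeneous components of the primitive
  space for the other.\<close>

lemma nichols_gen:
  assumes "\<And>g. g \<in> G \<Longrightarrow> g \<in> Prim (hall_algebra \<A>)"
    and "\<And>g. g \<in> G \<Longrightarrow> \<exists>\<gamma> \<in> carrier (groth_monoid \<A>). g \<in> component (hall_algebra \<A>) \<gamma>"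
  shows "nichols_algebra (groth_monoid \<A>) (euler_char \<A>) (sub_bialg (hall_algebra \<A>) (subalgebra_gen (hall_algebra \<A>) G))"
proof -
  interpret primitive_generators "groth_monoid \<A>" "euler_char \<A>" "Iso \<A>" "groth_class \<A>" "zero_class \<A>"
    "prod_coeff \<A>" "coprod_coeff \<A>" "autr \<A>" G
    by unfold_locales (use assms in \<open>simp_all add: hall_algebra_eq\<close>)
  show ?thesis using nichols_subalgebra unfolding hall_algebra_eq .
qed

lemma nichols_C: "nichols_algebra (groth_monoid \<A>) (euler_char \<A>) (sub_bialg (hall_algebra \<A>) (C_algebra \<A>))"
  unfolding C_algebra_def
proof (rule nichols_gen)
  fix g assume "g \<in> {basis_vector (iso_class \<A> X) |X. almost_simple \<A> X}"
  then obtain X where X: "g = basis_vector (iso_class \<A> X)" "almost_simple \<A> X" by blast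
  show "g \<in> Prim (hall_algebra \<A>)" unfolding X(1) hall_algebra_eq by (rule almost_simple_Prim[OF X(2)])
  have c: "iso_class \<A> X \<in> Iso \<A>" using X(2) iso_class_in_Iso by (simp add: almost_simple_def)
  show "\<exists>\<gamma> \<in> carrier (groth_monoid \<A>). g \<in> component (hall_algebra \<A>) \<gamma>"
    by (rule bexI[OF _ groth_class_carrier[OF c]])
      (use basis_vector_fin_supp[OF c] in \<open>simp add: hall_algebra_eq X(1) basis_vector_apply\<close>)
qed

lemma nichols_U: "nichols_algebra (groth_monoid \<A>) (euler_char \<A>) (sub_bialg (hall_algebra \<A>) (U_algebra \<A>))"
  unfolding U_algebra_def by (rule nichols_gen) (auto simp: V_component_def)

end

theorem corollary1p12:
  fixes \<A> :: "('o, 'm) preadd_cat"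
  assumes "abelian_category \<A>"
    and "profinitary \<A>"
    and "hereditary \<A>"
  shows "nichols_algebra (groth_monoid \<A>) (euler_char \<A>)
           (sub_bialg (hall_algebra \<A>) (C_algebra \<A>)) \<and>
         nichols_algebra (groth_monoid \<A>) (euler_char \<A>)
           (sub_bialg (hall_algebra \<A>) (U_algebra \<A>))"
proof -
  have "abelian_category \<A>" by (rule assms(1))
  then interpret hall_category \<A>
    by (rule hall_category.intro) (simp add: hall_category_axioms_def assms)
  show ?thesis using nichols_C nichols_U by blast
qed

end
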